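(* Let $f$ be a stationary Gaussian process as in the context. Then $\rho(\{\lambda\})>0$ for some $\lambda\in\mathbb R\setminus\{\sigma,-\sigma\}$ if and only if there exist constants $C_1,C_2>0$ and $T_0>0$ such that $C_1T^2\le\operatorname{Var}[N(T)]\le C_2T^2$ for all $T\ge T_0$.
   Context: Let $f:\mathbb R\to\mathbb R$ be a real-valued centred stationary Gaussian process with continuous covariance $r(t)=\mathbb E[f(0)f(t)]$, $r(0)=1$, and spectral measure $\rho$ (symmetric probability measure with $r(t)=\int e^{-i\lambda t}d\rho(\lambda)$). Assume the Geman condition $\int\log(1+|\lambda|)\lambda^2\,d\rho(\lambda)<\infty$; $\sigma^2=-r''(0)=\int\lambda^2 d\rho$, $\sigma>0$. $N(T)=\#\{t\in[0,T]:f(t)=0\}$. Atoms of the symmetric measure $\rho$ come in symmetric pairs $\pm\lambda$. *)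

theory Defs
  imports "HOL-Probability.Probability"
begin

text \<open>A real random variable is Gaussian (possibly degenerate) iff its characteristic
function is that of a normal law N(m, v) with v \<ge> 0.\<close>
definition gaussian_rv :: "'a measure \<Rightarrow> ('a \<Rightarrow> real) \<Rightarrow> bool" where
  "gaussian_rv M X \<longleftrightarrow> X \<in> borel_measurable M \<and>
     (\<exists>m v. v \<ge> 0 \<and> (\<forall>\<theta>. char (distr M borel X) \<theta> =
        exp (\<i> * complex_of_real (m * \<theta>) - complex_of_real (v * \<theta>\<^sup>2 / 2))))"

definition gaussian_process :: "'a measure \<Rightarrow> (real \<Rightarrow> 'a \<Rightarrow> real) \<Rightarrow> bool" where
  "gaussian_process M f \<longleftrightarrow>
     (\<forall>cts :: (real \<times> real) list. gaussian_rv M (\<lambda>\<omega>. \<Sum>(c, t)\<leftarrow>cts. c * f t \<omega>))"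

definition zero_count :: "(real \<Rightarrow> 'a \<Rightarrow> real) \<Rightarrow> real \<Rightarrow> 'a \<Rightarrow> real" where
  "zero_count f T \<omega> = real (card {t \<in> {0..T}. f t \<omega> = 0})"

end

theory Submission
  imports Defs
begin

text \<open>Zeros are counted as sign changes on fine grids; the Geman condition makes the second moment of
  the count finite on a short interval, and stationarity then gives the quadratic upper bound on the
  variance. For a linear functional \<open>X\<close> of \<open>f\<close>, conditioning at a zero (a weighted Kac--Rice formula)
  expresses the covariance of \<open>N(T)\<close> with \<open>exp (i X)\<close> as an integral over \<open>[0, T]\<close> of an explicit
  function of \<open>Cov (X, f(s))\<close> and its derivative. If \<open>\<rho>\<close> has an atom off \<open>\<plusminus>\<sigma>\<close>, a functional
  concentrated at this frequency has covariance of order \<open>T\<close> with \<open>N(T)\<close>, and Cauchy--Schwarz yields the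
  lower bound. If all atoms are at \<open>\<plusminus>\<sigma>\<close>, they contribute nothing over full periods because a random
  sinusoid has a deterministic number of zeros, while the continuous part is negligible by Wiener's
  theorem; approximating the signs of \<open>f\<close> on the grid by trigonometric polynomials makes the variance
  \<open>o(T\<^sup>2)\<close> along full periods.\<close>

text \<open>Paths are only assumed continuous, so no derivative of \<open>f\<close> is ever formed.
  Increments play its role: by stationarity \<open>f s + f (s + h)\<close> and
  \<open>f (s + h) - f s\<close> are uncorrelated, hence independent, and a sign change on the cell
  means exactly that the sum is smaller in modulus than the difference. The Gaussian computations
  reduce to this pair and an independent remainder. Exponentials are the test functionals because
  their integrand is explicit: with a the covariance of the functional with f(s) and b that with the
  normalised derivative, it is a multiple of \<open>kr_density a b\<close>, which is 1 + (a^2 -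
  b^2)/2 up to third order. At frequency \<mu> the amplitudes of b and a are in the ratio
  |\<mu>|/\<sigma>, so the averaged quadratic term vanishes precisely at +-\<sigma>; there the full
  function still has mean 1 over a period. Full periods are enough for the converse, since a
  quadratic lower bound has to hold at all large T. The discretisation error has to be small
  relative to T^2 uniformly in T, so that the mesh can be fixed before T grows.\<close>

section \<open>Joint laws are determined by characteristic functions\<close>

text \<open>A signed weight is made positive by adding 2 and then normalised to a probability
  density, so that the one-dimensional uniqueness theorem of Levy applies to the law of
  \<open>Y\<close> under the tilted measure.\<close>

lemma char_weight_unique_real:
  fixes V Y :: "'a \<Rightarrow> real" and V' Y' :: "'b \<Rightarrow> real"
  assumes M: "prob_space M" and M': "prob_space M'"
    and [measurable]: "V \<in> borel_measurable M" "Y \<in> borel_measurable M"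
      "V' \<in> borel_measurable M'" "Y' \<in> borel_measurable M'"
    and V: "\<And>x. \<bar>V x\<bar> \<le> 1" and V': "\<And>x. \<bar>V' x\<bar> \<le> 1"
    and eq1: "\<And>t. (CLINT x|M. iexp (t * Y x)) = (CLINT x|M'. iexp (t * Y' x))"
    and eqV: "\<And>t. (CLINT x|M. V x * iexp (t * Y x)) = (CLINT x|M'. V' x * iexp (t * Y' x))"
    and B[measurable]: "B \<in> sets borel"
  shows "(LINT x|M. V x * indicator B (Y x)) = (LINT x|M'. V' x * indicator B (Y' x))"
proof -
  interpret M: prob_space M by fact
  interpret M': prob_space M' by fact
  have intV [intro,simp]: "integrable M V" "integrable M' V'"
    using V V' by (auto intro!: M.integrable_const_bound[of _ 1] M'.integrable_const_bound[of _ 1])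
  have intVc [intro,simp]: "integrable M (\<lambda>x. V x * iexp (t * Y x))"
      "integrable M' (\<lambda>x. V' x * iexp (t * Y' x))" 
      "integrable M (\<lambda>x. iexp (t * Y x))"
      "integrable M' (\<lambda>x. iexp (t * Y' x))" for t
    using V V' by (auto intro!: M.integrable_const_bound[of _ 1] M'.integrable_const_bound[of _ 1] 
       simp: norm_mult simp del: of_real_mult)
  have intVi [intro,simp]: "integrable M (\<lambda>x. V x * indicator B (Y x))"
      "integrable M' (\<lambda>x. V' x * indicator B (Y' x))" 
      "integrable M (\<lambda>x. indicator B (Y x) :: real)"
      "integrable M' (\<lambda>x. indicator B (Y' x) :: real)"
    using V V' by (auto intro!: M.integrable_const_bound[of _ 1] M'.integrable_const_bound[of _ 1] 
       simp: indicator_def)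
  have pos: "V x + c \<ge> 0" "V' y + c \<ge> 0" if "c \<ge> 1" for x y c
    using V[of x] V'[of y] that by (auto simp: abs_le_iff)
  \<comment> \<open>\<open>a\<close> switches the weight on or off. The case 0 settles the constant
    weight 2, and subtracting it from the case 1 isolates \<open>V\<close>.\<close>
  have key: "(LINT x|M. (a * V x + 2) * indicator B (Y x)) = (LINT x|M'. (a * V' x + 2) * indicator B (Y' x))"
    if a: "a = 0 \<or> a = 1" for a :: real
  proof -
    have pos: "a * V x + 2 \<ge> 1" "a * V' y + 2 \<ge> 1" for x y
      using V[of x] V'[of y] a by (auto simp: abs_le_iff)
    have pos2: "a * V x + 2 \<ge> 0" "a * V' y + 2 \<ge> 0" for x y
      using pos(1)[of x] pos(2)[of y] by linarith+
    have "complex_of_real (LINT x|M. V x) = complex_of_real (LINT x|M'. V' x)"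
      using eqV[of 0] by simp
    then have VV': "(LINT x|M. V x) = (LINT x|M'. V' x)" by (simp only: of_real_eq_iff)
    define c where "c = (LINT x|M. a * V x + 2)"
    have c': "c = (LINT x|M'. a * V' x + 2)"
      using a VV' by (auto simp: c_def M.prob_space M'.prob_space)
    have "c \<ge> (LINT x|M. 1)" unfolding c_def
      by (intro integral_mono) (use pos in auto)
    then have c: "c \<ge> 1" by (simp add: M.prob_space)
    define P where "P = distr (density M (\<lambda>x. ennreal ((a * V x + 2) / c))) borel Y"
    define Q where "Q = distr (density M' (\<lambda>x. ennreal ((a * V' x + 2) / c))) borel Y'"
    have nn: "(\<integral>\<^sup>+x. ennreal ((a * V x + 2) / c) \<partial>M) = 1"
             "(\<integral>\<^sup>+x. ennreal ((a * V' x + 2) / c) \<partial>M') = 1"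
    proof -
      have "(LINT x|M. (a * V x + 2) / c) = 1" "(LINT x|M'. (a * V' x + 2) / c) = 1"
        using c by (simp_all only: integral_divide_zero c_def[symmetric] c'[symmetric]) auto
      moreover have "integrable M (\<lambda>x. (a * V x + 2) / c)" "integrable M' (\<lambda>x. (a * V' x + 2) / c)"
        by simp_all
      ultimately show "(\<integral>\<^sup>+x. ennreal ((a * V x + 2) / c) \<partial>M) = 1"
             "(\<integral>\<^sup>+x. ennreal ((a * V' x + 2) / c) \<partial>M') = 1"
        using c pos2 by (subst nn_integral_eq_integral; auto)+
    qed
    interpret P0: prob_space "density M (\<lambda>x. ennreal ((a * V x + 2) / c))"
      by (rule prob_spaceI) (simp add: emeasure_density nn cong: nn_integral_cong)
    interpret Q0: prob_space "density M' (\<lambda>x. ennreal ((a * V' x + 2) / c))"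
      by (rule prob_spaceI) (simp add: emeasure_density nn cong: nn_integral_cong)
    have PQ: "real_distribution P" "real_distribution Q"
      unfolding P_def Q_def by (intro P0.real_distribution_distr Q0.real_distribution_distr; simp)+
    have lin: "((a * v + 2) / c) *\<^sub>R z = complex_of_real (a / c) * (complex_of_real v * z) + complex_of_real (2 / c) * z" for v z
      by (simp add: scaleR_conv_of_real add_divide_distrib distrib_right)
    have "char P t = char Q t" for t
    proof -
      have "char P t = (CLINT x|M. ((a * V x + 2)/c) *\<^sub>R iexp (t * Y x))"
        unfolding P_def char_def using pos2 c
        by (subst integral_distr) (auto simp: integral_density)
      also have "\<dots> = (CLINT x|M. complex_of_real (a / c) * (complex_of_real (V x) * iexp (t * Y x)) + complex_of_real (2 / c) * iexp (t * Y x))"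
        by (simp only: lin)
      also have "\<dots> = complex_of_real (a/c) * (CLINT x|M. V x * iexp (t * Y x)) + complex_of_real (2/c) * (CLINT x|M. iexp (t * Y x))"
        by (subst Bochner_Integration.integral_add; (intro integrable_mult_right intVc)?) simp
      also have "\<dots> = complex_of_real (a/c) * (CLINT x|M'. V' x * iexp (t * Y' x)) + complex_of_real (2/c) * (CLINT x|M'. iexp (t * Y' x))"
        using eqV eq1 by simp
      also have "\<dots> = (CLINT x|M'. complex_of_real (a / c) * (complex_of_real (V' x) * iexp (t * Y' x)) + complex_of_real (2 / c) * iexp (t * Y' x))"
        by (subst Bochner_Integration.integral_add; (intro integrable_mult_right intVc)?) simp
      also have "\<dots> = (CLINT x|M'. ((a * V' x + 2)/c) *\<^sub>R iexp (t * Y' x))"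
        by (simp only: lin)
      also have "\<dots> = char Q t"
        unfolding Q_def char_def using pos2 c
        by (subst integral_distr) (auto simp: integral_density)
      finally show ?thesis .
    qed
    then have "P = Q" using Levy_uniqueness[OF PQ] by auto
    have "(LINT x|M. ((a * V x + 2)/c) *\<^sub>R indicator B (Y x)) = (LINT x|P. indicator B x :: real)"
      unfolding P_def using pos2 c by (subst integral_distr) (auto simp: integral_density)
    also have "\<dots> = (LINT x|Q. indicator B x)" using \<open>P = Q\<close> by simp
    also have "\<dots> = (LINT x|M'. ((a * V' x + 2)/c) *\<^sub>R indicator B (Y' x))"
      unfolding Q_def using pos2 c by (subst integral_distr) (auto simp: integral_density)
    finally have "(LINT x|M. (a * V x + 2) * indicator B (Y x)) / c = (LINT x|M'. (a * V' x + 2) * indicator B (Y' x)) / c"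
      by simp
    then show ?thesis using c by simp
  qed
  have eq: "(LINT x|M. a * (V x * indicator B (Y x))) + (LINT x|M. 2 * indicator B (Y x)) =
     (LINT x|M'. a * (V' x * indicator B (Y' x))) + (LINT x|M'. 2 * indicator B (Y' x))"
    if "a = 0 \<or> a = 1" for a :: real
  proof -
    have "(a * v + 2) * i = a * (v * i) + 2 * i" for v i :: real by (simp add: distrib_right)
    then show ?thesis using key[OF that] by simp
  qed
  from eq[of 0] eq[of 1] show ?thesis by simp
qed

text \<open>Real and imaginary parts are linear combinations of the weight and its conjugate; the
  hypothesis for the conjugate weight is the conjugate of the given one at
  \<open>- t\<close>.\<close>

lemma char_weight_unique:
  fixes Y :: "'a \<Rightarrow> real" and Y' :: "'b \<Rightarrow> real" and V :: "'a \<Rightarrow> complex" and V' :: "'b \<Rightarrow> complex"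
  assumes M: "prob_space M" and M': "prob_space M'"
    and meas[measurable]: "V \<in> borel_measurable M" "Y \<in> borel_measurable M"
      "V' \<in> borel_measurable M'" "Y' \<in> borel_measurable M'"
    and V: "\<And>x. norm (V x) \<le> 1" and V': "\<And>x. norm (V' x) \<le> 1"
    and eq1: "\<And>t. (CLINT x|M. iexp (t * Y x)) = (CLINT x|M'. iexp (t * Y' x))"
    and eqV: "\<And>t. (CLINT x|M. V x * iexp (t * Y x)) = (CLINT x|M'. V' x * iexp (t * Y' x))"
    and B[measurable]: "B \<in> sets borel"
  shows "(CLINT x|M. V x * indicator B (Y x)) = (CLINT x|M'. V' x * indicator B (Y' x))"
proof -
  interpret M: prob_space M by fact
  interpret M': prob_space M' by fact
  have intV: "integrable M V" "integrable M' V'"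
    using V V' by (auto intro!: M.integrable_const_bound[of _ 1] M'.integrable_const_bound[of _ 1])
  have cnj_meas[measurable]: "(\<lambda>x. cnj (V x)) \<in> borel_measurable M" "(\<lambda>x. cnj (V' x)) \<in> borel_measurable M'"
    by (rule borel_measurable_continuous_on[of cnj]; intro continuous_intros meas)+
  have intVc [intro,simp]: "integrable M (\<lambda>x. V x * iexp (t * Y x))"
      "integrable M' (\<lambda>x. V' x * iexp (t * Y' x))" 
      "integrable M (\<lambda>x. cnj (V x) * iexp (t * Y x))"
      "integrable M' (\<lambda>x. cnj (V' x) * iexp (t * Y' x))" for t
    using V V' by (auto intro!: M.integrable_const_bound[of _ 1] M'.integrable_const_bound[of _ 1] 
       simp: norm_mult simp del: of_real_mult)
  have intVi [intro,simp]: "integrable M (\<lambda>x. V x * indicator B (Y x))"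
      "integrable M' (\<lambda>x. V' x * indicator B (Y' x))" 
    using V V' by (auto intro!: M.integrable_const_bound[of _ 1] M'.integrable_const_bound[of _ 1] 
       simp: indicator_def)
  have eqC: "(CLINT x|M. cnj (V x) * iexp (t * Y x)) = (CLINT x|M'. cnj (V' x) * iexp (t * Y' x))" for t
  proof -
    have "(CLINT x|M. cnj (V x) * iexp (t * Y x)) = cnj (CLINT x|M. V x * iexp (-t * Y x))"
      unfolding Bochner_Integration.integral_cnj[symmetric] by (intro Bochner_Integration.integral_cong) (auto simp: exp_cnj)
    also have "\<dots> = cnj (CLINT x|M'. V' x * iexp (-t * Y' x))" by (simp only: eqV)
    also have "\<dots> = (CLINT x|M'. cnj (V' x) * iexp (t * Y' x))"
      unfolding Bochner_Integration.integral_cnj[symmetric] by (intro Bochner_Integration.integral_cong) (auto simp: exp_cnj)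
    finally show ?thesis .
  qed
  have ReV: "complex_of_real (Re z) * w = (1/2) * (z * w) + (1/2) * (cnj z * w)" for z w
    by (simp add: complex_eq_iff field_simps)
  have ImV: "complex_of_real (Im z) * w = (-\<i>/2) * (z * w) + (\<i>/2) * (cnj z * w)" for z w
    by (simp add: complex_eq_iff field_simps)
  have eqRe: "(CLINT x|M. complex_of_real (Re (V x)) * iexp (t * Y x)) 
        = (CLINT x|M'. complex_of_real (Re (V' x)) * iexp (t * Y' x))" for t
    unfolding ReV
    by (subst (1 2) Bochner_Integration.integral_add; (intro integrable_mult_right intVc)?)
       (use eqV[of t] eqC[of t] in \<open>simp del: of_real_mult\<close>)
  have eqIm: "(CLINT x|M. complex_of_real (Im (V x)) * iexp (t * Y x)) 
        = (CLINT x|M'. complex_of_real (Im (V' x)) * iexp (t * Y' x))" for t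
    unfolding ImV
    by (subst (1 2) Bochner_Integration.integral_add; (intro integrable_mult_right intVc)?)
       (use eqV[of t] eqC[of t] in \<open>simp del: of_real_mult\<close>)
  have R: "(LINT x|M. Re (V x) * indicator B (Y x)) = (LINT x|M'. Re (V' x) * indicator B (Y' x))"
    by (rule char_weight_unique_real[OF M M' _ _ _ _ _ _ eq1 eqRe B])
       (use V V' order_trans[OF abs_Re_le_cmod] in auto)
  have I: "(LINT x|M. Im (V x) * indicator B (Y x)) = (LINT x|M'. Im (V' x) * indicator B (Y' x))"
    by (rule char_weight_unique_real[OF M M' _ _ _ _ _ _ eq1 eqIm B])
       (use V V' order_trans[OF abs_Im_le_cmod] in auto)
  have ReI: "Re (indicator B x) = indicator B x" "Im (indicator B x) = 0" for x
    by (auto simp: indicator_def)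
  show ?thesis
  proof (rule complex_eqI)
    have "(LINT x|M. Re (V x * indicator B (Y x))) = (LINT x|M'. Re (V' x * indicator B (Y' x)))"
      unfolding times_complex.sel ReI mult_zero_right diff_zero by (fact R)
    then show "Re (CLINT x|M. V x * indicator B (Y x)) = Re (CLINT x|M'. V' x * indicator B (Y' x))"
      by (simp only: integral_Re[OF intVi(1)] integral_Re[OF intVi(2)])
    have "(LINT x|M. Im (V x * indicator B (Y x))) = (LINT x|M'. Im (V' x * indicator B (Y' x)))"
      unfolding times_complex.sel ReI mult_zero_right add_0_left by (fact I)
    then show "Im (CLINT x|M. V x * indicator B (Y x)) = Im (CLINT x|M'. V' x * indicator B (Y' x))"
      by (simp only: integral_Im[OF intVi(1)] integral_Im[OF intVi(2)])
  qed
qed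

lemma integral_indicator_distr_complex:
  assumes C: "C \<in> sets L" and g: "g \<in> measurable N L"
  shows "(CLINT x|N. indicator C (g x)) = measure (distr N L g) C"
proof -
  have "(CLINT x|N. indicator C (g x)) = complex_of_real (LINT x|N. indicator C (g x))"
    by (simp only: integral_complex_of_real[symmetric] of_real_indicator)
  also have "(LINT x|N. indicator C (g x)) = (LINT x|distr N L g. indicator C x :: real)"
    using C by (intro integral_distr[OF g, symmetric]) simp
  finally show ?thesis using C sets.sets_into_space[OF C] by (simp add: Int_absorb2)
qed

text \<open>Exponential factors are traded for indicators one coordinate at a time. In each trade
  the product of all the other factors is a complex weight of modulus at most 1, so weighted
  one-dimensional uniqueness suffices; after the last trade the two measures agree on boxes.\<close>

theorem multivariate_char_unique:
  fixes X :: "'i \<Rightarrow> 'a \<Rightarrow> real" and X' :: "'i \<Rightarrow> 'b \<Rightarrow> real"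
  assumes M: "prob_space M" and M': "prob_space M'" and I: "finite I"
    and X[measurable]: "\<And>i. i \<in> I \<Longrightarrow> X i \<in> borel_measurable M"
    and X'[measurable]: "\<And>i. i \<in> I \<Longrightarrow> X' i \<in> borel_measurable M'"
    and eq: "\<And>c. (CLINT x|M. iexp (\<Sum>i\<in>I. c i * X i x)) = (CLINT x|M'. iexp (\<Sum>i\<in>I. c i * X' i x))"
  shows "distr M (PiM I (\<lambda>_. borel)) (\<lambda>x. \<lambda>i\<in>I. X i x) = distr M' (PiM I (\<lambda>_. borel)) (\<lambda>x. \<lambda>i\<in>I. X' i x)"
proof -
  interpret M: prob_space M by fact
  interpret M': prob_space M' by fact
  have eqJ: "(CLINT x|M. (\<Prod>i\<in>J. indicator (B i) (X i x)) * iexp (\<Sum>i\<in>I-J. c i * X i x)) =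
        (CLINT x|M'. (\<Prod>i\<in>J. indicator (B i) (X' i x)) * iexp (\<Sum>i\<in>I-J. c i * X' i x))"
    if "finite J" "J \<subseteq> I" "\<And>i. i \<in> J \<Longrightarrow> B i \<in> sets borel" for J and B :: "'i \<Rightarrow> real set" and c
    using that
  proof (induction J arbitrary: c rule: finite_induct)
    case empty
    then show ?case using eq by simp
  next
    case (insert k J)
    define L where "L = I - insert k J"
    have k: "k \<in> I" and J: "J \<subseteq> I" and [measurable]: "B k \<in> sets borel" 
      and Bi: "\<And>i. i \<in> J \<Longrightarrow> B i \<in> sets borel" using insert by auto
    have IJ: "I - J = insert k L" "k \<notin> L" "finite L" "L \<subseteq> I" using insert k I by (auto simp: L_def)
    define V where "V x = (\<Prod>i\<in>J. indicator (B i) (X i x) :: complex) * iexp (\<Sum>i\<in>L. c i * X i x)" for x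
    define V' where "V' x = (\<Prod>i\<in>J. indicator (B i) (X' i x) :: complex) * iexp (\<Sum>i\<in>L. c i * X' i x)" for x
    have m: "(\<lambda>x. indicator (B i) (X i x) :: complex) \<in> borel_measurable M"
            "(\<lambda>x. indicator (B i) (X' i x) :: complex) \<in> borel_measurable M'" if "i \<in> J" for i
      using X[of i] X'[of i] Bi[OF that] that J 
      by (auto intro!: borel_measurable_indicator' simp: subset_iff)
    have ms: "(\<lambda>x. \<Sum>i\<in>L. c i * X i x) \<in> borel_measurable M" "(\<lambda>x. \<Sum>i\<in>L. c i * X' i x) \<in> borel_measurable M'"
      using IJ(4) by (auto intro!: borel_measurable_sum borel_measurable_times)
    have mV: "V \<in> borel_measurable M" "V' \<in> borel_measurable M'"
      unfolding V_def V'_def 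
      by (intro borel_measurable_times borel_measurable_prod m ms borel_measurable_continuous_on[OF _ ms(1)]
         borel_measurable_continuous_on[OF _ ms(2)]; 
         (assumption | intro continuous_intros))+
    have nV: "norm (V x) \<le> 1" "norm (V' y) \<le> 1" for x y
      unfolding V_def V'_def norm_mult 
      by (auto simp: norm_mult prod_norm[symmetric] simp del: of_real_sum of_real_mult intro!: prod_le_1 split: split_indicator)
    have eqV: "(CLINT x|M. V x * iexp (t * X k x)) = (CLINT x|M'. V' x * iexp (t * X' k x))" for t
    proof -
      \<comment> \<open>Updating \<open>c\<close> at \<open>k\<close> frees the frequency of the
        coordinate about to be traded.\<close>
      have s: "(\<Sum>i\<in>I - J. (c(k := t)) i * y i) = (\<Sum>i\<in>L. c i * y i) + t * y k" for y
        using IJ by (auto simp: intro!: sum.cong)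
      show ?thesis
        using insert.IH[OF J Bi, of "c(k := t)"] unfolding s V_def V'_def
        by (simp add: exp_add distrib_left mult.assoc)
    qed
    have eq1: "(CLINT x|M. iexp (t * X k x)) = (CLINT x|M'. iexp (t * X' k x))" for t
    proof -
      have s: "(\<Sum>i\<in>I. (if i = k then t else 0) * y i) = t * y k" for y :: "'i \<Rightarrow> real"
        using k I by (simp add: if_distrib if_distribR sum.delta cong: if_cong)
      show ?thesis using eq[of "\<lambda>i. if i = k then t else 0"] unfolding s .
    qed
    have "(CLINT x|M. V x * indicator (B k) (X k x)) = (CLINT x|M'. V' x * indicator (B k) (X' k x))"
      by (rule char_weight_unique[OF M M' mV(1) X[OF k] mV(2) X'[OF k] nV eq1 eqV]) simp
    then show ?case
      using insert.hyps by (simp add: V_def V'_def L_def mult_ac)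
  qed
  have mm: "(\<lambda>x. \<lambda>i\<in>I. X i x) \<in> measurable M (PiM I (\<lambda>_. borel))" 
    "(\<lambda>x. \<lambda>i\<in>I. X' i x) \<in> measurable M' (PiM I (\<lambda>_. borel))"
    by (auto intro!: measurable_restrict)
  show ?thesis
  proof (rule measure_eqI_PiM_finite[OF I, where A = "\<lambda>_. \<Pi>\<^sub>E i\<in>I. UNIV" and M = "\<lambda>_. borel"])
    fix B :: "'i \<Rightarrow> real set" assume B: "\<And>i. i \<in> I \<Longrightarrow> B i \<in> sets borel"
    have "(\<Prod>i\<in>I. indicator (B i) (X i x)) = (indicator (\<Pi>\<^sub>E i\<in>I. B i) (\<lambda>i\<in>I. X i x) :: complex)" for x
      using I by (auto simp: indicator_def PiE_iff extensional_def)
    moreover have "(\<Prod>i\<in>I. indicator (B i) (X' i x)) = (indicator (\<Pi>\<^sub>E i\<in>I. B i) (\<lambda>i\<in>I. X' i x) :: complex)" for x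
      using I by (auto simp: indicator_def PiE_iff extensional_def)
    ultimately have "(CLINT x|M. indicator (\<Pi>\<^sub>E i\<in>I. B i) (\<lambda>i\<in>I. X i x)) = 
        (CLINT x|M'. indicator (\<Pi>\<^sub>E i\<in>I. B i) (\<lambda>i\<in>I. X' i x))"
      using eqJ[of I B "\<lambda>_. 0", OF I order_refl B] by simp
    moreover have PE: "(\<Pi>\<^sub>E i\<in>I. B i) \<in> sets (PiM I (\<lambda>_. borel))" 
      using B I by (intro sets_PiM_I_finite) auto
    moreover note integral_indicator_distr_complex[OF PE mm(1)] integral_indicator_distr_complex[OF PE mm(2)]
    ultimately have "measure (distr M (PiM I (\<lambda>_. borel)) (\<lambda>x. \<lambda>i\<in>I. X i x)) (\<Pi>\<^sub>E i\<in>I. B i) = 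
      measure (distr M' (PiM I (\<lambda>_. borel)) (\<lambda>x. \<lambda>i\<in>I. X' i x)) (\<Pi>\<^sub>E i\<in>I. B i)" by simp
    then show "emeasure (distr M (PiM I (\<lambda>_. borel)) (\<lambda>x. \<lambda>i\<in>I. X i x)) (\<Pi>\<^sub>E i\<in>I. B i) = 
      emeasure (distr M' (PiM I (\<lambda>_. borel)) (\<lambda>x. \<lambda>i\<in>I. X' i x)) (\<Pi>\<^sub>E i\<in>I. B i)"
      using prob_space.prob_space_distr[OF M mm(1)] prob_space.prob_space_distr[OF M' mm(2)]
      by (simp add: finite_measure.emeasure_eq_measure prob_space.finite_measure)
  next
    show "range (\<lambda>_::nat. \<Pi>\<^sub>E i\<in>I. UNIV) \<subseteq> prod_algebra I (\<lambda>_. borel :: real measure)"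
      using I by (auto intro!: prod_algebraI_finite)
    show "(\<Union>i::nat. \<Pi>\<^sub>E i\<in>I. UNIV) = space (PiM I (\<lambda>_. borel :: real measure))"
      by (auto simp: space_PiM)
    show "emeasure (distr M (PiM I (\<lambda>_. borel)) (\<lambda>x. \<lambda>i\<in>I. X i x)) (\<Pi>\<^sub>E i\<in>I. UNIV) \<noteq> \<infinity>" for i :: nat
      using prob_space.prob_space_distr[OF M mm(1)]
      by (simp add: finite_measure.emeasure_eq_measure prob_space.finite_measure)
  qed simp_all
qed

section \<open>The standard normal law: small balls and absolute moments\<close>

abbreviation N1 :: "real measure" where "N1 \<equiv> std_normal_distribution"

interpretation N1: prob_space N1
  by (rule prob_space_normal_density) simp

lemma sets_N1[measurable_cong]: "sets N1 = sets borel" by simp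

lemma norm_integral_le:
  fixes f :: "'a \<Rightarrow> 'b::{banach, second_countable_topology}"
  assumes g: "integrable M g" and [measurable]: "f \<in> borel_measurable M"
    and le: "\<And>x. x \<in> space M \<Longrightarrow> norm (f x) \<le> g x"
  shows "integrable M f" "norm (LINT x|M. f x) \<le> (LINT x|M. g x)"
proof -
  show f: "integrable M f"
    by (rule Bochner_Integration.integrable_bound[OF g]) (auto intro!: AE_I2 order_trans[OF le])
  have "norm (LINT x|M. f x) \<le> (LINT x|M. norm (f x))" by (rule integral_norm_bound)
  also have "\<dots> \<le> (LINT x|M. g x)" by (intro integral_mono integrable_norm f g le)
  finally show "norm (LINT x|M. f x) \<le> (LINT x|M. g x)" .
qed

lemma integral_bounded_product:
  fixes f :: "'a \<Rightarrow> complex" and g :: "'b \<Rightarrow> complex"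
  assumes "prob_space M1" "prob_space M2"
    and [measurable]: "f \<in> borel_measurable M1" "g \<in> borel_measurable M2"
    and f: "\<And>x. norm (f x) \<le> 1" and g: "\<And>x. norm (g x) \<le> 1"
  shows "(CLINT p|M1 \<Otimes>\<^sub>M M2. f (fst p) * g (snd p)) = (CLINT x|M1. f x) * (CLINT y|M2. g y)"
proof -
  interpret M1: prob_space M1 by fact
  interpret M2: prob_space M2 by fact
  interpret P: pair_prob_space M1 M2 ..
  have "integrable (M1 \<Otimes>\<^sub>M M2) (\<lambda>(x, y). f x * g y)"
    by (rule P.integrable_const_bound[of _ 1]) (auto simp: norm_mult split: prod.split intro!: AE_I2 mult_le_one f g)
  from P.integral_fst'[OF this] show ?thesis
    by (simp add: case_prod_beta')
qed

text \<open>The tuple form fits \<open>uncorrelated_law\<close>: two uncorrelated variables and two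
  remainders.\<close>

lemma char_unique4:
  fixes X1 X2 X3 X4 :: "'a \<Rightarrow> real" and Y1 Y2 Y3 Y4 :: "'b \<Rightarrow> real"
  assumes M: "prob_space M" and M': "prob_space M'"
    and [measurable]: "X1 \<in> borel_measurable M" "X2 \<in> borel_measurable M" "X3 \<in> borel_measurable M" "X4 \<in> borel_measurable M"
      "Y1 \<in> borel_measurable M'" "Y2 \<in> borel_measurable M'" "Y3 \<in> borel_measurable M'" "Y4 \<in> borel_measurable M'"
    and eq: "\<And>a b c d. (CLINT x|M. iexp (a * X1 x + b * X2 x + c * X3 x + d * X4 x)) =
                    (CLINT x|M'. iexp (a * Y1 x + b * Y2 x + c * Y3 x + d * Y4 x))"
  shows "distr M (borel \<Otimes>\<^sub>M borel \<Otimes>\<^sub>M borel \<Otimes>\<^sub>M borel) (\<lambda>x. (X1 x, X2 x, X3 x, X4 x)) =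
         distr M' (borel \<Otimes>\<^sub>M borel \<Otimes>\<^sub>M borel \<Otimes>\<^sub>M borel) (\<lambda>x. (Y1 x, Y2 x, Y3 x, Y4 x))"
proof -
  let ?I = "{0, 1, 2, 3::nat}"
  let ?P = "borel \<Otimes>\<^sub>M borel \<Otimes>\<^sub>M borel \<Otimes>\<^sub>M (borel :: real measure)"
  define X where "X i = (if i = 0 then X1 else if i = 1 then X2 else if i = 2 then X3 else X4)" for i :: nat
  define Y where "Y i = (if i = 0 then Y1 else if i = 1 then Y2 else if i = 2 then Y3 else Y4)" for i :: nat
  have [measurable]: "X i \<in> borel_measurable M" "Y i \<in> borel_measurable M'" for i
    by (auto simp: X_def Y_def)
  have eq': "distr M (PiM ?I (\<lambda>_. borel)) (\<lambda>x. \<lambda>i\<in>?I. X i x) = distr M' (PiM ?I (\<lambda>_. borel)) (\<lambda>x. \<lambda>i\<in>?I. Y i x)"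
  proof (rule multivariate_char_unique[OF M M'])
    fix c
    show "(CLINT x|M. iexp (\<Sum>i\<in>?I. c i * X i x)) = (CLINT x|M'. iexp (\<Sum>i\<in>?I. c i * Y i x))"
      using eq[of "c 0" "c 1" "c 2" "c 3"] by (simp add: X_def Y_def add.assoc del: of_real_add of_real_mult)
  qed simp_all
  define h :: "(nat \<Rightarrow> real) \<Rightarrow> real \<times> real \<times> real \<times> real" where "h = (\<lambda>x. (x 0, x 1, x 2, x 3))"
  have [measurable]: "h \<in> measurable (PiM ?I (\<lambda>_. borel)) ?P"
    unfolding h_def by (intro measurable_Pair measurable_component_singleton) auto
  have "distr (distr M (PiM ?I (\<lambda>_. borel)) (\<lambda>x. \<lambda>i\<in>?I. X i x)) ?P h = 
        distr M ?P (\<lambda>x. (X1 x, X2 x, X3 x, X4 x))"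
    by (subst distr_distr) (auto simp: h_def X_def comp_def intro!: measurable_restrict)
  moreover have "distr (distr M' (PiM ?I (\<lambda>_. borel)) (\<lambda>x. \<lambda>i\<in>?I. Y i x)) ?P h = 
        distr M' ?P (\<lambda>x. (Y1 x, Y2 x, Y3 x, Y4 x))"
    by (subst distr_distr) (auto simp: h_def Y_def comp_def intro!: measurable_restrict)
  ultimately show ?thesis using eq' by simp
qed

lemma char_N1: "(CLINT x|N1. iexp (t * x)) = complex_of_real (exp (- (t\<^sup>2 / 2)))"
  using char_std_normal_distribution[THEN fun_cong, of t] unfolding char_def by simp

lemma N1_moment_2: "integrable N1 (\<lambda>x. x\<^sup>2)" "(LINT x|N1. x\<^sup>2) = 1"
  using integrable_std_normal_distribution_moment[of 2] std_normal_distribution_even_moments(1)[of 1]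
  by (auto simp: numeral_2_eq_2)

lemma N1_moment_1: "integrable N1 (\<lambda>x. x)" "(LINT x|N1. x) = 0"
  using integrable_std_normal_distribution_moment[of 1] integral_std_normal_distribution_moment_odd[of 1]
  by auto

lemma N1_abs_moment: "integrable N1 (\<lambda>x. \<bar>x\<bar> ^ k)"
  using integrable_abs[OF integrable_std_normal_distribution_moment[of k]] by (simp add: power_abs)

lemma N1_abs_moments: "(LINT x|N1. \<bar>x\<bar>) = sqrt (2/pi)" "(LINT x|N1. \<bar>x\<bar>^3) = 2 * sqrt (2/pi)"
    "(LINT x|N1. \<bar>x\<bar>^5) = 8 * sqrt (2/pi)"
  using std_normal_distribution_odd_moments_abs[of 0] std_normal_distribution_odd_moments_abs[of 1]
    std_normal_distribution_odd_moments_abs[of 2] by (simp_all add: fact_numeral eval_nat_numeral)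

text \<open>In Kac--Rice terms |y| is the modulus of the normalised derivative at a zero, and the
  cosine is the part of the exponential functional that is correlated with this derivative.\<close>

definition ell :: "real \<Rightarrow> real" where "ell b = (LINT y|N1. \<bar>y\<bar> * cos (b * y))"

lemma integrable_abs_cos: "integrable N1 (\<lambda>y. \<bar>y\<bar> * cos (b * y))"
  using N1_abs_moment[of 1]
  by (rule Bochner_Integration.integrable_bound) (auto simp: abs_mult intro!: mult_left_le)

lemma N1_integral_reflect:
  fixes g :: "real \<Rightarrow> real"
  assumes [measurable]: "g \<in> borel_measurable borel"
  shows "(LINT y|N1. g (- y)) = (LINT y|N1. g y)"
  using lborel_integral_real_affine[of "-1" "\<lambda>y. std_normal_density y * g y" 0]
  by (simp add: integral_density std_normal_density_def)

lemma integral_abs_iexp: "(CLINT y|N1. \<bar>y\<bar> * iexp (b * y)) = of_real (ell b)"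
proof -
  have i: "integrable N1 (\<lambda>y. complex_of_real \<bar>y\<bar> * iexp (b * y))"
    using N1_abs_moment[of 1]
    by (rule Bochner_Integration.integrable_bound) (auto simp: norm_mult simp del: of_real_mult)
  have "(LINT y|N1. \<bar>y\<bar> * sin (b * y)) = - (LINT y|N1. \<bar>y\<bar> * sin (b * y))"
    using N1_integral_reflect[of "\<lambda>y. \<bar>y\<bar> * sin (b * y)"] by simp
  then have s: "(LINT y|N1. \<bar>y\<bar> * sin (b * y)) = 0" by linarith
  have "Re (CLINT y|N1. \<bar>y\<bar> * iexp (b * y)) = (LINT y|N1. Re (\<bar>y\<bar> * iexp (b * y)))"
    by (rule integral_Re[OF i, symmetric])
  moreover have "Im (CLINT y|N1. \<bar>y\<bar> * iexp (b * y)) = (LINT y|N1. Im (\<bar>y\<bar> * iexp (b * y)))"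
    by (rule integral_Im[OF i, symmetric])
  ultimately show ?thesis using s
    by (intro complex_eqI) (simp_all add: ell_def Re_exp Im_exp)
qed

lemma std_normal_density_le: "std_normal_density x \<le> 1/2"
proof -
  have "2 \<le> sqrt (2 * pi)" using pi_gt3 by (intro real_le_rsqrt) auto
  then have "1 / sqrt (2 * pi) \<le> 1/2" by (simp add: field_simps)
  moreover have "std_normal_density x \<le> 1 / sqrt (2 * pi) * 1"
    unfolding std_normal_density_def by (intro mult_left_mono) auto
  ultimately show ?thesis by linarith
qed

lemma N1_small_ball:
  assumes "a \<ge> 0"
  shows "emeasure N1 {x. \<bar>x\<bar> \<le> a} \<le> ennreal a"
proof -
  have "emeasure N1 {x. \<bar>x\<bar> \<le> a} = (\<integral>\<^sup>+x. ennreal (std_normal_density x) * indicator {x. \<bar>x\<bar> \<le> a} x \<partial>lborel)"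
    by (subst emeasure_density) auto
  also have "\<dots> \<le> (\<integral>\<^sup>+x. ennreal (1/2) * indicator {-a..a} x \<partial>lborel)"
    using ennreal_leI[OF std_normal_density_le]
    by (intro nn_integral_mono mult_mono) (simp_all only: zero_le, auto split: split_indicator)
  also have "\<dots> = ennreal (1/2) * ennreal (2 * a)"
    using assms by (subst nn_integral_cmult_indicator) auto
  also have "\<dots> = ennreal (1/2 * (2 * a))" by (rule ennreal_mult[symmetric]) (use assms in auto)
  also have "\<dots> = ennreal a" by simp
  finally show ?thesis .
qed

text \<open>On the short interval the integrand is replaced by the density at 0, whose product with
  the length 2a is \<open>sqrt (2/pi) * a\<close>. The density and the oscillating factor each vary
  at most linearly in |x|, which after integration leaves a quadratic error.\<close>

lemma N1_small_ball_char:
  assumes a: "a \<ge> 0"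
  shows "norm ((CLINT x|N1. indicator {x. \<bar>x\<bar> < a} x * iexp (t * x)) - of_real (sqrt (2/pi) * a)) \<le> (1 + \<bar>t\<bar>) * a\<^sup>2"
proof -
  define p where "p = 1 / sqrt (2 * pi)"
  have p: "p = std_normal_density 0" "p \<ge> 0" "p \<le> 1/2" using std_normal_density_le[of 0] by (auto simp: p_def std_normal_density_def)
  have set: "{x. \<bar>x\<bar> < a} = {-a<..<a}" by auto
  have "sqrt (2/pi) = 2 * p" unfolding p_def using real_sqrt_mult[of 2 2]
    by (simp add: real_sqrt_divide real_sqrt_mult field_simps)
  then have c: "of_real (sqrt (2/pi) * a) = (CLINT x|lborel. indicator {-a<..<a} x *\<^sub>R (of_real p::complex))"
    using a by (simp add: scaleR_conv_of_real)
  have i1: "integrable lborel (\<lambda>x. indicator {-a<..<a} x *\<^sub>R (of_real p::complex))"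
    by (intro integrable_indicator integrable_real_indicator) (use a in \<open>auto simp: emeasure_lborel_Ioo\<close>)
  have i2: "integrable lborel (\<lambda>x. std_normal_density x *\<^sub>R (indicator {-a<..<a} x * iexp (t * x)))"
    by (rule Bochner_Integration.integrable_bound[where f = std_normal_density])
       (auto simp: indicator_def norm_mult simp del: of_real_mult)
  have pt: "norm (std_normal_density x *\<^sub>R iexp (t * x) - of_real p) \<le> (1 + \<bar>t\<bar>) * a * (1/2)" if "\<bar>x\<bar> < a" for x
  proof -
    have e: "1 - exp (- x\<^sup>2 / 2) \<le> \<bar>x\<bar>"
    proof (cases "\<bar>x\<bar> \<ge> 1")
      case True then show ?thesis by (smt (verit) exp_gt_zero)
    next
      case False
      have "1 - exp (- x\<^sup>2 / 2) \<le> x\<^sup>2 / 2" using exp_ge_add_one_self[of "- x\<^sup>2 / 2"] by simp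
      also have "\<dots> \<le> \<bar>x\<bar>" using False by (auto simp: power2_eq_square abs_if intro: mult_left_le) (smt (verit) mult_left_le mult_minus_left mult_minus_right)+
      finally show ?thesis .
    qed
    have "std_normal_density x *\<^sub>R iexp (t * x) - of_real p = 
        of_real (std_normal_density x - p) * iexp (t * x) + of_real p * (iexp (t * x) - 1)"
      by (simp add: scaleR_conv_of_real algebra_simps)
    also have "norm \<dots> \<le> \<bar>std_normal_density x - p\<bar> + p * norm (iexp (t * x) - 1)"
      by (rule order_trans[OF norm_triangle_ineq]) (use p in \<open>auto simp: norm_mult simp del: of_real_mult of_real_diff\<close>)
    also have "\<bar>std_normal_density x - p\<bar> = p * (1 - exp (- x\<^sup>2 / 2))"
      using p(2) by (simp add: std_normal_density_def p_def abs_if field_simps)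
    also have "norm (iexp (t * x) - 1) \<le> \<bar>t * x\<bar>"
      using iexp_approx1[of "t * x" 0] by simp
    finally have "norm (std_normal_density x *\<^sub>R iexp (t * x) - of_real p) \<le> p * (\<bar>x\<bar> + \<bar>t\<bar> * \<bar>x\<bar>)"
      using e p(2) by (auto simp: distrib_left abs_mult intro: order_trans mult_left_mono add_mono)
    also have "\<dots> \<le> (1/2) * (a + \<bar>t\<bar> * a)"
      using p that by (intro mult_mono add_mono mult_left_mono) auto
    finally show ?thesis by (simp add: algebra_simps)
  qed
  have "(CLINT x|N1. indicator {x. \<bar>x\<bar> < a} x * iexp (t * x)) = 
      (CLINT x|lborel. std_normal_density x *\<^sub>R (indicator {-a<..<a} x * iexp (t * x)))"
    unfolding set by (subst integral_density) auto
  then have eq: "(CLINT x|N1. indicator {x. \<bar>x\<bar> < a} x * iexp (t * x)) - of_real (sqrt (2/pi) * a) =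
      (CLINT x|lborel. std_normal_density x *\<^sub>R (indicator {-a<..<a} x * iexp (t * x)) - indicator {-a<..<a} x *\<^sub>R of_real p)"
    unfolding c using i1 i2 by simp
  have "norm (CLINT x|lborel. std_normal_density x *\<^sub>R (indicator {-a<..<a} x * iexp (t * x)) - indicator {-a<..<a} x *\<^sub>R of_real p)
      \<le> (LINT x|lborel. indicator {-a<..<a} x * ((1 + \<bar>t\<bar>) * a * (1/2)))"
  proof (rule norm_integral_le(2))
    have "integrable lborel (\<lambda>x. indicator {-a<..<a} x :: real)"
      using a by (intro integrable_real_indicator) auto
    then show "integrable lborel (\<lambda>x. indicator {-a<..<a} x * ((1 + \<bar>t\<bar>) * a * (1/2)) :: real)" by simp
    show "norm (std_normal_density x *\<^sub>R (indicator {-a<..<a} x * iexp (t * x)) - indicator {-a<..<a} x *\<^sub>R of_real p)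
        \<le> indicator {-a<..<a} x * ((1 + \<bar>t\<bar>) * a * (1/2))" for x
      using pt[of x] by (cases "x \<in> {-a<..<a}") (auto simp: abs_less_iff)
  qed simp
  also have "\<dots> = (LINT x|lborel. indicator {-a<..<a} x) * ((1 + \<bar>t\<bar>) * a * (1/2))"
    by (rule integral_mult_left_zero)
  also have "(LINT x|lborel. indicator {-a<..<a} x) = 2 * a"
    using a by simp
  also have "2 * a * ((1 + \<bar>t\<bar>) * a * (1/2)) = (1 + \<bar>t\<bar>) * a\<^sup>2" by (simp only: power2_eq_square) simp
  finally show ?thesis unfolding eq .
qed

section \<open>Centred Gaussian spaces: independence, one sign change, two sign changes\<close>

text \<open>Only one-dimensional laws are prescribed: closure under linear combinations turns them
  into statements on joint laws, through characteristic functions.\<close>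

locale gauss_space = prob_space M for M :: "'a measure" +
  fixes G :: "('a \<Rightarrow> real) set"
  assumes G_meas: "X \<in> G \<Longrightarrow> X \<in> borel_measurable M"
    and G_zero: "(\<lambda>_. 0) \<in> G"
    and G_add: "X \<in> G \<Longrightarrow> Y \<in> G \<Longrightarrow> (\<lambda>\<omega>. X \<omega> + Y \<omega>) \<in> G"
    and G_scale: "X \<in> G \<Longrightarrow> (\<lambda>\<omega>. c * X \<omega>) \<in> G"
    and G_normal: "X \<in> G \<Longrightarrow> \<exists>v\<ge>0. \<forall>t. (CLINT \<omega>|M. iexp (t * X \<omega>)) = complex_of_real (exp (- (v * t\<^sup>2 / 2)))"
begin

definition cov :: "('a \<Rightarrow> real) \<Rightarrow> ('a \<Rightarrow> real) \<Rightarrow> real" where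
  "cov X Y = expectation (\<lambda>\<omega>. X \<omega> * Y \<omega>)"

lemma G_diff: assumes "X \<in> G" "Y \<in> G" shows "(\<lambda>\<omega>. X \<omega> - Y \<omega>) \<in> G"
  using G_add[OF assms(1) G_scale[OF assms(2), of "-1"]] by simp

lemma G_sum: "finite I \<Longrightarrow> (\<And>i. i \<in> I \<Longrightarrow> X i \<in> G) \<Longrightarrow> (\<lambda>\<omega>. \<Sum>i\<in>I. X i \<omega>) \<in> G"
  by (induction I rule: finite_induct) (auto intro: G_zero G_add)

lemma normal_law:
  assumes X: "X \<in> G"
  shows "integrable M (\<lambda>\<omega>. (X \<omega>)\<^sup>2)" "cov X X \<ge> 0" "integrable M X" "expectation X = 0"
    "distr M borel X = distr N1 borel (\<lambda>x. sqrt (cov X X) * x)"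
proof -
  note [measurable] = G_meas[OF X]
  obtain v where v: "v \<ge> 0" "\<And>t. (CLINT \<omega>|M. iexp (t * X \<omega>)) = complex_of_real (exp (- (v * t\<^sup>2 / 2)))"
    using G_normal[OF X] by auto
  have law: "distr M borel X = distr N1 borel (\<lambda>x. sqrt v * x)"
  proof (rule Levy_uniqueness)
    show "real_distribution (distr M borel X)" "real_distribution (distr N1 borel (\<lambda>x. sqrt v * x))"
      by (intro real_distribution_distr N1.real_distribution_distr; simp)+
    show "char (distr M borel X) = char (distr N1 borel (\<lambda>x. sqrt v * x))"
    proof
      fix t
      have "char (distr M borel X) t = complex_of_real (exp (- (v * t\<^sup>2 / 2)))"
        unfolding char_def by (subst integral_distr) (use v in auto)
      moreover have "char (distr N1 borel (\<lambda>x. sqrt v * x)) t = complex_of_real (exp (- (v * t\<^sup>2 / 2)))"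
        unfolding char_def using char_N1[of "t * sqrt v"] v(1)
        by (subst integral_distr) (auto simp: power_mult_distrib mult_ac)
      ultimately show "char (distr M borel X) t = char (distr N1 borel (\<lambda>x. sqrt v * x)) t" by simp
    qed
  qed
  have "integrable (distr M borel X) (\<lambda>x. x\<^sup>2)"
    unfolding law using N1_moment_2 by (subst integrable_distr_eq) (auto simp: power_mult_distrib)
  then show i2: "integrable M (\<lambda>\<omega>. (X \<omega>)\<^sup>2)"
    by (rule integrable_distr_eq[THEN iffD1, rotated 2]) simp_all
  have "integrable (distr M borel X) (\<lambda>x. x)"
    unfolding law using integrable_mult_right[OF N1_moment_1(1), of "sqrt v"] by (intro integrable_distr_eq[THEN iffD2]) simp_all
  then show "integrable M X"
    by (rule integrable_distr_eq[THEN iffD1, rotated 2]) simp_all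
  have "expectation X = (LINT x|distr M borel X. x)" by (subst integral_distr) auto
  also have "\<dots> = (LINT x|N1. sqrt v * x)" unfolding law by (rule integral_distr) simp_all
  also have "\<dots> = 0" unfolding integral_mult_right_zero N1_moment_1(2) by simp
  finally show "expectation X = 0" .
  have "expectation (\<lambda>\<omega>. (X \<omega>)\<^sup>2) = (LINT x|distr M borel X. x\<^sup>2)" by (subst integral_distr) auto
  also have "\<dots> = v" unfolding law using v(1) by (subst integral_distr) (auto simp: power_mult_distrib N1_moment_2)
  finally have "cov X X = v" by (simp add: cov_def power2_eq_square)
  then show "cov X X \<ge> 0" "distr M borel X = distr N1 borel (\<lambda>x. sqrt (cov X X) * x)" using v law by auto
qed

lemma expectation_iexp: 
  assumes X: "X \<in> G" shows "(CLINT \<omega>|M. iexp (X \<omega>)) = complex_of_real (exp (- (cov X X / 2)))"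
proof -
  note [measurable] = G_meas[OF X]
  have "(CLINT \<omega>|M. iexp (X \<omega>)) = (CLINT x|distr M borel X. iexp x)" by (subst integral_distr) auto
  also have "\<dots> = (CLINT x|N1. iexp (sqrt (cov X X) * x))"
    unfolding normal_law(5)[OF X] by (subst integral_distr) auto
  finally show ?thesis unfolding char_N1 using normal_law(2)[OF X] by simp
qed

lemma cov_integrable:
  assumes X: "X \<in> G" and Y: "Y \<in> G" shows "integrable M (\<lambda>\<omega>. X \<omega> * Y \<omega>)"
proof -
  note [measurable] = G_meas[OF X] G_meas[OF Y]
  have "integrable M (\<lambda>\<omega>. (X \<omega>)\<^sup>2 + (Y \<omega>)\<^sup>2)" using normal_law(1) X Y by auto
  then show ?thesis
  proof (rule Bochner_Integration.integrable_bound)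
    have "\<bar>x * y\<bar> \<le> x\<^sup>2 + y\<^sup>2" for x y :: real
    proof -
      have "2 * (\<bar>x\<bar> * \<bar>y\<bar>) \<le> x\<^sup>2 + y\<^sup>2" using sum_squares_bound[of "\<bar>x\<bar>" "\<bar>y\<bar>"] by simp
      moreover have "0 \<le> \<bar>x\<bar> * \<bar>y\<bar>" by simp
      ultimately show ?thesis unfolding abs_mult by linarith
    qed
    then show "AE x in M. norm (X x * Y x) \<le> norm ((X x)\<^sup>2 + (Y x)\<^sup>2)" by auto
  qed simp
qed

lemma cov_commute: "cov X Y = cov Y X" by (simp add: cov_def mult.commute)

lemma cov_zero: "cov X (\<lambda>_. 0) = 0" by (simp add: cov_def)

lemma cov_add_left: "X \<in> G \<Longrightarrow> Y \<in> G \<Longrightarrow> Z \<in> G \<Longrightarrow> cov (\<lambda>\<omega>. X \<omega> + Y \<omega>) Z = cov X Z + cov Y Z"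
  unfolding cov_def by (simp add: distrib_right cov_integrable)
lemma cov_diff_left: "X \<in> G \<Longrightarrow> Y \<in> G \<Longrightarrow> Z \<in> G \<Longrightarrow> cov (\<lambda>\<omega>. X \<omega> - Y \<omega>) Z = cov X Z - cov Y Z"
  unfolding cov_def by (simp add: left_diff_distrib cov_integrable)
lemma cov_scale_left: "cov (\<lambda>\<omega>. c * X \<omega>) Z = c * cov X Z"
  unfolding cov_def by (simp add: mult.assoc)
lemma cov_add_right: "X \<in> G \<Longrightarrow> Y \<in> G \<Longrightarrow> Z \<in> G \<Longrightarrow> cov Z (\<lambda>\<omega>. X \<omega> + Y \<omega>) = cov Z X + cov Z Y"
  using cov_add_left by (simp add: cov_commute)
lemma cov_diff_right: "X \<in> G \<Longrightarrow> Y \<in> G \<Longrightarrow> Z \<in> G \<Longrightarrow> cov Z (\<lambda>\<omega>. X \<omega> - Y \<omega>) = cov Z X - cov Z Y"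
  using cov_diff_left by (simp add: cov_commute)
lemma cov_scale_right: "cov Z (\<lambda>\<omega>. c * X \<omega>) = c * cov Z X"
  using cov_scale_left by (simp add: cov_commute)
lemmas cov_simps = cov_add_left cov_diff_left cov_scale_left cov_add_right cov_diff_right cov_scale_right
  G_add G_diff G_scale

lemma cov_sum_left: "finite I \<Longrightarrow> (\<And>i. i \<in> I \<Longrightarrow> X i \<in> G) \<Longrightarrow> Z \<in> G \<Longrightarrow> 
    cov (\<lambda>\<omega>. \<Sum>i\<in>I. X i \<omega>) Z = (\<Sum>i\<in>I. cov (X i) Z)"
proof (induction I rule: finite_induct)
  case empty then show ?case by (simp add: cov_def)
next
  case (insert i I)
  then show ?case by (simp add: cov_add_left G_sum)
qed

lemma cov_Cauchy_Schwarz: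
  assumes X: "X \<in> G" and Y: "Y \<in> G" shows "\<bar>cov X Y\<bar> \<le> sqrt (cov X X) * sqrt (cov Y Y)"
proof -
  have "(cov X Y)\<^sup>2 \<le> cov X X * cov Y Y"
  proof (cases "cov Y Y = 0")
    case True
    have "0 \<le> cov (\<lambda>\<omega>. X \<omega> - c * Y \<omega>) (\<lambda>\<omega>. X \<omega> - c * Y \<omega>)" for c
      using X Y by (intro normal_law) (auto intro: G_diff G_scale)
    then have *: "0 \<le> cov X X - 2 * c * cov X Y" for c
      using X Y True by (simp add: cov_simps cov_commute[of Y X] mult.assoc)
    have "cov X Y = 0"
    proof (rule ccontr)
      assume "cov X Y \<noteq> 0"
      then show False using *[of "(cov X X + 1) / (2 * cov X Y)"] by simp
    qed
    then show ?thesis using True by simp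
  next
    case False
    define c where "c = cov X Y / cov Y Y"
    have "0 \<le> cov (\<lambda>\<omega>. X \<omega> - c * Y \<omega>) (\<lambda>\<omega>. X \<omega> - c * Y \<omega>)"
      using X Y by (intro normal_law) (auto intro: G_diff G_scale)
    also have "\<dots> = cov X X - c * cov X Y - c * (cov X Y - c * cov Y Y)"
      using X Y by (simp add: cov_simps cov_commute[of Y X])
    also have "\<dots> = cov X X - (cov X Y)\<^sup>2 / cov Y Y"
      using False by (simp add: c_def power2_eq_square)
    finally show ?thesis using normal_law(2)[OF Y] False by (simp add: field_simps)
  qed
  then have "sqrt ((cov X Y)\<^sup>2) \<le> sqrt (cov X X * cov Y Y)" by (rule real_sqrt_le_mono)
  then show ?thesis by (simp add: real_sqrt_mult)
qed

text \<open>The exponent of the joint characteristic function is a variance, and it splits because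
  the cross terms vanish. The two remainders may depend on each other, so they stay variables on
  \<open>M\<close> and only the first two coordinates become fresh normals, over which Fubini can
  then integrate first.\<close>

lemma uncorrelated_law:
  assumes u: "u \<in> G" and w: "w \<in> G" and e: "e \<in> G" and e': "e' \<in> G"
    and "cov u w = 0" "cov u e = 0" "cov u e' = 0" "cov w e = 0" "cov w e' = 0"
  shows "distr M (borel \<Otimes>\<^sub>M borel \<Otimes>\<^sub>M borel \<Otimes>\<^sub>M borel) (\<lambda>\<omega>. (u \<omega>, w \<omega>, e \<omega>, e' \<omega>)) =
         distr (N1 \<Otimes>\<^sub>M (N1 \<Otimes>\<^sub>M M)) (borel \<Otimes>\<^sub>M borel \<Otimes>\<^sub>M borel \<Otimes>\<^sub>M borel)
           (\<lambda>p. (sqrt (cov u u) * fst p, sqrt (cov w w) * fst (snd p), e (snd (snd p)), e' (snd (snd p))))"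
proof -
  note [measurable] = G_meas[OF u] G_meas[OF w] G_meas[OF e] G_meas[OF e']
  show ?thesis
  proof (rule char_unique4[OF prob_space_axioms])
  interpret Q: pair_prob_space N1 M ..
  interpret P: pair_prob_space N1 "N1 \<Otimes>\<^sub>M M" ..
  show "prob_space (N1 \<Otimes>\<^sub>M (N1 \<Otimes>\<^sub>M M))" by (rule P.prob_space_axioms)
  fix a b c d :: real
  define g where "g = (\<lambda>\<omega>. c * e \<omega> + d * e' \<omega>)"
  have g: "g \<in> G" unfolding g_def using e e' by (intro G_add G_scale)
  note [measurable] = G_meas[OF g]
  have z: "(\<lambda>\<omega>. a * u \<omega> + b * w \<omega> + g \<omega>) \<in> G" using u w g by (intro G_add G_scale)
  have z1: "cov u g = 0" "cov w g = 0"
    using assms by (simp_all add: cov_simps g_def)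
  then have "cov g u = 0" "cov g w = 0" "cov w u = 0"
    using assms(5) by (simp_all only: cov_commute[of g u] cov_commute[of g w] cov_commute[of w u])
  with z1 have v: "cov (\<lambda>\<omega>. a * u \<omega> + b * w \<omega> + g \<omega>) (\<lambda>\<omega>. a * u \<omega> + b * w \<omega> + g \<omega>) = a\<^sup>2 * cov u u + b\<^sup>2 * cov w w + cov g g"
    using u w g assms(5) by (simp add: cov_simps power2_eq_square)
  have l: "(CLINT x|M. iexp (a * u x + b * w x + g x)) = complex_of_real (exp (- ((a\<^sup>2 * cov u u + b\<^sup>2 * cov w w + cov g g) / 2)))"
    using expectation_iexp[OF z] unfolding v .
  have c1: "(CLINT x|N1. iexp (a * sqrt (cov u u) * x)) = complex_of_real (exp (- (a\<^sup>2 * cov u u / 2)))"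
    unfolding char_N1 using normal_law(2)[OF u] by (simp add: power_mult_distrib)
  have c2: "(CLINT x|N1. iexp (b * sqrt (cov w w) * x)) = complex_of_real (exp (- (b\<^sup>2 * cov w w / 2)))"
    unfolding char_N1 using normal_law(2)[OF w] by (simp add: power_mult_distrib)
  have "(CLINT p|N1 \<Otimes>\<^sub>M (N1 \<Otimes>\<^sub>M M). iexp (a * sqrt (cov u u) * fst p) * 
        (iexp (b * sqrt (cov w w) * fst (snd p)) * iexp (g (snd (snd p))))) =
      (CLINT x|N1. iexp (a * sqrt (cov u u) * x)) * (CLINT q|N1 \<Otimes>\<^sub>M M. iexp (b * sqrt (cov w w) * fst q) * iexp (g (snd q)))"
    using integral_bounded_product[OF N1.prob_space_axioms Q.prob_space_axioms,
      of "\<lambda>x. iexp (a * sqrt (cov u u) * x)" "\<lambda>q. iexp (b * sqrt (cov w w) * fst q) * iexp (g (snd q))"]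
    by (simp add: norm_mult del: of_real_mult)
  also have "(CLINT q|N1 \<Otimes>\<^sub>M M. iexp (b * sqrt (cov w w) * fst q) * iexp (g (snd q))) =
      (CLINT x|N1. iexp (b * sqrt (cov w w) * x)) * (CLINT x|M. iexp (g x))"
    using integral_bounded_product[OF N1.prob_space_axioms prob_space_axioms,
      of "\<lambda>x. iexp (b * sqrt (cov w w) * x)" "\<lambda>q. iexp (g q)"]
    by (simp add: norm_mult del: of_real_mult)
  also have "(CLINT x|N1. iexp (a * sqrt (cov u u) * x)) * \<dots> = complex_of_real (exp (- ((a\<^sup>2 * cov u u + b\<^sup>2 * cov w w + cov g g) / 2)))"
    unfolding c1 c2 expectation_iexp[OF g] of_real_mult[symmetric] exp_add[symmetric] by (simp add: field_simps)
  finally show "(CLINT x|M. iexp (a * u x + b * w x + c * e x + d * e' x)) =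
     (CLINT p|N1 \<Otimes>\<^sub>M (N1 \<Otimes>\<^sub>M M). iexp (a * (sqrt (cov u u) * fst p) + b * (sqrt (cov w w) * fst (snd p)) + c * e (snd (snd p)) + d * e' (snd (snd p))))"
    using l by (simp add: g_def distrib_left exp_add mult_ac add_ac)
qed simp_all
qed


text \<open>Regressing \<open>z\<close> on \<open>u\<close> and \<open>w\<close> leaves an
  independent remainder. With y the normalised value of \<open>w\<close>, the event confines the
  normalised \<open>u\<close> to a ball of radius \<tau> |y|, whose weight is sqrt (2/pi) \<tau> |y|
  to first order; the factor |y| turns the integral over \<open>w\<close> into \<open>ell b\<close>,
  and the remainder contributes the exponential.\<close>

lemma kac_rice_step:
  assumes u: "u \<in> G" and w: "w \<in> G" and z: "z \<in> G"
    and uw: "cov u w = 0" and Vu: "cov u u > 0" and Vw: "cov w w > 0"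
  defines "a \<equiv> cov z u / sqrt (cov u u)" and "b \<equiv> cov z w / sqrt (cov w w)"
    and "\<tau> \<equiv> sqrt (cov w w) / sqrt (cov u u)"
  shows "norm ((CLINT \<omega>|M. if \<bar>u \<omega>\<bar> < \<bar>w \<omega>\<bar> then iexp (z \<omega>) else 0) -
      complex_of_real (\<tau> * sqrt (2/pi) * exp (- ((cov z z - a\<^sup>2 - b\<^sup>2) / 2)) * ell b)) \<le> (1 + \<bar>a\<bar>) * \<tau>\<^sup>2"
proof -
  define su sw where "su = sqrt (cov u u)" and "sw = sqrt (cov w w)"
  have s: "su > 0" "sw > 0" "cov u u = su * su" "cov w w = sw * sw" using Vu Vw by (auto simp: su_def sw_def)
  have ab: "cov z u = a * su" "cov z w = b * sw" "\<tau> = sw / su" using s unfolding a_def b_def \<tau>_def su_def sw_def by auto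
  have \<tau>: "\<tau> > 0" using s ab by auto
  \<comment> \<open>Regression coefficients of \<open>z\<close> on \<open>u\<close> and
    \<open>w\<close>; \<open>a\<close> and \<open>b\<close> are the same for the normalised
    regressors.\<close>
  define p r where "p = a / su" and "r = b / sw"
  have pr: "cov z u = p * cov u u" "cov z w = r * cov w w" "a\<^sup>2 = p * (p * cov u u)" "b\<^sup>2 = r * (r * cov w w)"
    using s ab by (auto simp: p_def r_def power2_eq_square)
  define e where "e = (\<lambda>\<omega>. z \<omega> - p * u \<omega> - r * w \<omega>)"
  have e: "e \<in> G" unfolding e_def using u w z by (intro G_diff G_scale)
  have wu: "cov w u = 0" using uw by (simp add: cov_commute[of w u])
  have ue: "cov u e = 0" "cov w e = 0"
    unfolding e_def using u w z pr uw wu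
    by (simp_all add: cov_simps cov_commute[of u z] cov_commute[of w z])
  then have ze: "cov z e = cov e e"
    using u w z e cov_diff_left[of "\<lambda>\<omega>. z \<omega> - p * u \<omega>" "\<lambda>\<omega>. r * w \<omega>" e]
    by (simp add: e_def[symmetric] cov_simps)
  have Ve: "cov e e = cov z z - a\<^sup>2 - b\<^sup>2"
    unfolding ze[symmetric] unfolding e_def pr(3,4) using u w z pr(1,2)
    by (simp add: cov_simps)
  note [measurable] = G_meas[OF u] G_meas[OF w] G_meas[OF z] G_meas[OF e]
  interpret Q: pair_prob_space N1 M ..
  interpret P: pair_prob_space N1 "N1 \<Otimes>\<^sub>M M" ..
  let ?B = "borel \<Otimes>\<^sub>M borel \<Otimes>\<^sub>M borel \<Otimes>\<^sub>M (borel :: real measure)"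
  define F :: "real \<times> real \<times> real \<times> real \<Rightarrow> complex" where
    "F = (\<lambda>x. if \<bar>fst x\<bar> < \<bar>fst (snd x)\<bar> then iexp (p * fst x + r * fst (snd x) + fst (snd (snd x))) else 0)"
  have F[measurable]: "F \<in> borel_measurable ?B" unfolding F_def by measurable
  \<comment> \<open>The inner integral over the normalised \<open>u\<close>, with the normalised
    \<open>w\<close> held at \<open>y\<close>.\<close>
  define J where "J y = (CLINT x|N1. if \<bar>x\<bar> < \<tau> * \<bar>y\<bar> then iexp (a * x) else 0)" for y
  have Jm[measurable]: "J \<in> borel_measurable borel" unfolding J_def[abs_def] by measurable
  have Jn: "norm (J y) \<le> 1" for y
  proof -
    have "norm (J y) \<le> (LINT x|N1. 1)" unfolding J_def
      by (rule norm_integral_le) (auto simp del: of_real_mult)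
    then show ?thesis using N1.prob_space by simp
  qed
  have "(CLINT \<omega>|M. if \<bar>u \<omega>\<bar> < \<bar>w \<omega>\<bar> then iexp (z \<omega>) else 0) = (CLINT \<omega>|M. F (u \<omega>, w \<omega>, e \<omega>, 0))"
    by (intro Bochner_Integration.integral_cong) (auto simp: F_def e_def)
  also have "\<dots> = (CLINT x|distr M ?B (\<lambda>\<omega>. (u \<omega>, w \<omega>, e \<omega>, 0)). F x)"
    by (rule integral_distr[symmetric]) simp_all
  also have "\<dots> = (CLINT p|N1 \<Otimes>\<^sub>M (N1 \<Otimes>\<^sub>M M). F (su * fst p, sw * fst (snd p), e (snd (snd p)), 0))"
    unfolding uncorrelated_law[OF u w e G_zero uw ue(1) cov_zero ue(2) cov_zero, folded su_def sw_def]
    by (rule integral_distr) simp_all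
  also have "\<dots> = (CLINT p|N1 \<Otimes>\<^sub>M (N1 \<Otimes>\<^sub>M M). 
      (\<lambda>(x, q). (if \<bar>x\<bar> < \<tau> * \<bar>fst q\<bar> then iexp (a * x) else 0) * (iexp (b * fst q) * iexp (e (snd q)))) p)"
  proof (intro Bochner_Integration.integral_cong refl)
    fix pp :: "real \<times> real \<times> 'a"
    obtain x y \<omega> where p: "pp = (x, y, \<omega>)" by (cases pp) auto
    have "\<bar>su * x\<bar> < \<bar>sw * y\<bar> \<longleftrightarrow> \<bar>x\<bar> < \<tau> * \<bar>y\<bar>"
      using s by (simp add: ab abs_mult field_simps)
    then show "F (su * fst pp, sw * fst (snd pp), e (snd (snd pp)), 0) = (\<lambda>(x, q). (if \<bar>x\<bar> < \<tau> * \<bar>fst q\<bar> then iexp (a * x) else 0) * (iexp (b * fst q) * iexp (e (snd q)))) pp"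
      using s by (simp add: F_def p p_def r_def exp_add distrib_left)
  qed
  also have "\<dots> = (CLINT q|N1 \<Otimes>\<^sub>M M. (CLINT x|N1. (if \<bar>x\<bar> < \<tau> * \<bar>fst q\<bar> then iexp (a * x) else 0) * (iexp (b * fst q) * iexp (e (snd q)))))"
    using P.integral_snd[of "\<lambda>x q. (if \<bar>x\<bar> < \<tau> * \<bar>fst q\<bar> then iexp (a * x) else 0) * (iexp (b * fst q) * iexp (e (snd q)))"]
    by (subst P.integral_snd) (auto intro!: P.integrable_const_bound[of _ 1] simp: norm_mult simp del: of_real_mult)
  also have "\<dots> = (CLINT q|N1 \<Otimes>\<^sub>M M. (J (fst q) * iexp (b * fst q)) * iexp (e (snd q)))"
    unfolding J_def by (simp add: mult.assoc)
  also have "\<dots> = (CLINT y|N1. J y * iexp (b * y)) * (CLINT \<omega>|M. iexp (e \<omega>))"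
    by (rule integral_bounded_product[OF N1.prob_space_axioms prob_space_axioms])
       (auto simp: norm_mult Jn simp del: of_real_mult)
  also have "(CLINT \<omega>|M. iexp (e \<omega>)) = complex_of_real (exp (- ((cov z z - a\<^sup>2 - b\<^sup>2) / 2)))"
    using expectation_iexp[OF e] unfolding Ve .
  finally have L: "(CLINT \<omega>|M. if \<bar>u \<omega>\<bar> < \<bar>w \<omega>\<bar> then iexp (z \<omega>) else 0) = 
     (CLINT y|N1. J y * iexp (b * y)) * complex_of_real (exp (- ((cov z z - a\<^sup>2 - b\<^sup>2) / 2)))" .
  have i1: "integrable N1 (\<lambda>y. J y * iexp (b * y))"
    by (rule N1.integrable_const_bound[of _ 1]) (auto simp: norm_mult Jn simp del: of_real_mult)
  have i2: "integrable N1 (\<lambda>y. complex_of_real \<bar>y\<bar> * iexp (b * y))"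
    using N1_abs_moment[of 1]
    by (rule Bochner_Integration.integrable_bound) (auto simp: norm_mult simp del: of_real_mult)
  have R: "complex_of_real (\<tau> * sqrt (2/pi) * ell b) = (CLINT y|N1. complex_of_real (\<tau> * sqrt (2/pi)) * (complex_of_real \<bar>y\<bar> * iexp (b * y)))"
    unfolding integral_mult_right_zero integral_abs_iexp by simp
  have D: "(CLINT y|N1. J y * iexp (b * y)) - complex_of_real (\<tau> * sqrt (2/pi) * ell b) = 
      (CLINT y|N1. J y * iexp (b * y) - complex_of_real (\<tau> * sqrt (2/pi)) * (complex_of_real \<bar>y\<bar> * iexp (b * y)))"
    unfolding R using i1 i2 by (intro Bochner_Integration.integral_diff[symmetric] integrable_mult_right)
  have N: "norm (CLINT y|N1. J y * iexp (b * y) - complex_of_real (\<tau> * sqrt (2/pi)) * (complex_of_real \<bar>y\<bar> * iexp (b * y)))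
      \<le> (LINT y|N1. (1 + \<bar>a\<bar>) * \<tau>\<^sup>2 * y\<^sup>2)"
  proof (rule norm_integral_le)
    show "integrable N1 (\<lambda>y. (1 + \<bar>a\<bar>) * \<tau>\<^sup>2 * y\<^sup>2)" using N1_moment_2(1) by (rule integrable_mult_right)
    fix y
    have "J y = (CLINT x|N1. indicator {x. \<bar>x\<bar> < \<tau> * \<bar>y\<bar>} x * iexp (a * x))"
      unfolding J_def by (intro Bochner_Integration.integral_cong) (auto simp: indicator_def)
    then have "norm (J y - of_real (sqrt (2/pi) * (\<tau> * \<bar>y\<bar>))) \<le> (1 + \<bar>a\<bar>) * (\<tau> * \<bar>y\<bar>)\<^sup>2"
      using N1_small_ball_char[of "\<tau> * \<bar>y\<bar>" a] \<tau> by simp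
    moreover have "J y * iexp (b * y) - complex_of_real (\<tau> * sqrt (2/pi)) * (complex_of_real \<bar>y\<bar> * iexp (b * y)) = 
        (J y - of_real (sqrt (2/pi) * (\<tau> * \<bar>y\<bar>))) * iexp (b * y)" by (simp add: algebra_simps)
    ultimately show "norm (J y * iexp (b * y) - complex_of_real (\<tau> * sqrt (2/pi)) * (complex_of_real \<bar>y\<bar> * iexp (b * y)))
       \<le> (1 + \<bar>a\<bar>) * \<tau>\<^sup>2 * y\<^sup>2"
      by (simp only: norm_mult norm_exp_i_times) (simp add: power_mult_distrib mult.assoc)
  qed measurable
  have Z: "(LINT y|N1. (1 + \<bar>a\<bar>) * \<tau>\<^sup>2 * y\<^sup>2) = (1 + \<bar>a\<bar>) * \<tau>\<^sup>2"
    unfolding integral_mult_right_zero N1_moment_2(2) by simp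
  have N': "norm ((CLINT y|N1. J y * iexp (b * y)) - complex_of_real (\<tau> * sqrt (2/pi) * ell b)) \<le> (1 + \<bar>a\<bar>) * \<tau>\<^sup>2"
    unfolding D by (rule N[unfolded Z])
  \<comment> \<open>The expectation of the exponential of the remainder; being at most 1, it does
    not enlarge the error.\<close>
  define E where "E = exp (- ((cov z z - a\<^sup>2 - b\<^sup>2) / 2))"
  have E: "0 \<le> E" "E \<le> 1" using normal_law(2)[OF e] Ve by (auto simp: E_def)
  have eq: "(CLINT y|N1. J y * iexp (b * y)) * complex_of_real E - complex_of_real (\<tau> * sqrt (2/pi) * E * ell b) =
      ((CLINT y|N1. J y * iexp (b * y)) - complex_of_real (\<tau> * sqrt (2/pi) * ell b)) * complex_of_real E"
    by (simp add: algebra_simps)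
  show ?thesis unfolding L E_def[symmetric] eq norm_mult
    using mult_mono[OF N' E(2)] E by simp
qed

text \<open>This serves as a bound for two simultaneous sign changes, with \<open>d0\<close>,
  \<open>d1\<close> in the role of increments. Their parts along \<open>u\<close> and
  \<open>w\<close> are small enough to be absorbed, so the event forces both |u| and |w| below a
  multiple of the residuals of \<open>d0\<close> and \<open>d1\<close>. As \<open>u\<close> and
  \<open>w\<close> are independent of each other and of the residuals, two small-ball estimates give
  the inverse product of the standard deviations times the second moment of the residuals. The free
  \<open>c\<close> enters because regression residuals have the least variance.\<close>

lemma pair_bound:
  assumes x: "x0 \<in> G" "x1 \<in> G" and d: "d0 \<in> G" "d1 \<in> G" and st: "cov x0 x0 = cov x1 x1"
  defines "u \<equiv> (\<lambda>\<omega>. x0 \<omega> + x1 \<omega>)" and "w \<equiv> (\<lambda>\<omega>. x1 \<omega> - x0 \<omega>)"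
  assumes Vu: "cov u u > 0" and Vw: "cov w w > 0" and q: "q \<ge> 0" "q \<le> sqrt (cov u u) / 8" "q \<le> sqrt (cov w w) / 8"
    and dq: "cov d0 d0 \<le> q\<^sup>2" "cov d1 d1 \<le> q\<^sup>2"
  shows "prob {\<omega>\<in>space M. \<bar>x0 \<omega>\<bar> \<le> \<bar>d0 \<omega>\<bar> \<and> \<bar>x1 \<omega>\<bar> \<le> \<bar>d1 \<omega>\<bar>} \<le>
     8 * (cov (\<lambda>\<omega>. d0 \<omega> - c * w \<omega>) (\<lambda>\<omega>. d0 \<omega> - c * w \<omega>) + cov (\<lambda>\<omega>. d1 \<omega> - c * w \<omega>) (\<lambda>\<omega>. d1 \<omega> - c * w \<omega>))
       / (sqrt (cov u u) * sqrt (cov w w))"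
proof -
  have u: "u \<in> G" and w: "w \<in> G" unfolding u_def w_def using x by (auto intro: G_add G_diff)
  have uw: "cov u w = 0" unfolding u_def w_def using x st by (simp add: cov_simps cov_commute[of x1 x0])
  have wu: "cov w u = 0" using uw by (simp add: cov_commute[of w u])
  define su sw where "su = sqrt (cov u u)" and "sw = sqrt (cov w w)"
  have s: "su > 0" "sw > 0" "cov u u = su * su" "cov w w = sw * sw" using Vu Vw by (auto simp: su_def sw_def)
  define P0 r0 where "P0 d = cov d u / (su * su)" and "r0 d = cov d w / (sw * sw)" for d
  have pr: "cov d u = P0 d * cov u u" "cov d w = r0 d * cov w w" for d
    using s by (auto simp: P0_def r0_def)
  define R where "R d = (\<lambda>\<omega>. d \<omega> - P0 d * u \<omega> - r0 d * w \<omega>)" for d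
  have R: "R d \<in> G" "cov u (R d) = 0" "cov w (R d) = 0" if "d \<in> G" for d
    unfolding R_def using u w that pr[of d] uw wu
    by (simp_all add: cov_simps cov_commute[of u d] cov_commute[of w d])
  \<comment> \<open>Regression is the best approximation in the span of \<open>u\<close> and
    \<open>w\<close>, so subtracting any multiple of \<open>w\<close> gives an upper bound for the
    residual variance.\<close>
  have RV: "cov (R d) (R d) \<le> cov (\<lambda>\<omega>. d \<omega> - c * w \<omega>) (\<lambda>\<omega>. d \<omega> - c * w \<omega>)" if dG: "d \<in> G" for d
  proof -
    define p r where "p = P0 d" and "r = r0 d - c"
    have h: "(\<lambda>\<omega>. d \<omega> - c * w \<omega>) = (\<lambda>\<omega>. R d \<omega> + p * u \<omega> + r * w \<omega>)"
      by (auto simp: R_def p_def r_def algebra_simps)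
    have c0: "cov (R d) u = 0" "cov (R d) w = 0" using R[OF dG] by (simp_all add: cov_commute[of "R d"])
    have "cov (\<lambda>\<omega>. d \<omega> - c * w \<omega>) (\<lambda>\<omega>. d \<omega> - c * w \<omega>) = cov (R d) (R d) + p * (p * cov u u) + r * (r * cov w w)"
      unfolding h using R[OF dG] u w uw wu c0 by (simp add: cov_simps)
    moreover have "0 \<le> p * (p * cov u u)" "0 \<le> r * (r * cov w w)" 
      using normal_law(2)[OF u] normal_law(2)[OF w] by (auto simp flip: mult.assoc)
    ultimately show ?thesis by linarith
  qed
  define W where "W \<omega> = 2 * (\<bar>R d0 \<omega>\<bar> + \<bar>R d1 \<omega>\<bar>)" for \<omega>
  note [measurable] = G_meas[OF u] G_meas[OF w] G_meas[OF R(1)[OF d(1)]] G_meas[OF R(1)[OF d(2)]]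
    G_meas[OF x(1)] G_meas[OF x(2)] G_meas[OF d(1)] G_meas[OF d(2)]
  have bound: "\<bar>d \<omega>\<bar> \<le> D / 4 + \<bar>R d \<omega>\<bar>" 
    if dG: "d \<in> G" "cov d d \<le> q\<^sup>2" and uD: "\<bar>u \<omega>\<bar> \<le> D" "\<bar>w \<omega>\<bar> \<le> D" for d D \<omega>
  proof -
    have sq: "sqrt (cov d d) \<le> q" using dG(2) q(1) real_le_lsqrt by blast
    have "\<bar>cov d u\<bar> \<le> q * su" 
      using cov_Cauchy_Schwarz[OF dG(1) u, folded su_def] mult_right_mono[OF sq, of su] s(1) by linarith
    also have "\<dots> \<le> su * su / 8" using mult_right_mono[OF q(2)[folded su_def], of su] s(1) by simp
    finally have a: "\<bar>cov d u / (su * su)\<bar> \<le> 1/8" using s(1) by (simp add: abs_mult field_simps)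
    have "\<bar>cov d w\<bar> \<le> q * sw" 
      using cov_Cauchy_Schwarz[OF dG(1) w, folded sw_def] mult_right_mono[OF sq, of sw] s(2) by linarith
    also have "\<dots> \<le> sw * sw / 8" using mult_right_mono[OF q(3)[folded sw_def], of sw] s(2) by simp
    finally have b: "\<bar>cov d w / (sw * sw)\<bar> \<le> 1/8" using s(2) by (simp add: abs_mult field_simps)
    have "\<bar>d \<omega>\<bar> = \<bar>R d \<omega> + cov d u / (su * su) * u \<omega> + cov d w / (sw * sw) * w \<omega>\<bar>" by (simp add: R_def P0_def r0_def)
    also have "\<dots> \<le> \<bar>R d \<omega>\<bar> + \<bar>cov d u / (su * su)\<bar> * \<bar>u \<omega>\<bar> + \<bar>cov d w / (sw * sw)\<bar> * \<bar>w \<omega>\<bar>"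
      unfolding abs_mult[symmetric] by linarith
    also have "\<dots> \<le> \<bar>R d \<omega>\<bar> + 1/8 * D + 1/8 * D"
      using a b uD by (intro add_mono mult_mono) auto
    finally show ?thesis by simp
  qed
  have incl: "\<bar>u \<omega>\<bar> \<le> W \<omega> \<and> \<bar>w \<omega>\<bar> \<le> W \<omega>" if "\<bar>x0 \<omega>\<bar> \<le> \<bar>d0 \<omega>\<bar>" "\<bar>x1 \<omega>\<bar> \<le> \<bar>d1 \<omega>\<bar>" for \<omega>
  proof -
    define D where "D = \<bar>d0 \<omega>\<bar> + \<bar>d1 \<omega>\<bar>"
    have uw: "\<bar>u \<omega>\<bar> \<le> D" "\<bar>w \<omega>\<bar> \<le> D" using that by (auto simp: u_def w_def D_def)
    note b = bound[OF d(1) dq(1) uw] bound[OF d(2) dq(2) uw] uw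
    \<comment> \<open>The two inequalities are added: the sum of the two increments occurs on the
      right with total factor 1/2 and is moved to the left.\<close>
    have aux: "v \<le> 2 * (e + f)" if "a \<le> (a + b) / 4 + e" "b \<le> (a + b) / 4 + f" "v \<le> a + b" for a b e f v :: real
      using that by (simp add: field_simps)
    show ?thesis
      unfolding W_def using aux[OF b(1,2)[unfolded D_def] b(3)[unfolded D_def]] aux[OF b(1,2)[unfolded D_def] b(4)[unfolded D_def]] by blast
  qed
  interpret Q: pair_prob_space N1 M ..
  interpret P: pair_prob_space N1 "N1 \<Otimes>\<^sub>M M" ..
  let ?B = "borel \<Otimes>\<^sub>M borel \<Otimes>\<^sub>M borel \<Otimes>\<^sub>M (borel :: real measure)"
  define A where "A = {x \<in> space ?B. \<bar>fst x\<bar> \<le> 2 * (\<bar>fst (snd (snd x))\<bar> + \<bar>snd (snd (snd x))\<bar>) \<and> \<bar>fst (snd x)\<bar> \<le> 2 * (\<bar>fst (snd (snd x))\<bar> + \<bar>snd (snd (snd x))\<bar>)}"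
  have A[measurable]: "A \<in> sets ?B" unfolding A_def by measurable
  have W0: "W \<omega> \<ge> 0" for \<omega> by (simp add: W_def)
  have Wm[measurable]: "W \<in> borel_measurable M" unfolding W_def[abs_def] by measurable
  have "emeasure M {\<omega>\<in>space M. \<bar>x0 \<omega>\<bar> \<le> \<bar>d0 \<omega>\<bar> \<and> \<bar>x1 \<omega>\<bar> \<le> \<bar>d1 \<omega>\<bar>} \<le> 
      emeasure M ((\<lambda>\<omega>. (u \<omega>, w \<omega>, R d0 \<omega>, R d1 \<omega>)) -` A \<inter> space M)"
    using incl by (intro emeasure_mono) (auto simp: A_def W_def space_pair_measure)
  also have "\<dots> = emeasure (distr M ?B (\<lambda>\<omega>. (u \<omega>, w \<omega>, R d0 \<omega>, R d1 \<omega>))) A"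
    by (rule emeasure_distr[symmetric]) simp_all
  also have "\<dots> = (\<integral>\<^sup>+x. indicator A x \<partial>distr M ?B (\<lambda>\<omega>. (u \<omega>, w \<omega>, R d0 \<omega>, R d1 \<omega>)))"
    by simp
  also have "\<dots> = (\<integral>\<^sup>+p. indicator A (su * fst p, sw * fst (snd p), R d0 (snd (snd p)), R d1 (snd (snd p))) \<partial>(N1 \<Otimes>\<^sub>M (N1 \<Otimes>\<^sub>M M)))"
    unfolding uncorrelated_law[OF u w R(1)[OF d(1)] R(1)[OF d(2)] uw R(2)[OF d(1)] R(2)[OF d(2)] R(3)[OF d(1)] R(3)[OF d(2)], folded su_def sw_def]
    by (rule nn_integral_distr) simp_all
  also have "\<dots> = (\<integral>\<^sup>+p. indicator {x. \<bar>x\<bar> \<le> W (snd (snd p)) / su} (fst p) * indicator {x. \<bar>x\<bar> \<le> W (snd (snd p)) / sw} (fst (snd p)) \<partial>(N1 \<Otimes>\<^sub>M (N1 \<Otimes>\<^sub>M M)))"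
    using s(1,2) by (intro nn_integral_cong) (auto simp: A_def W_def space_pair_measure indicator_def abs_mult field_simps)
  also have "\<dots> = (\<integral>\<^sup>+q. (\<integral>\<^sup>+x. indicator {x. \<bar>x\<bar> \<le> W (snd q) / su} x * indicator {x. \<bar>x\<bar> \<le> W (snd q) / sw} (fst q) \<partial>N1) \<partial>(N1 \<Otimes>\<^sub>M M))"
    by (subst P.nn_integral_snd[symmetric]) (simp_all add: case_prod_beta')
  also have "\<dots> \<le> (\<integral>\<^sup>+q. ennreal (W (snd q) / su) * indicator {x. \<bar>x\<bar> \<le> W (snd q) / sw} (fst q) \<partial>(N1 \<Otimes>\<^sub>M M))"
  proof (rule nn_integral_mono)
    fix q :: "real \<times> 'a"
    have "(\<integral>\<^sup>+x. indicator {x. \<bar>x\<bar> \<le> W (snd q) / su} x * indicator {x. \<bar>x\<bar> \<le> W (snd q) / sw} (fst q) \<partial>N1)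
       = emeasure N1 {x. \<bar>x\<bar> \<le> W (snd q) / su} * indicator {x. \<bar>x\<bar> \<le> W (snd q) / sw} (fst q)"
      by (subst nn_integral_multc) simp_all
    also have "\<dots> \<le> ennreal (W (snd q) / su) * indicator {x. \<bar>x\<bar> \<le> W (snd q) / sw} (fst q)"
      using s(1,2) W0 by (intro mult_right_mono N1_small_ball) auto
    finally show "(\<integral>\<^sup>+x. indicator {x. \<bar>x\<bar> \<le> W (snd q) / su} x * indicator {x. \<bar>x\<bar> \<le> W (snd q) / sw} (fst q) \<partial>N1) \<le> \<dots>" .
  qed
  also have "\<dots> = (\<integral>\<^sup>+\<omega>. (\<integral>\<^sup>+y. ennreal (W \<omega> / su) * indicator {x. \<bar>x\<bar> \<le> W \<omega> / sw} y \<partial>N1) \<partial>M)"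
    by (subst Q.nn_integral_snd[symmetric]) (simp_all add: case_prod_beta')
  also have "\<dots> \<le> (\<integral>\<^sup>+\<omega>. ennreal (W \<omega> * W \<omega> / (su * sw)) \<partial>M)"
  proof (rule nn_integral_mono)
    fix \<omega>
    have "(\<integral>\<^sup>+y. ennreal (W \<omega> / su) * indicator {x. \<bar>x\<bar> \<le> W \<omega> / sw} y \<partial>N1) = ennreal (W \<omega> / su) * emeasure N1 {x. \<bar>x\<bar> \<le> W \<omega> / sw}"
      by (subst nn_integral_cmult) simp_all
    also have "\<dots> \<le> ennreal (W \<omega> / su) * ennreal (W \<omega> / sw)"
      using s(1,2) W0 by (intro mult_left_mono N1_small_ball) auto
    also have "\<dots> = ennreal (W \<omega> / su * (W \<omega> / sw))" using s(1,2) W0 by (intro ennreal_mult[symmetric]) auto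
    finally show "(\<integral>\<^sup>+y. ennreal (W \<omega> / su) * indicator {x. \<bar>x\<bar> \<le> W \<omega> / sw} y \<partial>N1) \<le> ennreal (W \<omega> * W \<omega> / (su * sw))"
      by simp
  qed
  also have "\<dots> \<le> (\<integral>\<^sup>+\<omega>. ennreal (8 / (su * sw) * (R d0 \<omega> * R d0 \<omega> + R d1 \<omega> * R d1 \<omega>)) \<partial>M)"
  proof (intro nn_integral_mono ennreal_leI)
    fix \<omega>
    have "W \<omega> * W \<omega> \<le> 8 * (R d0 \<omega> * R d0 \<omega> + R d1 \<omega> * R d1 \<omega>)"
      using sum_squares_bound[of "\<bar>R d0 \<omega>\<bar>" "\<bar>R d1 \<omega>\<bar>"] by (simp add: W_def power2_eq_square algebra_simps)
    then show "W \<omega> * W \<omega> / (su * sw) \<le> 8 / (su * sw) * (R d0 \<omega> * R d0 \<omega> + R d1 \<omega> * R d1 \<omega>)"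
      using divide_right_mono[of "W \<omega> * W \<omega>" _ "su * sw"] s(1,2) by simp
  qed
  also have "\<dots> = ennreal (expectation (\<lambda>\<omega>. 8 / (su * sw) * (R d0 \<omega> * R d0 \<omega> + R d1 \<omega> * R d1 \<omega>)))"
    using s(1,2) cov_integrable R d by (intro nn_integral_eq_integral) auto
  also have "expectation (\<lambda>\<omega>. 8 / (su * sw) * (R d0 \<omega> * R d0 \<omega> + R d1 \<omega> * R d1 \<omega>)) = 8 / (su * sw) * (cov (R d0) (R d0) + cov (R d1) (R d1))"
    unfolding cov_def using cov_integrable R(1)[OF d(1)] R(1)[OF d(2)] by simp
  finally have "emeasure M {\<omega>\<in>space M. \<bar>x0 \<omega>\<bar> \<le> \<bar>d0 \<omega>\<bar> \<and> \<bar>x1 \<omega>\<bar> \<le> \<bar>d1 \<omega>\<bar>} \<le> ennreal (8 / (su * sw) * (cov (R d0) (R d0) + cov (R d1) (R d1)))" .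
  then have "prob {\<omega>\<in>space M. \<bar>x0 \<omega>\<bar> \<le> \<bar>d0 \<omega>\<bar> \<and> \<bar>x1 \<omega>\<bar> \<le> \<bar>d1 \<omega>\<bar>} \<le> 8 / (su * sw) * (cov (R d0) (R d0) + cov (R d1) (R d1))"
    using s(1,2) normal_law(2)[OF R(1)[OF d(1)]] normal_law(2)[OF R(1)[OF d(2)]] by (simp add: emeasure_eq_measure)
  also have "\<dots> \<le> 8 / (su * sw) * (cov (\<lambda>\<omega>. d0 \<omega> - c * w \<omega>) (\<lambda>\<omega>. d0 \<omega> - c * w \<omega>) + cov (\<lambda>\<omega>. d1 \<omega> - c * w \<omega>) (\<lambda>\<omega>. d1 \<omega> - c * w \<omega>))"
    using s(1,2) RV[OF d(1)] RV[OF d(2)] by (intro mult_left_mono add_mono) auto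
  finally show ?thesis unfolding su_def sw_def by simp
qed

end

section \<open>Sign changes on dyadic grids and zeros of a continuous path\<close>

text \<open>Only strict sign changes are counted, so a zero sitting on a grid point does not
  contribute and a finite number of zeros is never exceeded.\<close>

definition crossings :: "(real \<Rightarrow> real) \<Rightarrow> real \<Rightarrow> real \<Rightarrow> nat \<Rightarrow> real" where
  "crossings g a h m = (\<Sum>j<m. of_bool (g (a + real j * h) * g (a + real (Suc j) * h) < 0))"

lemma crossings_card: "crossings g a h m = real (card {j. j < m \<and> g (a + real j * h) * g (a + real (Suc j) * h) < 0})"
proof -
  have "{j. j < m \<and> g (a + real j * h) * g (a + real (Suc j) * h) < 0} =
      {..<m} \<inter> {j. g (a + real j * h) * g (a + real (Suc j) * h) < 0}" by auto
  then show ?thesis unfolding crossings_def of_bool_def by (simp add: sum.If_cases)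
qed

lemma crossings_nonneg: "crossings g a h m \<ge> 0"
  unfolding crossings_def by (intro sum_nonneg) auto

lemma zero_of_sign_change:
  fixes g :: "real \<Rightarrow> real"
  assumes g: "continuous_on UNIV g" and xy: "x < y" and s: "g x * g y < 0"
  obtains t where "x < t" "t < y" "g t = 0"
proof -
  have c: "continuous_on {x..y} g" using g by (rule continuous_on_subset) auto
  have "\<exists>t. x \<le> t \<and> t \<le> y \<and> g t = 0"
  proof (cases "g x < 0")
    case True
    then have "g y > 0" using s by (simp add: mult_less_0_iff)
    then show ?thesis using IVT'[of g x 0 y] True xy c by auto
  next
    case False
    then have "g x > 0" "g y < 0" using s by (auto simp: mult_less_0_iff)
    then show ?thesis using IVT2'[of g y 0 x] xy c by auto
  qed
  then obtain t where t: "x \<le> t" "t \<le> y" "g t = 0" by auto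
  then have "t \<noteq> x" "t \<noteq> y" using s by auto
  with t show ?thesis by (intro that[of t]) auto
qed

text \<open>The intermediate value theorem puts a zero in the open interior of each such cell, and
  the open cells are disjoint. Finiteness matters since \<open>card\<close> of an infinite set is
  0.\<close>

lemma crossings_le_card_zeros:
  assumes g: "continuous_on UNIV g" and h: "h > 0" and fin: "finite {t \<in> {a..a + real m * h}. g t = 0}"
  shows "crossings g a h m \<le> real (card {t \<in> {a..a + real m * h}. g t = 0})"
proof -
  let ?J = "{j. j < m \<and> g (a + real j * h) * g (a + real (Suc j) * h) < 0}"
  have "\<exists>t. a + real j * h < t \<and> t < a + real (Suc j) * h \<and> g t = 0" if "j \<in> ?J" for j
  proof -
    have "a + real j * h < a + real (Suc j) * h" using h by simp
    moreover have "g (a + real j * h) * g (a + real (Suc j) * h) < 0" using that by blast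
    ultimately show ?thesis by (rule zero_of_sign_change[OF g]) blast
  qed
  then have "\<forall>j\<in>?J. \<exists>t. a + real j * h < t \<and> t < a + real (Suc j) * h \<and> g t = 0" by blast
  from bchoice[OF this] obtain z where "\<forall>j\<in>?J. a + real j * h < z j \<and> z j < a + real (Suc j) * h \<and> g (z j) = 0" ..
  then have z: "\<And>j. j \<in> ?J \<Longrightarrow> a + real j * h < z j \<and> z j < a + real (Suc j) * h \<and> g (z j) = 0" by blast
  have "inj_on z ?J"
  proof (rule inj_onI)
    fix i j assume ij: "i \<in> ?J" "j \<in> ?J" "z i = z j"
    have "real i * h < real (Suc j) * h" "real j * h < real (Suc i) * h"
      using z[OF ij(1)] z[OF ij(2)] ij(3) by linarith+
    then have "real i < real (Suc j)" "real j < real (Suc i)" using h mult_less_cancel_right_pos by blast+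
    then show "i = j" by linarith
  qed
  moreover have "z ` ?J \<subseteq> {t \<in> {a..a + real m * h}. g t = 0}"
  proof
    fix t assume "t \<in> z ` ?J"
    then obtain j where j: "j \<in> ?J" "t = z j" by auto
    have "real j * h \<ge> 0" "real (Suc j) * h \<le> real m * h" using h j(1) by (auto intro!: mult_right_mono simp del: of_nat_Suc)
    then show "t \<in> {t \<in> {a..a + real m * h}. g t = 0}" using z[OF j(1)] j(2) by force
  qed
  ultimately have "card ?J \<le> card {t \<in> {a..a + real m * h}. g t = 0}"
    using card_inj_on_le fin by blast
  then show ?thesis by (simp add: crossings_card)
qed

lemma discrete_sign_change:
  fixes v :: "nat \<Rightarrow> real"
  assumes "a \<le> b" "v a * v b < 0" "\<And>j. a \<le> j \<Longrightarrow> j \<le> b \<Longrightarrow> v j \<noteq> 0"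
  shows "\<exists>j. a \<le> j \<and> j < b \<and> v j * v (Suc j) < 0"
  using assms
proof (induction b rule: dec_induct)
  case base then show ?case by (simp add: mult_less_0_iff)
next
  case (step n)
  show ?case
  proof (cases "v a * v n < 0")
    case True
    then show ?thesis using step by (metis le_SucI less_SucI)
  next
    case False
    have "v n \<noteq> 0" "v a \<noteq> 0" using step by auto
    then have "v n * v (Suc n) < 0" using False step(4) by (auto simp: mult_less_0_iff)
    then show ?thesis using step by auto
  qed
qed

text \<open>Tangency without derivatives: the maximum over the interval equals 0. If it fails for
  both signs of the path, an interval with a zero contains values of both signs.\<close>

definition touches :: "(real \<Rightarrow> real) \<Rightarrow> real \<Rightarrow> real \<Rightarrow> bool" where
  "touches g x y \<longleftrightarrow> (\<forall>t\<in>{x..y}. g t \<le> 0) \<and> (\<exists>t\<in>{x..y}. g t = 0)"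

lemma sign_at_grid_point:
  fixes g :: "real \<Rightarrow> real"
  assumes g: "continuous_on UNIV g" and y: "g y > 0" and p: "p > 0"
  shows "\<exists>n0. \<forall>n\<ge>n0. g (real_of_int \<lfloor>y / (p / 2^n)\<rfloor> * (p / 2^n)) > 0"
proof -
  have "isCont g y" using g by (simp add: continuous_on_eq_continuous_at)
  then obtain e where e: "e > 0" "\<And>x. dist x y < e \<Longrightarrow> dist (g x) (g y) < g y"
    using y unfolding continuous_at_eps_delta by metis
  have "(\<lambda>n. p / 2^n) \<longlonglongrightarrow> 0" by (rule LIMSEQ_divide_realpow_zero) simp
  then obtain n0 where n0: "\<And>n. n \<ge> n0 \<Longrightarrow> p / 2^n < e"
    using e(1) p by (auto simp: tendsto_iff eventually_sequentially dist_real_def)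
  have "g (real_of_int \<lfloor>y / (p / 2^n)\<rfloor> * (p / 2^n)) > 0" if n: "n \<ge> n0" for n
  proof -
    define h where "h = p / 2^n"
    have h: "h > 0" "h < e" using p n0[OF n] by (auto simp: h_def)
    have "real_of_int \<lfloor>y / h\<rfloor> \<le> y / h" "y / h < real_of_int \<lfloor>y / h\<rfloor> + 1" by linarith+
    then have "real_of_int \<lfloor>y / h\<rfloor> * h \<le> y" "y < real_of_int \<lfloor>y / h\<rfloor> * h + h"
      using h(1) by (simp_all only: pos_le_divide_eq pos_divide_less_eq distrib_right mult_1_left)
    then have "dist (real_of_int \<lfloor>y / h\<rfloor> * h) y < e" using h by (auto simp: dist_real_def abs_if)
    from e(2)[OF this] show ?thesis unfolding h_def[symmetric] by (auto simp: dist_real_def abs_if split: if_splits)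
  qed
  then show ?thesis by blast
qed

text \<open>A coarse level puts the points of \<open>A\<close> into distinct cells. Since the path
  does not merely touch 0 there, each of these cells contains both signs; fine grids see both, hence
  a sign change inside the same coarse cell. Working with a finite set \<open>A\<close> of zeros
  allows the use both before the zero set is known to be finite and afterwards.\<close>

lemma card_zeros_le_crossings:
  fixes g :: "real \<Rightarrow> real"
  assumes g: "continuous_on UNIV g" and p: "p > 0"
    and nz: "\<And>n j. g (real j * (p / 2^n)) \<noteq> 0"
    and nt: "\<And>n j. j < K * 2^n \<Longrightarrow> \<not> touches g (real j * (p / 2^n)) (real (Suc j) * (p / 2^n))"
    and nt': "\<And>n j. j < K * 2^n \<Longrightarrow> \<not> touches (\<lambda>t. - g t) (real j * (p / 2^n)) (real (Suc j) * (p / 2^n))"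
    and A: "finite A" "A \<subseteq> {t \<in> {0..real K * p}. g t = 0}"
  shows "\<exists>n0. \<forall>n\<ge>n0. real (card A) \<le> crossings g 0 (p / 2^n) (K * 2^n)"
proof -
  have "\<exists>d>0. \<forall>s\<in>A. \<forall>t\<in>A. s \<noteq> t \<longrightarrow> d \<le> dist s t" 
  proof -
    let ?S = "(\<lambda>(s, t). dist s t) ` {(s, t). s \<in> A \<and> t \<in> A \<and> s \<noteq> t}"
    have f: "finite ?S" using A(1) by (intro finite_imageI finite_subset[OF _ finite_cartesian_product[OF A(1) A(1)]]) auto
    \<comment> \<open>The inserted 1 covers the case of fewer than two points, where no distance is
      available.\<close>
    show ?thesis
      by (rule exI[of _ "Min (insert 1 ?S)"]) (use f in \<open>auto intro!: Min_le\<close>)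
  qed
  then obtain d where d: "d > 0" "\<And>s t. s \<in> A \<Longrightarrow> t \<in> A \<Longrightarrow> s \<noteq> t \<Longrightarrow> d \<le> dist s t" by auto
  have "(\<lambda>n. p / 2^n) \<longlonglongrightarrow> 0" by (rule LIMSEQ_divide_realpow_zero) simp
  then obtain n1 where n1: "p / 2^n1 < d"
    using d(1) p by (auto simp: tendsto_iff eventually_sequentially dist_real_def)
  define h where "h = p / 2^n1"
  have h: "h > 0" "h < d" using p n1 by (auto simp: h_def)
  define c where "c t = nat \<lfloor>t / h\<rfloor>" for t
  have c: "real (c t) * h \<le> t" "t < real (Suc (c t)) * h" "c t < K * 2^n1" if t: "t \<in> A" for t
  proof -
    have t0: "0 \<le> t" "t \<le> real K * p" "g t = 0" using A(2) t by auto
    \<comment> \<open>The right end is a grid point, hence not a zero; otherwise the cell index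
      could run out of range.\<close>
    have "t \<noteq> real K * p" using nz[of "K" 0] t0(3) by auto
    then have tK: "t < real K * p" using t0 by simp
    have ct: "real (c t) \<le> t / h" "t / h < real (c t) + 1" using t0 h unfolding c_def by (simp, linarith)
    then show 1: "real (c t) * h \<le> t" "t < real (Suc (c t)) * h" using h by (auto simp: field_simps)
    have "real (c t) * h < real K * p" using 1 tK by linarith
    also have "real K * p = real (K * 2^n1) * h" by (simp add: h_def)
    finally have "real (c t) < real (K * 2^n1)" using h(1) mult_less_cancel_right_pos by blast
    then show "c t < K * 2^n1" by (simp only: of_nat_less_iff)
  qed
  have inj: "inj_on c A"
  proof (rule inj_onI, rule ccontr)
    fix s t assume st: "s \<in> A" "t \<in> A" "c s = c t" "s \<noteq> t"
    have "\<bar>s - t\<bar> < h" using c(1,2)[OF st(1)] c(1,2)[OF st(2)] st(3) by (auto simp: field_simps abs_if)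
    then show False using d(2)[OF st(1,2,4)] h(2) by (simp add: dist_real_def)
  qed
  have "\<exists>n0. \<forall>n\<ge>n0. \<exists>j. c t * 2^(n - n1) \<le> j \<and> j < Suc (c t) * 2^(n - n1) \<and> g (real j * (p / 2^n)) * g (real (Suc j) * (p / 2^n)) < 0"
    if t: "t \<in> A" for t
  proof -
    have tc: "t \<in> {real (c t) * h..real (Suc (c t)) * h}" "g t = 0" using c[OF t] A(2) t by auto
    from nt[OF c(3)[OF t]] tc obtain y1 where y1: "y1 \<in> {real (c t) * h..real (Suc (c t)) * h}" "g y1 > 0"
      unfolding touches_def h_def[symmetric] by force
    from nt'[OF c(3)[OF t]] tc obtain y2 where y2: "y2 \<in> {real (c t) * h..real (Suc (c t)) * h}" "- g y2 > 0"
      unfolding touches_def h_def[symmetric] by force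
    have g': "continuous_on UNIV (\<lambda>t. - g t)" using g by (intro continuous_intros)
    from sign_at_grid_point[OF g y1(2) p] obtain m1 where m1: "\<And>n. n \<ge> m1 \<Longrightarrow> g (real_of_int \<lfloor>y1 / (p / 2^n)\<rfloor> * (p / 2^n)) > 0" by blast
    from sign_at_grid_point[OF g' y2(2) p] obtain m2 where m2: "\<And>n. n \<ge> m2 \<Longrightarrow> - g (real_of_int \<lfloor>y2 / (p / 2^n)\<rfloor> * (p / 2^n)) > 0" by blast
    have "\<exists>j. c t * 2^(n - n1) \<le> j \<and> j < Suc (c t) * 2^(n - n1) \<and> g (real j * (p / 2^n)) * g (real (Suc j) * (p / 2^n)) < 0"
      if n: "n \<ge> max n1 (max m1 m2)" for n
    proof -
      define k where "k = p / 2^n"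
      define D where "D = (2::nat)^(n - n1)"
      have k: "k > 0" and hk: "h = real D * k" 
        using p n by (auto simp: k_def h_def D_def field_simps simp flip: power_add)
      have fl: "c t * D \<le> nat \<lfloor>y / k\<rfloor>" "nat \<lfloor>y / k\<rfloor> \<le> Suc (c t) * D" "real_of_int \<lfloor>y / k\<rfloor> = real (nat \<lfloor>y / k\<rfloor>)"
        if y: "y \<in> {real (c t) * h..real (Suc (c t)) * h}" for y
      proof -
        have yk: "real (c t * D) \<le> y / k" "y / k \<le> real (Suc (c t) * D)"
          using y k by (auto simp: hk field_simps)
        have "int (c t * D) \<le> \<lfloor>y / k\<rfloor>" using yk(1) by (subst le_floor_iff) (simp only: of_int_of_nat_eq)
        then show "c t * D \<le> nat \<lfloor>y / k\<rfloor>" by linarith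
        have "\<lfloor>y / k\<rfloor> \<le> \<lfloor>real (Suc (c t) * D)\<rfloor>" using yk(2) by (rule floor_mono)
        then have "\<lfloor>y / k\<rfloor> \<le> int (Suc (c t) * D)" by (simp only: floor_of_nat)
        then show "nat \<lfloor>y / k\<rfloor> \<le> Suc (c t) * D" by linarith
        have "0 \<le> \<lfloor>y / k\<rfloor>" using \<open>int (c t * D) \<le> \<lfloor>y / k\<rfloor>\<close> by linarith
        then show "real_of_int \<lfloor>y / k\<rfloor> = real (nat \<lfloor>y / k\<rfloor>)" by simp
      qed
      define v where "v j = g (real j * k)" for j :: nat
      define j1 j2 where "j1 = nat \<lfloor>y1 / k\<rfloor>" and "j2 = nat \<lfloor>y2 / k\<rfloor>"
      have v: "v j1 > 0" "v j2 < 0" 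
        using m1[of n] m2[of n] n fl(3)[OF y1(1)] fl(3)[OF y2(1)] by (auto simp: v_def j1_def j2_def k_def[symmetric])
      have v0: "v j \<noteq> 0" for j unfolding v_def k_def by (rule nz)
      have "v (min j1 j2) * v (max j1 j2) < 0" using v by (auto simp: min_def max_def mult_less_0_iff)
      moreover have "min j1 j2 \<le> max j1 j2" by simp
      ultimately have "\<exists>j. min j1 j2 \<le> j \<and> j < max j1 j2 \<and> v j * v (Suc j) < 0"
        using v0 by (intro discrete_sign_change)
      then obtain j where j: "min j1 j2 \<le> j" "j < max j1 j2" "v j * v (Suc j) < 0" by auto
      have "c t * D \<le> j" "j < Suc (c t) * D" using j fl(1,2)[OF y1(1)] fl(1,2)[OF y2(1)] unfolding j1_def j2_def by linarith+
      then show ?thesis using j(3) unfolding v_def k_def D_def by blast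
    qed
    then show ?thesis by blast
  qed
  then obtain N where N: "\<And>t n. t \<in> A \<Longrightarrow> n \<ge> N t \<Longrightarrow> \<exists>j. c t * 2^(n - n1) \<le> j \<and> j < Suc (c t) * 2^(n - n1) \<and> g (real j * (p / 2^n)) * g (real (Suc j) * (p / 2^n)) < 0"
    by metis
  define n0 where "n0 = Max (insert n1 (N ` A))"
  have "real (card A) \<le> crossings g 0 (p / 2^n) (K * 2^n)" if n: "n \<ge> n0" for n
  proof -
    have nn: "n \<ge> n1" "\<And>t. t \<in> A \<Longrightarrow> n \<ge> N t" using n A(1) unfolding n0_def by auto
    define D where "D = (2::nat)^(n - n1)"
    from N[OF _ nn(2)] obtain J where J: "\<And>t. t \<in> A \<Longrightarrow> c t * D \<le> J t \<and> J t < Suc (c t) * D \<and> g (real (J t) * (p / 2^n)) * g (real (Suc (J t)) * (p / 2^n)) < 0"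
      unfolding D_def by metis
    have D: "D > 0" by (simp add: D_def)
    \<comment> \<open>Integer division recovers the coarse cell, so sign changes belonging to
      different points are different.\<close>
    have cJ: "c t = J t div D" if "t \<in> A" for t
      using J[OF that] D by (metis div_nat_eqI mult.commute)
    have "inj_on J A"
      by (rule inj_onI) (metis cJ inj inj_onD)
    moreover have "J ` A \<subseteq> {j. j < K * 2^n \<and> g (0 + real j * (p / 2^n)) * g (0 + real (Suc j) * (p / 2^n)) < 0}"
    proof -
      have "J t < K * 2^n" if "t \<in> A" for t
      proof -
        have "J t < Suc (c t) * D" using J[OF that] by simp
        also have "\<dots> \<le> (K * 2^n1) * D" using c(3)[OF that] by (intro mult_right_mono) auto
        also have "\<dots> = K * 2^n" using nn(1) by (simp add: D_def mult.assoc flip: power_add)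
        finally show ?thesis .
      qed
      then show ?thesis using J by auto
    qed
    ultimately have "card A \<le> card {j. j < K * 2^n \<and> g (0 + real j * (p / 2^n)) * g (0 + real (Suc j) * (p / 2^n)) < 0}"
      by (intro card_inj_on_le) auto
    then show ?thesis by (simp add: crossings_card)
  qed
  then show ?thesis by blast
qed

text \<open>By compactness a continuous path has a zero on the interval exactly when its modulus has
  infimum 0, and by continuity a countable dense subset detects this.\<close>

lemma hit_measurable:
  fixes f :: "real \<Rightarrow> 'a \<Rightarrow> real"
  assumes [measurable]: "\<And>t. f t \<in> borel_measurable M"
    and cont: "\<And>\<omega>. \<omega> \<in> space M \<Longrightarrow> continuous_on UNIV (\<lambda>t. f t \<omega>)"
  shows "{\<omega>\<in>space M. \<exists>t\<in>{x..y}. f t \<omega> = 0} \<in> sets M"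
proof (cases "x \<le> y")
  case False then show ?thesis by simp
next
  case True
  \<comment> \<open>The affine image of the rationals contains both end points, which also covers a
    degenerate interval.\<close>
  define D where "D = {x..y} \<inter> range (\<lambda>q::rat. x + (y - x) * of_rat q)"
  have eq: "(\<exists>t\<in>{x..y}. f t \<omega> = 0) \<longleftrightarrow> (\<forall>n::nat. \<exists>t\<in>D. \<bar>f t \<omega>\<bar> < 1 / real (Suc n))" if \<omega>: "\<omega> \<in> space M" for \<omega>
  proof
    assume "\<exists>t\<in>{x..y}. f t \<omega> = 0"
    then obtain t where t: "t \<in> {x..y}" "f t \<omega> = 0" by auto
    show "\<forall>n::nat. \<exists>t\<in>D. \<bar>f t \<omega>\<bar> < 1 / real (Suc n)"
    proof
      fix n :: nat
      have "isCont (\<lambda>t. f t \<omega>) t" using cont[OF \<omega>] by (simp add: continuous_on_eq_continuous_at)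
      then obtain d where d: "d > 0" "\<And>s. dist s t < d \<Longrightarrow> dist (f s \<omega>) (f t \<omega>) < 1 / real (Suc n)"
        unfolding continuous_at_eps_delta by (metis divide_pos_pos of_nat_0_less_iff zero_less_Suc zero_less_one)
      have "\<exists>s\<in>D. dist s t < d"
      proof (cases "x = y")
        case True
        then show ?thesis using t d by (intro bexI[of _ x]) (auto simp: D_def)
      next
        case False
        define l u where "l = max 0 ((t - d - x) / (y - x))" and "u = min 1 ((t + d - x) / (y - x))"
        have xy: "y - x > 0" using True False by simp
        have "(t - d - x) / (y - x) < (t + d - x) / (y - x)" using d(1) xy by (intro divide_strict_right_mono) auto
        moreover have "(t - d - x) / (y - x) < 1" "0 < (t + d - x) / (y - x)" using t d(1) xy by auto
        ultimately have "l < u" by (auto simp: l_def u_def)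
        then obtain q :: rat where q: "l < of_rat q" "of_rat q < u" using of_rat_dense by blast
        then have q': "0 < real_of_rat q" "real_of_rat q < 1" "(t - d - x) / (y - x) < of_rat q" "of_rat q < (t + d - x) / (y - x)"
          by (auto simp: l_def u_def)
        then have "t - d < x + (y - x) * of_rat q" "x + (y - x) * of_rat q < t + d"
          using xy by (auto simp: field_simps)
        moreover have "(y - x) * of_rat q \<le> y - x" "0 \<le> (y - x) * of_rat q"
          using q' xy by (intro mult_left_le mult_nonneg_nonneg; simp)+
        then have "x + (y - x) * of_rat q \<in> D" unfolding D_def by auto
        ultimately show ?thesis by (intro bexI[of _ "x + (y - x) * of_rat q"]) (auto simp: dist_real_def abs_less_iff)
      qed
      then show "\<exists>t\<in>D. \<bar>f t \<omega>\<bar> < 1 / real (Suc n)" using d(2) t(2) by (auto simp: dist_real_def)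
    qed
  next
    assume a: "\<forall>n::nat. \<exists>t\<in>D. \<bar>f t \<omega>\<bar> < 1 / real (Suc n)"
    have "continuous_on {x..y} (\<lambda>t. \<bar>f t \<omega>\<bar>)" 
      using cont[OF \<omega>] by (intro continuous_intros) (auto intro: continuous_on_subset)
    from continuous_attains_inf[OF compact_Icc _ this] True obtain t where t: "t \<in> {x..y}" "\<And>s. s \<in> {x..y} \<Longrightarrow> \<bar>f t \<omega>\<bar> \<le> \<bar>f s \<omega>\<bar>" by auto
    have "f t \<omega> = 0"
    proof (rule ccontr)
      assume "f t \<omega> \<noteq> 0"
      then obtain n where "1 / real (Suc n) < \<bar>f t \<omega>\<bar>" using nat_approx_posE[of "\<bar>f t \<omega>\<bar>"] by auto
      moreover obtain s where "s \<in> D" "\<bar>f s \<omega>\<bar> < 1 / real (Suc n)" using a by auto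
      ultimately show False using t(2)[of s] by (auto simp: D_def)
    qed
    then show "\<exists>t\<in>{x..y}. f t \<omega> = 0" using t(1) by auto
  qed
  have "countable D" unfolding D_def by auto
  then have "{\<omega>\<in>space M. \<forall>n::nat. \<exists>t\<in>D. \<bar>f t \<omega>\<bar> < 1 / real (Suc n)} \<in> sets M" by measurable
  then show ?thesis using eq by (simp cong: conj_cong)
qed

text \<open>At least k zeros exist precisely when k pairwise disjoint rational intervals each
  contain one, and there are countably many such families. The events \<open>A k\<close> also hold
  the paths with infinitely many zeros, for which \<open>card\<close> is 0.\<close>

lemma zero_count_measurable:
  fixes f :: "real \<Rightarrow> 'a \<Rightarrow> real"
  assumes fm: "\<And>t. f t \<in> borel_measurable M"
    and cont: "\<And>\<omega>. \<omega> \<in> space M \<Longrightarrow> continuous_on UNIV (\<lambda>t. f t \<omega>)"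
  shows "zero_count f T \<in> borel_measurable M"
proof -
  define Z where "Z \<omega> = {t \<in> {0..T}. f t \<omega> = 0}" for \<omega>
  define DD :: "(rat \<times> rat) set set" where "DD = {B. finite B \<and> disjoint_family_on (\<lambda>P. {of_rat (fst P)..of_rat (snd P) :: real}) B}"
  have cDD: "countable DD" unfolding DD_def
    by (rule countable_subset[OF _ countable_Collect_finite_subset[of UNIV]]) auto
  define hit where "hit P \<omega> \<longleftrightarrow> (\<exists>t\<in>{max 0 (of_rat (fst P))..min T (of_rat (snd P))}. f t \<omega> = 0)" for P :: "rat \<times> rat" and \<omega>
  have hm[measurable]: "{\<omega>\<in>space M. hit P \<omega>} \<in> sets M" for P unfolding hit_def by (rule hit_measurable[OF fm cont])
  have eq: "(infinite (Z \<omega>) \<or> k \<le> card (Z \<omega>)) \<longleftrightarrow> (\<exists>B\<in>DD. card B = k \<and> (\<forall>P\<in>B. hit P \<omega>))" for k \<omega>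
  proof
    assume "infinite (Z \<omega>) \<or> k \<le> card (Z \<omega>)"
    then obtain A where A: "finite A" "A \<subseteq> Z \<omega>" "card A = k"
      using infinite_arbitrarily_large obtain_subset_with_card_n by metis
    have "\<exists>d>0. \<forall>s\<in>A. \<forall>t\<in>A. s \<noteq> t \<longrightarrow> d \<le> dist s t" 
    proof -
      let ?S = "(\<lambda>(s, t). dist s t) ` {(s, t). s \<in> A \<and> t \<in> A \<and> s \<noteq> t}"
      have f: "finite ?S" using A(1) by (intro finite_imageI finite_subset[OF _ finite_cartesian_product[OF A(1) A(1)]]) auto
      show ?thesis
        by (rule exI[of _ "Min (insert 1 ?S)"]) (use f in \<open>auto intro!: Min_le\<close>)
    qed
    then obtain d where d: "d > 0" "\<And>s t. s \<in> A \<Longrightarrow> t \<in> A \<Longrightarrow> s \<noteq> t \<Longrightarrow> d \<le> dist s t" by auto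
    have "\<exists>P::rat\<times>rat. t - d/2 < of_rat (fst P) \<and> of_rat (fst P) < t \<and> t < of_rat (snd P) \<and> of_rat (snd P) < t + d/2" for t
    proof -
      obtain q1 :: rat where "t - d/2 < of_rat q1" "of_rat q1 < t" using of_rat_dense[of "t - d/2" t] d(1) by auto
      moreover obtain q2 :: rat where "t < of_rat q2" "of_rat q2 < t + d/2" using of_rat_dense[of t "t + d/2"] d(1) by auto
      ultimately show ?thesis by (intro exI[of _ "(q1, q2)"]) auto
    qed
    then obtain P :: "real \<Rightarrow> rat \<times> rat" where P: "\<And>t. t - d/2 < of_rat (fst (P t)) \<and> of_rat (fst (P t)) < t \<and> t < of_rat (snd (P t)) \<and> of_rat (snd (P t)) < t + d/2"
      by metis
    have dj: "{of_rat (fst (P s))..of_rat (snd (P s)) :: real} \<inter> {of_rat (fst (P t))..of_rat (snd (P t))} = {}" if "s \<in> A" "t \<in> A" "s \<noteq> t" for s t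
      using d(2)[OF that] P[of s] P[of t] by (auto simp: dist_real_def abs_if split: if_splits)
    have "inj_on P A"
    proof (rule inj_onI, rule ccontr)
      fix s t assume st: "s \<in> A" "t \<in> A" "P s = P t" "s \<noteq> t"
      have "s \<in> {of_rat (fst (P s))..of_rat (snd (P s)) :: real}" using P[of s] by auto
      then show False using dj[OF st(1,2,4)] st(3) by auto
    qed
    then have "card (P ` A) = k" using A by (simp add: card_image)
    moreover have "P ` A \<in> DD" using A(1) dj unfolding DD_def disjoint_family_on_def by auto
    moreover have "\<forall>Q\<in>P ` A. hit Q \<omega>"
    proof
      fix Q assume "Q \<in> P ` A"
      then obtain t where t: "t \<in> A" "Q = P t" by auto
      then have "t \<in> {0..T}" "f t \<omega> = 0" using A(2) by (auto simp: Z_def)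
      then show "hit Q \<omega>" unfolding hit_def t(2) using P[of t] by (intro bexI[of _ t]) auto
    qed
    ultimately show "\<exists>B\<in>DD. card B = k \<and> (\<forall>P\<in>B. hit P \<omega>)" by blast
  next
    assume "\<exists>B\<in>DD. card B = k \<and> (\<forall>P\<in>B. hit P \<omega>)"
    then obtain B where B: "B \<in> DD" "card B = k" "\<And>P. P \<in> B \<Longrightarrow> hit P \<omega>" by blast
    then obtain z where z: "\<And>P. P \<in> B \<Longrightarrow> z P \<in> {max 0 (of_rat (fst P))..min T (of_rat (snd P))} \<and> f (z P) \<omega> = 0"
      unfolding hit_def by metis
    have "inj_on z B"
    proof (rule inj_onI, rule ccontr)
      fix P Q assume PQ: "P \<in> B" "Q \<in> B" "z P = z Q" "P \<noteq> Q"
      have "z P \<in> {of_rat (fst P)..of_rat (snd P)}" "z P \<in> {of_rat (fst Q)..of_rat (snd Q)}"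
        using z[OF PQ(1)] z[OF PQ(2)] PQ(3) by auto
      then show False using B(1) PQ(1,2,4) unfolding DD_def disjoint_family_on_def by blast
    qed
    moreover have "z ` B \<subseteq> Z \<omega>" using z by (auto simp: Z_def)
    ultimately show "infinite (Z \<omega>) \<or> k \<le> card (Z \<omega>)"
      using card_inj_on_le[of z B "Z \<omega>"] B(2) by blast
  qed
  define A where "A k = {\<omega>\<in>space M. infinite (Z \<omega>) \<or> k \<le> card (Z \<omega>)}" for k
  have A: "A k \<in> sets M" for k
  proof -
    have fB: "{\<omega>\<in>space M. \<forall>P\<in>B. hit P \<omega>} \<in> sets M" if "B \<in> DD" for B
      using that by (intro sets.sets_Collect_finite_All) (auto simp: DD_def)
    have "A k = (\<Union>B\<in>{B\<in>DD. card B = k}. {\<omega>\<in>space M. \<forall>P\<in>B. hit P \<omega>})"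
      unfolding A_def eq by auto
    also have "\<dots> \<in> sets M" using cDD fB by (intro sets.countable_UN') (auto intro: countable_subset)
    finally show ?thesis .
  qed
  have "(\<lambda>\<omega>. card (Z \<omega>)) \<in> measurable M (count_space UNIV)"
  proof (subst measurable_count_space_eq_countable, safe)
    fix k :: nat
    \<comment> \<open>The value 0 collects the empty and the infinite zero sets, the latter being
      the intersection of all \<open>A n\<close>.\<close>
    have "(\<lambda>\<omega>. card (Z \<omega>)) -` {k} \<inter> space M = (if k = 0 then (A 0 - A 1) \<union> (\<Inter>n. A n) else A k - A (Suc k))"
      using infinite_arbitrarily_large by (auto simp: A_def not_less_eq_eq) (metis Suc_n_not_le_n)+
    also have "\<dots> \<in> sets M" using A by auto
    finally show "(\<lambda>\<omega>. card (Z \<omega>)) -` {k} \<inter> space M \<in> sets M" .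
  qed auto
  then have "(\<lambda>\<omega>. real (card (Z \<omega>))) \<in> borel_measurable M" by measurable
  then show ?thesis unfolding Z_def zero_count_def[abs_def] .
qed

text \<open>The probability of 0 is at most the expectation of a narrow Gaussian bump in
  \<open>X\<close>. The bump is itself a Gaussian average of exponentials, so Fubini bounds this
  expectation, through the characteristic function, by the normal mean of the same bump, which
  vanishes as the width shrinks.\<close>

lemma no_atom_at_zero:
  assumes "prob_space M" and [measurable]: "X \<in> borel_measurable M"
    and le: "\<And>t. norm (CLINT \<omega>|M. iexp (t * X \<omega>)) \<le> exp (- (t\<^sup>2 / 2))"
  shows "AE \<omega> in M. X \<omega> \<noteq> 0"
proof -
  interpret prob_space M by fact
  interpret P: pair_prob_space N1 M ..
  have bound: "prob {\<omega>\<in>space M. X \<omega> = 0} \<le> (LINT x|N1. exp (- ((l * x)\<^sup>2 / 2)))" for l :: real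
  proof -
    have "prob {\<omega>\<in>space M. X \<omega> = 0} = expectation (indicator {\<omega>\<in>space M. X \<omega> = 0})" by simp
    also have "\<dots> \<le> expectation (\<lambda>\<omega>. exp (- ((l * X \<omega>)\<^sup>2 / 2)))"
      by (intro integral_mono integrable_const_bound[of _ 1]) (auto simp: indicator_def)
    finally have 1: "prob {\<omega>\<in>space M. X \<omega> = 0} \<le> expectation (\<lambda>\<omega>. exp (- ((l * X \<omega>)\<^sup>2 / 2)))" .
    have "complex_of_real (expectation (\<lambda>\<omega>. exp (- ((l * X \<omega>)\<^sup>2 / 2)))) = (CLINT \<omega>|M. (CLINT x|N1. iexp (l * X \<omega> * x)))"
      unfolding char_N1 by (simp only: integral_complex_of_real)
    also have "\<dots> = (CLINT x|N1. (CLINT \<omega>|M. iexp (l * X \<omega> * x)))"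
    proof (rule P.Fubini_integral)
      show "integrable (N1 \<Otimes>\<^sub>M M) (\<lambda>(x, \<omega>). iexp (l * X \<omega> * x))"
        by (rule P.integrable_const_bound[of _ 1]) (auto intro!: AE_I2 simp del: of_real_mult)
    qed
    finally have eq: "complex_of_real (expectation (\<lambda>\<omega>. exp (- ((l * X \<omega>)\<^sup>2 / 2)))) = (CLINT x|N1. (CLINT \<omega>|M. iexp (l * X \<omega> * x)))" .
    have "norm (CLINT x|N1. (CLINT \<omega>|M. iexp (l * X \<omega> * x))) \<le> (LINT x|N1. exp (- ((l * x)\<^sup>2 / 2)))"
    proof (rule norm_integral_le)
      show "integrable N1 (\<lambda>x. exp (- ((l * x)\<^sup>2 / 2)))" by (rule N1.integrable_const_bound[of _ 1]) auto
      show "norm (CLINT \<omega>|M. iexp (l * X \<omega> * x)) \<le> exp (- ((l * x)\<^sup>2 / 2))" for x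
        using le[of "l * x"] by (simp add: mult_ac)
    qed measurable
    then have 2: "\<bar>expectation (\<lambda>\<omega>. exp (- ((l * X \<omega>)\<^sup>2 / 2)))\<bar> \<le> (LINT x|N1. exp (- ((l * x)\<^sup>2 / 2)))"
      unfolding eq[symmetric] by (simp only: norm_of_real)
    show ?thesis using 1 2 by linarith
  qed
  have "(\<lambda>n. LINT x|N1. exp (- ((real n * x)\<^sup>2 / 2))) \<longlonglongrightarrow> (LINT x|N1. 0)"
  proof (rule integral_dominated_convergence[where w = "\<lambda>_. 1"])
    have "AE x in N1. x \<noteq> 0"
      by (subst AE_density) (auto intro: AE_lborel_singleton eventually_mono)
    then show "AE x in N1. (\<lambda>n. exp (- ((real n * x)\<^sup>2 / 2))) \<longlonglongrightarrow> 0"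
    proof (rule eventually_mono)
      fix x :: real assume x: "x \<noteq> 0"
      have "filterlim (\<lambda>n. x\<^sup>2/2 * (real n * real n)) at_top sequentially"
        using x by (intro filterlim_tendsto_pos_mult_at_top[OF tendsto_const] filterlim_at_top_mult_at_top filterlim_real_sequentially) auto
      then have "filterlim (\<lambda>n. - ((real n * x)\<^sup>2 / 2)) at_bot sequentially"
        by (subst filterlim_uminus_at_bot) (simp add: power_mult_distrib power2_eq_square mult_ac)
      then show "(\<lambda>n. exp (- ((real n * x)\<^sup>2 / 2))) \<longlonglongrightarrow> 0"
        by (rule filterlim_compose[OF exp_at_bot])
    qed
  qed auto
  then have "prob {\<omega>\<in>space M. X \<omega> = 0} \<le> 0"
    using bound by (intro LIMSEQ_le_const[where X = "\<lambda>n. LINT x|N1. exp (- ((real n * x)\<^sup>2 / 2))"]) auto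
  then have "prob {\<omega>\<in>space M. X \<omega> = 0} = 0" by (simp add: measure_le_0_iff)
  then show ?thesis by (subst (asm) prob_eq_0) (auto simp: elim: eventually_mono)
qed

section \<open>Elementary estimates for exponentials and a logarithmic sum\<close>

lemma cmod_iexp_diff_le: "cmod (iexp a - iexp b) \<le> \<bar>a - b\<bar>"
proof -
  have "iexp a - iexp b = iexp b * (iexp (a - b) - 1)"
    by (simp add: right_diff_distrib flip: exp_add)
  then have "cmod (iexp a - iexp b) = cmod (iexp (a - b) - 1)"
    by (simp only: norm_mult norm_exp_i_times mult_1_left)
  then show ?thesis using iexp_approx1[of "a - b" 0] by simp
qed

lemma abs_cos_diff_le: "\<bar>cos a - cos b\<bar> \<le> \<bar>a - b\<bar>" for a b :: real
  using order_trans[OF abs_Re_le_cmod cmod_iexp_diff_le[of a b]] by (simp add: Re_exp)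

lemma abs_sin_diff_le: "\<bar>sin a - sin b\<bar> \<le> \<bar>a - b\<bar>" for a b :: real
  using order_trans[OF abs_Im_le_cmod cmod_iexp_diff_le[of a b]] by (simp add: Im_exp)

lemma iexp_first_order: 
  shows "cmod (iexp x - 1 - \<i> * of_real x) \<le> x\<^sup>2 / 2" "cmod (iexp x - 1 - \<i> * of_real x) \<le> 2 * \<bar>x\<bar>"
  using iexp_approx1[of x 1] iexp_approx2[of x 1] by (simp_all add: diff_diff_eq power2_eq_square)

lemma cos_first_order: "\<bar>cos (x + y) - cos x + y * sin x\<bar> \<le> y\<^sup>2 / 2" for x y :: real
proof -
  have "cos (x + y) - cos x + y * sin x = Re (iexp x * (iexp y - 1 - \<i> * of_real y))"
    by (simp add: Re_exp Im_exp cos_add algebra_simps)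
  also have "\<bar>\<dots>\<bar> \<le> cmod (iexp x * (iexp y - 1 - \<i> * of_real y))" by (rule abs_Re_le_cmod)
  also have "\<dots> \<le> y\<^sup>2 / 2" using iexp_first_order(1)[of y] by (simp only: norm_mult norm_exp_i_times mult_1_left)
  finally show ?thesis .
qed

lemma cos_second_order: "\<bar>cos x - (1 - x\<^sup>2 / 2)\<bar> \<le> \<bar>x\<bar>^3 / 6" for x :: real
proof -
  have "cos x - (1 - x\<^sup>2 / 2) = Re (iexp x - (\<Sum>k \<le> 2. (\<i> * x)^k / fact k))"
    by (simp add: Re_exp numeral_2_eq_2 power2_eq_square)
  also have "\<bar>\<dots>\<bar> \<le> \<bar>x\<bar>^3 / 6"
    using order_trans[OF abs_Re_le_cmod iexp_approx1[of x 2]] by (simp add: fact_numeral eval_nat_numeral)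
  finally show ?thesis .
qed

text \<open>Each summand is at most twice an increment of ln (1 + A^2 k^2). This sum is the source
  of the logarithm that the Geman condition controls.\<close>

lemma log_telescope:
  fixes A :: real
  shows "(\<Sum>k=1..m. min 1 (A\<^sup>2 * (real k)\<^sup>2) / real k) \<le> 2 * ln (1 + A\<^sup>2 * (real m)\<^sup>2)"
proof (induction m)
  case 0 then show ?case by simp
next
  case (Suc m)
  define k where "k = real (Suc m)"
  have k: "k \<ge> 1" "real m = k - 1" by (auto simp: k_def)
  define p q where "p = 1 + A\<^sup>2 * k\<^sup>2" and "q = 1 + A\<^sup>2 * (k - 1)\<^sup>2"
  have pq: "p \<ge> 1" "q \<ge> 1" by (auto simp: p_def q_def)
  have "min 1 (A\<^sup>2 * k\<^sup>2) / k \<le> 2 * (A\<^sup>2 * k / p)"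
  proof -
    have "min 1 x * (1 + x) \<le> 2 * x" if "x \<ge> 0" for x :: real
    proof (cases "x \<le> 1")
      case True
      then have "x * x \<le> x * 1" using that by (intro mult_left_mono) auto
      then show ?thesis using True by (simp add: min_def algebra_simps)
    qed (use that in \<open>auto simp: min_def\<close>)
    from this[of "A\<^sup>2 * k\<^sup>2"] have "min 1 (A\<^sup>2 * k\<^sup>2) * p \<le> 2 * (A\<^sup>2 * k\<^sup>2)" by (simp add: p_def)
    then show ?thesis using k(1) pq(1) by (simp add: field_simps power2_eq_square)
  qed
  also have "\<dots> \<le> 2 * (1 - q / p)"
  proof -
    have "A\<^sup>2 * k * 1 \<le> A\<^sup>2 * (2 * k - 1)" using k(1) by (simp add: mult_left_mono)
    also have "\<dots> = p - q" by (simp add: p_def q_def power2_eq_square algebra_simps)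
    finally show ?thesis using pq by (simp add: field_simps)
  qed
  also have "\<dots> \<le> 2 * (ln p - ln q)"
  proof -
    have "ln (q / p) \<le> q / p - 1" using pq by (intro ln_le_minus_one) auto
    then show ?thesis using pq by (simp add: ln_div)
  qed
  finally have "min 1 (A\<^sup>2 * k\<^sup>2) / k \<le> 2 * (ln p - ln q)" .
  moreover have "(\<Sum>k=1..m. min 1 (A\<^sup>2 * (real k)\<^sup>2) / real k) \<le> 2 * ln q" using Suc by (simp add: q_def k(2))
  ultimately show ?case unfolding p_def q_def k_def by simp
qed

section \<open>The covariance function in spectral form, and the Geman condition\<close>

locale spectral = R: prob_space \<rho> for \<rho> :: "real measure" +
  fixes r :: "real \<Rightarrow> real" and \<sigma> :: real
  assumes rho_sets[measurable_cong]: "sets \<rho> = sets borel"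
    and rho_sym: "distr \<rho> borel uminus = \<rho>"
    and spectral: "\<And>t. complex_of_real (r t) = (CLINT l|\<rho>. exp (- \<i> * complex_of_real (l * t)))"
    and geman: "integrable \<rho> (\<lambda>l. ln (1 + \<bar>l\<bar>) * l\<^sup>2)"
    and sigma_pos: "\<sigma> > 0"
    and sigma_def: "\<sigma>\<^sup>2 = (LINT l|\<rho>. l\<^sup>2)"
begin

lemma bounded_integrable:
  fixes g :: "real \<Rightarrow> real"
  assumes "g \<in> borel_measurable borel" "\<And>l. \<bar>g l\<bar> \<le> B"
  shows "integrable \<rho> g"
  using assms by (intro R.integrable_const_bound[of _ B]) (auto simp: measurable_cong_sets[OF rho_sets refl])

lemma r_cos: "r t = (LINT l|\<rho>. cos (l * t))"
proof -
  have i: "integrable \<rho> (\<lambda>l. exp (- \<i> * complex_of_real (l * t)))"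
    by (intro R.integrable_const_bound[of _ 1]) (auto simp: norm_exp_eq_Re simp del: of_real_mult)
  have "r t = Re (CLINT l|\<rho>. exp (- \<i> * complex_of_real (l * t)))"
    using arg_cong[OF spectral, of Re] by simp
  also have "\<dots> = (LINT l|\<rho>. Re (exp (- \<i> * complex_of_real (l * t))))"
    by (rule integral_Re[OF i, symmetric])
  finally show ?thesis by (simp add: Re_exp)
qed

lemma int_l2: "integrable \<rho> (\<lambda>l. l\<^sup>2)"
proof (rule norm_integral_le)
  show "integrable \<rho> (\<lambda>l. 4 + ln (1 + \<bar>l\<bar>) * l\<^sup>2)" using geman by (intro Bochner_Integration.integrable_add) auto
  show "norm (l\<^sup>2) \<le> 4 + ln (1 + \<bar>l\<bar>) * l\<^sup>2" for l :: real
  proof (cases "\<bar>l\<bar> \<le> 2")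
    case True
    then have "\<bar>l\<bar>\<^sup>2 \<le> 2\<^sup>2" by (intro power_mono) auto
    then have "l\<^sup>2 \<le> 4" by simp
    moreover have "0 \<le> ln (1 + \<bar>l\<bar>) * l\<^sup>2" by simp
    ultimately have "l\<^sup>2 \<le> 4 + ln (1 + \<bar>l\<bar>) * l\<^sup>2" by linarith
    then show ?thesis by simp
  next
    case False
    have "exp 1 \<le> 1 + \<bar>l\<bar>" using exp_le False by linarith
    then have "1 \<le> ln (1 + \<bar>l\<bar>)" by (subst ln_ge_iff) auto
    then have "1 * l\<^sup>2 \<le> ln (1 + \<bar>l\<bar>) * l\<^sup>2" by (intro mult_right_mono) auto
    then have "l\<^sup>2 \<le> 4 + ln (1 + \<bar>l\<bar>) * l\<^sup>2" by linarith
    then show ?thesis by simp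
  qed
qed measurable

lemma int_l1: "integrable \<rho> (\<lambda>l. \<bar>l\<bar>)"
proof (rule norm_integral_le)
  show "integrable \<rho> (\<lambda>l. 1 + l\<^sup>2)" using int_l2 by (intro Bochner_Integration.integrable_add) auto
  have "\<bar>l\<bar> \<le> 1 + l\<^sup>2" for l :: real
  proof -
    have "0 \<le> (\<bar>l\<bar> - 1)\<^sup>2" by simp
    then have "2 * \<bar>l\<bar> \<le> l\<^sup>2 + 1" unfolding power2_diff by simp
    then show ?thesis using abs_ge_zero[of l] by linarith
  qed
  then show "norm \<bar>l\<bar> \<le> 1 + l\<^sup>2" for l :: real by simp
qed measurable

lemma int_l_mult:
  fixes g :: "real \<Rightarrow> real"
  assumes [measurable]: "g \<in> borel_measurable borel" and g: "\<And>l. \<bar>g l\<bar> \<le> B"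
  shows "integrable \<rho> (\<lambda>l. l * g l)"
proof (rule norm_integral_le)
  show "integrable \<rho> (\<lambda>l. \<bar>l\<bar> * B)" using int_l1 by simp
  show "norm (l * g l) \<le> \<bar>l\<bar> * B" for l using g[of l] by (simp add: abs_mult mult_left_mono)
qed measurable

text \<open>The derivative of \<open>r\<close>, obtained by differentiating the cosine integral;
  \<open>r_taylor\<close> justifies this quantitatively.\<close>

definition r1 :: "real \<Rightarrow> real" where "r1 s = - (LINT l|\<rho>. l * sin (l * s))"

lemma int_cos: "integrable \<rho> (\<lambda>l. cos (l * t))" by (rule bounded_integrable[of _ 1]) auto
lemma int_l_sin: "integrable \<rho> (\<lambda>l. l * sin (l * t))" by (rule int_l_mult[of _ 1]) auto

lemma abs_r_le: "\<bar>r t\<bar> \<le> 1"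
proof -
  have "norm (LINT l|\<rho>. cos (l * t)) \<le> (LINT l|\<rho>. 1)" by (rule norm_integral_le) auto
  then show ?thesis using R.prob_space by (simp add: r_cos)
qed

lemma r_even: "r (- t) = r t" by (simp add: r_cos)
lemma r_taylor: "\<bar>r (s + h) - r s - h * r1 s\<bar> \<le> \<sigma>\<^sup>2 * h\<^sup>2 / 2"
proof -
  have "r (s + h) - r s - h * r1 s = (LINT l|\<rho>. cos (l * (s + h)) - cos (l * s) + h * (l * sin (l * s)))"
    using int_cos int_l_sin by (simp add: r_cos r1_def)
  also have "norm \<dots> \<le> (LINT l|\<rho>. l\<^sup>2 * (h\<^sup>2 / 2))"
  proof (rule norm_integral_le)
    show "integrable \<rho> (\<lambda>l. l\<^sup>2 * (h\<^sup>2 / 2))" using int_l2 by (rule integrable_mult_left)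
    show "norm (cos (l * (s + h)) - cos (l * s) + h * (l * sin (l * s))) \<le> l\<^sup>2 * (h\<^sup>2 / 2)" for l
      using cos_first_order[of "l * s" "l * h"] by (simp add: algebra_simps power_mult_distrib)
  qed measurable
  also have "\<dots> = \<sigma>\<^sup>2 * (h\<^sup>2 / 2)" unfolding sigma_def by (rule integral_mult_left_zero)
  finally show ?thesis by simp
qed

lemma r1_lipschitz: "\<bar>r1 s - r1 t\<bar> \<le> \<sigma>\<^sup>2 * \<bar>s - t\<bar>"
proof -
  have "r1 t - r1 s = (LINT l|\<rho>. l * sin (l * s) - l * sin (l * t))"
    using int_l_sin by (simp add: r1_def)
  also have "norm \<dots> \<le> (LINT l|\<rho>. l\<^sup>2 * \<bar>s - t\<bar>)"
  proof (rule norm_integral_le)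
    show "integrable \<rho> (\<lambda>l. l\<^sup>2 * \<bar>s - t\<bar>)" using int_l2 by (rule integrable_mult_left)
    fix l
    have "norm (l * sin (l * s) - l * sin (l * t)) = \<bar>l\<bar> * \<bar>sin (l * s) - sin (l * t)\<bar>"
      by (simp add: right_diff_distrib[symmetric] abs_mult)
    also have "\<dots> \<le> \<bar>l\<bar> * \<bar>l * s - l * t\<bar>" by (intro mult_left_mono abs_sin_diff_le) auto
    also have "\<dots> = l\<^sup>2 * \<bar>s - t\<bar>" by (simp add: right_diff_distrib[symmetric] abs_mult power2_eq_square)
    finally show "norm (l * sin (l * s) - l * sin (l * t)) \<le> l\<^sup>2 * \<bar>s - t\<bar>" .
  qed measurable
  also have "\<dots> = \<sigma>\<^sup>2 * \<bar>s - t\<bar>" unfolding sigma_def by (rule integral_mult_left_zero)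
  finally show ?thesis by (simp add: abs_minus_commute)
qed

lemma r_at_0: "r 0 = 1" using R.prob_space by (simp add: r_cos)
lemma r1_at_0: "r1 0 = 0" by (simp add: r1_def)

lemma one_minus_r_le: "1 - r h \<le> \<sigma>\<^sup>2 * h\<^sup>2 / 2"
  using r_taylor[of 0 h, unfolded r_at_0 r1_at_0 add_0_left mult_zero_right diff_zero] by linarith

lemma mean_abs_le: "(LINT l|\<rho>. \<bar>l\<bar>) \<le> \<sigma>"
proof -
  have "0 \<le> (LINT l|\<rho>. (\<bar>l\<bar> - \<sigma>)\<^sup>2)" by simp
  also have "(LINT l|\<rho>. (\<bar>l\<bar> - \<sigma>)\<^sup>2) = (LINT l|\<rho>. l\<^sup>2 - (2 * \<sigma>) * \<bar>l\<bar> + \<sigma>\<^sup>2)"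
    by (intro Bochner_Integration.integral_cong) (auto simp: power2_diff)
  also have "\<dots> = \<sigma>\<^sup>2 - (2 * \<sigma>) * (LINT l|\<rho>. \<bar>l\<bar>) + \<sigma>\<^sup>2"
    using int_l2 int_l1 R.prob_space by (simp add: sigma_def)
  finally have "2 * \<sigma> * (LINT l|\<rho>. \<bar>l\<bar>) \<le> 2 * \<sigma> * \<sigma>" by (simp add: power2_eq_square)
  then show ?thesis by (rule mult_left_le_imp_le) (use sigma_pos in simp)
qed

lemma r1_le: "\<bar>r1 s\<bar> \<le> \<sigma>"
proof -
  have "\<bar>LINT l|\<rho>. l * sin (l * s)\<bar> \<le> (LINT l|\<rho>. \<bar>l\<bar>)"
  proof -
    have "norm (LINT l|\<rho>. l * sin (l * s)) \<le> (LINT l|\<rho>. \<bar>l\<bar>)"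
      by (rule norm_integral_le(2)[OF int_l1]) (auto simp: abs_mult intro!: mult_left_le)
    then show ?thesis by simp
  qed
  moreover note mean_abs_le
  ultimately show ?thesis by (simp add: r1_def)
qed

lemma r_lipschitz: "\<bar>r s - r t\<bar> \<le> \<sigma> * \<bar>s - t\<bar>"
proof -
  have "r s - r t = (LINT l|\<rho>. cos (l * s) - cos (l * t))" using int_cos by (simp add: r_cos)
  also have "norm \<dots> \<le> (LINT l|\<rho>. \<bar>l\<bar> * \<bar>s - t\<bar>)"
  proof (rule norm_integral_le)
    show "integrable \<rho> (\<lambda>l. \<bar>l\<bar> * \<bar>s - t\<bar>)" using int_l1 by (rule integrable_mult_left)
    show "norm (cos (l * s) - cos (l * t)) \<le> \<bar>l\<bar> * \<bar>s - t\<bar>" for l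
      using abs_cos_diff_le[of "l * s" "l * t"] by (simp add: right_diff_distrib[symmetric] abs_mult)
  qed measurable
  also have "\<dots> = (LINT l|\<rho>. \<bar>l\<bar>) * \<bar>s - t\<bar>" by (rule integral_mult_left_zero)
  also have "\<dots> \<le> \<sigma> * \<bar>s - t\<bar>" by (rule mult_right_mono[OF mean_abs_le]) simp
  finally show ?thesis by simp
qed

text \<open>Dominated convergence with majorant l^2/2. The limit says that an increment of the
  process over \<open>h\<close> has a standard deviation asymptotic to
  \<open>\<sigma> * h\<close>.\<close>

lemma r_second_order: "((\<lambda>h. (1 - r h) / h\<^sup>2) \<longlongrightarrow> \<sigma>\<^sup>2 / 2) (at_right 0)"
  unfolding tendsto_at_iff_sequentially
proof (intro allI impI)
  fix X :: "nat \<Rightarrow> real" assume X: "\<forall>i. X i \<in> {0<..} - {0}" "X \<longlonglongrightarrow> 0"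
  then have X0: "X i > 0" for i by auto
  have L: "(\<lambda>i. LINT l|\<rho>. (1 - cos (l * X i)) / (X i)\<^sup>2) \<longlonglongrightarrow> (LINT l|\<rho>. l\<^sup>2 / 2)"
  proof (rule integral_dominated_convergence[where w = "\<lambda>l. l\<^sup>2 / 2"])
    show "integrable \<rho> (\<lambda>l. l\<^sup>2 / 2)" using int_l2 by simp
    have b: "\<bar>(1 - cos (l * X i)) / (X i)\<^sup>2 - l\<^sup>2 / 2\<bar> \<le> \<bar>l\<bar>^3 / 6 * X i" for l i
    proof -
      have "(1 - cos (l * X i)) / (X i)\<^sup>2 - l\<^sup>2 / 2 = - (cos (l * X i) - (1 - (l * X i)\<^sup>2 / 2)) / (X i)\<^sup>2"
        using X0[of i] by (simp add: field_simps power_mult_distrib)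
      also have "\<bar>\<dots>\<bar> \<le> (\<bar>l * X i\<bar>^3 / 6) / (X i)\<^sup>2"
        using cos_second_order[of "l * X i"] by (simp only: abs_divide abs_minus_cancel abs_power2) (rule divide_right_mono, auto)
      also have "\<dots> = \<bar>l\<bar>^3 / 6 * X i" using X0[of i] by (simp add: abs_mult power_mult_distrib eval_nat_numeral)
      finally show ?thesis .
    qed
    show "AE l in \<rho>. (\<lambda>i. (1 - cos (l * X i)) / (X i)\<^sup>2) \<longlonglongrightarrow> l\<^sup>2 / 2"
    proof (rule AE_I2)
      fix l
      have lim: "(\<lambda>i. \<bar>l\<bar>^3 / 6 * X i) \<longlonglongrightarrow> 0" by (rule tendsto_mult_right_zero[OF X(2)])
      have "(\<lambda>i. (1 - cos (l * X i)) / (X i)\<^sup>2 - l\<^sup>2 / 2) \<longlonglongrightarrow> 0"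
        by (rule Lim_null_comparison[OF always_eventually lim], rule allI, unfold real_norm_def, rule b)
      then show "(\<lambda>i. (1 - cos (l * X i)) / (X i)\<^sup>2) \<longlonglongrightarrow> l\<^sup>2 / 2" by (simp add: LIM_zero_iff)
    qed
    show "AE l in \<rho>. norm ((1 - cos (l * X i)) / (X i)\<^sup>2) \<le> l\<^sup>2 / 2" for i
    proof (rule AE_I2)
      fix l
      have "1 - cos (l * X i) \<le> (l * X i)\<^sup>2 / 2" using cos_first_order[of 0 "l * X i"] by simp
      then have "(1 - cos (l * X i)) / (X i)\<^sup>2 \<le> ((l * X i)\<^sup>2 / 2) / (X i)\<^sup>2" by (rule divide_right_mono) simp
      also have "\<dots> = l\<^sup>2 / 2" using X0[of i] by (simp add: power_mult_distrib)
      finally show "norm ((1 - cos (l * X i)) / (X i)\<^sup>2) \<le> l\<^sup>2 / 2" by simp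
    qed
  qed measurable
  have e1: "(LINT l|\<rho>. (1 - cos (l * X i)) / (X i)\<^sup>2) = (1 - r (X i)) / (X i)\<^sup>2" for i
    using int_cos R.prob_space by (simp add: r_cos)
  have e2: "(LINT l|\<rho>. l\<^sup>2 / 2) = \<sigma>\<^sup>2 / 2" by (simp add: sigma_def)
  show "((\<lambda>h. (1 - r h) / h\<^sup>2) \<circ> X) \<longlonglongrightarrow> \<sigma>\<^sup>2 / 2" using L unfolding e1 e2 comp_def .
qed

text \<open>Below this scale \<open>r\<close> stays nonnegative and increments over t have variance
  at least \<sigma>^2 t^2 / 2. The bound 1/8 prepares the condition on \<open>q\<close> in
  \<open>pair_bound\<close>.\<close>

lemma small_scale:
  obtains \<delta> where "\<delta> > 0" "\<delta> \<le> 1" "\<sigma> * \<delta> \<le> 1/8" "\<And>t. 0 < t \<Longrightarrow> t \<le> \<delta> \<Longrightarrow> \<sigma>\<^sup>2 * t\<^sup>2 / 4 \<le> 1 - r t \<and> 0 \<le> r t"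
proof -
  have "\<sigma>\<^sup>2 / 4 < \<sigma>\<^sup>2 / 2" using sigma_pos by simp
  from order_tendstoD(1)[OF r_second_order this] obtain b where b: "b > 0" "\<And>h. 0 < h \<Longrightarrow> h < b \<Longrightarrow> \<sigma>\<^sup>2 / 4 < (1 - r h) / h\<^sup>2"
    unfolding eventually_at_right_field by auto
  define \<delta> where "\<delta> = min (b / 2) (min 1 (1 / (8 * \<sigma>)))"
  have "\<delta> \<le> b / 2" unfolding \<delta>_def by simp
  then have d: "\<delta> > 0" "\<delta> \<le> 1" "\<delta> < b" "\<delta> \<le> 1 / (8 * \<sigma>)" using b(1) sigma_pos by (simp_all add: \<delta>_def)
  have sd: "\<sigma> * \<delta> \<le> 1/8" using mult_left_mono[OF d(4), of \<sigma>] sigma_pos by simp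
  have "\<sigma>\<^sup>2 * t\<^sup>2 / 4 \<le> 1 - r t \<and> 0 \<le> r t" if t: "0 < t" "t \<le> \<delta>" for t
  proof
    show "\<sigma>\<^sup>2 * t\<^sup>2 / 4 \<le> 1 - r t" using b(2)[of t] t d(3) by (simp add: field_simps)
    have "\<sigma> * t \<le> 1/8" using mult_left_mono[OF t(2), of \<sigma>] sigma_pos sd by linarith
    then have "(\<sigma> * t)\<^sup>2 \<le> 1\<^sup>2" using sigma_pos t by (intro power_mono) auto
    then show "0 \<le> r t" using one_minus_r_le[of t] by (simp add: power_mult_distrib)
  qed
  with d sd that show ?thesis by blast
qed

text \<open>Variances of linear combinations become spectral integrals, so that Taylor bounds for
  exponentials can be applied frequency by frequency.\<close>

lemma quadratic_form:
  assumes I: "finite I"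
  shows "(\<Sum>i\<in>I. \<Sum>j\<in>I. c i * c j * r (t i - t j)) = (LINT l|\<rho>. (cmod (\<Sum>i\<in>I. c i * iexp (l * t i)))\<^sup>2)"
proof -
  have p: "(cmod (\<Sum>i\<in>I. c i * iexp (l * t i)))\<^sup>2 = (\<Sum>i\<in>I. \<Sum>j\<in>I. c i * c j * cos (l * (t i - t j)))" for l
  proof -
    have "Re (\<Sum>i\<in>I. c i * iexp (l * t i)) = (\<Sum>i\<in>I. c i * cos (l * t i))"
         "Im (\<Sum>i\<in>I. c i * iexp (l * t i)) = (\<Sum>i\<in>I. c i * sin (l * t i))"
      by (simp_all add: Re_exp Im_exp)
    then have "(cmod (\<Sum>i\<in>I. c i * iexp (l * t i)))\<^sup>2 = (\<Sum>i\<in>I. c i * cos (l * t i))\<^sup>2 + (\<Sum>i\<in>I. c i * sin (l * t i))\<^sup>2"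
      unfolding cmod_power2 by simp
    also have "\<dots> = (\<Sum>i\<in>I. \<Sum>j\<in>I. c i * cos (l * t i) * (c j * cos (l * t j)) + c i * sin (l * t i) * (c j * sin (l * t j)))"
      by (simp add: power2_eq_square sum_product sum.distrib)
    also have "\<dots> = (\<Sum>i\<in>I. \<Sum>j\<in>I. c i * c j * cos (l * (t i - t j)))"
      by (intro sum.cong refl) (simp add: right_diff_distrib cos_diff algebra_simps)
    finally show ?thesis .
  qed
  show ?thesis unfolding p r_cos using int_cos by simp
qed

text \<open>Measures how far increments at scale \<open>t\<close> are from linear: frequencies below
  1/t count through the second-order Taylor bound, higher ones through the first-order
  bound.\<close>

definition \<kappa> :: "real \<Rightarrow> real" where "\<kappa> t = (LINT l|\<rho>. l\<^sup>2 * min 1 (l\<^sup>2 * t\<^sup>2))"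

lemma int_kappa: "integrable \<rho> (\<lambda>l. l\<^sup>2 * min 1 (l\<^sup>2 * t\<^sup>2))"
  by (rule norm_integral_le(1)[OF int_l2]) (auto intro!: mult_left_le)

lemma kappa_nonneg: "\<kappa> t \<ge> 0" unfolding \<kappa>_def by (intro Bochner_Integration.integral_nonneg) auto

text \<open>The increment over \<open>h\<close> and the increment over \<open>t\<close> rescaled by
  \<open>h / t\<close> have the same linear part, which cancels; what remains is bounded by the two
  estimates of \<open>iexp_first_order\<close>. Negative \<open>t\<close> is allowed because the
  later of two points looks back at the earlier one.\<close>

lemma secant_defect:
  assumes h: "0 < h" "h \<le> \<bar>t\<bar>"
  shows "(LINT l|\<rho>. (cmod (iexp (l * h) - 1 - of_real (h / t) * (iexp (l * t) - 1)))\<^sup>2) \<le> 16 * h\<^sup>2 * \<kappa> t"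
proof -
  have p: "(cmod (iexp (l * h) - 1 - of_real (h / t) * (iexp (l * t) - 1)))\<^sup>2 \<le> 16 * h\<^sup>2 * (l\<^sup>2 * min 1 (l\<^sup>2 * t\<^sup>2))" for l
  proof -
    have t: "t \<noteq> 0" "\<bar>h / t\<bar> = h / \<bar>t\<bar>" "h / \<bar>t\<bar> \<ge> 0" "h / \<bar>t\<bar> * \<bar>t\<bar> = h" using h by auto
    have "iexp (l * h) - 1 - of_real (h / t) * (iexp (l * t) - 1) = 
        (iexp (l * h) - 1 - \<i> * of_real (l * h)) - of_real (h / t) * (iexp (l * t) - 1 - \<i> * of_real (l * t))"
      using t by (simp add: field_simps)
    then have d: "cmod (iexp (l * h) - 1 - of_real (h / t) * (iexp (l * t) - 1)) \<le> 
        cmod (iexp (l * h) - 1 - \<i> * of_real (l * h)) + (h / \<bar>t\<bar>) * cmod (iexp (l * t) - 1 - \<i> * of_real (l * t))"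
      using norm_triangle_ineq4[of "iexp (l * h) - 1 - \<i> * of_real (l * h)" "of_real (h / t) * (iexp (l * t) - 1 - \<i> * of_real (l * t))"]
      by (simp only: norm_mult norm_of_real t(2))
    have "cmod (iexp (l * h) - 1 - of_real (h / t) * (iexp (l * t) - 1)) \<le> 2 * \<bar>l * h\<bar> + (h / \<bar>t\<bar>) * (2 * \<bar>l * t\<bar>)"
      by (rule order_trans[OF d]) (intro add_mono mult_left_mono iexp_first_order(2) t(3))
    also have "\<dots> = 4 * h * \<bar>l\<bar>" using h t by (simp add: abs_mult)
    finally have b1: "cmod (iexp (l * h) - 1 - of_real (h / t) * (iexp (l * t) - 1)) \<le> 4 * h * \<bar>l\<bar>" .
    have "cmod (iexp (l * h) - 1 - of_real (h / t) * (iexp (l * t) - 1)) \<le> (l * h)\<^sup>2 / 2 + (h / \<bar>t\<bar>) * ((l * t)\<^sup>2 / 2)"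
      by (rule order_trans[OF d]) (intro add_mono mult_left_mono iexp_first_order(1) t(3))
    also have "\<dots> = (l\<^sup>2 * h / 2) * h + (h / \<bar>t\<bar> * \<bar>t\<bar>) * (l\<^sup>2 / 2) * \<bar>t\<bar>"
    proof -
      have "(h / a) * ((l\<^sup>2 * (a * a)) / 2) = (h / a * a) * (l\<^sup>2 / 2) * a" for a :: real by simp
      from this[of "\<bar>t\<bar>"] have "(h / \<bar>t\<bar>) * ((l * t)\<^sup>2 / 2) = (h / \<bar>t\<bar> * \<bar>t\<bar>) * (l\<^sup>2 / 2) * \<bar>t\<bar>"
        by (simp add: power_mult_distrib power2_eq_square[of t])
      moreover have "(l * h)\<^sup>2 / 2 = (l\<^sup>2 * h / 2) * h" by (simp add: power2_eq_square)
      ultimately show ?thesis by simp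
    qed
    also have "\<dots> = (l\<^sup>2 * h / 2) * h + (l\<^sup>2 * h / 2) * \<bar>t\<bar>" unfolding t(4) by simp
    also have "\<dots> \<le> (l\<^sup>2 * h / 2) * \<bar>t\<bar> + (l\<^sup>2 * h / 2) * \<bar>t\<bar>" using h by (intro add_mono mult_left_mono) auto
    also have "\<dots> = h * \<bar>l\<bar> * \<bar>l * t\<bar>" by (simp add: power2_eq_square abs_mult)
    also have "\<dots> \<le> 4 * h * \<bar>l\<bar> * \<bar>l * t\<bar>" using h by (simp add: mult_nonneg_nonneg)
    finally have b2: "cmod (iexp (l * h) - 1 - of_real (h / t) * (iexp (l * t) - 1)) \<le> 4 * h * \<bar>l\<bar> * \<bar>l * t\<bar>" .
    have "(cmod (iexp (l * h) - 1 - of_real (h / t) * (iexp (l * t) - 1)))\<^sup>2 \<le> (4 * h * \<bar>l\<bar>)\<^sup>2"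
      by (intro power_mono b1) simp
    moreover have "(cmod (iexp (l * h) - 1 - of_real (h / t) * (iexp (l * t) - 1)))\<^sup>2 \<le> (4 * h * \<bar>l\<bar> * \<bar>l * t\<bar>)\<^sup>2"
      by (intro power_mono b2) simp
    moreover have "(4 * h * \<bar>l\<bar>)\<^sup>2 = 16 * h\<^sup>2 * (l\<^sup>2 * 1)" "(4 * h * \<bar>l\<bar> * \<bar>l * t\<bar>)\<^sup>2 = 16 * h\<^sup>2 * (l\<^sup>2 * (l\<^sup>2 * t\<^sup>2))"
      by (simp_all add: power_mult_distrib)
    ultimately show ?thesis by (cases "1 \<le> l\<^sup>2 * t\<^sup>2") (simp_all only: min_def if_True if_False)
  qed
  have "(LINT l|\<rho>. (cmod (iexp (l * h) - 1 - of_real (h / t) * (iexp (l * t) - 1)))\<^sup>2) \<le> (LINT l|\<rho>. 16 * h\<^sup>2 * (l\<^sup>2 * min 1 (l\<^sup>2 * t\<^sup>2)))"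
    using norm_integral_le(2)[OF integrable_mult_right[OF int_kappa, of "16 * h\<^sup>2"], of "\<lambda>l. (cmod (iexp (l * h) - 1 - of_real (h / t) * (iexp (l * t) - 1)))\<^sup>2"] p
    by (simp del: of_real_mult of_real_divide)
  also have "\<dots> = 16 * h\<^sup>2 * \<kappa> t" unfolding \<kappa>_def by (rule integral_mult_right_zero)
  finally show ?thesis .
qed

definition geman_const :: real where "geman_const = (LINT l|\<rho>. 4 * (ln (1 + \<bar>l\<bar>) * l\<^sup>2))"

text \<open>Summed over lags, \<kappa>(kh)/k is a discrete version of the integral of \<kappa>(t)/t
  near 0. Exchanging the sum with the spectral integral leaves a logarithm that is bounded,
  uniformly in \<open>h\<close>, by a multiple of ln (1 + |l|).\<close>

lemma geman_sum:
  assumes h: "h > 0" "real m * h \<le> 1"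
  shows "(\<Sum>k=1..m. \<kappa> (real k * h) / real k) \<le> geman_const"
proof -
  have i: "integrable \<rho> (\<lambda>l. l\<^sup>2 * min 1 (l\<^sup>2 * (real k * h)\<^sup>2) / real k)" for k
    using int_kappa by (rule integrable_divide)
  have "(\<Sum>k=1..m. \<kappa> (real k * h) / real k) = (LINT l|\<rho>. (\<Sum>k=1..m. l\<^sup>2 * min 1 (l\<^sup>2 * (real k * h)\<^sup>2) / real k))"
    using i by (simp add: \<kappa>_def)
  also have "\<dots> \<le> (LINT l|\<rho>. 4 * (ln (1 + \<bar>l\<bar>) * l\<^sup>2))"
  proof (intro integral_mono)
    show "integrable \<rho> (\<lambda>l. \<Sum>k = 1..m. l\<^sup>2 * min 1 (l\<^sup>2 * (real k * h)\<^sup>2) / real k)" using i by (intro Bochner_Integration.integrable_sum)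
    show "integrable \<rho> (\<lambda>l. 4 * (ln (1 + \<bar>l\<bar>) * l\<^sup>2))" using geman by (rule integrable_mult_right)
    fix l
    have "(\<Sum>k = 1..m. l\<^sup>2 * min 1 (l\<^sup>2 * (real k * h)\<^sup>2) / real k) = l\<^sup>2 * (\<Sum>k=1..m. min 1 ((l * h)\<^sup>2 * (real k)\<^sup>2) / real k)"
      by (simp add: sum_distrib_left power_mult_distrib mult_ac)
    also have "\<dots> \<le> l\<^sup>2 * (2 * ln (1 + (l * h)\<^sup>2 * (real m)\<^sup>2))" by (intro mult_left_mono log_telescope) auto
    also have "\<dots> \<le> l\<^sup>2 * (2 * (2 * ln (1 + \<bar>l\<bar>)))"
    proof (intro mult_left_mono)
      have "\<bar>l\<bar> * (real m * h) \<le> \<bar>l\<bar> * 1" using h by (intro mult_left_mono) auto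
      then have "(\<bar>l\<bar> * (real m * h))\<^sup>2 \<le> (\<bar>l\<bar> * 1)\<^sup>2" using h by (intro power_mono) auto
      then have "1 + (l * h)\<^sup>2 * (real m)\<^sup>2 \<le> (1 + \<bar>l\<bar>)\<^sup>2" by (simp add: power_mult_distrib power2_sum mult_ac)
      then have "ln (1 + (l * h)\<^sup>2 * (real m)\<^sup>2) \<le> ln ((1 + \<bar>l\<bar>)\<^sup>2)" by (intro ln_mono) (auto intro: add_pos_nonneg)
      then show "ln (1 + (l * h)\<^sup>2 * (real m)\<^sup>2) \<le> 2 * ln (1 + \<bar>l\<bar>)" by (simp add: ln_realpow)
    qed auto
    also have "\<dots> = 4 * (ln (1 + \<bar>l\<bar>) * l\<^sup>2)" by simp
    finally show "(\<Sum>k = 1..m. l\<^sup>2 * min 1 (l\<^sup>2 * (real k * h)\<^sup>2) / real k) \<le> 4 * (ln (1 + \<bar>l\<bar>) * l\<^sup>2)" .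
  qed
  finally show ?thesis unfolding geman_const_def .
qed

end

section \<open>The process as a Gaussian space; absence of tangential zeros\<close>

lemma Max_image_add_const:
  fixes b :: "'i \<Rightarrow> real"
  assumes "finite I" "I \<noteq> {}"
  shows "Max ((\<lambda>i. a + b i) ` I) = a + Max (b ` I)"
  using Max_add_commute[OF assms, of b a] by (simp add: add.commute)

text \<open>Covariance 1 with \<open>X\<close> makes every \<open>Y i - X\<close> uncorrelated with
  \<open>X\<close>, hence the whole family of differences is independent of it. The maximum is
  \<open>X\<close> plus the maximum of the differences, so its characteristic function contains that
  of a standard normal variable as a factor.\<close>

lemma (in gauss_space) max_char_bound:
  fixes I :: "'i set"
  assumes I: "finite I" "I \<noteq> {}" and X: "X \<in> G" and Y: "\<And>i. i \<in> I \<Longrightarrow> Y i \<in> G"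
    and c: "cov X X = 1" "\<And>i. i \<in> I \<Longrightarrow> cov X (Y i) = 1"
  shows "norm (CLINT \<omega>|M. iexp (t * Max ((\<lambda>i. Y i \<omega>) ` I))) \<le> exp (- (t\<^sup>2 / 2))"
proof -
  interpret P: pair_prob_space M M ..
  note [measurable] = G_meas[OF X]
  have Ym[measurable]: "Y i \<in> borel_measurable M" if "i \<in> I" for i using Y[OF that] by (rule G_meas)
  \<comment> \<open>\<open>X\<close> and the differences are read off independent copies; the joint
    law of the family is unchanged.\<close>
  define Y' where "Y' i p = X (fst p) + (Y i (snd p) - X (snd p))" for i p
  have Y'm[measurable]: "Y' i \<in> borel_measurable (M \<Otimes>\<^sub>M M)" if "i \<in> I" for i
    using Ym[OF that] unfolding Y'_def by measurable
  have law: "distr M (PiM I (\<lambda>_. borel)) (\<lambda>x. \<lambda>i\<in>I. Y i x) = distr (M \<Otimes>\<^sub>M M) (PiM I (\<lambda>_. borel)) (\<lambda>x. \<lambda>i\<in>I. Y' i x)"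
  proof (rule multivariate_char_unique[OF prob_space_axioms P.prob_space_axioms I(1) Ym Y'm])
    fix c' :: "'i \<Rightarrow> real"
    define C where "C = (\<Sum>i\<in>I. c' i)"
    define W where "W = (\<lambda>\<omega>. \<Sum>i\<in>I. c' i * (Y i \<omega> - X \<omega>))"
    have W: "W \<in> G" unfolding W_def using I X Y by (intro G_sum G_scale G_diff) auto
    note [measurable] = G_meas[OF W]
    have "cov W X = (\<Sum>i\<in>I. cov (\<lambda>\<omega>. c' i * (Y i \<omega> - X \<omega>)) X)"
      unfolding W_def using I X Y by (intro cov_sum_left G_scale G_diff) auto
    also have "\<dots> = 0" using X Y c by (intro sum.neutral) (auto simp: cov_scale_left cov_diff_left cov_commute[of "Y _" X])
    finally have WX: "cov W X = 0" .
    then have XW: "cov X W = 0" by (simp add: cov_commute[of X W])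
    have CX: "(\<lambda>\<omega>. C * X \<omega>) \<in> G" using X by (rule G_scale)
    have V: "cov (\<lambda>\<omega>. C * X \<omega> + W \<omega>) (\<lambda>\<omega>. C * X \<omega> + W \<omega>) = C\<^sup>2 + cov W W"
      using X W CX WX XW c(1) by (simp add: cov_simps power2_eq_square)
    have V': "cov (\<lambda>\<omega>. C * X \<omega>) (\<lambda>\<omega>. C * X \<omega>) = C\<^sup>2" 
      using c(1) by (simp add: cov_scale_left cov_scale_right power2_eq_square)
    have s1: "(\<Sum>i\<in>I. c' i * Y i x) = C * X x + W x" for x
      by (simp add: C_def W_def right_diff_distrib sum_subtractf sum_distrib_right)
    have s2: "(\<Sum>i\<in>I. c' i * Y' i p) = C * X (fst p) + W (snd p)" for p
      by (simp add: C_def W_def Y'_def distrib_left sum.distrib sum_distrib_right)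
    have "(CLINT x|M. iexp (C * X x + W x)) = complex_of_real (exp (- ((C\<^sup>2 + cov W W) / 2)))"
      using expectation_iexp[OF G_add[OF CX W]] unfolding V .
    also have "\<dots> = (CLINT x|M. iexp (C * X x)) * (CLINT x|M. iexp (W x))"
      unfolding expectation_iexp[OF CX] expectation_iexp[OF W] V' of_real_mult[symmetric] exp_add[symmetric]
      by (simp add: add_divide_distrib)
    also have "\<dots> = (CLINT p|M \<Otimes>\<^sub>M M. iexp (C * X (fst p)) * iexp (W (snd p)))"
      by (rule integral_bounded_product[OF prob_space_axioms prob_space_axioms, symmetric]) (auto simp del: of_real_mult)
    finally show "(CLINT x|M. iexp (\<Sum>i\<in>I. c' i * Y i x)) = (CLINT x|M \<Otimes>\<^sub>M M. iexp (\<Sum>i\<in>I. c' i * Y' i x))"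
      unfolding s1 s2 by (simp add: distrib_left exp_add)
  qed
  have r1: "(\<lambda>x. \<lambda>i\<in>I. Y i x) \<in> measurable M (PiM I (\<lambda>_. borel))" using Ym by (intro measurable_restrict)
  have r2: "(\<lambda>x. \<lambda>i\<in>I. Y' i x) \<in> measurable (M \<Otimes>\<^sub>M M) (PiM I (\<lambda>_. borel))" using Y'm by (intro measurable_restrict)
  define Fm where "Fm = (\<lambda>x. iexp (t * Max ((\<lambda>i. x i) ` I)))"
  have Fm: "Fm \<in> borel_measurable (PiM I (\<lambda>_. borel))"
    unfolding Fm_def
    by (rule borel_measurable_continuous_on[where f = "\<lambda>y. iexp (t * y)"])
       (use I in \<open>auto intro!: continuous_intros borel_measurable_Max measurable_component_singleton\<close>)
  have mx: "(\<lambda>\<omega>. Max ((\<lambda>i. Y i \<omega> - X \<omega>) ` I)) \<in> borel_measurable M"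
    using I Ym by (intro borel_measurable_Max) auto
  have "(CLINT \<omega>|M. iexp (t * Max ((\<lambda>i. Y i \<omega>) ` I))) = (CLINT \<omega>|M. Fm (\<lambda>i\<in>I. Y i \<omega>))"
    unfolding Fm_def by simp
  also have "\<dots> = (CLINT x|distr M (PiM I (\<lambda>_. borel)) (\<lambda>x. \<lambda>i\<in>I. Y i x). Fm x)"
    by (rule integral_distr[OF r1 Fm, symmetric])
  also have "\<dots> = (CLINT p|M \<Otimes>\<^sub>M M. Fm (\<lambda>i\<in>I. Y' i p))"
    unfolding law by (rule integral_distr[OF r2 Fm])
  also have "\<dots> = (CLINT p|M \<Otimes>\<^sub>M M. iexp (t * X (fst p)) * iexp (t * Max ((\<lambda>i. Y i (snd p) - X (snd p)) ` I)))"
    unfolding Fm_def using I by (simp add: Y'_def Max_image_add_const distrib_left exp_add)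
  also have "\<dots> = (CLINT x|M. iexp (t * X x)) * (CLINT x|M. iexp (t * Max ((\<lambda>i. Y i x - X x) ` I)))"
    by (rule integral_bounded_product[OF prob_space_axioms prob_space_axioms]) (use mx in \<open>auto simp del: of_real_mult\<close>)
  finally have eq: "(CLINT \<omega>|M. iexp (t * Max ((\<lambda>i. Y i \<omega>) ` I))) = \<dots>" .
  have n1: "norm (CLINT x|M. iexp (t * X x)) = exp (- (t\<^sup>2 / 2))"
    using expectation_iexp[OF G_scale[OF X, of t]] c(1) by (simp add: cov_scale_left cov_scale_right power2_eq_square del: of_real_mult)
  have "norm (CLINT x|M. iexp (t * Max ((\<lambda>i. Y i x - X x) ` I))) \<le> (LINT x|M. 1)"
    by (rule norm_integral_le) (use mx in \<open>auto simp del: of_real_mult\<close>)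
  then have n2: "norm (CLINT x|M. iexp (t * Max ((\<lambda>i. Y i x - X x) ` I))) \<le> 1" using prob_space by simp
  show ?thesis unfolding eq norm_mult n1 using n2 by (simp add: mult_left_le)
qed

text \<open>The parameter \<open>m\<close> of the characteristic function is identified as the
  expectation, so that centring of the process forces it to vanish for all linear
  combinations.\<close>

lemma mean_of_gaussian:
  assumes "prob_space M" and [measurable]: "X \<in> borel_measurable M" and v: "v \<ge> 0"
    and ch: "\<And>t. char (distr M borel X) t = exp (\<i> * complex_of_real (m * t) - complex_of_real (v * t\<^sup>2 / 2))"
  shows "integrable M X" "(LINT \<omega>|M. X \<omega>) = m"
proof -
  interpret prob_space M by fact
  have law: "distr M borel X = distr N1 borel (\<lambda>x. m + sqrt v * x)"
  proof (rule Levy_uniqueness)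
    show "real_distribution (distr M borel X)" "real_distribution (distr N1 borel (\<lambda>x. m + sqrt v * x))"
      by (intro real_distribution_distr N1.real_distribution_distr; simp)+
    show "char (distr M borel X) = char (distr N1 borel (\<lambda>x. m + sqrt v * x))"
    proof
      fix t
      have "char (distr N1 borel (\<lambda>x. m + sqrt v * x)) t = (CLINT x|N1. iexp (t * (m + sqrt v * x)))"
        unfolding char_def by (rule integral_distr) simp_all
      also have "\<dots> = (CLINT x|N1. iexp (t * m) * iexp ((t * sqrt v) * x))"
        by (simp add: distrib_left exp_add mult_ac)
      also have "\<dots> = iexp (t * m) * complex_of_real (exp (- ((t * sqrt v)\<^sup>2 / 2)))"
        unfolding integral_mult_right_zero char_N1 ..
      also have "\<dots> = char (distr M borel X) t"
        unfolding ch exp_of_real[symmetric] exp_add[symmetric] using v by (simp add: power_mult_distrib mult_ac)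
      finally show "char (distr M borel X) t = char (distr N1 borel (\<lambda>x. m + sqrt v * x)) t" ..
    qed
  qed
  have i: "integrable N1 (\<lambda>x. m + sqrt v * x)" using N1_moment_1(1) by simp
  then have "integrable (distr M borel X) (\<lambda>x. x)"
    unfolding law by (intro integrable_distr_eq[THEN iffD2]) simp_all
  then show "integrable M X"
    by (rule integrable_distr_eq[THEN iffD1, rotated 2]) simp_all
  have "expectation X = (LINT x|distr M borel X. x)" by (rule integral_distr[symmetric]) simp_all
  also have "\<dots> = (LINT x|N1. m + sqrt v * x)" unfolding law by (rule integral_distr) simp_all
  also have "\<dots> = (LINT x|N1. m) + (LINT x|N1. sqrt v * x)"
    using N1_moment_1(1) by (intro Bochner_Integration.integral_add) simp_all
  also have "\<dots> = m" unfolding integral_mult_right_zero N1_moment_1(2) using N1.prob_space by simp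
  finally show "expectation X = m" .
qed

locale stat_gauss = spectral \<rho> r \<sigma> + prob_space M
  for \<rho> :: "real measure" and r :: "real \<Rightarrow> real" and \<sigma> :: real and M :: "'a measure" +
  fixes f :: "real \<Rightarrow> 'a \<Rightarrow> real"
  assumes gp: "gaussian_process M f"
    and paths: "\<And>\<omega>. \<omega> \<in> space M \<Longrightarrow> continuous_on UNIV (\<lambda>t. f t \<omega>)"
    and centred: "\<And>t. expectation (f t) = 0"
    and covariance: "\<And>s t. expectation (\<lambda>\<omega>. f s \<omega> * f t \<omega>) = r (t - s)"
begin

definition lin :: "('a \<Rightarrow> real) set" where
  "lin = {X. \<exists>cts :: (real \<times> real) list. X = (\<lambda>\<omega>. \<Sum>(c, t)\<leftarrow>cts. c * f t \<omega>)}"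

lemma f_gaussian: "gaussian_rv M (\<lambda>\<omega>. \<Sum>(c, t)\<leftarrow>cts. c * f t \<omega>)"
  using gp unfolding gaussian_process_def by blast

lemma f_single: "f t = (\<lambda>\<omega>. \<Sum>(c, t)\<leftarrow>[(1, t)]. c * f t \<omega>)" by simp

lemma f_meas[measurable]: "f t \<in> borel_measurable M"
  using f_gaussian[of "[(1, t)]"] by (simp add: gaussian_rv_def)

lemma f_integrable: "integrable M (f t)"
proof -
  from f_gaussian[of "[(1, t)]"] obtain m v where "v \<ge> 0"
    "\<And>\<theta>. char (distr M borel (f t)) \<theta> = exp (\<i> * complex_of_real (m * \<theta>) - complex_of_real (v * \<theta>\<^sup>2 / 2))"
    by (auto simp: gaussian_rv_def)
  from mean_of_gaussian(1)[OF prob_space_axioms f_meas this] show ?thesis .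
qed

lemma lin_mean: "integrable M (\<lambda>\<omega>. \<Sum>(c, t)\<leftarrow>cts. c * f t \<omega>) \<and> expectation (\<lambda>\<omega>. \<Sum>(c, t)\<leftarrow>cts. c * f t \<omega>) = 0"
proof (induction cts)
  case Nil then show ?case by simp
next
  case (Cons p cts)
  obtain c t where p: "p = (c, t)" by (cases p)
  have "integrable M (\<lambda>\<omega>. c * f t \<omega>)" "expectation (\<lambda>\<omega>. c * f t \<omega>) = 0" using f_integrable centred by simp_all
  then show ?case using Cons unfolding p by simp
qed

sublocale gauss_space M lin
proof
  fix X assume "X \<in> lin"
  then obtain cts where X: "X = (\<lambda>\<omega>. \<Sum>(c, t)\<leftarrow>cts. c * f t \<omega>)" by (auto simp: lin_def)
  from f_gaussian[of cts] obtain m v where Xm[measurable]: "X \<in> borel_measurable M" and v: "v \<ge> 0"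
    and ch: "\<And>\<theta>. char (distr M borel X) \<theta> = exp (\<i> * complex_of_real (m * \<theta>) - complex_of_real (v * \<theta>\<^sup>2 / 2))"
    unfolding X[symmetric] gaussian_rv_def by auto
  show "X \<in> borel_measurable M" by (rule Xm)
  have "m = 0" using mean_of_gaussian(2)[OF prob_space_axioms Xm v ch] lin_mean[of cts] unfolding X by simp
  have "(CLINT \<omega>|M. iexp (t * X \<omega>)) = complex_of_real (exp (- (v * t\<^sup>2 / 2)))" for t
  proof -
    have "(CLINT \<omega>|M. iexp (t * X \<omega>)) = char (distr M borel X) t"
      unfolding char_def by (rule integral_distr[symmetric]) simp_all
    then show ?thesis unfolding ch \<open>m = 0\<close> by (simp flip: exp_of_real)
  qed
  with v show "\<exists>v\<ge>0. \<forall>t. (CLINT \<omega>|M. iexp (t * X \<omega>)) = complex_of_real (exp (- (v * t\<^sup>2 / 2)))" by blast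
next
  show "(\<lambda>_. 0) \<in> lin" unfolding lin_def by (auto intro!: exI[of _ "[]"])
next
  fix X Y assume "X \<in> lin" "Y \<in> lin"
  then obtain cts dts where "X = (\<lambda>\<omega>. \<Sum>(c, t)\<leftarrow>cts. c * f t \<omega>)" "Y = (\<lambda>\<omega>. \<Sum>(c, t)\<leftarrow>dts. c * f t \<omega>)" by (auto simp: lin_def)
  then show "(\<lambda>\<omega>. X \<omega> + Y \<omega>) \<in> lin" unfolding lin_def by (auto intro!: exI[of _ "cts @ dts"])
next
  fix X and c :: real assume "X \<in> lin"
  then obtain cts where X: "X = (\<lambda>\<omega>. \<Sum>(c, t)\<leftarrow>cts. c * f t \<omega>)" by (auto simp: lin_def)
  have "c * (\<Sum>(c, t)\<leftarrow>cts. c * f t \<omega>) = (\<Sum>(c', t)\<leftarrow>map (\<lambda>(d, t). (c * d, t)) cts. c' * f t \<omega>)" for \<omega>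
    by (induction cts) (auto simp: algebra_simps)
  then show "(\<lambda>\<omega>. c * X \<omega>) \<in> lin" unfolding X lin_def by blast
qed

lemma f_lin: "f t \<in> lin" unfolding lin_def by (rule CollectI, rule exI, rule f_single)

lemma cov_f: "cov (f s) (f t) = r (t - s)" unfolding cov_def by (rule covariance)

lemma sum_lin: "finite I \<Longrightarrow> (\<lambda>\<omega>. \<Sum>i\<in>I. c i * f (t i) \<omega>) \<in> lin"
  by (intro G_sum G_scale f_lin) auto

lemma cov_sum_f: "finite I \<Longrightarrow> cov (\<lambda>\<omega>. \<Sum>i\<in>I. c i * f (t i) \<omega>) (f s) = (\<Sum>i\<in>I. c i * r (s - t i))"
  by (subst cov_sum_left) (auto intro: G_scale f_lin simp: cov_scale_left cov_f)

lemma cov_sum_sum: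
  assumes I: "finite I"
  shows "cov (\<lambda>\<omega>. \<Sum>i\<in>I. c i * f (t i) \<omega>) (\<lambda>\<omega>. \<Sum>i\<in>I. c i * f (t i) \<omega>) = (LINT l|\<rho>. (cmod (\<Sum>i\<in>I. c i * iexp (l * t i)))\<^sup>2)"
proof -
  have "cov (\<lambda>\<omega>. \<Sum>i\<in>I. c i * f (t i) \<omega>) (\<lambda>\<omega>. \<Sum>i\<in>I. c i * f (t i) \<omega>) = (\<Sum>i\<in>I. cov (\<lambda>\<omega>. c i * f (t i) \<omega>) (\<lambda>\<omega>. \<Sum>i\<in>I. c i * f (t i) \<omega>))"
    using I by (intro cov_sum_left) (auto intro: G_scale f_lin sum_lin)
  also have "\<dots> = (\<Sum>i\<in>I. \<Sum>j\<in>I. c i * c j * r (t i - t j))"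
  proof (intro sum.cong refl)
    fix i assume "i \<in> I"
    have "cov (\<lambda>\<omega>. c i * f (t i) \<omega>) (\<lambda>\<omega>. \<Sum>i\<in>I. c i * f (t i) \<omega>) = c i * cov (\<lambda>\<omega>. \<Sum>i\<in>I. c i * f (t i) \<omega>) (f (t i))"
      by (simp add: cov_scale_left cov_commute[of "f (t i)"])
    then show "cov (\<lambda>\<omega>. c i * f (t i) \<omega>) (\<lambda>\<omega>. \<Sum>i\<in>I. c i * f (t i) \<omega>) = (\<Sum>j\<in>I. c i * c j * r (t i - t j))"
      by (simp add: cov_sum_f[OF I] sum_distrib_left mult.assoc)
  qed
  finally show ?thesis unfolding quadratic_form[OF I] .
qed

text \<open>Dividing by the positive number r(t - x) keeps signs and zeros but makes the covariance
  with the value at \<open>x\<close> equal to 1. By \<open>max_char_bound\<close> the maxima over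
  dyadic grids have characteristic functions below a fixed Gaussian; so does their limit, the
  maximum over the interval, which therefore has no atom at 0. Touching would make this maximum 0.
  The sign \<open>s\<close> treats both sides at once.\<close>

lemma no_touch:
  assumes xy: "x < y" and rp: "\<And>t. 0 \<le> t \<Longrightarrow> t \<le> y - x \<Longrightarrow> r t > 0" and s: "s * s = 1"
  shows "AE \<omega> in M. \<not> touches (\<lambda>t. s * f t \<omega>) x y"
proof -
  define T where "T n i = x + (y - x) * (real i / 2^n)" for n i :: nat
  define q where "q t \<omega> = (s / r (t - x)) * f t \<omega>" for t \<omega>
  define Q where "Q n \<omega> = Max ((\<lambda>i. q (T n i) \<omega>) ` {..2^n})" for n \<omega>
  have q_lin: "q t \<in> lin" for t unfolding q_def by (intro G_scale f_lin)
  have T: "x \<le> T n i" "T n i \<le> y" "0 \<le> T n i - x" "T n i - x \<le> y - x" if "i \<le> 2^n" for n i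
  proof -
    have "real i \<le> real (2^n)" using that by (simp only: of_nat_le_iff)
    then have "real i / 2^n \<le> 1" by simp
    then have "(y - x) * (real i / 2^n) \<le> (y - x) * 1" using xy by (intro mult_left_mono) auto
    moreover have "0 \<le> (y - x) * (real i / 2^n)" using xy by auto
    ultimately show "x \<le> T n i" "T n i \<le> y" "0 \<le> T n i - x" "T n i - x \<le> y - x" by (auto simp: T_def)
  qed
  have qc: "continuous_on {x..y} (\<lambda>t. q t \<omega>)" if \<omega>: "\<omega> \<in> space M" for \<omega>
  proof -
    have "continuous_on {x..y} (\<lambda>t. r (t - x))"
    proof (rule lipschitz_on_continuous_on)
      show "\<sigma>-lipschitz_on {x..y} (\<lambda>t. r (t - x))"
        using r_lipschitz[of "_ - x" "_ - x"] sigma_pos by (intro lipschitz_onI) (auto simp: dist_real_def)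
    qed
    moreover have "r (t - x) \<noteq> 0" if "t \<in> {x..y}" for t using rp[of "t - x"] that by auto
    ultimately show ?thesis unfolding q_def using continuous_on_subset[OF paths[OF \<omega>], of "{x..y}"]
      by (intro continuous_intros) auto
  qed
  have mono: "Q n \<omega> \<le> Q (Suc n) \<omega>" for n \<omega>
    unfolding Q_def
  proof (rule Max.boundedI)
    fix a assume "a \<in> (\<lambda>i. q (T n i) \<omega>) ` {..2^n}"
    then obtain i where i: "i \<le> 2^n" "a = q (T n i) \<omega>" by auto
    have "T n i = T (Suc n) (2 * i)" by (simp add: T_def)
    then show "a \<le> Max ((\<lambda>i. q (T (Suc n) i) \<omega>) ` {..2^Suc n})"
      using i by (intro Max_ge) auto
  qed auto
  have Qm[measurable]: "Q n \<in> borel_measurable M" for n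
    unfolding Q_def[abs_def] using G_meas[OF q_lin] by (intro borel_measurable_Max) auto
  have conv: "convergent (\<lambda>n. Q n \<omega>)" if \<omega>: "\<omega> \<in> space M" for \<omega>
  proof -
    have "bounded ((\<lambda>t. q t \<omega>) ` {x..y})" using qc[OF \<omega>] by (intro compact_imp_bounded compact_continuous_image) auto
    then obtain B where "\<forall>z\<in>(\<lambda>t. q t \<omega>) ` {x..y}. norm z \<le> B" unfolding bounded_iff by blast
    then have B: "\<And>t. t \<in> {x..y} \<Longrightarrow> \<bar>q t \<omega>\<bar> \<le> B" by auto
    have "Q n \<omega> \<le> B" for n
      unfolding Q_def using B T by (intro Max.boundedI) (auto simp: abs_le_iff)
    moreover have "incseq (\<lambda>n. Q n \<omega>)" using mono by (rule incseq_SucI)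
    ultimately obtain L where "(\<lambda>n. Q n \<omega>) \<longlonglongrightarrow> L" using incseq_convergent[of "\<lambda>n. Q n \<omega>" B] by blast
    then show ?thesis by (rule convergentI)
  qed
  define L where "L \<omega> = lim (\<lambda>n. Q n \<omega>)" for \<omega>
  have [measurable]: "L \<in> borel_measurable M" unfolding L_def[abs_def] by (intro borel_measurable_lim_metric Qm)
  have lim: "(\<lambda>n. Q n \<omega>) \<longlonglongrightarrow> L \<omega>" if "\<omega> \<in> space M" for \<omega>
    using conv[OF that] unfolding L_def by (simp add: convergent_LIMSEQ_iff)
  have chQ: "norm (CLINT \<omega>|M. iexp (t * Q n \<omega>)) \<le> exp (- (t\<^sup>2 / 2))" for t n
    unfolding Q_def
  proof (rule max_char_bound)
    have qq: "cov (q x) (q u) = s * (s / r (u - x)) * r (u - x)" for u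
      unfolding q_def[abs_def] cov_scale_left cov_scale_right cov_f by (simp add: r_at_0)
    show "q x \<in> lin" "\<And>i. q (T n i) \<in> lin" by (rule q_lin)+
    show "cov (q x) (q x) = 1" unfolding qq using s by (simp add: r_at_0)
    show "cov (q x) (q (T n i)) = 1" if "i \<in> {..2^n}" for i
      unfolding qq using s rp[OF T(3,4)[of i n]] that by simp
  qed auto
  have "norm (CLINT \<omega>|M. iexp (t * L \<omega>)) \<le> exp (- (t\<^sup>2 / 2))" for t
  proof (rule LIMSEQ_le_const2)
    show "(\<lambda>n. norm (CLINT \<omega>|M. iexp (t * Q n \<omega>))) \<longlonglongrightarrow> norm (CLINT \<omega>|M. iexp (t * L \<omega>))"
    proof (intro tendsto_norm integral_dominated_convergence[where w = "\<lambda>_. 1"])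
      show "AE \<omega> in M. (\<lambda>n. iexp (t * Q n \<omega>)) \<longlonglongrightarrow> iexp (t * L \<omega>)"
        using lim by (intro AE_I2) (auto intro!: tendsto_intros)
    qed (auto simp del: of_real_mult)
    show "\<exists>N. \<forall>n\<ge>N. norm (CLINT \<omega>|M. iexp (t * Q n \<omega>)) \<le> exp (- (t\<^sup>2 / 2))" using chQ by blast
  qed
  then have ae: "AE \<omega> in M. L \<omega> \<noteq> 0" by (intro no_atom_at_zero[OF prob_space_axioms]) auto
  have L0: "L \<omega> = 0" if \<omega>: "\<omega> \<in> space M" and t: "touches (\<lambda>t. s * f t \<omega>) x y" for \<omega>
  proof (rule antisym)
    have le: "q u \<omega> \<le> 0" if "u \<in> {x..y}" for u
    proof -
      have "s * f u \<omega> \<le> 0" "r (u - x) > 0" using t that rp[of "u - x"] by (auto simp: touches_def)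
      then show ?thesis unfolding q_def by (simp add: divide_nonpos_pos)
    qed
    have "Q n \<omega> \<le> 0" for n
      unfolding Q_def using le T by (intro Max.boundedI) auto
    then show "L \<omega> \<le> 0" using lim[OF \<omega>] by (intro LIMSEQ_le_const2) auto
    obtain u where u: "u \<in> {x..y}" "s * f u \<omega> = 0" using t by (auto simp: touches_def)
    \<comment> \<open>Grid points approaching the touching point \<open>u\<close> from the left;
      they force the limit of the maxima to be at least 0.\<close>
    define J where "J n = nat \<lfloor>(u - x) / (y - x) * 2^n\<rfloor>" for n :: nat
    have fl: "real (J n) \<le> (u - x) / (y - x) * 2^n" "(u - x) / (y - x) * 2^n - 1 \<le> real (J n)" for n
    proof -
      have "0 \<le> (u - x) / (y - x) * 2^n" using u xy by auto
      then show "real (J n) \<le> (u - x) / (y - x) * 2^n" "(u - x) / (y - x) * 2^n - 1 \<le> real (J n)" unfolding J_def by linarith+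
    qed
    have Jn: "J n \<le> 2^n" for n
    proof -
      have "(u - x) / (y - x) * 2^n \<le> 1 * 2^n" using u xy by (intro mult_right_mono) auto
      with fl(1)[of n] have "real (J n) \<le> 1 * 2^n" by (rule order_trans)
      then have "real (J n) \<le> real (2^n)" unfolding of_nat_power by simp
      then show ?thesis by (simp only: of_nat_le_iff)
    qed
    have "(\<lambda>n. real (J n) / 2^n) \<longlonglongrightarrow> (u - x) / (y - x)"
    proof (rule tendsto_sandwich)
      have "(\<lambda>n::nat. (u - x) / (y - x) - 1 / 2^n) \<longlonglongrightarrow> (u - x) / (y - x) - 0"
        by (intro tendsto_diff tendsto_const LIMSEQ_divide_realpow_zero) simp
      then show "(\<lambda>n::nat. (u - x) / (y - x) - 1 / 2^n) \<longlonglongrightarrow> (u - x) / (y - x)" by simp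
      show "\<forall>\<^sub>F n in sequentially. (u - x) / (y - x) - 1 / 2 ^ n \<le> real (J n) / 2 ^ n"
      proof (intro always_eventually allI)
        fix n
        have "((u - x) / (y - x) * 2^n - 1) / 2^n \<le> real (J n) / 2^n" by (intro divide_right_mono fl) simp
        then show "(u - x) / (y - x) - 1 / 2 ^ n \<le> real (J n) / 2 ^ n" by (simp add: diff_divide_distrib)
      qed
      show "\<forall>\<^sub>F n in sequentially. real (J n) / 2 ^ n \<le> (u - x) / (y - x)"
      proof (intro always_eventually allI)
        fix n
        have "real (J n) / 2^n \<le> ((u - x) / (y - x) * 2^n) / 2^n" by (intro divide_right_mono fl) simp
        then show "real (J n) / 2 ^ n \<le> (u - x) / (y - x)" by simp
      qed
    qed auto
    then have "(\<lambda>n. T n (J n)) \<longlonglongrightarrow> x + (y - x) * ((u - x) / (y - x))" unfolding T_def by (intro tendsto_add tendsto_mult tendsto_const)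
    then have Tu: "(\<lambda>n. T n (J n)) \<longlonglongrightarrow> u" using xy by simp
    have "(\<lambda>n. q (T n (J n)) \<omega>) \<longlonglongrightarrow> q u \<omega>"
      by (rule continuous_on_tendsto_compose[OF qc[OF \<omega>] Tu u(1)]) (use T(1,2)[OF Jn] in \<open>auto intro!: always_eventually\<close>)
    moreover have "q u \<omega> = 0" using u(2) by (auto simp: q_def)
    ultimately have lim0: "(\<lambda>n. q (T n (J n)) \<omega>) \<longlonglongrightarrow> 0" by simp
    have "q (T n (J n)) \<omega> \<le> Q n \<omega>" for n unfolding Q_def using Jn by (intro Max_ge) auto
    then show "0 \<le> L \<omega>" by (intro LIMSEQ_le[OF lim0 lim[OF \<omega>]]) blast
  qed
  show ?thesis using ae by (rule AE_mp) (use L0 in \<open>auto intro!: AE_I2\<close>)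
qed

end

section \<open>Second moment of the number of sign changes\<close>

lemma ell_0: "ell 0 = sqrt (2/pi)"
  using N1_abs_moments(1) by (simp add: ell_def)

text \<open>As \<open>k\<close> varies, each distance to \<open>j\<close> is taken at most
  twice.\<close>

lemma sum_abs_diff_le:
  fixes b :: "nat \<Rightarrow> real"
  assumes b: "\<And>d. b d \<ge> 0" and j: "j < m"
  shows "(\<Sum>k<m. b (nat \<bar>int j - int k\<bar>)) \<le> 2 * (\<Sum>d<m. b d)"
proof -
  have "(\<Sum>k<m. b (nat \<bar>int j - int k\<bar>)) = (\<Sum>k\<in>{..j}. b (nat \<bar>int j - int k\<bar>)) + (\<Sum>k\<in>{j<..<m}. b (nat \<bar>int j - int k\<bar>))"
    using j by (subst sum.union_disjoint[symmetric]) (auto intro!: sum.cong)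
  also have "(\<Sum>k\<in>{..j}. b (nat \<bar>int j - int k\<bar>)) = (\<Sum>d\<in>{..j}. b d)"
    by (rule sum.reindex_bij_witness[where i = "\<lambda>d. j - d" and j = "\<lambda>k. j - k"]) (auto simp: nat_diff_distrib')
  also have "\<dots> \<le> (\<Sum>d<m. b d)" using j b by (intro sum_mono2) auto
  also have "(\<Sum>k\<in>{j<..<m}. b (nat \<bar>int j - int k\<bar>)) = (\<Sum>d\<in>{0<..<m - j}. b d)"
    by (rule sum.reindex_bij_witness[where i = "\<lambda>d. j + d" and j = "\<lambda>k. k - j"]) (auto simp: nat_diff_distrib')
  also have "\<dots> \<le> (\<Sum>d<m. b d)" using b by (intro sum_mono2) auto
  finally show ?thesis by simp
qed

lemma crossings_blocks:
  "crossings g a h (K * m) = (\<Sum>i<K. crossings g (a + real (i * m) * h) h m)"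
proof -
  have "crossings g a h (K * m) = (\<Sum>i<K. \<Sum>j\<in>{i * m..<i * m + m}. of_bool (g (a + real j * h) * g (a + real (Suc j) * h) < 0))"
    unfolding crossings_def by (rule sum.nat_group[symmetric])
  also have "\<dots> = (\<Sum>i<K. crossings g (a + real (i * m) * h) h m)"
  proof (intro sum.cong refl)
    fix i
    have "(\<Sum>j\<in>{i * m..<i * m + m}. of_bool (g (a + real j * h) * g (a + real (Suc j) * h) < 0)) =
       (\<Sum>j<m. of_bool (g (a + real (i * m + j) * h) * g (a + real (Suc (i * m + j)) * h) < 0) :: real)"
      by (rule sum.reindex_bij_witness[where i = "\<lambda>j. i * m + j" and j = "\<lambda>j. j - i * m"]) auto
    also have "\<dots> = crossings g (a + real (i * m) * h) h m"
      unfolding crossings_def by (intro sum.cong refl) (simp add: distrib_right add.assoc add.left_commute)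
    finally show "(\<Sum>j\<in>{i * m..<i * m + m}. of_bool (g (a + real j * h) * g (a + real (Suc j) * h) < 0)) = crossings g (a + real (i * m) * h) h m" .
  qed
  finally show ?thesis .
qed

lemma square_sum_le:
  fixes x :: "nat \<Rightarrow> real"
  shows "(\<Sum>i<K. x i)\<^sup>2 \<le> real K * (\<Sum>i<K. (x i)\<^sup>2)"
  using Cauchy_Schwarz_ineq_sum[of "\<lambda>_. 1" x "{..<K}"] by simp

context stat_gauss
begin

definition \<delta>\<^sub>0 :: real where
  "\<delta>\<^sub>0 = (SOME \<delta>. \<delta> > 0 \<and> \<delta> \<le> 1 \<and> \<sigma> * \<delta> \<le> 1/8 \<and> (\<forall>t. 0 < t \<longrightarrow> t \<le> \<delta> \<longrightarrow> \<sigma>\<^sup>2 * t\<^sup>2 / 4 \<le> 1 - r t \<and> 0 \<le> r t))"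

lemma delta0: "\<delta>\<^sub>0 > 0" "\<delta>\<^sub>0 \<le> 1" "\<sigma> * \<delta>\<^sub>0 \<le> 1/8"
   "0 < t \<Longrightarrow> t \<le> \<delta>\<^sub>0 \<Longrightarrow> \<sigma>\<^sup>2 * t\<^sup>2 / 4 \<le> 1 - r t" "0 < t \<Longrightarrow> t \<le> \<delta>\<^sub>0 \<Longrightarrow> 0 \<le> r t"
proof -
  have "\<exists>\<delta>. \<delta> > 0 \<and> \<delta> \<le> 1 \<and> \<sigma> * \<delta> \<le> 1/8 \<and> (\<forall>t. 0 < t \<longrightarrow> t \<le> \<delta> \<longrightarrow> \<sigma>\<^sup>2 * t\<^sup>2 / 4 \<le> 1 - r t \<and> 0 \<le> r t)"
    by (rule small_scale) blast
  from someI_ex[OF this, folded \<delta>\<^sub>0_def]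
  show "\<delta>\<^sub>0 > 0" "\<delta>\<^sub>0 \<le> 1" "\<sigma> * \<delta>\<^sub>0 \<le> 1/8"
   "0 < t \<Longrightarrow> t \<le> \<delta>\<^sub>0 \<Longrightarrow> \<sigma>\<^sup>2 * t\<^sup>2 / 4 \<le> 1 - r t" "0 < t \<Longrightarrow> t \<le> \<delta>\<^sub>0 \<Longrightarrow> 0 \<le> r t" by blast+
qed

definition usum :: "real \<Rightarrow> real \<Rightarrow> 'a \<Rightarrow> real" where "usum s h = (\<lambda>\<omega>. f s \<omega> + f (s + h) \<omega>)"
definition wdiff :: "real \<Rightarrow> real \<Rightarrow> 'a \<Rightarrow> real" where "wdiff s h = (\<lambda>\<omega>. f (s + h) \<omega> - f s \<omega>)"

lemma uw_lin: "usum s h \<in> lin" "wdiff s h \<in> lin"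
  unfolding usum_def wdiff_def by (intro G_add G_diff f_lin)+

lemma cov_uw: "cov (usum s h) (wdiff s h) = 0" "cov (usum s h) (usum s h) = 2 * (1 + r h)" "cov (wdiff s h) (wdiff s h) = 2 * (1 - r h)"
  using r_even[of h] by (simp_all add: usum_def wdiff_def cov_simps f_lin cov_f r_at_0)

text \<open>The squares of sum and difference differ by four times the product of the two values. A
  sign condition on two correlated values thus becomes a comparison of two uncorrelated
  variables.\<close>

lemma sign_change_iff: "f s \<omega> * f (s + h) \<omega> < 0 \<longleftrightarrow> \<bar>usum s h \<omega>\<bar> < \<bar>wdiff s h \<omega>\<bar>"
proof -
  have "\<bar>usum s h \<omega>\<bar> < \<bar>wdiff s h \<omega>\<bar> \<longleftrightarrow> (usum s h \<omega>)\<^sup>2 < (wdiff s h \<omega>)\<^sup>2"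
    using abs_le_square_iff[of "wdiff s h \<omega>" "usum s h \<omega>"] by (simp only: not_le[symmetric])
  also have "(wdiff s h \<omega>)\<^sup>2 = (usum s h \<omega>)\<^sup>2 - 4 * (f s \<omega> * f (s + h) \<omega>)"
    by (simp add: usum_def wdiff_def power2_eq_square algebra_simps)
  finally show ?thesis by auto
qed

lemma variances: 
  assumes h: "0 < h" "h \<le> \<delta>\<^sub>0"
  shows "1 \<le> sqrt (2 * (1 + r h))" "0 < 1 - r h" "0 < 1 + r h" "sqrt (2 * (1 - r h)) \<le> \<sigma> * h" "\<sigma> * h / 2 \<le> sqrt (2 * (1 - r h))"
   "\<sigma>\<^sup>2 * h\<^sup>2 / 2 \<le> 2 * (1 - r h)"
proof -
  note d = delta0(4,5)[OF h]
  have sh: "0 < \<sigma> * h" "0 < \<sigma>\<^sup>2 * h\<^sup>2" using sigma_pos h by auto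
  show "1 \<le> sqrt (2 * (1 + r h))" using d(2) by (intro real_le_rsqrt) auto
  show "0 < 1 - r h" "0 < 1 + r h" using d sh by auto
  have "2 * (1 - r h) \<le> (\<sigma> * h)\<^sup>2" using one_minus_r_le[of h] by (simp add: power_mult_distrib)
  then show "sqrt (2 * (1 - r h)) \<le> \<sigma> * h" using sh by (intro real_le_lsqrt) auto
  show q: "\<sigma>\<^sup>2 * h\<^sup>2 / 2 \<le> 2 * (1 - r h)" using d(1) by simp
  have "(\<sigma> * h / 2)\<^sup>2 \<le> \<sigma>\<^sup>2 * h\<^sup>2 / 2" by (simp add: power_mult_distrib power_divide)
  then show "\<sigma> * h / 2 \<le> sqrt (2 * (1 - r h))" using q by (intro real_le_rsqrt) linarith
qed

lemma kr_step:
  fixes s h :: real and z :: "'a \<Rightarrow> real"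
  assumes z: "z \<in> lin" and h: "0 < h" "h \<le> \<delta>\<^sub>0"
  defines "a \<equiv> cov z (usum s h) / sqrt (2 * (1 + r h))" and "b \<equiv> cov z (wdiff s h) / sqrt (2 * (1 - r h))"
    and "\<tau> \<equiv> sqrt (2 * (1 - r h)) / sqrt (2 * (1 + r h))"
  shows "norm ((CLINT \<omega>|M. if f s \<omega> * f (s + h) \<omega> < 0 then iexp (z \<omega>) else 0) -
      complex_of_real (\<tau> * sqrt (2/pi) * exp (- ((cov z z - a\<^sup>2 - b\<^sup>2) / 2)) * ell b)) \<le> (1 + \<bar>a\<bar>) * \<tau>\<^sup>2"
  using kac_rice_step[OF uw_lin(1) uw_lin(2) z cov_uw(1), of s h] variances[OF h]
  unfolding cov_uw sign_change_iff a_def b_def \<tau>_def by simp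

lemma tau_le:
  assumes h: "0 < h" "h \<le> \<delta>\<^sub>0"
  shows "0 \<le> sqrt (2 * (1 - r h)) / sqrt (2 * (1 + r h))" "sqrt (2 * (1 - r h)) / sqrt (2 * (1 + r h)) \<le> \<sigma> * h"
proof -
  note v = variances[OF h]
  show "0 \<le> sqrt (2 * (1 - r h)) / sqrt (2 * (1 + r h))" using v by simp
  have "sqrt (2 * (1 - r h)) / sqrt (2 * (1 + r h)) \<le> (\<sigma> * h) / 1" using v by (intro frac_le) auto
  then show "sqrt (2 * (1 - r h)) / sqrt (2 * (1 + r h)) \<le> \<sigma> * h" by simp
qed

text \<open>The functional 0 in \<open>kr_step\<close>: the main term is
  \<open>\<tau> * (2/pi)\<close>, and \<open>\<tau>\<close> is at most
  \<open>\<sigma> * h\<close>.\<close>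

lemma cell_prob:
  assumes h: "0 < h" "h \<le> \<delta>\<^sub>0"
  shows "prob {\<omega>\<in>space M. f s \<omega> * f (s + h) \<omega> < 0} \<le> 2 * (\<sigma> * h)"
proof -
  define \<tau> where "\<tau> = sqrt (2 * (1 - r h)) / sqrt (2 * (1 + r h))"
  have \<tau>: "0 \<le> \<tau>" "\<tau> \<le> \<sigma> * h" using tau_le[OF h] unfolding \<tau>_def by auto
  have "\<sigma> * h \<le> \<sigma> * \<delta>\<^sub>0" using h sigma_pos by (intro mult_left_mono) auto
  then have s1: "\<sigma> * h \<le> 1/8" using delta0(3) by linarith
  have c0: "cov (\<lambda>_. 0) X = 0" for X by (simp add: cov_def)
  have "(CLINT \<omega>|M. if f s \<omega> * f (s + h) \<omega> < 0 then iexp 0 else 0) = (CLINT \<omega>|M. complex_of_real (indicator {\<omega>\<in>space M. f s \<omega> * f (s + h) \<omega> < 0} \<omega>))"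
    by (intro Bochner_Integration.integral_cong) (auto simp: indicator_def)
  also have "\<dots> = complex_of_real (LINT \<omega>|M. indicator {\<omega>\<in>space M. f s \<omega> * f (s + h) \<omega> < 0} \<omega>)"
    by (rule integral_complex_of_real)
  also have "(LINT \<omega>|M. indicator {\<omega>\<in>space M. f s \<omega> * f (s + h) \<omega> < 0} \<omega>) = prob {\<omega>\<in>space M. f s \<omega> * f (s + h) \<omega> < 0}"
    by simp
  finally have P: "(CLINT \<omega>|M. if f s \<omega> * f (s + h) \<omega> < 0 then iexp 0 else 0) = complex_of_real (prob {\<omega>\<in>space M. f s \<omega> * f (s + h) \<omega> < 0})" .
  have "norm (complex_of_real (prob {\<omega>\<in>space M. f s \<omega> * f (s + h) \<omega> < 0}) - complex_of_real (\<tau> * (2/pi))) \<le> \<tau>\<^sup>2"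
    using kr_step[OF G_zero h, of s] unfolding P c0 \<tau>_def[symmetric] by (simp add: ell_0 mult.assoc)
  then have "\<bar>prob {\<omega>\<in>space M. f s \<omega> * f (s + h) \<omega> < 0} - \<tau> * (2/pi)\<bar> \<le> \<tau>\<^sup>2"
    by (simp only: of_real_diff[symmetric] norm_of_real)
  then have "prob {\<omega>\<in>space M. f s \<omega> * f (s + h) \<omega> < 0} \<le> \<tau> * (2/pi) + \<tau> * \<tau>" by (simp add: power2_eq_square)
  also have "\<dots> \<le> \<tau> * 1 + \<tau> * 1" using \<tau> s1 pi_gt3 by (intro add_mono mult_left_mono) auto
  finally show ?thesis using \<tau> by linarith
qed

text \<open>A sign change bounds the modulus of the value at the left end of the cell by that of the
  increment, which is the event of \<open>pair_bound\<close>. Both increments are predicted by the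
  slope of the secant between the two points, so \<open>c\<close> is \<open>h / t\<close> and the
  residuals are controlled by \<open>secant_defect\<close>.\<close>

lemma pair_prob:
  assumes h: "0 < h" "12 * h \<le> t" "t \<le> \<delta>\<^sub>0"
  shows "prob {\<omega>\<in>space M. f s \<omega> * f (s + h) \<omega> < 0 \<and> f (s + t) \<omega> * f (s + t + h) \<omega> < 0} \<le> 512 * h\<^sup>2 * \<kappa> t / (\<sigma> * t)"
proof -
  have t: "0 < t" "h \<le> \<delta>\<^sub>0" "h \<le> t" using h by auto
  define c where "c = h / t"
  note v = variances[OF t(1) h(3)] and vh = variances[OF h(1) t(2)]
  have sh: "\<sigma> * h \<le> 1/8"
    using mult_left_mono[OF t(2), of \<sigma>] sigma_pos delta0(3) by linarith
  have defect: "cov (\<lambda>\<omega>. wdiff s' h \<omega> - c * wdiff s t \<omega>) (\<lambda>\<omega>. wdiff s' h \<omega> - c * wdiff s t \<omega>) \<le> 16 * h\<^sup>2 * \<kappa> t"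
    if s': "s' = s \<or> s' = s + t" for s'
  proof -
    define cc where "cc i = (if i = (0::nat) then 1 else if i = 1 then -1 else if i = 2 then - c else c)" for i
    define tt where "tt i = (if i = (0::nat) then s' + h else if i = 1 then s' else if i = 2 then s + t else s)" for i
    have "(\<lambda>\<omega>. wdiff s' h \<omega> - c * wdiff s t \<omega>) = (\<lambda>\<omega>. \<Sum>i\<in>{0,1,2,3}. cc i * f (tt i) \<omega>)"
      by (auto simp: cc_def tt_def wdiff_def algebra_simps)
    then have "cov (\<lambda>\<omega>. wdiff s' h \<omega> - c * wdiff s t \<omega>) (\<lambda>\<omega>. wdiff s' h \<omega> - c * wdiff s t \<omega>) =
        (LINT l|\<rho>. (cmod (\<Sum>i\<in>{0,1,2,3}. cc i * iexp (l * tt i)))\<^sup>2)"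
      by (simp only: cov_sum_sum[of "{0,1,2,3::nat}"] finite.intros)
    \<comment> \<open>Seen from \<open>s + t\<close> the secant runs backwards, hence the scale
      \<open>- t\<close>; the common phase has modulus 1 and drops out.\<close>
    also have "\<dots> = (LINT l|\<rho>. (cmod (iexp (l * h) - 1 - of_real (h / (if s' = s then t else -t)) * (iexp (l * (if s' = s then t else -t)) - 1)))\<^sup>2)"
    proof (intro Bochner_Integration.integral_cong refl)
      fix l
      have e: "(\<Sum>i\<in>{0,1,2,3}. cc i * iexp (l * tt i)) = iexp (l * (s' + h)) - iexp (l * s') - c * iexp (l * (s + t)) + c * iexp (l * s)"
        by (simp add: cc_def tt_def)
      also have "\<dots> = iexp (l * s') * (iexp (l * h) - 1 - of_real (h / (if s' = s then t else -t)) * (iexp (l * (if s' = s then t else -t)) - 1))"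
        using s' t(1) by (auto simp: c_def distrib_left right_diff_distrib exp_add exp_diff exp_minus field_simps)
      finally have "cmod (\<Sum>i\<in>{0,1,2,3}. cc i * iexp (l * tt i)) = cmod (iexp (l * h) - 1 - of_real (h / (if s' = s then t else -t)) * (iexp (l * (if s' = s then t else -t)) - 1))"
        by (simp only: norm_mult norm_exp_i_times mult_1_left)
      then show "(cmod (\<Sum>i\<in>{0,1,2,3}. cc i * iexp (l * tt i)))\<^sup>2 = (cmod (iexp (l * h) - 1 - of_real (h / (if s' = s then t else -t)) * (iexp (l * (if s' = s then t else -t)) - 1)))\<^sup>2"
        by simp
    qed
    also have "\<dots> \<le> 16 * h\<^sup>2 * \<kappa> (if s' = s then t else -t)"
      using h t by (intro secant_defect) auto
    also have "\<kappa> (if s' = s then t else -t) = \<kappa> t" by (simp add: \<kappa>_def)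
    finally show ?thesis .
  qed
  have u: "(\<lambda>\<omega>. f s \<omega> + f (s + t) \<omega>) = usum s t" and w: "f (s + t) \<omega> - f s \<omega> = wdiff s t \<omega>" for \<omega>
    by (simp_all add: usum_def wdiff_def)
  have "prob {\<omega>\<in>space M. f s \<omega> * f (s + h) \<omega> < 0 \<and> f (s + t) \<omega> * f (s + t + h) \<omega> < 0} \<le>
      prob {\<omega>\<in>space M. \<bar>f s \<omega>\<bar> \<le> \<bar>wdiff s h \<omega>\<bar> \<and> \<bar>f (s + t) \<omega>\<bar> \<le> \<bar>wdiff (s + t) h \<omega>\<bar>}"
  proof (rule finite_measure_mono)
    note [measurable] = G_meas[OF uw_lin(2)]
    show "{\<omega>\<in>space M. \<bar>f s \<omega>\<bar> \<le> \<bar>wdiff s h \<omega>\<bar> \<and> \<bar>f (s + t) \<omega>\<bar> \<le> \<bar>wdiff (s + t) h \<omega>\<bar>} \<in> events" by measurable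
    have "\<bar>x\<bar> \<le> \<bar>y - x\<bar>" if "x * y < 0" for x y :: real using that by (auto simp: mult_less_0_iff)
    then show "{\<omega>\<in>space M. f s \<omega> * f (s + h) \<omega> < 0 \<and> f (s + t) \<omega> * f (s + t + h) \<omega> < 0} \<subseteq>
        {\<omega>\<in>space M. \<bar>f s \<omega>\<bar> \<le> \<bar>wdiff s h \<omega>\<bar> \<and> \<bar>f (s + t) \<omega>\<bar> \<le> \<bar>wdiff (s + t) h \<omega>\<bar>}"
      unfolding wdiff_def by auto
  qed
  also have "\<dots> \<le> 8 * (cov (\<lambda>\<omega>. wdiff s h \<omega> - c * wdiff s t \<omega>) (\<lambda>\<omega>. wdiff s h \<omega> - c * wdiff s t \<omega>) + 
      cov (\<lambda>\<omega>. wdiff (s + t) h \<omega> - c * wdiff s t \<omega>) (\<lambda>\<omega>. wdiff (s + t) h \<omega> - c * wdiff s t \<omega>)) / (sqrt (2 * (1 + r t)) * sqrt (2 * (1 - r t)))"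
  proof (rule pair_bound[of "f s" "f (s + t)" "wdiff s h" "wdiff (s + t) h" "\<sigma> * h" c, unfolded u w, unfolded cov_uw])
    show "f s \<in> lin" "f (s + t) \<in> lin" "wdiff s h \<in> lin" "wdiff (s + t) h \<in> lin" by (rule f_lin uw_lin)+
    show "cov (f s) (f s) = cov (f (s + t)) (f (s + t))" by (simp add: cov_f)
    show "0 < 2 * (1 + r t)" "0 < 2 * (1 - r t)" using v by auto
    show "0 \<le> \<sigma> * h" using sigma_pos h by simp
    show "\<sigma> * h \<le> sqrt (2 * (1 + r t)) / 8" using sh v(1) by linarith
    show "2 * (1 - r h) \<le> (\<sigma> * h)\<^sup>2" "2 * (1 - r h) \<le> (\<sigma> * h)\<^sup>2" using one_minus_r_le[of h] by (simp_all add: power_mult_distrib)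
    \<comment> \<open>\<open>pair_bound\<close> asks for a ratio 8 against a standard deviation that
      is at least \<sigma> t divided by the root of 2. So t / h has to exceed 8 times the root of 2;
      12 is the next integer.\<close>
    have "(8 * (\<sigma> * h))\<^sup>2 = \<sigma>\<^sup>2 * (64 * h\<^sup>2)" by (simp add: power_mult_distrib)
    also have "\<dots> \<le> \<sigma>\<^sup>2 * (t\<^sup>2 / 2)"
    proof (rule mult_left_mono)
      have "(12 * h)\<^sup>2 \<le> t\<^sup>2" using h by (intro power_mono) auto
      then have "144 * h\<^sup>2 \<le> t\<^sup>2" by (simp add: power_mult_distrib)
      then show "64 * h\<^sup>2 \<le> t\<^sup>2 / 2" using zero_le_power2[of h] by linarith
    qed simp
    also have "\<dots> \<le> 2 * (1 - r t)" using v(6) by simp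
    finally have "8 * (\<sigma> * h) \<le> sqrt (2 * (1 - r t))" by (rule real_le_rsqrt)
    then show "\<sigma> * h \<le> sqrt (2 * (1 - r t)) / 8" by simp
  qed
  also have "\<dots> \<le> 8 * (16 * h\<^sup>2 * \<kappa> t + 16 * h\<^sup>2 * \<kappa> t) / (1 * (\<sigma> * t / 2))"
  proof (rule frac_le)
    show "0 \<le> 8 * (16 * h\<^sup>2 * \<kappa> t + 16 * h\<^sup>2 * \<kappa> t)" using kappa_nonneg by simp
    show "8 * (cov (\<lambda>\<omega>. wdiff s h \<omega> - c * wdiff s t \<omega>) (\<lambda>\<omega>. wdiff s h \<omega> - c * wdiff s t \<omega>) + 
      cov (\<lambda>\<omega>. wdiff (s + t) h \<omega> - c * wdiff s t \<omega>) (\<lambda>\<omega>. wdiff (s + t) h \<omega> - c * wdiff s t \<omega>)) \<le> 8 * (16 * h\<^sup>2 * \<kappa> t + 16 * h\<^sup>2 * \<kappa> t)"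
      by (intro mult_left_mono add_mono defect) simp_all
    show "0 < 1 * (\<sigma> * t / 2)" using sigma_pos t by simp
    show "1 * (\<sigma> * t / 2) \<le> sqrt (2 * (1 + r t)) * sqrt (2 * (1 - r t))"
      using v sigma_pos t by (intro mult_mono) auto
  qed
  also have "\<dots> = 512 * h\<^sup>2 * \<kappa> t / (\<sigma> * t)" by simp
  finally show ?thesis .
qed

text \<open>The 48 comes from the 12 lags below the range of \<open>pair_prob\<close>, each costing
  2 \<sigma> h, and the 1024 from the factor 512 there; both are doubled because a lag has two
  signs. The mesh does not enter.\<close>

definition B\<^sub>0 :: real where "B\<^sub>0 = 48 + 1024 * geman_const / \<sigma>"

lemma geman_const_nonneg: "geman_const \<ge> 0"
  unfolding geman_const_def by (intro Bochner_Integration.integral_nonneg) auto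

lemma B0_pos: "B\<^sub>0 > 0" using geman_const_nonneg sigma_pos by (simp add: B\<^sub>0_def add_pos_nonneg)

lemma crossings_meas[measurable]: "(\<lambda>\<omega>. crossings (\<lambda>t. f t \<omega>) a h m) \<in> borel_measurable M"
  unfolding crossings_def by measurable

lemma crossings_le: "crossings g a h m \<le> real m"
proof -
  have "card {j. j < m \<and> g (a + real j * h) * g (a + real (Suc j) * h) < 0} \<le> card {..<m}"
    by (intro card_mono) auto
  then show ?thesis unfolding crossings_card by simp
qed

lemma crossings_integrable: "integrable M (\<lambda>\<omega>. (crossings (\<lambda>t. f t \<omega>) a h m)\<^sup>2)"
proof (rule integrable_const_bound[of _ "(real m)\<^sup>2"])
  show "AE \<omega> in M. norm ((crossings (\<lambda>t. f t \<omega>) a h m)\<^sup>2) \<le> (real m)\<^sup>2"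
    using crossings_le crossings_nonneg by (intro AE_I2) (auto intro!: power_mono)
qed measurable

text \<open>The square of the count expands into joint probabilities of pairs of cells. By
  \<open>geman_sum\<close> each cell contributes \<open>h\<close> times a bounded sum over lags, and
  there are \<open>m\<close> cells with \<open>m * h\<close> bounded, so the bound is uniform in the
  mesh.\<close>

lemma crossings_second_moment:
  assumes h: "h > 0" "real m * h \<le> \<delta>\<^sub>0"
  shows "expectation (\<lambda>\<omega>. (crossings (\<lambda>t. f t \<omega>) a h m)\<^sup>2) \<le> B\<^sub>0"
proof (cases "m = 0")
  case True
  then show ?thesis using B0_pos by (simp add: crossings_def)
next
  case False
  have "1 * h \<le> real m * h" using False h by (intro mult_right_mono) auto
  then have hd: "h \<le> \<delta>\<^sub>0" using h by linarith
  \<comment> \<open>Pairs of nearby cells are out of the range of \<open>pair_prob\<close> and are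
    bounded by a single cell; as there are at most 12 such lags, a factor \<open>h\<close> is
    enough.\<close>
  define b where "b d = (if d < 12 then 2 * (\<sigma> * h) else (512 * h / \<sigma>) * (\<kappa> (real d * h) / real d))" for d :: nat
  have b0: "b d \<ge> 0" for d using sigma_pos h kappa_nonneg by (auto simp: b_def)
  define E where "E j = {\<omega>\<in>space M. f (a + real j * h) \<omega> * f (a + real (Suc j) * h) \<omega> < 0}" for j
  have E[measurable]: "E j \<in> events" for j unfolding E_def by measurable
  have e: "a + real (Suc j) * h = a + real j * h + h" for j by (simp add: distrib_right)
  have Pj: "prob (E j) \<le> 2 * (\<sigma> * h)" for j
    using cell_prob[OF h(1) hd, of "a + real j * h"] unfolding E_def e .
  have Pjk: "prob (E j \<inter> E k) \<le> b (k - j)" if jk: "j \<le> k" "k < m" for j k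
  proof (cases "k - j < 12")
    case True
    have "prob (E j \<inter> E k) \<le> prob (E j)" by (intro finite_measure_mono) auto
    then show ?thesis using Pj[of j] True by (simp add: b_def)
  next
    case False
    define d where "d = k - j"
    have d: "12 \<le> d" "d \<le> m" "k = j + d" using False jk by (auto simp: d_def)
    have "12 * h \<le> real d * h" using d h by (intro mult_right_mono) auto
    moreover have "real d * h \<le> real m * h" using d h by (intro mult_right_mono) auto
    ultimately have "prob {\<omega>\<in>space M. f (a + real j * h) \<omega> * f (a + real j * h + h) \<omega> < 0 \<and> f (a + real j * h + real d * h) \<omega> * f (a + real j * h + real d * h + h) \<omega> < 0}
        \<le> 512 * h\<^sup>2 * \<kappa> (real d * h) / (\<sigma> * (real d * h))"
      using h by (intro pair_prob) linarith+
    also have "{\<omega>\<in>space M. f (a + real j * h) \<omega> * f (a + real j * h + h) \<omega> < 0 \<and> f (a + real j * h + real d * h) \<omega> * f (a + real j * h + real d * h + h) \<omega> < 0} = E j \<inter> E k"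
    proof -
      have e2: "a + real (j + d) * h = a + real j * h + real d * h" by (simp add: distrib_right)
      show ?thesis unfolding E_def e d(3) e2 by auto
    qed
    also have "512 * h\<^sup>2 * \<kappa> (real d * h) / (\<sigma> * (real d * h)) = b d"
      using d h sigma_pos by (simp add: b_def power2_eq_square)
    finally show ?thesis by (simp add: d_def)
  qed
  have Pjk': "prob (E j \<inter> E k) \<le> b (nat \<bar>int j - int k\<bar>)" if "j < m" "k < m" for j k
  proof (cases "j \<le> k")
    case True
    then have "nat \<bar>int j - int k\<bar> = k - j" by arith
    then show ?thesis using Pjk[OF True that(2)] by (simp only:)
  next
    case False
    then have "nat \<bar>int j - int k\<bar> = j - k" "k \<le> j" by arith+
    then show ?thesis using Pjk[of k j] that by (simp only: Int_commute)
  qed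
  have "(crossings (\<lambda>t. f t \<omega>) a h m)\<^sup>2 = (\<Sum>j<m. \<Sum>k<m. indicator (E j \<inter> E k) \<omega>)" if "\<omega> \<in> space M" for \<omega>
  proof -
    have "crossings (\<lambda>t. f t \<omega>) a h m = (\<Sum>j<m. indicator (E j) \<omega>)"
      unfolding crossings_def using that by (intro sum.cong) (auto simp: E_def indicator_def)
    then show ?thesis by (simp add: power2_eq_square sum_product indicator_inter_arith)
  qed
  then have "expectation (\<lambda>\<omega>. (crossings (\<lambda>t. f t \<omega>) a h m)\<^sup>2) = expectation (\<lambda>\<omega>. \<Sum>j<m. \<Sum>k<m. indicator (E j \<inter> E k) \<omega>)"
    by (intro Bochner_Integration.integral_cong) auto
  also have "\<dots> = (\<Sum>j<m. \<Sum>k<m. prob (E j \<inter> E k))"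
  proof -
    have i: "integrable M (indicator (E j \<inter> E k) :: 'a \<Rightarrow> real)" for j k
      by (intro integrable_real_indicator) (auto simp: emeasure_eq_measure)
    have "expectation (\<lambda>\<omega>. \<Sum>j<m. \<Sum>k<m. indicator (E j \<inter> E k) \<omega>) = (\<Sum>j<m. expectation (\<lambda>\<omega>. \<Sum>k<m. indicator (E j \<inter> E k) \<omega> :: real))"
      by (intro Bochner_Integration.integral_sum Bochner_Integration.integrable_sum i)
    also have "\<dots> = (\<Sum>j<m. \<Sum>k<m. expectation (indicator (E j \<inter> E k)))"
      by (intro sum.cong refl Bochner_Integration.integral_sum i)
    finally show ?thesis by simp
  qed
  also have "\<dots> \<le> (\<Sum>j<m. \<Sum>k<m. b (nat \<bar>int j - int k\<bar>))"
    using Pjk' by (intro sum_mono) auto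
  also have "\<dots> \<le> (\<Sum>j<m. 2 * (\<Sum>d<m. b d))" using b0 by (intro sum_mono sum_abs_diff_le) auto
  also have "\<dots> = 2 * real m * (\<Sum>d<m. b d)" by simp
  also have "\<dots> \<le> 2 * real m * (24 * (\<sigma> * h) + (512 * h / \<sigma>) * geman_const)"
  proof (rule mult_left_mono)
    have "(\<Sum>d<m. b d) \<le> (\<Sum>d<m. (if d < 12 then 2 * (\<sigma> * h) else 0) + (if d = 0 then 0 else (512 * h / \<sigma>) * (\<kappa> (real d * h) / real d)))"
      using sigma_pos h kappa_nonneg by (intro sum_mono) (auto simp: b_def)
    also have "\<dots> = (\<Sum>d<m. if d < 12 then 2 * (\<sigma> * h) else 0) + (\<Sum>d<m. if d = 0 then 0 else (512 * h / \<sigma>) * (\<kappa> (real d * h) / real d))"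
      by (rule sum.distrib)
    also have "(\<Sum>d<m. if d < 12 then 2 * (\<sigma> * h) else 0) \<le> (\<Sum>d<(12::nat). 2 * (\<sigma> * h))"
    proof -
      have "(\<Sum>d<m. if d < 12 then 2 * (\<sigma> * h) else 0) = (\<Sum>d\<in>{..<m} \<inter> {d. d < 12}. 2 * (\<sigma> * h))" by (simp add: sum.If_cases)
      also have "\<dots> \<le> (\<Sum>d<(12::nat). 2 * (\<sigma> * h))" using sigma_pos h by (intro sum_mono2) auto
      finally show ?thesis .
    qed
    also have "(\<Sum>d<m. if d = 0 then 0 else (512 * h / \<sigma>) * (\<kappa> (real d * h) / real d)) \<le> (512 * h / \<sigma>) * geman_const"
    proof -
      have "(\<Sum>d<m. if d = 0 then 0 else (512 * h / \<sigma>) * (\<kappa> (real d * h) / real d)) = (\<Sum>d\<in>{1..<m}. (512 * h / \<sigma>) * (\<kappa> (real d * h) / real d))"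
        by (rule sum.mono_neutral_cong_right) auto
      also have "\<dots> \<le> (\<Sum>d=1..m. (512 * h / \<sigma>) * (\<kappa> (real d * h) / real d))"
        using sigma_pos h kappa_nonneg by (intro sum_mono2) auto
      also have "\<dots> = (512 * h / \<sigma>) * (\<Sum>d=1..m. \<kappa> (real d * h) / real d)" by (simp only: sum_distrib_left)
      also have "\<dots> \<le> (512 * h / \<sigma>) * geman_const"
        using sigma_pos h delta0(2) by (intro mult_left_mono geman_sum) auto
      finally show ?thesis .
    qed
    finally show "(\<Sum>d<m. b d) \<le> 24 * (\<sigma> * h) + (512 * h / \<sigma>) * geman_const" by simp
  qed simp
  also have "\<dots> = 48 * (\<sigma> * (real m * h)) + 1024 * geman_const / \<sigma> * (real m * h)" by (simp add: algebra_simps)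
  also have "\<dots> \<le> 48 * 1 + 1024 * geman_const / \<sigma> * 1"
  proof (intro add_mono mult_left_mono)
    have "\<sigma> * (real m * h) \<le> \<sigma> * \<delta>\<^sub>0" using h sigma_pos by (intro mult_left_mono) auto
    then show "\<sigma> * (real m * h) \<le> 1" using delta0(3) by linarith
    show "real m * h \<le> 1" using h delta0(2) by linarith
    show "0 \<le> 1024 * geman_const / \<sigma>" using geman_const_nonneg sigma_pos by simp
  qed auto
  finally show ?thesis by (simp add: B\<^sub>0_def)
qed

text \<open>A long window is cut into \<open>K\<close> blocks of admissible length, and
  Cauchy--Schwarz turns the bound for one block into quadratic growth.\<close>

lemma crossings_blocks_second_moment:
  assumes h: "h > 0" "real m * h \<le> \<delta>\<^sub>0"
  shows "expectation (\<lambda>\<omega>. (crossings (\<lambda>t. f t \<omega>) a h (K * m))\<^sup>2) \<le> (real K)\<^sup>2 * B\<^sub>0"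
proof -
  let ?c = "\<lambda>i \<omega>. crossings (\<lambda>t. f t \<omega>) (a + real (i * m) * h) h m"
  have "expectation (\<lambda>\<omega>. (crossings (\<lambda>t. f t \<omega>) a h (K * m))\<^sup>2) \<le> expectation (\<lambda>\<omega>. real K * (\<Sum>i<K. (?c i \<omega>)\<^sup>2))"
  proof (rule integral_mono)
    show "integrable M (\<lambda>\<omega>. real K * (\<Sum>i<K. (?c i \<omega>)\<^sup>2))"
      by (intro integrable_mult_right Bochner_Integration.integrable_sum crossings_integrable)
    show "(crossings (\<lambda>t. f t \<omega>) a h (K * m))\<^sup>2 \<le> real K * (\<Sum>i<K. (?c i \<omega>)\<^sup>2)" for \<omega>
      unfolding crossings_blocks by (rule square_sum_le)
  qed (rule crossings_integrable)
  also have "\<dots> = real K * (\<Sum>i<K. expectation (\<lambda>\<omega>. (?c i \<omega>)\<^sup>2))"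
    using crossings_integrable by simp
  also have "\<dots> \<le> real K * (\<Sum>i<K. B\<^sub>0)" using h by (intro mult_left_mono sum_mono crossings_second_moment) auto
  also have "\<dots> = (real K)\<^sup>2 * B\<^sub>0" by (simp add: power2_eq_square)
  finally show ?thesis .
qed

end

section \<open>From grid counts to the number of zeros\<close>

context stat_gauss
begin

lemma r_pos: assumes "0 \<le> t" "t \<le> \<delta>\<^sub>0" shows "r t > 0"
proof -
  have "\<sigma> * t \<le> \<sigma> * \<delta>\<^sub>0" using assms sigma_pos by (intro mult_left_mono) auto
  then have "\<sigma> * t \<le> 1" using delta0(3) by linarith
  then have "(\<sigma> * t)\<^sup>2 \<le> 1\<^sup>2" using assms sigma_pos by (intro power_mono) auto
  then show ?thesis using one_minus_r_le[of t] by (simp add: power_mult_distrib)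
qed

lemma f_nonzero_AE: "AE \<omega> in M. f t \<omega> \<noteq> 0"
proof (rule no_atom_at_zero[OF prob_space_axioms f_meas])
  fix u
  have "(CLINT \<omega>|M. iexp (u * f t \<omega>)) = complex_of_real (exp (- (u\<^sup>2 / 2)))"
    using expectation_iexp[OF G_scale[OF f_lin, of u]] by (simp add: cov_scale_left cov_scale_right cov_f r_at_0 power2_eq_square)
  then show "norm (CLINT \<omega>|M. iexp (u * f t \<omega>)) \<le> exp (- (u\<^sup>2 / 2))" by (simp only: norm_of_real) simp
qed

text \<open>There are countably many exceptional events, one for each grid point and one for each
  dyadic cell and sign; \<open>p\<close> below the basic scale keeps \<open>r\<close> positive over
  each cell, as \<open>no_touch\<close> requires.\<close>

lemma transversal_AE:
  assumes p: "0 < p" "p \<le> \<delta>\<^sub>0"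
  shows "AE \<omega> in M. (\<forall>n j. f (real j * (p / 2^n)) \<omega> \<noteq> 0) \<and>
     (\<forall>n j. \<not> touches (\<lambda>t. f t \<omega>) (real j * (p / 2^n)) (real (Suc j) * (p / 2^n))) \<and>
     (\<forall>n j. \<not> touches (\<lambda>t. - f t \<omega>) (real j * (p / 2^n)) (real (Suc j) * (p / 2^n)))"
proof -
  have nt: "AE \<omega> in M. \<not> touches (\<lambda>t. s * f t \<omega>) (real j * (p / 2^n)) (real (Suc j) * (p / 2^n))" if "s * s = 1" for s and n j :: nat
  proof (rule no_touch[OF _ _ that])
    have e: "real (Suc j) * (p / 2^n) - real j * (p / 2^n) = p / 2^n" by (simp add: field_simps)
    have pn: "0 < p / 2^n" using p by simp
    show "real j * (p / 2^n) < real (Suc j) * (p / 2^n)" using e pn by linarith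
    fix t assume t: "0 \<le> t" "t \<le> real (Suc j) * (p / 2^n) - real j * (p / 2^n)"
    have "p / 2^n \<le> p / 1" using p by (intro divide_left_mono) auto
    then have "t \<le> \<delta>\<^sub>0" using t(2) p(2) unfolding e by linarith
    then show "r t > 0" using r_pos t(1) by blast
  qed
  show ?thesis
    using f_nonzero_AE nt[of 1] nt[of "-1"] by (simp add: AE_all_countable)
qed

lemma zero_count_eq: "zero_count f T \<omega> = real (card {t \<in> {0..T}. f t \<omega> = 0})"
  by (simp add: zero_count_def)

lemma zero_count_meas[measurable]: "zero_count f T \<in> borel_measurable M"
  by (rule zero_count_measurable[OF f_meas paths])

context
  fixes p :: real and K :: nat
  assumes p: "0 < p" "p \<le> \<delta>\<^sub>0"
begin

definition NN :: "nat \<Rightarrow> 'a \<Rightarrow> real" where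
  "NN n \<omega> = crossings (\<lambda>t. f t \<omega>) 0 (p / 2^n) (K * 2^n)"

lemma NN_meas[measurable]: "NN n \<in> borel_measurable M"
  unfolding NN_def[abs_def] by measurable

lemma NN_second_moment: "expectation (\<lambda>\<omega>. (NN n \<omega>)\<^sup>2) \<le> (real K)\<^sup>2 * B\<^sub>0"
  unfolding NN_def using p by (intro crossings_blocks_second_moment) auto

lemma NN_nonneg: "NN n \<omega> \<ge> 0" unfolding NN_def by (rule crossings_nonneg)

text \<open>Infinitely many zeros would make the grid counts eventually exceed every bound, whereas
  by Fatou the liminf of their squares has finite expectation. This has to come first, because an
  infinite zero set would count as 0.\<close>

lemma finite_zeros_AE: "AE \<omega> in M. finite {t \<in> {0..real K * p}. f t \<omega> = 0}"
proof -
  have "(\<integral>\<^sup>+\<omega>. liminf (\<lambda>n. ennreal ((NN n \<omega>)\<^sup>2)) \<partial>M) \<le> liminf (\<lambda>n. \<integral>\<^sup>+\<omega>. ennreal ((NN n \<omega>)\<^sup>2) \<partial>M)"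
    by (rule nn_integral_liminf) measurable
  also have "\<dots> \<le> ennreal ((real K)\<^sup>2 * B\<^sub>0)"
  proof (rule Liminf_le)
    have "(\<integral>\<^sup>+\<omega>. ennreal ((NN n \<omega>)\<^sup>2) \<partial>M) \<le> ennreal ((real K)\<^sup>2 * B\<^sub>0)" for n
      using NN_second_moment[of n] crossings_integrable unfolding NN_def by (subst nn_integral_eq_integral) (auto intro: ennreal_leI)
    then show "\<forall>\<^sub>F n in sequentially. (\<integral>\<^sup>+\<omega>. ennreal ((NN n \<omega>)\<^sup>2) \<partial>M) \<le> ennreal ((real K)\<^sup>2 * B\<^sub>0)" by simp
  qed simp
  also have "\<dots> < \<infinity>" by simp
  finally have "AE \<omega> in M. liminf (\<lambda>n. ennreal ((NN n \<omega>)\<^sup>2)) \<noteq> \<infinity>"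
    by (intro nn_integral_noteq_infinite) auto
  then show ?thesis using transversal_AE[OF p] AE_space
  proof eventually_elim
    case (elim \<omega>)
    show ?case
    proof (rule ccontr)
      assume inf: "infinite {t \<in> {0..real K * p}. f t \<omega> = 0}"
      have "ennreal (real k) \<le> liminf (\<lambda>n. ennreal ((NN n \<omega>)\<^sup>2))" for k :: nat
      proof (rule Liminf_bounded)
        obtain A where A: "finite A" "card A = k" "A \<subseteq> {t \<in> {0..real K * p}. f t \<omega> = 0}"
          using infinite_arbitrarily_large[OF inf] by blast
        have "\<exists>n0. \<forall>n\<ge>n0. real (card A) \<le> crossings (\<lambda>t. f t \<omega>) 0 (p / 2^n) (K * 2^n)"
          by (rule card_zeros_le_crossings[OF paths[OF elim(3)] p(1)]) (use elim(2) A in auto)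
        then obtain n0 where n0: "\<And>n. n \<ge> n0 \<Longrightarrow> real k \<le> NN n \<omega>" unfolding NN_def A(2) by blast
        show "\<forall>\<^sub>F n in sequentially. ennreal (real k) \<le> ennreal ((NN n \<omega>)\<^sup>2)"
          unfolding eventually_sequentially
        proof (intro exI[of _ n0] allI impI ennreal_leI)
          fix n assume "n0 \<le> n"
          then have "real k \<le> NN n \<omega>" by (rule n0)
          then have "(real k)\<^sup>2 \<le> (NN n \<omega>)\<^sup>2" by (intro power_mono) auto
          moreover have "real k \<le> (real k)\<^sup>2" by (cases k) (auto simp: power2_eq_square)
          ultimately show "real k \<le> (NN n \<omega>)\<^sup>2" by linarith
        qed
      qed
      note unbounded = this
      have "liminf (\<lambda>n. ennreal ((NN n \<omega>)\<^sup>2)) = \<infinity>"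
      proof (cases "liminf (\<lambda>n. ennreal ((NN n \<omega>)\<^sup>2))")
        case (real y)
        obtain k :: nat where "y < real k" using reals_Archimedean2 by blast
        then show ?thesis using unbounded[of k] real by (simp add: ennreal_le_iff)
      qed simp
      then show False using elim(1) by simp
    qed
  qed
qed

text \<open>With finitely many zeros the upper and the lower comparison meet, so the grid counts are
  eventually equal to the number of zeros.\<close>

lemma NN_convergence: "AE \<omega> in M. (\<forall>n. NN n \<omega> \<le> zero_count f (real K * p) \<omega>) \<and> (\<lambda>n. NN n \<omega>) \<longlonglongrightarrow> zero_count f (real K * p) \<omega>"
  using finite_zeros_AE transversal_AE[OF p] AE_space
proof eventually_elim
  case (elim \<omega>)
  have le: "NN n \<omega> \<le> zero_count f (real K * p) \<omega>" for n
    using crossings_le_card_zeros[OF paths[OF elim(3)], of "p / 2^n" 0 "K * 2^n"] elim(1) p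
    by (simp add: NN_def zero_count_eq)
  have "\<exists>n0. \<forall>n\<ge>n0. real (card {t \<in> {0..real K * p}. f t \<omega> = 0}) \<le> crossings (\<lambda>t. f t \<omega>) 0 (p / 2^n) (K * 2^n)"
    by (rule card_zeros_le_crossings[OF paths[OF elim(3)] p(1)]) (use elim(1,2) in auto)
  then obtain n0 where "\<And>n. n \<ge> n0 \<Longrightarrow> zero_count f (real K * p) \<omega> \<le> NN n \<omega>"
    unfolding NN_def zero_count_eq by blast
  then have "\<forall>\<^sub>F n in sequentially. NN n \<omega> = zero_count f (real K * p) \<omega>"
    unfolding eventually_sequentially using le by (intro exI[of _ n0]) (auto intro: antisym)
  then show ?case using le by (auto intro: tendsto_eventually)
qed

lemma zero_count_second_moment:
  "integrable M (\<lambda>\<omega>. (zero_count f (real K * p) \<omega>)\<^sup>2)" "expectation (\<lambda>\<omega>. (zero_count f (real K * p) \<omega>)\<^sup>2) \<le> (real K)\<^sup>2 * B\<^sub>0"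
proof -
  have "(\<integral>\<^sup>+\<omega>. ennreal ((zero_count f (real K * p) \<omega>)\<^sup>2) \<partial>M) = (\<integral>\<^sup>+\<omega>. liminf (\<lambda>n. ennreal ((NN n \<omega>)\<^sup>2)) \<partial>M)"
  proof (rule nn_integral_cong_AE)
    show "AE \<omega> in M. ennreal ((zero_count f (real K * p) \<omega>)\<^sup>2) = liminf (\<lambda>n. ennreal ((NN n \<omega>)\<^sup>2))"
      using NN_convergence
    proof eventually_elim
      case (elim \<omega>)
      then have "(\<lambda>n. ennreal ((NN n \<omega>)\<^sup>2)) \<longlonglongrightarrow> ennreal ((zero_count f (real K * p) \<omega>)\<^sup>2)"
        by (intro tendsto_ennrealI tendsto_power) auto
      from lim_imp_Liminf[OF _ this] show ?case by simp
    qed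
  qed
  also have "\<dots> \<le> liminf (\<lambda>n. \<integral>\<^sup>+\<omega>. ennreal ((NN n \<omega>)\<^sup>2) \<partial>M)"
    by (rule nn_integral_liminf) measurable
  also have "\<dots> \<le> ennreal ((real K)\<^sup>2 * B\<^sub>0)"
  proof (rule Liminf_le)
    have "(\<integral>\<^sup>+\<omega>. ennreal ((NN n \<omega>)\<^sup>2) \<partial>M) \<le> ennreal ((real K)\<^sup>2 * B\<^sub>0)" for n
      using NN_second_moment[of n] crossings_integrable unfolding NN_def by (subst nn_integral_eq_integral) (auto intro: ennreal_leI)
    then show "\<forall>\<^sub>F n in sequentially. (\<integral>\<^sup>+\<omega>. ennreal ((NN n \<omega>)\<^sup>2) \<partial>M) \<le> ennreal ((real K)\<^sup>2 * B\<^sub>0)" by simp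
  qed simp
  finally have b: "(\<integral>\<^sup>+\<omega>. ennreal ((zero_count f (real K * p) \<omega>)\<^sup>2) \<partial>M) \<le> ennreal ((real K)\<^sup>2 * B\<^sub>0)" .
  show i: "integrable M (\<lambda>\<omega>. (zero_count f (real K * p) \<omega>)\<^sup>2)"
  proof (rule integrableI_bounded)
    show "(\<integral>\<^sup>+\<omega>. ennreal (norm ((zero_count f (real K * p) \<omega>)\<^sup>2)) \<partial>M) < \<infinity>"
      using le_less_trans[OF b ennreal_less_top] by simp
  qed measurable
  have "ennreal (expectation (\<lambda>\<omega>. (zero_count f (real K * p) \<omega>)\<^sup>2)) \<le> ennreal ((real K)\<^sup>2 * B\<^sub>0)"
    using b nn_integral_eq_integral[OF i] by simp
  then show "expectation (\<lambda>\<omega>. (zero_count f (real K * p) \<omega>)\<^sup>2) \<le> (real K)\<^sup>2 * B\<^sub>0"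
    using B0_pos by (subst (asm) ennreal_le_iff) auto
qed

text \<open>Lets estimates between two grids, which involve finitely many values of the process,
  pass to the true count. The squared count dominates, since both grid counts lie between 0 and the
  count.\<close>

lemma NN_L2_diff_limit:
  "(\<lambda>k. expectation (\<lambda>\<omega>. (NN k \<omega> - NN n \<omega>)\<^sup>2)) \<longlonglongrightarrow> expectation (\<lambda>\<omega>. (zero_count f (real K * p) \<omega> - NN n \<omega>)\<^sup>2)"
proof (rule integral_dominated_convergence[where w = "\<lambda>\<omega>. (zero_count f (real K * p) \<omega>)\<^sup>2"])
  show "integrable M (\<lambda>\<omega>. (zero_count f (real K * p) \<omega>)\<^sup>2)" by (rule zero_count_second_moment)
  show "AE \<omega> in M. (\<lambda>k. (NN k \<omega> - NN n \<omega>)\<^sup>2) \<longlonglongrightarrow> (zero_count f (real K * p) \<omega> - NN n \<omega>)\<^sup>2"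
    using NN_convergence by eventually_elim (auto intro!: tendsto_intros)
  show "AE \<omega> in M. norm ((NN k \<omega> - NN n \<omega>)\<^sup>2) \<le> (zero_count f (real K * p) \<omega>)\<^sup>2" for k
    using NN_convergence
  proof eventually_elim
    case (elim \<omega>)
    have "\<bar>NN k \<omega> - NN n \<omega>\<bar> \<le> zero_count f (real K * p) \<omega>"
      using elim NN_nonneg[of k \<omega>] NN_nonneg[of n \<omega>] by (smt (verit))
    then have "\<bar>NN k \<omega> - NN n \<omega>\<bar>\<^sup>2 \<le> (zero_count f (real K * p) \<omega>)\<^sup>2" by (intro power_mono) auto
    then show ?case by simp
  qed
qed measurable

lemma NN_L2_limit: "(\<lambda>n. expectation (\<lambda>\<omega>. (zero_count f (real K * p) \<omega> - NN n \<omega>)\<^sup>2)) \<longlonglongrightarrow> 0"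
proof -
  have "(\<lambda>n. expectation (\<lambda>\<omega>. (zero_count f (real K * p) \<omega> - NN n \<omega>)\<^sup>2)) \<longlonglongrightarrow> expectation (\<lambda>\<omega>. 0)"
  proof (rule integral_dominated_convergence[where w = "\<lambda>\<omega>. (zero_count f (real K * p) \<omega>)\<^sup>2"])
    show "integrable M (\<lambda>\<omega>. (zero_count f (real K * p) \<omega>)\<^sup>2)" by (rule zero_count_second_moment)
    show "AE \<omega> in M. (\<lambda>n. (zero_count f (real K * p) \<omega> - NN n \<omega>)\<^sup>2) \<longlonglongrightarrow> 0"
      using NN_convergence
    proof eventually_elim
      case (elim \<omega>)
      then have "(\<lambda>n. (zero_count f (real K * p) \<omega> - NN n \<omega>)\<^sup>2) \<longlonglongrightarrow> (zero_count f (real K * p) \<omega> - zero_count f (real K * p) \<omega>)\<^sup>2"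
        by (intro tendsto_intros) auto
      then show ?case by simp
    qed
    show "AE \<omega> in M. norm ((zero_count f (real K * p) \<omega> - NN n \<omega>)\<^sup>2) \<le> (zero_count f (real K * p) \<omega>)\<^sup>2" for n
      using NN_convergence
    proof eventually_elim
      case (elim \<omega>)
      have "\<bar>zero_count f (real K * p) \<omega> - NN n \<omega>\<bar> \<le> zero_count f (real K * p) \<omega>"
        using elim NN_nonneg[of n \<omega>] by (smt (verit))
      then have "\<bar>zero_count f (real K * p) \<omega> - NN n \<omega>\<bar>\<^sup>2 \<le> (zero_count f (real K * p) \<omega>)\<^sup>2" by (intro power_mono) auto
      then show ?case by simp
    qed
  qed measurable
  then show ?thesis by simp
qed

end

text \<open>A shift multiplies the spectral sum by a factor of modulus 1, hence the variances of all
  linear combinations are kept.\<close>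

lemma stationary_law:
  "distr M (PiM {..m} (\<lambda>_. borel)) (\<lambda>\<omega>. \<lambda>j\<in>{..m}. f (a + real j * h) \<omega>) =
   distr M (PiM {..m} (\<lambda>_. borel)) (\<lambda>\<omega>. \<lambda>j\<in>{..m::nat}. f (real j * h) \<omega>)"
proof (rule multivariate_char_unique[OF prob_space_axioms prob_space_axioms])
  fix c :: "nat \<Rightarrow> real"
  have "(cmod (\<Sum>j\<le>m. c j * iexp (l * (a + real j * h)))) = (cmod (\<Sum>j\<le>m. c j * iexp (l * (real j * h))))" for l
  proof -
    have "(\<Sum>j\<le>m. c j * iexp (l * (a + real j * h))) = iexp (l * a) * (\<Sum>j\<le>m. c j * iexp (l * (real j * h)))"
      by (simp add: sum_distrib_left distrib_left exp_add mult_ac)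
    then show ?thesis by (simp only: norm_mult norm_exp_i_times mult_1_left)
  qed
  then have "cov (\<lambda>\<omega>. \<Sum>j\<le>m. c j * f (a + real j * h) \<omega>) (\<lambda>\<omega>. \<Sum>j\<le>m. c j * f (a + real j * h) \<omega>) =
     cov (\<lambda>\<omega>. \<Sum>j\<le>m. c j * f (real j * h) \<omega>) (\<lambda>\<omega>. \<Sum>j\<le>m. c j * f (real j * h) \<omega>)"
    by (simp add: cov_sum_sum[of "{..m}" c "\<lambda>j. a + real j * h"] cov_sum_sum[of "{..m}" c "\<lambda>j. real j * h"])
  then show "(CLINT \<omega>|M. iexp (\<Sum>j\<le>m. c j * f (a + real j * h) \<omega>)) = (CLINT \<omega>|M. iexp (\<Sum>j\<le>m. c j * f (real j * h) \<omega>))"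
    using expectation_iexp[OF sum_lin[of "{..m}" c "\<lambda>j. a + real j * h"]] expectation_iexp[OF sum_lin[of "{..m}" c "\<lambda>j. real j * h"]] by simp
qed auto

text \<open>The coarse grid has mesh \<open>real D * h\<close>, so both counts are functions of the
  same finite family of values, and stationarity enters through finite-dimensional laws.\<close>

lemma stationary_crossings_diff:
  "expectation (\<lambda>\<omega>. (crossings (\<lambda>t. f t \<omega>) a h (m * D) - crossings (\<lambda>t. f t \<omega>) a (real D * h) m)\<^sup>2) =
   expectation (\<lambda>\<omega>. (crossings (\<lambda>t. f t \<omega>) 0 h (m * D) - crossings (\<lambda>t. f t \<omega>) 0 (real D * h) m)\<^sup>2)"
proof -
  define G where "G = (\<lambda>x :: nat \<Rightarrow> real. ((\<Sum>j<m * D. of_bool (x j * x (Suc j) < 0)) - (\<Sum>j<m. of_bool (x (j * D) * x (Suc j * D) < 0)) :: real)\<^sup>2)"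
  have b: "j * D \<le> m * D" "Suc j * D \<le> m * D" if "j < m" for j
    using that by (auto intro!: mult_le_mono1 simp del: mult_Suc)
  have comp: "(\<lambda>x. x j) \<in> borel_measurable (PiM {..m * D} (\<lambda>_. borel :: real measure))" if "j \<le> m * D" for j
    using that by (intro measurable_component_singleton) auto
  have s1: "(\<lambda>x. of_bool (x j * x (Suc j) < 0) :: real) \<in> borel_measurable (PiM {..m * D} (\<lambda>_. borel :: real measure))" if "j < m * D" for j
  proof -
    have [measurable]: "(\<lambda>x. x j) \<in> borel_measurable (PiM {..m * D} (\<lambda>_. borel :: real measure))"
      "(\<lambda>x. x (Suc j)) \<in> borel_measurable (PiM {..m * D} (\<lambda>_. borel :: real measure))" using that by (auto intro!: comp)
    show ?thesis by measurable
  qed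
  have s2: "(\<lambda>x. of_bool (x (j * D) * x (Suc j * D) < 0) :: real) \<in> borel_measurable (PiM {..m * D} (\<lambda>_. borel :: real measure))" if "j < m" for j
  proof -
    have [measurable]: "(\<lambda>x. x (j * D)) \<in> borel_measurable (PiM {..m * D} (\<lambda>_. borel :: real measure))"
      "(\<lambda>x. x (Suc j * D)) \<in> borel_measurable (PiM {..m * D} (\<lambda>_. borel :: real measure))" using b[OF that] by (auto intro!: comp simp del: mult_Suc)
    show ?thesis by measurable
  qed
  have Gm: "G \<in> borel_measurable (PiM {..m * D} (\<lambda>_. borel))"
    unfolding G_def by (intro borel_measurable_power borel_measurable_diff borel_measurable_sum s1 s2) auto
  have e: "(crossings (\<lambda>t. f t \<omega>) a h (m * D) - crossings (\<lambda>t. f t \<omega>) a (real D * h) m)\<^sup>2 = G (\<lambda>j\<in>{..m * D}. f (a + real j * h) \<omega>)" for a \<omega>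
  proof -
    have "(\<Sum>j<m. of_bool (f (a + real j * (real D * h)) \<omega> * f (a + real (Suc j) * (real D * h)) \<omega> < 0)) =
       (\<Sum>j<m. of_bool ((\<lambda>j\<in>{..m * D}. f (a + real j * h) \<omega>) (j * D) * (\<lambda>j\<in>{..m * D}. f (a + real j * h) \<omega>) (Suc j * D) < 0) :: real)"
      by (intro sum.cong refl) (use b in \<open>simp add: mult.assoc del: mult_Suc of_nat_Suc\<close>)
    then show ?thesis unfolding G_def crossings_def by (simp del: mult_Suc of_nat_Suc)
  qed
  have rm: "(\<lambda>\<omega>. \<lambda>j\<in>{..m * D}. f (a + real j * h) \<omega>) \<in> measurable M (PiM {..m * D} (\<lambda>_. borel))" for a
    by (intro measurable_restrict) auto
  have "expectation (\<lambda>\<omega>. G (\<lambda>j\<in>{..m * D}. f (a + real j * h) \<omega>)) = expectation (\<lambda>\<omega>. G (\<lambda>j\<in>{..m * D}. f (0 + real j * h) \<omega>))"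
    using arg_cong[OF stationary_law[of "m * D" a h], of "\<lambda>N. integral\<^sup>L N G"]
    by (simp only: integral_distr[OF rm Gm] integral_distr[OF rm[of 0, unfolded add_0_left] Gm] add_0_left)
  then show ?thesis unfolding e .
qed

text \<open>Stationarity and Cauchy--Schwarz make the discretisation error grow at most like \<open>K\<^sup>2\<close>, uniformly in \<open>K\<close>.\<close>
lemma NN_L2_uniform:
  assumes p: "0 < p" "p \<le> \<delta>\<^sub>0"
  shows "expectation (\<lambda>\<omega>. (zero_count f (real K * p) \<omega> - NN p K n \<omega>)\<^sup>2) \<le> 
    (real K)\<^sup>2 * expectation (\<lambda>\<omega>. (zero_count f p \<omega> - NN p 1 n \<omega>)\<^sup>2)"
proof (rule LIMSEQ_le[OF NN_L2_diff_limit[OF p]])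
  show "(\<lambda>k. (real K)\<^sup>2 * expectation (\<lambda>\<omega>. (NN p 1 k \<omega> - NN p 1 n \<omega>)\<^sup>2)) \<longlonglongrightarrow>
     (real K)\<^sup>2 * expectation (\<lambda>\<omega>. (zero_count f p \<omega> - NN p 1 n \<omega>)\<^sup>2)"
    using NN_L2_diff_limit[OF p, of 1 n] by (intro tendsto_mult_left) simp
  show "\<exists>k0. \<forall>k\<ge>k0. expectation (\<lambda>\<omega>. (NN p K k \<omega> - NN p K n \<omega>)\<^sup>2) \<le> (real K)\<^sup>2 * expectation (\<lambda>\<omega>. (NN p 1 k \<omega> - NN p 1 n \<omega>)\<^sup>2)"
  proof (intro exI[of _ n] allI impI)
    fix k assume k: "n \<le> k"
    define D where "D = (2::nat)^(k - n)"
    have D: "(2::nat)^k = 2^n * D" "p / 2^n = real D * (p / 2^k)" 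
      using k by (auto simp: D_def field_simps simp flip: power_add)
    let ?d = "\<lambda>a \<omega>. crossings (\<lambda>t. f t \<omega>) a (p / 2^k) (2^k) - crossings (\<lambda>t. f t \<omega>) a (p / 2^n) (2^n)"
    have st: "expectation (\<lambda>\<omega>. (?d a \<omega>)\<^sup>2) = expectation (\<lambda>\<omega>. (?d 0 \<omega>)\<^sup>2)" for a
      unfolding D using stationary_crossings_diff[of a "p / 2^k" "2^n" D] by simp
    have di: "integrable M (\<lambda>\<omega>. (?d a \<omega>)\<^sup>2)" for a
    proof (rule integrable_const_bound[of _ "(2^k + 2^n)\<^sup>2"])
      have "\<bar>?d a \<omega>\<bar> \<le> 2^k + 2^n" for \<omega>
        using crossings_le[of "\<lambda>t. f t \<omega>" a "p / 2^k" "2^k"] crossings_le[of "\<lambda>t. f t \<omega>" a "p / 2^n" "2^n"]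
          crossings_nonneg[of "\<lambda>t. f t \<omega>" a "p / 2^k" "2^k"] crossings_nonneg[of "\<lambda>t. f t \<omega>" a "p / 2^n" "2^n"]
        by (simp add: abs_le_iff)
      then have "\<bar>?d a \<omega>\<bar>\<^sup>2 \<le> (2^k + 2^n)\<^sup>2" for \<omega> by (intro power_mono) auto
      then show "AE \<omega> in M. norm ((?d a \<omega>)\<^sup>2) \<le> (2^k + 2^n)\<^sup>2" by simp
    qed measurable
    have e: "NN p K k \<omega> - NN p K n \<omega> = (\<Sum>i<K. ?d (real i * p) \<omega>)" for \<omega>
      unfolding NN_def[OF p] crossings_blocks by (simp add: sum_subtractf)
    have "expectation (\<lambda>\<omega>. (NN p K k \<omega> - NN p K n \<omega>)\<^sup>2) \<le> expectation (\<lambda>\<omega>. real K * (\<Sum>i<K. (?d (real i * p) \<omega>)\<^sup>2))"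
    proof (rule integral_mono')
      show "integrable M (\<lambda>\<omega>. real K * (\<Sum>i<K. (?d (real i * p) \<omega>)\<^sup>2))"
        by (intro integrable_mult_right Bochner_Integration.integrable_sum di)
      show "(NN p K k \<omega> - NN p K n \<omega>)\<^sup>2 \<le> real K * (\<Sum>i<K. (?d (real i * p) \<omega>)\<^sup>2)" for \<omega>
        unfolding e by (rule square_sum_le)
    qed (intro mult_nonneg_nonneg sum_nonneg, auto)
    also have "\<dots> = real K * (\<Sum>i<K. expectation (\<lambda>\<omega>. (?d (real i * p) \<omega>)\<^sup>2))"
      by (simp only: integral_mult_right_zero Bochner_Integration.integral_sum[OF di])
    also have "\<dots> = (real K)\<^sup>2 * expectation (\<lambda>\<omega>. (?d 0 \<omega>)\<^sup>2)"
    proof -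
      have "(\<Sum>i<K. expectation (\<lambda>\<omega>. (?d (real i * p) \<omega>)\<^sup>2)) = (\<Sum>i<K. expectation (\<lambda>\<omega>. (?d 0 \<omega>)\<^sup>2))"
        by (intro sum.cong refl st)
      then show ?thesis by (simp only: sum_constant card_lessThan) (simp only: power2_eq_square mult.assoc)
    qed
    also have "(\<lambda>\<omega>. (?d 0 \<omega>)\<^sup>2) = (\<lambda>\<omega>. (NN p 1 k \<omega> - NN p 1 n \<omega>)\<^sup>2)"
      unfolding NN_def[OF p] by simp
    finally show "expectation (\<lambda>\<omega>. (NN p K k \<omega> - NN p K n \<omega>)\<^sup>2) \<le> (real K)\<^sup>2 * expectation (\<lambda>\<omega>. (NN p 1 k \<omega> - NN p 1 n \<omega>)\<^sup>2)" .
  qed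
qed

end

section \<open>The weighted Kac--Rice formula\<close>

lemma abs_exp_diff_le:
  fixes x y m :: real
  assumes "x \<le> m" "y \<le> m" shows "\<bar>exp x - exp y\<bar> \<le> exp m * \<bar>x - y\<bar>"
proof -
  have *: "exp a - exp b \<le> exp m * (a - b)" if "b \<le> a" "a \<le> m" for a b :: real
  proof -
    have "exp a - exp b = exp a * (1 - exp (b - a))" by (simp add: right_diff_distrib flip: exp_add)
    also have "\<dots> \<le> exp a * (a - b)"
    proof (rule mult_left_mono)
      show "1 - exp (b - a) \<le> a - b" using exp_ge_add_one_self[of "b - a"] by linarith
    qed simp
    also have "\<dots> \<le> exp m * (a - b)" using that by (intro mult_right_mono) auto
    finally show ?thesis .
  qed
  show ?thesis
  proof (cases "x \<le> y")
    case True
    then have "exp x \<le> exp y" by simp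
    then show ?thesis using *[of x y] True assms by simp
  next
    case False
    then have "exp y \<le> exp x" by simp
    then show ?thesis using *[of y x] False assms by simp
  qed
qed

lemma abs_div_add_mult_le:
  fixes x y k :: real
  assumes "\<bar>x\<bar> \<le> X" "0 < d\<^sub>0" "d\<^sub>0 \<le> d" "\<bar>y\<bar> \<le> Y"
  shows "\<bar>x / d + y * k\<bar> \<le> X / d\<^sub>0 + Y * \<bar>k\<bar>"
proof -
  have "\<bar>x / d\<bar> \<le> X / d\<^sub>0"
    unfolding abs_divide using assms by (intro frac_le) auto
  moreover have "\<bar>y * k\<bar> \<le> Y * \<bar>k\<bar>" unfolding abs_mult using assms(4) by (intro mult_right_mono) auto
  ultimately show ?thesis using abs_triangle_ineq[of "x / d" "y * k"] by linarith
qed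

lemma sqrt_2_div_pi_le_1: "sqrt (2/pi) \<le> 1" using pi_gt3 by simp

lemma abs_ell_le: "\<bar>ell b\<bar> \<le> 1"
proof -
  have "norm (LINT y|N1. \<bar>y\<bar> * cos (b * y)) \<le> (LINT y|N1. \<bar>y\<bar>)"
    by (rule norm_integral_le) (use N1_abs_moment[of 1] in \<open>auto simp: abs_mult intro!: mult_left_le\<close>)
  then have "\<bar>ell b\<bar> \<le> sqrt (2/pi)" unfolding ell_def N1_abs_moments(1) by simp
  then show ?thesis using sqrt_2_div_pi_le_1 by linarith
qed

lemma ell_lipschitz: "\<bar>ell b - ell c\<bar> \<le> \<bar>b - c\<bar>"
proof -
  have "ell b - ell c = (LINT y|N1. \<bar>y\<bar> * cos (b * y) - \<bar>y\<bar> * cos (c * y))"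
    unfolding ell_def using integrable_abs_cos by simp
  also have "norm \<dots> \<le> (LINT y|N1. y\<^sup>2 * \<bar>b - c\<bar>)"
  proof (rule norm_integral_le)
    show "integrable N1 (\<lambda>y. y\<^sup>2 * \<bar>b - c\<bar>)" using N1_moment_2(1) by (rule integrable_mult_left)
    fix y :: real
    have "norm (\<bar>y\<bar> * cos (b * y) - \<bar>y\<bar> * cos (c * y)) = \<bar>y\<bar> * \<bar>cos (b * y) - cos (c * y)\<bar>"
      by (simp add: right_diff_distrib[symmetric] abs_mult)
    also have "\<dots> \<le> \<bar>y\<bar> * \<bar>b * y - c * y\<bar>" by (intro mult_left_mono abs_cos_diff_le) auto
    also have "\<dots> = y\<^sup>2 * \<bar>b - c\<bar>" by (simp add: left_diff_distrib[symmetric] abs_mult power2_eq_square)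
    finally show "norm (\<bar>y\<bar> * cos (b * y) - \<bar>y\<bar> * cos (c * y)) \<le> y\<^sup>2 * \<bar>b - c\<bar>" .
  qed measurable
  also have "\<dots> = \<bar>b - c\<bar>" unfolding integral_mult_left_zero N1_moment_2(2) by simp
  finally show ?thesis by simp
qed

text \<open>Conditioning on a zero at time s lowers the variance of the functional by a^2, with a
  its covariance with f(s). Splitting off the normalised derivative, with covariance b, lowers it by
  b^2 and leaves the factor \<open>ell b\<close>. The last factor normalises the value at (0, 0) to
  1.\<close>

definition kr_density :: "real \<Rightarrow> real \<Rightarrow> real" where
  "kr_density a b = exp ((a\<^sup>2 + b\<^sup>2) / 2) * ell b * sqrt (pi/2)"

lemma kr_density_lipschitz:
  assumes "\<bar>a\<bar> \<le> C" "\<bar>b\<bar> \<le> C" "\<bar>a'\<bar> \<le> C" "\<bar>b'\<bar> \<le> C"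
  shows "\<bar>kr_density a b - kr_density a' b'\<bar> \<le> 2 * exp (C\<^sup>2) * (C + 1) * (\<bar>a - a'\<bar> + \<bar>b - b'\<bar>)"
proof -
  have C: "C \<ge> 0" using assms(1) by linarith
  have sq: "x\<^sup>2 \<le> C\<^sup>2" if "\<bar>x\<bar> \<le> C" for x using power_mono[OF that, of 2] by simp
  have d: "\<bar>x\<^sup>2 - y\<^sup>2\<bar> \<le> 2 * C * \<bar>x - y\<bar>" if "\<bar>x\<bar> \<le> C" "\<bar>y\<bar> \<le> C" for x y
  proof -
    have "\<bar>x\<^sup>2 - y\<^sup>2\<bar> = \<bar>x + y\<bar> * \<bar>x - y\<bar>" by (simp add: power2_eq_square abs_mult[symmetric] algebra_simps)
    also have "\<dots> \<le> (2 * C) * \<bar>x - y\<bar>" using that by (intro mult_right_mono) auto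
    finally show ?thesis by simp
  qed
  define E E' where "E = exp ((a\<^sup>2 + b\<^sup>2) / 2)" and "E' = exp ((a'\<^sup>2 + b'\<^sup>2) / 2)"
  have b1: "(a\<^sup>2 + b\<^sup>2) / 2 \<le> C\<^sup>2" "(a'\<^sup>2 + b'\<^sup>2) / 2 \<le> C\<^sup>2" using sq[OF assms(1)] sq[OF assms(2)] sq[OF assms(3)] sq[OF assms(4)] by simp_all
  have "\<bar>E - E'\<bar> \<le> exp (C\<^sup>2) * \<bar>(a\<^sup>2 + b\<^sup>2) / 2 - (a'\<^sup>2 + b'\<^sup>2) / 2\<bar>"
    unfolding E_def E'_def by (rule abs_exp_diff_le[OF b1])
  also have "\<bar>(a\<^sup>2 + b\<^sup>2) / 2 - (a'\<^sup>2 + b'\<^sup>2) / 2\<bar> \<le> C * (\<bar>a - a'\<bar> + \<bar>b - b'\<bar>)"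
  proof -
    have "\<bar>(a\<^sup>2 + b\<^sup>2) / 2 - (a'\<^sup>2 + b'\<^sup>2) / 2\<bar> = \<bar>(a\<^sup>2 - a'\<^sup>2) + (b\<^sup>2 - b'\<^sup>2)\<bar> / 2" by (simp add: abs_if field_simps)
    also have "\<dots> \<le> (\<bar>a\<^sup>2 - a'\<^sup>2\<bar> + \<bar>b\<^sup>2 - b'\<^sup>2\<bar>) / 2" by (intro divide_right_mono abs_triangle_ineq) simp
    also have "\<dots> \<le> (2 * C * \<bar>a - a'\<bar> + 2 * C * \<bar>b - b'\<bar>) / 2"
      using d[OF assms(1,3)] d[OF assms(2,4)] by (intro divide_right_mono add_mono) auto
    also have "\<dots> = C * (\<bar>a - a'\<bar> + \<bar>b - b'\<bar>)" by (simp add: distrib_left add_divide_distrib)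
    finally show ?thesis .
  qed
  finally have EE: "\<bar>E - E'\<bar> \<le> exp (C\<^sup>2) * (C * (\<bar>a - a'\<bar> + \<bar>b - b'\<bar>))" by simp
  have E': "0 \<le> E'" "E' \<le> exp (C\<^sup>2)" using b1(2) by (auto simp: E'_def)
  have "E * ell b - E' * ell b' = (E - E') * ell b + E' * (ell b - ell b')" by (simp add: algebra_simps)
  also have "\<bar>\<dots>\<bar> \<le> \<bar>E - E'\<bar> * \<bar>ell b\<bar> + E' * \<bar>ell b - ell b'\<bar>"
    using E'(1) abs_triangle_ineq[of "(E - E') * ell b" "E' * (ell b - ell b')"] by (simp add: abs_mult)
  also have "\<dots> \<le> (exp (C\<^sup>2) * (C * (\<bar>a - a'\<bar> + \<bar>b - b'\<bar>))) * 1 + exp (C\<^sup>2) * \<bar>b - b'\<bar>"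
    using EE E' abs_ell_le[of b] ell_lipschitz[of b b'] C by (intro add_mono mult_mono) auto
  also have "\<dots> \<le> exp (C\<^sup>2) * (C * (\<bar>a - a'\<bar> + \<bar>b - b'\<bar>)) + exp (C\<^sup>2) * (\<bar>a - a'\<bar> + \<bar>b - b'\<bar>)" by simp
  also have "\<dots> = exp (C\<^sup>2) * (C + 1) * (\<bar>a - a'\<bar> + \<bar>b - b'\<bar>)" by (simp add: algebra_simps)
  finally have m: "\<bar>E * ell b - E' * ell b'\<bar> \<le> exp (C\<^sup>2) * (C + 1) * (\<bar>a - a'\<bar> + \<bar>b - b'\<bar>)" .
  have s2: "sqrt (pi/2) \<le> 2" "0 \<le> sqrt (pi/2)" using pi_less_4 by (auto intro!: real_le_lsqrt)
  have "kr_density a b - kr_density a' b' = (E * ell b - E' * ell b') * sqrt (pi/2)"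
    by (simp add: kr_density_def E_def E'_def algebra_simps)
  then have "\<bar>kr_density a b - kr_density a' b'\<bar> = \<bar>E * ell b - E' * ell b'\<bar> * sqrt (pi/2)"
    using s2(2) by (simp add: abs_mult)
  also have "\<dots> \<le> (exp (C\<^sup>2) * (C + 1) * (\<bar>a - a'\<bar> + \<bar>b - b'\<bar>)) * 2"
    using m s2 C by (intro mult_mono) auto
  finally show ?thesis by simp
qed

lemma abs_kr_density_le:
  assumes "\<bar>a\<bar> \<le> C" "\<bar>b\<bar> \<le> C" shows "\<bar>kr_density a b\<bar> \<le> 2 * exp (C\<^sup>2)"
proof -
  have sq: "x\<^sup>2 \<le> C\<^sup>2" if "\<bar>x\<bar> \<le> C" for x using power_mono[OF that, of 2] by simp
  have e: "exp ((a\<^sup>2 + b\<^sup>2) / 2) \<le> exp (C\<^sup>2)" using sq[OF assms(1)] sq[OF assms(2)] by simp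
  have s2: "sqrt (pi/2) \<le> 2" "0 \<le> sqrt (pi/2)" using pi_less_4 by (auto intro!: real_le_lsqrt)
  have "\<bar>kr_density a b\<bar> = exp ((a\<^sup>2 + b\<^sup>2) / 2) * \<bar>ell b\<bar> * sqrt (pi/2)"
    using s2 by (simp add: kr_density_def abs_mult)
  also have "\<dots> \<le> exp (C\<^sup>2) * 1 * 2" using e s2 abs_ell_le[of b] by (intro mult_mono) auto
  finally show ?thesis by simp
qed

lemma kr_density_0: "kr_density 0 0 = 1"
proof -
  have "sqrt (2/pi) * sqrt (pi/2) = sqrt ((2/pi) * (pi/2))" by (rule real_sqrt_mult[symmetric])
  then show ?thesis by (simp add: kr_density_def ell_0)
qed

lemma riemann_sum_lipschitz:
  fixes g :: "real \<Rightarrow> real"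
  assumes g: "\<And>s t. \<bar>g s - g t\<bar> \<le> L * \<bar>s - t\<bar>" and L: "L \<ge> 0" and h: "h > 0"
  shows "\<bar>(\<Sum>j<m. h * g (real j * h)) - integral {0..real m * h} g\<bar> \<le> real m * (L * h\<^sup>2)"
proof (induction m)
  case 0 then show ?case by simp
next
  case (Suc m)
  have cont: "continuous_on S g" for S
    by (rule lipschitz_on_continuous_on[of L], rule lipschitz_onI) (use g L in \<open>auto simp: dist_real_def\<close>)
  define x where "x = real m * h"
  have x: "0 \<le> x" "real (Suc m) * h = x + h" using h by (auto simp: x_def distrib_right)
  have "integral {0..x + h} g = integral {0..x} g + integral {x..x + h} g"
    using x h by (intro Henstock_Kurzweil_Integration.integral_combine[symmetric] integrable_continuous_real cont) auto
  moreover have "\<bar>integral {x..x + h} g - h * g x\<bar> \<le> L * h\<^sup>2"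
  proof -
    have "integral {x..x + h} g - h * g x = integral {x..x + h} (\<lambda>s. g s - g x)"
      using h by (subst Henstock_Kurzweil_Integration.integral_diff) (auto intro!: integrable_continuous_real cont)
    also have "norm \<dots> \<le> (L * h) * (x + h - x)"
    proof (rule integral_bound)
      show "continuous_on {x..x + h} (\<lambda>s. g s - g x)" by (intro continuous_intros cont)
      fix s assume s: "s \<in> {x..x + h}"
      have "\<bar>g s - g x\<bar> \<le> L * \<bar>s - x\<bar>" by (rule g)
      also have "\<dots> \<le> L * h" using s L by (intro mult_left_mono) auto
      finally show "norm (g s - g x) \<le> L * h" by simp
    qed (use h in simp)
    finally show ?thesis by (simp add: power2_eq_square)
  qed
  ultimately show ?case using Suc unfolding x(2) by (simp add: x_def[symmetric] distrib_right)
qed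

context stat_gauss
begin

text \<open>The covariance with f(s) of the functional with coefficients \<open>c\<close> at the
  times \<open>t\<close>. Its derivative in s divided by \<sigma> is \<open>\<beta>f\<close>,
  formally the covariance with the normalised derivative of f.\<close>

definition "\<alpha>f I c t s = (\<Sum>i\<in>I. c i * r (s - t i))" for I :: "nat set" and c t :: "nat \<Rightarrow> real"
definition "\<beta>f I c t s = (\<Sum>i\<in>I. c i * r1 (s - t i)) / \<sigma>" for I :: "nat set" and c t :: "nat \<Rightarrow> real"

context
  fixes I :: "nat set" and c t :: "nat \<Rightarrow> real" and C :: real
  assumes fin: "finite I" and C: "(\<Sum>i\<in>I. \<bar>c i\<bar>) \<le> C"
begin

lemma C_nonneg: "0 \<le> C" using order_trans[OF sum_nonneg C] by simp

lemma weighted_sum_le: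
  assumes "\<And>i. i \<in> I \<Longrightarrow> \<bar>g i\<bar> \<le> B" "B \<ge> 0" shows "\<bar>\<Sum>i\<in>I. c i * g i\<bar> \<le> C * B"
proof -
  have "\<bar>\<Sum>i\<in>I. c i * g i\<bar> \<le> (\<Sum>i\<in>I. \<bar>c i * g i\<bar>)" by (rule sum_abs)
  also have "\<dots> \<le> (\<Sum>i\<in>I. \<bar>c i\<bar> * B)" using assms by (intro sum_mono) (auto simp: abs_mult intro!: mult_left_mono)
  also have "\<dots> = (\<Sum>i\<in>I. \<bar>c i\<bar>) * B" by (rule sum_distrib_right[symmetric])
  also have "\<dots> \<le> C * B" using C assms(2) by (rule mult_right_mono)
  finally show ?thesis .
qed

lemma alpha_le: "\<bar>\<alpha>f I c t s\<bar> \<le> C"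
  unfolding \<alpha>f_def using weighted_sum_le[of "\<lambda>i. r (s - t i)" 1] abs_r_le by simp

lemma beta_le: "\<bar>\<beta>f I c t s\<bar> \<le> C"
  unfolding \<beta>f_def using weighted_sum_le[of "\<lambda>i. r1 (s - t i)" \<sigma>] r1_le sigma_pos by (simp add: field_simps)

lemma alpha_lipschitz: "\<bar>\<alpha>f I c t s - \<alpha>f I c t s'\<bar> \<le> C * \<sigma> * \<bar>s - s'\<bar>"
proof -
  have "\<alpha>f I c t s - \<alpha>f I c t s' = (\<Sum>i\<in>I. c i * (r (s - t i) - r (s' - t i)))"
    by (simp add: \<alpha>f_def sum_subtractf right_diff_distrib)
  also have "\<bar>\<dots>\<bar> \<le> C * (\<sigma> * \<bar>s - s'\<bar>)"
  proof (rule weighted_sum_le)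
    show "\<bar>r (s - t i) - r (s' - t i)\<bar> \<le> \<sigma> * \<bar>s - s'\<bar>" for i
      using r_lipschitz[of "s - t i" "s' - t i"] by simp
  qed (use sigma_pos in simp)
  finally show ?thesis by (simp add: mult.assoc)
qed

lemma beta_lipschitz: "\<bar>\<beta>f I c t s - \<beta>f I c t s'\<bar> \<le> C * \<sigma> * \<bar>s - s'\<bar>"
proof -
  have "\<beta>f I c t s - \<beta>f I c t s' = (\<Sum>i\<in>I. c i * (r1 (s - t i) - r1 (s' - t i))) / \<sigma>"
    by (simp add: \<beta>f_def sum_subtractf right_diff_distrib diff_divide_distrib)
  also have "\<bar>\<dots>\<bar> = \<bar>\<Sum>i\<in>I. c i * (r1 (s - t i) - r1 (s' - t i))\<bar> / \<sigma>" using sigma_pos by simp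
  also have "\<dots> \<le> (C * (\<sigma>\<^sup>2 * \<bar>s - s'\<bar>)) / \<sigma>"
  proof (intro divide_right_mono weighted_sum_le)
    show "\<bar>r1 (s - t i) - r1 (s' - t i)\<bar> \<le> \<sigma>\<^sup>2 * \<bar>s - s'\<bar>" for i
      using r1_lipschitz[of "s - t i" "s' - t i"] by simp
  qed (use sigma_pos in simp_all)
  finally show ?thesis using sigma_pos by (simp add: power2_eq_square)
qed

lemma alpha_taylor: "\<bar>\<alpha>f I c t (s + h) - \<alpha>f I c t s - h * \<sigma> * \<beta>f I c t s\<bar> \<le> C * (\<sigma>\<^sup>2 * h\<^sup>2 / 2)"
proof -
  have "\<alpha>f I c t (s + h) - \<alpha>f I c t s - h * \<sigma> * \<beta>f I c t s = (\<Sum>i\<in>I. c i * (r (s - t i + h) - r (s - t i) - h * r1 (s - t i)))"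
  proof -
    have a: "s + h - t i = s - t i + h" for i by simp
    have b: "h * \<sigma> * \<beta>f I c t s = (\<Sum>i\<in>I. c i * (h * r1 (s - t i)))"
      using sigma_pos by (simp add: \<beta>f_def) (simp add: sum_distrib_left mult_ac)
    show ?thesis unfolding b \<alpha>f_def a by (simp add: sum_subtractf right_diff_distrib)
  qed
  also have "\<bar>\<dots>\<bar> \<le> C * (\<sigma>\<^sup>2 * h\<^sup>2 / 2)" using r_taylor by (intro weighted_sum_le) auto
  finally show ?thesis .
qed

definition "zf = (\<lambda>\<omega>. \<Sum>i\<in>I. c i * f (t i) \<omega>)"
definition "kd s = kr_density (\<alpha>f I c t s) (\<beta>f I c t s)"

lemma zf_lin: "zf \<in> lin" unfolding zf_def by (rule sum_lin[OF fin])
lemma zf_meas[measurable]: "zf \<in> borel_measurable M" by (rule G_meas[OF zf_lin])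
lemma cov_zf: "cov zf (f s) = \<alpha>f I c t s" unfolding zf_def \<alpha>f_def by (rule cov_sum_f[OF fin])

lemma cov_zf_le: "cov zf zf \<le> C\<^sup>2"
proof -
  have "cov zf zf = (\<Sum>i\<in>I. c i * cov (f (t i)) zf)"
    unfolding zf_def using fin by (subst cov_sum_left) (auto intro: G_scale f_lin sum_lin simp: cov_scale_left)
  also have "\<dots> \<le> C * C"
    using weighted_sum_le[of "\<lambda>i. cov (f (t i)) zf" C] alpha_le C_nonneg by (simp add: cov_commute[of _ zf] cov_zf abs_le_iff)
  finally show ?thesis by (simp add: power2_eq_square)
qed

lemma kd_lipschitz: "\<bar>kd s - kd s'\<bar> \<le> (2 * exp (C\<^sup>2) * (C + 1) * (2 * C * \<sigma>)) * \<bar>s - s'\<bar>"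
proof -
  have "\<bar>kd s - kd s'\<bar> \<le> 2 * exp (C\<^sup>2) * (C + 1) * (\<bar>\<alpha>f I c t s - \<alpha>f I c t s'\<bar> + \<bar>\<beta>f I c t s - \<beta>f I c t s'\<bar>)"
    unfolding kd_def by (intro kr_density_lipschitz alpha_le beta_le)
  also have "\<dots> \<le> 2 * exp (C\<^sup>2) * (C + 1) * (C * \<sigma> * \<bar>s - s'\<bar> + C * \<sigma> * \<bar>s - s'\<bar>)"
    using C_nonneg by (intro mult_left_mono add_mono alpha_lipschitz beta_lipschitz) auto
  finally show ?thesis by (simp add: algebra_simps)
qed

text \<open>Three sources of error: the remainder of \<open>kr_step\<close>, the deviation of the
  ratio of standard deviations from its linear rate, and the replacement of the discrete covariances
  by \<open>\<alpha>f\<close> and \<open>\<beta>f\<close>. None depends on the position of the cell,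
  so the errors can be summed over cells.\<close>

definition "kr_error h = (1 + C) * \<sigma>\<^sup>2 * h + 2 * exp (C\<^sup>2) * \<bar>sqrt (2 * (1 - r h)) / h / sqrt (2 * (1 + r h)) - \<sigma> / 2\<bar>
   + \<sigma> / 2 * (2 * exp (C\<^sup>2) * (C + 1)) * (2 * (C * \<sigma> * h) + C * \<bar>2 / sqrt (2 * (1 + r h)) - 1\<bar> + C * \<bar>\<sigma> / (sqrt (2 * (1 - r h)) / h) - 1\<bar>)"

lemma kr_error_tendsto: "(kr_error \<longlongrightarrow> 0) (at_right 0)"
proof -
  have "isCont r 0"
  proof -
    have "\<sigma>-lipschitz_on UNIV r" using r_lipschitz sigma_pos by (intro lipschitz_onI) (auto simp: dist_real_def)
    then show ?thesis using lipschitz_on_continuous_on continuous_on_eq_continuous_at open_UNIV by blast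
  qed
  then have r0: "(r \<longlongrightarrow> 1) (at_right 0)" by (simp add: isCont_def r_at_0 filterlim_at_split)
  have "((\<lambda>h. sqrt (2 * (1 + r h))) \<longlongrightarrow> sqrt (2 * (1 + 1))) (at_right 0)" by (intro tendsto_intros r0)
  then have u: "((\<lambda>h. sqrt (2 * (1 + r h))) \<longlongrightarrow> 2) (at_right 0)" by simp
  have "((\<lambda>h. sqrt (2 * ((1 - r h) / h\<^sup>2))) \<longlongrightarrow> sqrt (2 * (\<sigma>\<^sup>2 / 2))) (at_right 0)" by (intro tendsto_intros r_second_order)
  then have "((\<lambda>h. sqrt (2 * ((1 - r h) / h\<^sup>2))) \<longlongrightarrow> \<sigma>) (at_right 0)" using sigma_pos by simp
  moreover have "\<forall>\<^sub>F h in at_right 0. sqrt (2 * ((1 - r h) / h\<^sup>2)) = sqrt (2 * (1 - r h)) / h"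
    by (rule eventually_at_right_less[THEN eventually_mono]) (simp add: real_sqrt_divide real_sqrt_mult)
  ultimately have w: "((\<lambda>h. sqrt (2 * (1 - r h)) / h) \<longlongrightarrow> \<sigma>) (at_right 0)" by (rule Lim_transform_eventually)
  have h0: "((\<lambda>h. h) \<longlongrightarrow> 0) (at_right (0::real))" by (rule tendsto_ident_at)
  have "((\<lambda>h. kr_error h) \<longlongrightarrow> (1 + C) * \<sigma>\<^sup>2 * 0 + 2 * exp (C\<^sup>2) * \<bar>\<sigma> / 2 - \<sigma> / 2\<bar>
    + \<sigma> / 2 * (2 * exp (C\<^sup>2) * (C + 1)) * (2 * (C * \<sigma> * 0) + C * \<bar>2 / 2 - 1\<bar> + C * \<bar>\<sigma> / \<sigma> - 1\<bar>)) (at_right 0)"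
    unfolding kr_error_def by (intro tendsto_add tendsto_mult tendsto_const tendsto_rabs tendsto_diff tendsto_divide h0 u w) (use sigma_pos in auto)
  then show ?thesis using sigma_pos by simp
qed

text \<open>In a short cell \<open>usum\<close> is close to twice f(s) and \<open>wdiff\<close> to h
  times the derivative, with standard deviations close to 2 and \<open>\<sigma> * h\<close>; the
  normalised covariances are therefore close to \<open>\<alpha>f\<close> and
  \<open>\<beta>f\<close>.\<close>

lemma kr_local:
  assumes h: "0 < h" "h \<le> \<delta>\<^sub>0"
  shows "norm ((CLINT \<omega>|M. if f s \<omega> * f (s + h) \<omega> < 0 then iexp (zf \<omega>) else 0) - 
    complex_of_real (h * (\<sigma> / pi * exp (- (cov zf zf / 2)) * kd s))) \<le> h * kr_error h"
proof -
  note v = variances[OF h]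
  define su sw where "su = sqrt (2 * (1 + r h))" and "sw = sqrt (2 * (1 - r h))"
  define \<tau> where "\<tau> = sw / su"
  define a b where "a = cov zf (usum s h) / su" and "b = cov zf (wdiff s h) / sw"
  define V where "V = cov zf zf"
  have V: "0 \<le> V" "V \<le> C\<^sup>2" unfolding V_def using normal_law(2)[OF zf_lin] cov_zf_le by auto
  have su: "1 \<le> su" "0 < su" and sw: "0 < sw" "\<sigma> * h / 2 \<le> sw" using v sigma_pos h by (auto simp: su_def sw_def)
  have sV: "sqrt V \<le> C" using V C_nonneg by (intro real_le_lsqrt) auto
  have ca: "cov zf (usum s h) = \<alpha>f I c t s + \<alpha>f I c t (s + h)" "cov zf (wdiff s h) = \<alpha>f I c t (s + h) - \<alpha>f I c t s"
    unfolding usum_def wdiff_def using zf_lin f_lin by (simp_all add: cov_simps cov_zf)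
  have aC: "\<bar>a\<bar> \<le> C"
  proof -
    have "\<bar>cov zf (usum s h)\<bar> \<le> sqrt V * su" using cov_Cauchy_Schwarz[OF zf_lin uw_lin(1), of s h] by (simp add: V_def su_def cov_uw)
    also have "\<dots> \<le> C * su" using sV su by (intro mult_right_mono) auto
    finally show ?thesis using su by (simp add: a_def field_simps)
  qed
  have bC: "\<bar>b\<bar> \<le> C"
  proof -
    have "\<bar>cov zf (wdiff s h)\<bar> \<le> sqrt V * sw" using cov_Cauchy_Schwarz[OF zf_lin uw_lin(2), of s h] by (simp add: V_def sw_def cov_uw)
    also have "\<dots> \<le> C * sw" using sV sw by (intro mult_right_mono) auto
    finally show ?thesis using sw by (simp add: b_def field_simps)
  qed
  have \<tau>: "0 \<le> \<tau>" "\<tau> \<le> \<sigma> * h" using tau_le[OF h] by (auto simp: \<tau>_def su_def sw_def)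
  define e where "e = exp (- (V / 2))"
  have e: "0 \<le> e" "e \<le> 1" using V by (auto simp: e_def)
  \<comment> \<open>Moves the constant of the small ball into the normalisation of
    \<open>kr_density\<close>.\<close>
  have pi2: "sqrt (2/pi) * x = 2 / pi * (sqrt (pi/2) * x)" for x
  proof -
    have q1: "sqrt (2/pi) * sqrt (2/pi) = 2/pi" by (rule real_sqrt_mult_self[THEN trans]) simp
    have "sqrt (2/pi) * sqrt (pi/2) = sqrt ((2/pi) * (pi/2))" by (rule real_sqrt_mult[symmetric])
    then have q2: "sqrt (2/pi) * sqrt (pi/2) = 1" by simp
    have "2 / pi * sqrt (pi/2) = sqrt (2/pi) * (sqrt (2/pi) * sqrt (pi/2))" by (simp only: q1 mult.assoc[symmetric])
    also have "\<dots> = sqrt (2/pi)" by (simp only: q2 mult_1_right)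
    finally have "2 / pi * sqrt (pi/2) = sqrt (2/pi)" .
    then show ?thesis by (simp only: mult.assoc[symmetric])
  qed
  have main: "norm ((CLINT \<omega>|M. if f s \<omega> * f (s + h) \<omega> < 0 then iexp (zf \<omega>) else 0) - complex_of_real (\<tau> * (2 / pi) * e * kr_density a b)) \<le> (1 + \<bar>a\<bar>) * \<tau>\<^sup>2"
  proof -
    have "\<tau> * sqrt (2/pi) * exp (- ((V - a\<^sup>2 - b\<^sup>2) / 2)) * ell b = \<tau> * (2 / pi) * e * kr_density a b"
    proof -
      have "exp (- ((V - a\<^sup>2 - b\<^sup>2) / 2)) = e * exp ((a\<^sup>2 + b\<^sup>2) / 2)"
        unfolding e_def exp_add[symmetric] by (simp add: field_simps)
      then show ?thesis using pi2[of "\<tau> * (e * exp ((a\<^sup>2 + b\<^sup>2) / 2)) * ell b"] by (simp add: kr_density_def mult_ac)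
    qed
    then show ?thesis
      using kr_step[OF zf_lin h, of s] unfolding a_def b_def \<tau>_def su_def sw_def V_def by simp
  qed
  have aa: "\<bar>a - \<alpha>f I c t s\<bar> \<le> C * \<sigma> * h + C * \<bar>2 / su - 1\<bar>"
  proof -
    have "a - \<alpha>f I c t s = (\<alpha>f I c t (s + h) - \<alpha>f I c t s) / su + \<alpha>f I c t s * (2 / su - 1)"
      using su by (simp add: a_def ca field_simps)
    also have "\<bar>\<dots>\<bar> \<le> (C * \<sigma> * h) / 1 + C * \<bar>2 / su - 1\<bar>"
    proof (rule abs_div_add_mult_le)
      show "\<bar>\<alpha>f I c t (s + h) - \<alpha>f I c t s\<bar> \<le> C * \<sigma> * h" using alpha_lipschitz[of "s + h" s] h(1) by simp
    qed (use alpha_le su in auto)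
    finally show ?thesis by simp
  qed
  have bb: "\<bar>b - \<beta>f I c t s\<bar> \<le> C * \<sigma> * h + C * \<bar>\<sigma> / (sw / h) - 1\<bar>"
  proof -
    \<comment> \<open>The first numerator is a Taylor remainder of order h^2, set against a standard
      deviation of order \<open>h\<close>.\<close>
    have "b - \<beta>f I c t s = (\<alpha>f I c t (s + h) - \<alpha>f I c t s - h * \<sigma> * \<beta>f I c t s) / sw + \<beta>f I c t s * (\<sigma> / (sw / h) - 1)"
      using sw h by (simp add: b_def ca field_simps)
    also have "\<bar>\<dots>\<bar> \<le> (C * (\<sigma>\<^sup>2 * h\<^sup>2 / 2)) / (\<sigma> * h / 2) + C * \<bar>\<sigma> / (sw / h) - 1\<bar>"
      by (rule abs_div_add_mult_le[OF alpha_taylor _ sw(2) beta_le]) (use sigma_pos h in simp)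
    also have "(C * (\<sigma>\<^sup>2 * h\<^sup>2 / 2)) / (\<sigma> * h / 2) = C * \<sigma> * h" using sigma_pos h by (simp add: power2_eq_square)
    finally show ?thesis .
  qed
  define A where "A = 2 * exp (C\<^sup>2) * (C + 1)"
  have A: "A \<ge> 0" using C_nonneg by (simp add: A_def)
  have KD: "\<bar>kr_density a b - kd s\<bar> \<le> A * (2 * (C * \<sigma> * h) + C * \<bar>2 / su - 1\<bar> + C * \<bar>\<sigma> / (sw / h) - 1\<bar>)"
  proof -
    have "\<bar>kr_density a b - kd s\<bar> \<le> A * (\<bar>a - \<alpha>f I c t s\<bar> + \<bar>b - \<beta>f I c t s\<bar>)"
      unfolding kd_def A_def by (intro kr_density_lipschitz aC bC alpha_le beta_le)
    also have "\<dots> \<le> A * ((C * \<sigma> * h + C * \<bar>2 / su - 1\<bar>) + (C * \<sigma> * h + C * \<bar>\<sigma> / (sw / h) - 1\<bar>))"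
      using A by (intro mult_left_mono add_mono aa bb)
    finally show ?thesis by (simp add: algebra_simps)
  qed
  have diff: "\<bar>\<tau> * (2 / pi) * e * kr_density a b - h * (\<sigma> / pi * e * kd s)\<bar> \<le>
      h * (2 * exp (C\<^sup>2) * \<bar>sw / h / su - \<sigma> / 2\<bar> + \<sigma> / 2 * (A * (2 * (C * \<sigma> * h) + C * \<bar>2 / su - 1\<bar> + C * \<bar>\<sigma> / (sw / h) - 1\<bar>)))"
  proof -
    have "\<tau> * (2 / pi) * e * kr_density a b - h * (\<sigma> / pi * e * kd s) = 
       ((2 / pi) * e) * (h * ((sw / h / su - \<sigma> / 2) * kr_density a b + \<sigma> / 2 * (kr_density a b - kd s)))"
      using h su by (simp add: \<tau>_def field_simps)
    also have "\<bar>\<dots>\<bar> = ((2 / pi) * e) * (h * \<bar>(sw / h / su - \<sigma> / 2) * kr_density a b + \<sigma> / 2 * (kr_density a b - kd s)\<bar>)"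
      using h e by (simp add: abs_mult)
    also have "\<dots> \<le> 1 * (h * \<bar>(sw / h / su - \<sigma> / 2) * kr_density a b + \<sigma> / 2 * (kr_density a b - kd s)\<bar>)"
    proof (rule mult_right_mono)
      have "(2 / pi) * e \<le> 1 * 1" using e pi_gt3 by (intro mult_mono) auto
      then show "(2 / pi) * e \<le> 1" by simp
    qed (use h in simp)
    also have "\<dots> \<le> h * (\<bar>sw / h / su - \<sigma> / 2\<bar> * \<bar>kr_density a b\<bar> + \<sigma> / 2 * \<bar>kr_density a b - kd s\<bar>)"
      using h sigma_pos abs_triangle_ineq[of "(sw / h / su - \<sigma> / 2) * kr_density a b" "\<sigma> / 2 * (kr_density a b - kd s)"]
      by (simp add: abs_mult mult_left_mono)
    also have "\<dots> \<le> h * (\<bar>sw / h / su - \<sigma> / 2\<bar> * (2 * exp (C\<^sup>2)) + \<sigma> / 2 * (A * (2 * (C * \<sigma> * h) + C * \<bar>2 / su - 1\<bar> + C * \<bar>\<sigma> / (sw / h) - 1\<bar>)))"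
      using h sigma_pos KD abs_kr_density_le[OF aC bC] by (intro mult_left_mono add_mono) auto
    finally show ?thesis by (simp add: mult_ac)
  qed
  have t2: "(1 + \<bar>a\<bar>) * \<tau>\<^sup>2 \<le> h * ((1 + C) * \<sigma>\<^sup>2 * h)"
  proof -
    have "\<tau>\<^sup>2 \<le> (\<sigma> * h)\<^sup>2" using \<tau> by (intro power_mono) auto
    then have "(1 + \<bar>a\<bar>) * \<tau>\<^sup>2 \<le> (1 + C) * (\<sigma> * h)\<^sup>2" using aC C_nonneg by (intro mult_mono) auto
    then show ?thesis by (simp add: power2_eq_square mult_ac)
  qed
  have "norm ((CLINT \<omega>|M. if f s \<omega> * f (s + h) \<omega> < 0 then iexp (zf \<omega>) else 0) - complex_of_real (h * (\<sigma> / pi * e * kd s))) \<le>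
     norm ((CLINT \<omega>|M. if f s \<omega> * f (s + h) \<omega> < 0 then iexp (zf \<omega>) else 0) - complex_of_real (\<tau> * (2 / pi) * e * kr_density a b)) +
     norm (complex_of_real (\<tau> * (2 / pi) * e * kr_density a b) - complex_of_real (h * (\<sigma> / pi * e * kd s)))"
    by (rule order_trans[OF _ norm_triangle_ineq]) simp
  also have "norm (complex_of_real (\<tau> * (2 / pi) * e * kr_density a b) - complex_of_real (h * (\<sigma> / pi * e * kd s))) = 
     \<bar>\<tau> * (2 / pi) * e * kr_density a b - h * (\<sigma> / pi * e * kd s)\<bar>"
    by (simp only: of_real_diff[symmetric] norm_of_real)
  finally have "norm ((CLINT \<omega>|M. if f s \<omega> * f (s + h) \<omega> < 0 then iexp (zf \<omega>) else 0) - complex_of_real (h * (\<sigma> / pi * e * kd s))) \<le>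
     h * ((1 + C) * \<sigma>\<^sup>2 * h) + h * (2 * exp (C\<^sup>2) * \<bar>sw / h / su - \<sigma> / 2\<bar> + \<sigma> / 2 * (A * (2 * (C * \<sigma> * h) + C * \<bar>2 / su - 1\<bar> + C * \<bar>\<sigma> / (sw / h) - 1\<bar>)))"
    using main t2 diff by linarith
  also have "\<dots> = h * kr_error h"
  proof -
    have "h * X + h * (Y + S * (A * Z)) = h * (X + Y + S * A * Z)" for X Y S Z :: real
      by (simp add: algebra_simps)
    then show ?thesis unfolding kr_error_def A_def[symmetric] su_def[symmetric] sw_def[symmetric] .
  qed
  finally show ?thesis unfolding e_def V_def .
qed

text \<open>Both sides are limits over dyadic meshes of the same sum over cells: the left by
  domination through the zero count, the right as a Riemann sum of a Lipschitz function. The number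
  of cells times the mesh is the length of the window, so the local errors add up to a vanishing
  multiple of it.\<close>

lemma weighted_kac_rice:
  assumes p: "0 < p" "p \<le> \<delta>\<^sub>0"
  shows "(CLINT \<omega>|M. complex_of_real (zero_count f (real K * p) \<omega>) * iexp (zf \<omega>)) = 
    complex_of_real (\<sigma> / pi * exp (- (cov zf zf / 2)) * integral {0..real K * p} kd)"
proof (rule LIMSEQ_unique)
  define g where "g = \<sigma> / pi * exp (- (cov zf zf / 2))"
  have g: "0 \<le> g" using sigma_pos by (simp add: g_def)
  have iN: "integrable M (zero_count f (real K * p))"
    by (rule square_integrable_imp_integrable[OF zero_count_meas zero_count_second_moment(1)[OF p]])
  show "(\<lambda>n. CLINT \<omega>|M. complex_of_real (NN p K n \<omega>) * iexp (zf \<omega>)) \<longlonglongrightarrow> (CLINT \<omega>|M. complex_of_real (zero_count f (real K * p) \<omega>) * iexp (zf \<omega>))"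
  proof (rule integral_dominated_convergence[where w = "zero_count f (real K * p)"])
    note [measurable] = NN_meas[OF p]
    show "integrable M (zero_count f (real K * p))" by (rule iN)
    show "AE \<omega> in M. (\<lambda>n. complex_of_real (NN p K n \<omega>) * iexp (zf \<omega>)) \<longlonglongrightarrow> complex_of_real (zero_count f (real K * p) \<omega>) * iexp (zf \<omega>)"
      using NN_convergence[OF p, of K] by eventually_elim (auto intro!: tendsto_intros)
    show "AE \<omega> in M. norm (complex_of_real (NN p K n \<omega>) * iexp (zf \<omega>)) \<le> zero_count f (real K * p) \<omega>" for n
      using NN_convergence[OF p, of K]
    proof eventually_elim
      case (elim \<omega>)
      then show ?case using NN_nonneg[OF p, of K n \<omega>] by (simp only: norm_mult norm_exp_i_times norm_of_real) simp
    qed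
    show "(\<lambda>\<omega>. complex_of_real (NN p K n \<omega>) * iexp (zf \<omega>)) \<in> borel_measurable M" for n by measurable
    show "(\<lambda>\<omega>. complex_of_real (zero_count f (real K * p) \<omega>) * iexp (zf \<omega>)) \<in> borel_measurable M" by measurable
  qed
  define h where "h n = p / 2^n" for n :: nat
  have h: "0 < h n" "h n \<le> \<delta>\<^sub>0" for n
  proof -
    show "0 < h n" using p by (simp add: h_def)
    have "p / 2^n \<le> p / 1" using p by (intro divide_left_mono) auto
    then show "h n \<le> \<delta>\<^sub>0" using p by (simp add: h_def)
  qed
  define L where "L = 2 * exp (C\<^sup>2) * (C + 1) * (2 * C * \<sigma>)"
  have L: "L \<ge> 0" using C_nonneg sigma_pos by (simp add: L_def)
  have T: "real (K * 2^n) * h n = real K * p" for n by (simp add: h_def)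
  have bound: "norm ((CLINT \<omega>|M. complex_of_real (NN p K n \<omega>) * iexp (zf \<omega>)) - complex_of_real (g * integral {0..real K * p} kd)) \<le>
      real K * p * (kr_error (h n) + g * (L * h n))" for n
  proof -
    let ?m = "K * 2^n"
    let ?S = "\<lambda>j \<omega>. if f (real j * h n) \<omega> * f (real j * h n + h n) \<omega> < 0 then iexp (zf \<omega>) else 0"
    have iS: "integrable M (?S j)" for j
      by (rule integrable_const_bound[of _ 1]) (auto simp del: of_real_sum)
    have "complex_of_real (NN p K n \<omega>) * iexp (zf \<omega>) = (\<Sum>j<?m. ?S j \<omega>)" for \<omega>
      unfolding NN_def[OF p] crossings_def h_def[symmetric] of_real_sum sum_distrib_right
      by (intro sum.cong refl) (simp add: distrib_right add.commute)
    then have "(CLINT \<omega>|M. complex_of_real (NN p K n \<omega>) * iexp (zf \<omega>)) = (\<Sum>j<?m. (CLINT \<omega>|M. ?S j \<omega>))"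
      using iS by simp
    then have eq: "(CLINT \<omega>|M. complex_of_real (NN p K n \<omega>) * iexp (zf \<omega>)) - complex_of_real (\<Sum>j<?m. h n * (g * kd (real j * h n))) = 
       (\<Sum>j<?m. (CLINT \<omega>|M. ?S j \<omega>) - complex_of_real (h n * (g * kd (real j * h n))))"
      by (simp only: sum_subtractf of_real_sum)
    have "norm (\<Sum>j<?m. (CLINT \<omega>|M. ?S j \<omega>) - complex_of_real (h n * (g * kd (real j * h n)))) \<le> (\<Sum>j<?m. h n * kr_error (h n))"
      unfolding g_def by (intro sum_norm_le kr_local h)
    then have 1: "norm ((CLINT \<omega>|M. complex_of_real (NN p K n \<omega>) * iexp (zf \<omega>)) - complex_of_real (\<Sum>j<?m. h n * (g * kd (real j * h n)))) \<le> real K * p * kr_error (h n)"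
      unfolding eq sum_constant card_lessThan T[of n, symmetric] by (simp only: mult.assoc)
    have "\<bar>(\<Sum>j<?m. h n * kd (real j * h n)) - integral {0..real ?m * h n} kd\<bar> \<le> real ?m * (L * (h n)\<^sup>2)"
      by (rule riemann_sum_lipschitz[OF _ L h(1)]) (use kd_lipschitz in \<open>simp add: L_def\<close>)
    also have "\<dots> = real ?m * h n * (L * h n)" by (simp only: power2_eq_square mult_ac)
    also have "\<dots> = real K * p * (L * h n)" by (simp only: T)
    finally have 2: "\<bar>(\<Sum>j<?m. h n * kd (real j * h n)) - integral {0..real K * p} kd\<bar> \<le> real K * p * (L * h n)" unfolding T .
    have "(\<Sum>j<?m. h n * (g * kd (real j * h n))) = g * (\<Sum>j<?m. h n * kd (real j * h n))"
      by (simp add: sum_distrib_left mult_ac)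
    then have "\<bar>(\<Sum>j<?m. h n * (g * kd (real j * h n))) - g * integral {0..real K * p} kd\<bar> = g * \<bar>(\<Sum>j<?m. h n * kd (real j * h n)) - integral {0..real K * p} kd\<bar>"
      using g by (simp add: right_diff_distrib[symmetric] abs_mult)
    also have "\<dots> \<le> g * (real K * p * (L * h n))" using 2 g by (intro mult_left_mono)
    finally have 3: "norm (complex_of_real (\<Sum>j<?m. h n * (g * kd (real j * h n))) - complex_of_real (g * integral {0..real K * p} kd)) \<le> real K * p * (g * (L * h n))"
      by (simp only: of_real_diff[symmetric] norm_of_real mult_ac)
    have "norm ((CLINT \<omega>|M. complex_of_real (NN p K n \<omega>) * iexp (zf \<omega>)) - complex_of_real (g * integral {0..real K * p} kd)) \<le>
       norm ((CLINT \<omega>|M. complex_of_real (NN p K n \<omega>) * iexp (zf \<omega>)) - complex_of_real (\<Sum>j<?m. h n * (g * kd (real j * h n)))) +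
       norm (complex_of_real (\<Sum>j<?m. h n * (g * kd (real j * h n))) - complex_of_real (g * integral {0..real K * p} kd))"
      by (rule order_trans[OF _ norm_triangle_ineq]) simp
    also have "\<dots> \<le> real K * p * kr_error (h n) + real K * p * (g * (L * h n))" by (rule add_mono[OF 1 3])
    finally show ?thesis by (simp only: distrib_left)
  qed
  have "h \<longlonglongrightarrow> 0" unfolding h_def by (rule LIMSEQ_divide_realpow_zero) simp
  then have hr: "filterlim h (at_right 0) sequentially"
    using h(1) by (intro tendsto_imp_filterlim_at_right) auto
  have "(\<lambda>n. real K * p * (kr_error (h n) + g * (L * h n))) \<longlonglongrightarrow> real K * p * (0 + g * (L * 0))"
    by (intro tendsto_intros filterlim_compose[OF kr_error_tendsto hr] \<open>h \<longlonglongrightarrow> 0\<close>)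
  then have l0: "(\<lambda>n. real K * p * (kr_error (h n) + g * (L * h n))) \<longlonglongrightarrow> 0" by simp
  show "(\<lambda>n. CLINT \<omega>|M. complex_of_real (NN p K n \<omega>) * iexp (zf \<omega>)) \<longlonglongrightarrow> complex_of_real (\<sigma> / pi * exp (- (cov zf zf / 2)) * integral {0..real K * p} kd)"
    unfolding g_def[symmetric]
    by (rule LIM_zero_cancel, rule Lim_null_comparison[OF always_eventually l0]) (use bound in blast)
qed

end

end

section \<open>The Kac--Rice density along random sinusoids\<close>

text \<open>The cosine is expanded and integrated termwise against the odd absolute moments of the
  normal law; the resulting terms are dominated by an exponential series.\<close>

lemma ell_sums: "(\<lambda>k. sqrt (2/pi) * ((- 2)^k * fact k / fact (2 * k)) * b^(2 * k)) sums ell b"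
proof -
  define u where "u k y = \<bar>y\<bar> * ((-1)^k / fact (2 * k) * (b * y)^(2 * k))" for k and y :: real
  have n: "norm (u k y) = b^(2*k) / fact (2 * k) * \<bar>y\<bar>^(2 * k + 1)" for k y
    by (simp add: u_def abs_mult power_mult_distrib power_abs power_even_abs abs_divide)
  have m: "(LINT y|N1. \<bar>y\<bar>^(2 * k + 1)) = sqrt (2/pi) * 2^k * fact k" for k
    by (rule std_normal_distribution_odd_moments_abs)
  have i: "integrable N1 (u k)" for k
  proof (rule norm_integral_le(1))
    show "integrable N1 (\<lambda>y. b^(2*k) / fact (2 * k) * \<bar>y\<bar>^(2 * k + 1))" using N1_abs_moment by (rule integrable_mult_right)
    show "u k \<in> borel_measurable N1" unfolding u_def[abs_def] by measurable
  qed (simp only: n order_refl)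
  have ev: "u k y = (-1)^k * b^(2*k) / fact (2 * k) * \<bar>y\<bar>^(2 * k + 1)" for k y
    by (simp add: u_def power_mult_distrib power_even_abs)
  have ni: "(LINT y|N1. norm (u k y)) = b^(2*k) / fact (2 * k) * (sqrt (2/pi) * 2^k * fact k)" for k
    unfolding n integral_mult_right_zero m ..
  have ui: "(LINT y|N1. u k y) = sqrt (2/pi) * ((- 2)^k * fact k / fact (2 * k)) * b^(2 * k)" for k
    unfolding ev integral_mult_right_zero m by (simp add: power_minus[of 2])
  have cs: "(\<lambda>k. (-1)^k / fact (2 * k) * x^(2 * k)) sums cos x" for x :: real by (rule cos_paired)
  have "(\<lambda>k. LINT y|N1. u k y) sums (LINT y|N1. (\<Sum>k. u k y))"
  proof (rule sums_integral[OF i])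
    show "AE y in N1. summable (\<lambda>k. norm (u k y))"
    proof (rule AE_I2)
      fix y :: real
      show "summable (\<lambda>k. norm (u k y))"
      proof (rule summable_comparison_test')
        show "summable (\<lambda>k. \<bar>y\<bar> * (((b * y)\<^sup>2)^k /\<^sub>R fact k))" using summable_exp_generic by (rule summable_mult)
        show "norm (norm (u k y)) \<le> \<bar>y\<bar> * (((b * y)\<^sup>2)^k /\<^sub>R fact k)" for k
        proof -
          define Z where "Z = (b * y)^(2 * k)"
          have Z: "0 \<le> Z" "((b * y)\<^sup>2)^k = Z" unfolding Z_def by (simp add: zero_le_even_power) (rule power_mult[symmetric])
          have "Z / fact (2 * k) \<le> Z / fact k" using Z by (intro divide_left_mono) (auto simp: fact_mono)
          moreover have "norm (norm (u k y)) = \<bar>y\<bar> * (Z / fact (2 * k))" using Z(1) by (simp add: u_def abs_mult abs_divide flip: Z_def)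
          ultimately show ?thesis unfolding Z(2) by (simp add: mult_left_mono divide_inverse mult.commute[of Z])
        qed
      qed
    qed
    show "summable (\<lambda>k. LINT y|N1. norm (u k y))"
    proof (rule summable_comparison_test')
      show "summable (\<lambda>k. sqrt (2/pi) * ((2 * b\<^sup>2)^k /\<^sub>R fact k))" using summable_exp_generic by (rule summable_mult)
      show "norm (LINT y|N1. norm (u k y)) \<le> sqrt (2/pi) * ((2 * b\<^sup>2)^k /\<^sub>R fact k)" for k
      proof -
        have "fact k * fact k \<le> (fact (2 * k) :: real)" by (rule square_fact_le_2_fact)
        then have "fact k / fact (2 * k) \<le> 1 / (fact k :: real)" by (simp add: field_simps)
        then have "(b^(2*k) * sqrt (2/pi) * 2^k) * (fact k / fact (2 * k)) \<le> (b^(2*k) * sqrt (2/pi) * 2^k) * (1 / fact k)"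
          by (intro mult_left_mono) (auto simp: zero_le_even_power)
        then show ?thesis unfolding ni power_mult_distrib power_mult[of b 2 k] by (simp add: field_simps)
      qed
    qed
  qed
  moreover have "(\<Sum>k. u k y) = \<bar>y\<bar> * cos (b * y)" for y
    unfolding u_def by (rule sums_unique[symmetric], rule sums_mult, rule cs)
  ultimately show ?thesis unfolding ui ell_def by simp
qed

text \<open>Wallis' recursion: the derivative of -cos t sin^(2k+1) t combines two consecutive even
  powers, and this primitive vanishes at both ends.\<close>

lemma sin_power_integral:
  "((\<lambda>t. sin t ^ (2 * k)) has_integral 2 * pi * fact (2 * k) / (4^k * (fact k)\<^sup>2)) {0..2 * pi}"
proof (induction k)
  case 0
  then show ?case using has_integral_const_real[of "1::real" 0 "2 * pi"] by simp
next
  case (Suc k)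
  have "((\<lambda>t. (2 * real k + 2) * sin t ^ (2 * k + 2) - (2 * real k + 1) * sin t ^ (2 * k)) has_integral
     (- cos (2*pi) * sin (2*pi) ^ (2*k+1)) - (- cos 0 * sin 0 ^ (2*k+1))) {0..2 * pi}"
  proof (rule fundamental_theorem_of_calculus)
    fix t :: real
    have c: "cos t * cos t = 1 - sin t * sin t" using sin_cos_squared_add[of t] by (simp add: power2_eq_square)
    have "((\<lambda>t. - cos t * sin t ^ Suc (2*k)) has_real_derivative
       - (- sin t) * sin t ^ Suc (2*k) + ((1 + of_nat (2*k)) * (cos t * sin t ^ (2*k))) * (- cos t)) (at t within {0..2*pi})"
      by (intro DERIV_mult DERIV_minus DERIV_power_Suc has_field_derivative_at_within[OF DERIV_cos] has_field_derivative_at_within[OF DERIV_sin])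
    then have "((\<lambda>t. - cos t * sin t ^ (2*k+1)) has_real_derivative
       (sin t * sin t ^ (2*k+1) - cos t * (real (2*k+1) * (cos t * sin t ^ (2*k))))) (at t within {0..2*pi})"
      by (simp add: algebra_simps)
    also have "sin t * sin t ^ (2*k+1) - cos t * (real (2*k+1) * (cos t * sin t ^ (2*k))) =
       sin t ^ (2*k+2) - (2 * real k + 1) * sin t ^ (2*k) * (cos t * cos t)" by (simp add: mult_ac)
    also have "\<dots> = (2 * real k + 2) * sin t ^ (2 * k + 2) - (2 * real k + 1) * sin t ^ (2 * k)"
      unfolding c by (simp add: algebra_simps)
    finally show "((\<lambda>t. - cos t * sin t ^ (2*k+1)) has_vector_derivative
       (2 * real k + 2) * sin t ^ (2 * k + 2) - (2 * real k + 1) * sin t ^ (2 * k)) (at t within {0..2*pi})"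
      by (simp only: has_real_derivative_iff_has_vector_derivative)
  qed simp
  then have "((\<lambda>t. (2 * real k + 2) * sin t ^ (2 * k + 2) - (2 * real k + 1) * sin t ^ (2 * k)) has_integral 0) {0..2 * pi}"
    by simp
  from has_integral_add[OF this has_integral_mult_right[OF Suc.IH, of "2 * real k + 1"]]
  have "((\<lambda>t. (2 * real k + 2) * sin t ^ (2 * k + 2)) has_integral (2 * real k + 1) * (2 * pi * fact (2 * k) / (4^k * (fact k)\<^sup>2))) {0..2 * pi}"
    by simp
  from has_integral_mult_right[OF this, of "1 / (2 * real k + 2)"]
  have "((\<lambda>t. (1 / (2 * real k + 2)) * ((2 * real k + 2) * sin t ^ (2 * k + 2))) has_integral (1 / (2 * real k + 2)) * ((2 * real k + 1) * (2 * pi * fact (2 * k) / (4^k * (fact k)\<^sup>2)))) {0..2 * pi}" .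
  moreover have "(1 / (2 * real k + 2)) * ((2 * real k + 2) * x) = x" for x by simp
  moreover have "(1 / (2 * real k + 2)) * ((2 * real k + 1) * (2 * pi * fact (2 * k) / (4^k * (fact k)\<^sup>2))) = 2 * pi * fact (2 * Suc k) / (4^Suc k * (fact (Suc k))\<^sup>2)"
  proof -
    define F where "F = (fact (2 * k) :: real)"
    define G where "G = (fact k :: real)"
    define P where "P = (4 ^ k :: real)"
    have e: "fact (2 * Suc k) = (2 * real k + 2) * ((2 * real k + 1) * F)" "fact (Suc k) = (real k + 1) * G" "4 ^ Suc k = 4 * P"
      by (simp_all add: F_def G_def P_def algebra_simps)
    have "G > 0" "P > 0" by (simp_all add: G_def P_def)
    then show ?thesis unfolding e F_def[symmetric] G_def[symmetric] P_def[symmetric]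
      by (simp add: divide_simps power2_eq_square) (simp add: algebra_simps)
  qed
  ultimately show ?case by simp
qed

text \<open>The Bessel-type identity expressing that a random sinusoid has a deterministic number of zeros.\<close>

lemma ell_sin_integral:
  "((\<lambda>t. ell (g * sin t)) has_integral 2 * pi * sqrt (2/pi) * exp (- (g\<^sup>2 / 2))) {0..2 * pi}"
proof -
  define a where "a k = sqrt (2/pi) * ((- 2)^k * fact k / fact (2 * k)) * g^(2 * k)" for k
  have an: "norm (a k) \<le> sqrt (2/pi) * ((2 * g\<^sup>2)^k /\<^sub>R fact k)" for k
  proof -
    have "fact k * fact k \<le> (fact (2 * k) :: real)" by (rule square_fact_le_2_fact)
    then have "fact k / fact (2 * k) \<le> 1 / (fact k :: real)" by (simp add: field_simps)
    then have "(g^(2*k) * sqrt (2/pi) * 2^k) * (fact k / fact (2 * k)) \<le> (g^(2*k) * sqrt (2/pi) * 2^k) * (1 / fact k)"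
      by (intro mult_left_mono) (auto simp: zero_le_even_power)
    moreover have "norm (a k) = (g^(2*k) * sqrt (2/pi) * 2^k) * (fact k / fact (2 * k))"
    proof -
      have "\<bar>(- 2::real)^k\<bar> = 2^k" by (simp add: power_abs)
      moreover have "\<bar>g^(2*k)\<bar> = g^(2*k)" by (rule abs_of_nonneg) (simp add: zero_le_even_power)
      ultimately show ?thesis unfolding a_def real_norm_def abs_mult abs_divide by simp
    qed
    moreover have "(g^(2*k) * sqrt (2/pi) * 2^k) * (1 / fact k) = sqrt (2/pi) * ((2 * g\<^sup>2)^k /\<^sub>R fact k)"
      unfolding power_mult_distrib power_mult[of g 2 k] by (simp add: field_simps)
    ultimately show ?thesis by linarith
  qed
  have u: "uniform_limit {0..2*pi} (\<lambda>n t. \<Sum>k<n. a k * sin t ^ (2 * k)) (\<lambda>t. \<Sum>k. a k * sin t ^ (2 * k)) sequentially"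
  proof (rule Weierstrass_m_test)
    show "summable (\<lambda>k. sqrt (2/pi) * ((2 * g\<^sup>2)^k /\<^sub>R fact k))" using summable_exp_generic by (rule summable_mult)
    fix k and t :: real
    have "\<bar>sin t ^ (2 * k)\<bar> \<le> 1" by (simp add: power_abs power_le_one)
    then have "norm (a k * sin t ^ (2 * k)) \<le> norm (a k) * 1" unfolding norm_mult by (intro mult_left_mono) auto
    then show "norm (a k * sin t ^ (2 * k)) \<le> sqrt (2/pi) * ((2 * g\<^sup>2)^k /\<^sub>R fact k)" using an[of k] by linarith
  qed
  obtain I J where IJ: "\<And>n. ((\<lambda>t. \<Sum>k<n. a k * sin t ^ (2 * k)) has_integral I n) {0..2*pi}"
      "((\<lambda>t. \<Sum>k. a k * sin t ^ (2 * k)) has_integral J) {0..2*pi}" "I \<longlonglongrightarrow> J"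
    by (rule uniform_limit_integral[OF u]) (auto intro!: continuous_intros)
  have In: "I n = (\<Sum>k<n. 2 * pi * sqrt (2/pi) * ((- (g\<^sup>2 / 2))^k /\<^sub>R fact k))" for n
  proof (rule has_integral_unique[OF IJ(1)])
    have "((\<lambda>t. \<Sum>k<n. a k * sin t ^ (2 * k)) has_integral (\<Sum>k<n. a k * (2 * pi * fact (2 * k) / (4^k * (fact k)\<^sup>2)))) {0..2*pi}"
      by (intro has_integral_sum has_integral_mult_right sin_power_integral) simp
    moreover have "a k * (2 * pi * fact (2 * k) / (4^k * (fact k)\<^sup>2)) = 2 * pi * sqrt (2/pi) * ((- (g\<^sup>2 / 2))^k /\<^sub>R fact k)" for k
    proof -
      define F where "F = (fact (2 * k) :: real)"
      define G where "G = (fact k :: real)"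
      have FG: "F > 0" "G > 0" by (simp_all add: F_def G_def)
      have "(-2::real)^k / 4^k = (-(1/2))^k" by (simp add: power_divide[symmetric])
      then have p: "(-2::real)^k = (-(1/2))^k * 4^k" by (simp add: field_simps)
      have q: "(- (g\<^sup>2 / 2))^k = (-(1/2))^k * g^(2*k)" by (simp add: power_mult power_mult_distrib[symmetric])
      show ?thesis unfolding a_def F_def[symmetric] G_def[symmetric] p q using FG by (simp add: field_simps power2_eq_square)
    qed
    ultimately show "((\<lambda>t. \<Sum>k<n. a k * sin t ^ (2 * k)) has_integral (\<Sum>k<n. 2 * pi * sqrt (2/pi) * ((- (g\<^sup>2 / 2))^k /\<^sub>R fact k))) {0..2*pi}"
      by simp
  qed
  have "(\<lambda>k. 2 * pi * sqrt (2/pi) * ((- (g\<^sup>2 / 2))^k /\<^sub>R fact k)) sums (2 * pi * sqrt (2/pi) * exp (- (g\<^sup>2 / 2)))"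
    by (intro sums_mult exp_converges)
  then have "I \<longlonglongrightarrow> 2 * pi * sqrt (2/pi) * exp (- (g\<^sup>2 / 2))" unfolding sums_def In[abs_def] .
  then have J: "J = 2 * pi * sqrt (2/pi) * exp (- (g\<^sup>2 / 2))" using IJ(3) LIMSEQ_unique by blast
  have "(\<Sum>k. a k * sin t ^ (2 * k)) = ell (g * sin t)" for t
    using ell_sums[of "g * sin t"] unfolding a_def by (intro sums_unique[symmetric]) (simp add: power_mult_distrib mult_ac)
  then show ?thesis using IJ(2) J by simp
qed

text \<open>On a circle of radius g the sum a^2 + b^2 is constant, so the exponential comes out of
  the integral and cancels the one produced by \<open>ell_sin_integral\<close>. Mean value 1 is the
  Kac--Rice form of a zero count that is uncorrelated with the test exponentials.\<close>

lemma kr_density_circle: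
  "integral {0..2 * pi} (\<lambda>t. kr_density (g * cos t) (g * sin t)) = 2 * pi"
proof -
  have e: "kr_density (g * cos t) (g * sin t) = exp (g\<^sup>2 / 2) * sqrt (pi/2) * ell (g * sin t)" for t
  proof -
    have "(g * cos t)\<^sup>2 + (g * sin t)\<^sup>2 = g\<^sup>2 * ((cos t)\<^sup>2 + (sin t)\<^sup>2)" by (simp only: power_mult_distrib distrib_left)
    then have "(g * cos t)\<^sup>2 + (g * sin t)\<^sup>2 = g\<^sup>2" by simp
    then show ?thesis unfolding kr_density_def by (simp add: mult_ac)
  qed
  have "sqrt (pi/2) * sqrt (2/pi) = sqrt ((pi/2) * (2/pi))" by (rule real_sqrt_mult[symmetric])
  then have q: "sqrt (pi/2) * sqrt (2/pi) = 1" by simp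
  have "exp (g\<^sup>2 / 2) * sqrt (pi/2) * (2 * pi * sqrt (2/pi) * exp (- (g\<^sup>2 / 2))) = 2 * pi * (sqrt (pi/2) * sqrt (2/pi)) * (exp (g\<^sup>2 / 2) * exp (- (g\<^sup>2 / 2)))"
    by (simp only: mult_ac)
  also have "\<dots> = 2 * pi" unfolding q by (simp flip: exp_add)
  finally have v: "exp (g\<^sup>2 / 2) * sqrt (pi/2) * (2 * pi * sqrt (2/pi) * exp (- (g\<^sup>2 / 2))) = 2 * pi" .
  have "((\<lambda>t. exp (g\<^sup>2 / 2) * sqrt (pi/2) * ell (g * sin t)) has_integral 2 * pi) {0..2 * pi}"
    using has_integral_mult_right[OF ell_sin_integral[of g], of "exp (g\<^sup>2 / 2) * sqrt (pi/2)"] unfolding v .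
  then show ?thesis unfolding e by (rule integral_unique)
qed

text \<open>The window may start anywhere: shifting by multiples of the period and splitting at its
  end rearranges one period into the standard one.\<close>

lemma integral_full_periods:
  fixes h :: "real \<Rightarrow> real"
  assumes per: "\<And>t. h (t + q) = h t" and c: "continuous_on UNIV h" and q: "q > 0"
  shows "integral {a..a + real n * q} h = real n * integral {0..q} h"
proof -
  have co: "continuous_on S h" for S using c continuous_on_subset by blast
  have perk: "h (t + of_int k * q) = h t" for t and k :: int
  proof (induction k rule: int_induct[of _ 0])
    case (step1 i) then show ?case using per[of "t + of_int i * q"] by (simp add: algebra_simps)
  next
    case (step2 i) then show ?case using per[of "t + of_int (i - 1) * q"] by (simp add: algebra_simps)
  qed simp
  have sh: "integral {x + k..y + k} h = integral {x..y} (\<lambda>t. h (t + k))" for x y k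
    using integral_shift_Icc_real[of x y h k] by (simp add: o_def add.commute)
  define k where "k = \<lfloor>a / q\<rfloor>"
  define b where "b = a - of_int k * q"
  have "of_int k \<le> a / q" "a / q < of_int k + 1" by (simp_all add: k_def)
  then have b: "0 \<le> b" "b \<le> q" using q by (simp_all add: b_def field_simps)
  have "integral {a..a + q} h = integral {b + of_int k * q..(b + q) + of_int k * q} h" by (simp add: b_def algebra_simps)
  also have "\<dots> = integral {b..b + q} h" unfolding sh perk ..
  also have "\<dots> = integral {b..q} h + integral {q..b + q} h"
    by (rule Henstock_Kurzweil_Integration.integral_combine[symmetric]) (use b co in \<open>auto intro!: integrable_continuous_real\<close>)
  also have "integral {q..b + q} h = integral {0..b} h" using sh[of 0 q b] per by simp
  also have "integral {b..q} h + integral {0..b} h = integral {0..q} h"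
    using Henstock_Kurzweil_Integration.integral_combine[of 0 b q h] b co by (simp add: integrable_continuous_real)
  finally have one: "integral {a..a + q} h = integral {0..q} h" .
  have sha: "integral {a + real n * q..a + real (Suc n) * q} h = integral {a..a + q} h" for n
    using sh[of a "real n * q" "a + q"] perk[of _ "int n"] by (simp add: algebra_simps)
  show ?thesis
  proof (induction n)
    case (Suc n)
    have "integral {a..a + real (Suc n) * q} h = integral {a..a + real n * q} h + integral {a + real n * q..a + real (Suc n) * q} h"
      by (rule Henstock_Kurzweil_Integration.integral_combine[symmetric]) (use q co in \<open>auto intro!: integrable_continuous_real simp: algebra_simps\<close>)
    then show ?case unfolding sha one Suc.IH by (simp add: algebra_simps)
  qed simp
qed

text \<open>Writing the complex amplitude in polar form, its phase only shifts the window of integration.\<close>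

lemma kr_density_sinusoid_integral:
  assumes s: "\<sigma> > 0"
  shows "integral {0..real L * (2 * pi / \<sigma>)} (\<lambda>s. kr_density (Re (z * iexp (\<sigma> * s))) (Im (z * iexp (\<sigma> * s)))) = real L * (2 * pi / \<sigma>)"
proof -
  define g \<theta> where "g = cmod z" and "\<theta> = Arg z"
  define h where "h t = kr_density (g * cos t) (g * sin t)" for t
  have z: "z = of_real g * iexp \<theta>" using rcis_cmod_Arg[of z] by (simp add: g_def \<theta>_def rcis_def cis_conv_exp)
  have e: "z * iexp (\<sigma> * s) = of_real g * iexp (\<sigma> * s + \<theta>)" for s
    unfolding z by (simp add: distrib_left exp_add)
  have hs: "kr_density (Re (z * iexp (\<sigma> * s))) (Im (z * iexp (\<sigma> * s))) = h (\<sigma> * s + \<theta>)" for s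
    unfolding e h_def by (simp add: Re_exp Im_exp)
  have hc: "continuous_on UNIV h"
  proof (rule continuous_on_eq[of _ "\<lambda>t. exp (((g * cos t)\<^sup>2 + (g * sin t)\<^sup>2) / 2) * ell (g * sin t) * sqrt (pi/2)"])
    have "1-lipschitz_on UNIV ell" by (rule lipschitz_onI) (use ell_lipschitz in \<open>auto simp: dist_real_def\<close>)
    then have "continuous_on UNIV ell" by (rule lipschitz_on_continuous_on)
    then have "continuous_on UNIV (\<lambda>t. ell (g * sin t))" by (rule continuous_on_compose2) (auto intro!: continuous_intros)
    then show "continuous_on UNIV (\<lambda>t. exp (((g * cos t)\<^sup>2 + (g * sin t)\<^sup>2) / 2) * ell (g * sin t) * sqrt (pi/2))"
      by (intro continuous_intros) auto
  qed (simp add: h_def kr_density_def)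
  have per: "h (t + 2 * pi) = h t" for t by (simp add: h_def)
  have i: "integral {\<theta>..\<theta> + real L * (2 * pi)} h = real L * (2 * pi)"
    using integral_full_periods[of h "2 * pi", OF per hc] kr_density_circle[of g] unfolding h_def by simp
  have "(h has_integral real L * (2 * pi)) {\<theta>..\<theta> + real L * (2 * pi)}"
    using integrable_integral[OF integrable_continuous_real[OF continuous_on_subset[OF hc subset_UNIV]], of \<theta> "\<theta> + real L * (2 * pi)"] unfolding i .
  from has_integral_affinity'[OF this[folded box_real(2)], of \<sigma> \<theta>] s
  have "((\<lambda>s. h (\<sigma> * s + \<theta>)) has_integral real L * (2 * pi) / \<sigma>) {0..real L * (2 * pi) / \<sigma>}"
    by (simp add: box_real divide_simps)
  then show ?thesis unfolding hs by (intro integral_unique) (simp only: times_divide_eq_right)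
qed

section \<open>Trigonometric polynomials approximating the sign\<close>

text \<open>Exponentials are the functions for which the Kac--Rice covariance is explicit; the
  inductive form lets bounds for them spread to the whole class. Products stay inside because
  frequencies add.\<close>

inductive trig :: "(real \<Rightarrow> complex) \<Rightarrow> bool" where
  iexp: "trig (\<lambda>x. iexp (\<theta> * x))"
| add: "trig F \<Longrightarrow> trig G \<Longrightarrow> trig (\<lambda>x. F x + G x)"
| scale: "trig F \<Longrightarrow> trig (\<lambda>x. c * F x)"

lemma trig_const: "trig (\<lambda>x. c)"
  using trig.scale[OF trig.iexp[of 0], of c] by simp

lemma trig_mult: assumes "trig F" "trig G" shows "trig (\<lambda>x. F x * G x)"
  using assms
proof (induction F arbitrary: G)
  case (iexp \<theta>)
  from iexp.prems show ?case
  proof (induction G)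
    case (iexp \<phi>)
    show ?case using trig.iexp[of "\<theta> + \<phi>"] by (simp add: distrib_left distrib_right exp_add)
  next
    case (add F G)
    show ?case using trig.add[OF add.IH] by (simp add: distrib_left)
  next
    case (scale F c)
    show ?case using trig.scale[OF scale.IH, of c] by (simp add: mult.left_commute)
  qed
next
  case (add F F')
  show ?case using trig.add[OF add.IH(1)[OF add.prems] add.IH(2)[OF add.prems]] by (simp add: distrib_right)
next
  case (scale F c)
  show ?case using trig.scale[OF scale.IH[OF scale.prems], of c] by (simp add: mult.assoc)
qed

lemma trig_meas: assumes "trig F" shows "F \<in> borel_measurable borel"
  using assms
proof induction
  case (scale F c)
  from scale.IH show ?case by (rule borel_measurable_times[OF borel_measurable_const])
qed measurable

lemma trig_bounded: assumes "trig F" shows "\<exists>B. \<forall>x. norm (F x) \<le> B"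
  using assms
proof induction
  case (iexp \<theta>)
  show ?case by (rule exI[of _ 1]) simp
next
  case (add F G)
  then obtain A B where "\<forall>x. norm (F x) \<le> A" "\<forall>x. norm (G x) \<le> B" by blast
  then show ?case by (intro exI[of _ "A + B"]) (auto intro: norm_triangle_mono)
next
  case (scale F c)
  then obtain A where "\<forall>x. norm (F x) \<le> A" by blast
  then show ?case by (intro exI[of _ "norm c * A"]) (auto simp: norm_mult intro: mult_left_mono)
qed

lemma trig_sin: "trig (\<lambda>x. complex_of_real (sin (\<theta> * x)))"
proof -
  have "complex_of_real (sin (\<theta> * x)) = (- \<i> / 2) * iexp (\<theta> * x) + (\<i> / 2) * iexp ((- \<theta>) * x)" for x
    by (rule complex_eqI) (simp_all add: Re_exp Im_exp)
  then show ?thesis using trig.add[OF trig.scale[OF trig.iexp[of \<theta>], of "- \<i> / 2"] trig.scale[OF trig.iexp[of "- \<theta>"], of "\<i> / 2"]]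
    by simp
qed

lemma trig_polynomial:
  fixes q :: "real \<Rightarrow> real"
  assumes "real_polynomial_function q"
  shows "trig (\<lambda>x. complex_of_real (q (sin (\<theta> * x))))"
  using assms
proof induction
  case (linear h)
  then have "h y = y * h 1" for y using bounded_linear.linear[OF linear, THEN linear_scale, of y 1] by simp
  then have "complex_of_real (h (sin (\<theta> * x))) = complex_of_real (h 1) * complex_of_real (sin (\<theta> * x))" for x
    by (metis of_real_mult mult.commute)
  then show ?case using trig.scale[OF trig_sin, of "complex_of_real (h 1)" \<theta>] by simp
next
  case (const c) then show ?case by (rule trig_const)
next
  case (add f g) then show ?case using trig.add by simp
next
  case (mult f g) then show ?case using trig_mult by simp
qed

text \<open>Inside the sine the scale 1/sqrt n tends to 0, so periodicity does not interfere, while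
  the prefactor n makes the clamped quantity grow like sqrt n times x, which leaves [-1, 1] unless x
  = 0.\<close>

lemma clamp_sin_tendsto_sgn:
  fixes x :: real
  shows "(\<lambda>n. max (-1) (min 1 (real n * sin (inverse (sqrt (real n)) * x)))) \<longlonglongrightarrow> sgn x"
proof -
  \<comment> \<open>Taking n beyond x^2 keeps the argument of the sine in (0, 1], where sin y is at
    least y/2; taking n beyond 4/x^2 makes sqrt n times x at least 2, enough for the clamp to
    saturate.\<close>
  have pos: "\<forall>\<^sub>F n in sequentially. max (-1) (min 1 (real n * sin (inverse (sqrt (real n)) * x))) = 1" if x: "x > 0" for x :: real
    using eventually_ge_at_top[of "max 1 (max (nat \<lceil>x\<^sup>2\<rceil>) (nat \<lceil>4 / x\<^sup>2\<rceil>))"]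
  proof eventually_elim
    case (elim n)
    define s where "s = sqrt (real n)"
    have n: "real n \<ge> 1" "x\<^sup>2 \<le> real n" "4 / x\<^sup>2 \<le> real n" using elim by linarith+
    have s: "s > 0" "s * s = real n" using n by (simp_all add: s_def)
    have xs: "x \<le> s" unfolding s_def using n x by (intro real_le_rsqrt)
    have "4 \<le> real n * x\<^sup>2" using n(3) x by (simp add: field_simps)
    then have "2\<^sup>2 \<le> (s * x)\<^sup>2" by (simp add: power_mult_distrib power2_eq_square[of s] s(2))
    then have sx: "2 \<le> s * x" using s x by (intro power2_le_imp_le[of 2 "s * x"]) auto
    define y where "y = inverse s * x"
    have y: "0 < y" "y \<le> 1" using s x xs by (simp_all add: y_def field_simps)
    have "y / 2 \<le> sin y"
    proof -
      have "\<bar>sin y - (\<Sum>i<3. sin_coeff i * y ^ i)\<bar> \<le> inverse (fact 3) * \<bar>y\<bar> ^ 3" by (rule Maclaurin_sin_bound)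
      then have "\<bar>sin y - y\<bar> \<le> y^3 / 6" using y by (simp add: eval_nat_numeral sin_coeff_def)
      moreover have "y^3 \<le> y" using power_decreasing[of 1 3 y] y by simp
      ultimately show ?thesis using y by linarith
    qed
    then have "real n * (y / 2) \<le> real n * sin y" by (intro mult_left_mono) auto
    moreover have "real n * (y / 2) = s * x / 2"
    proof -
      have "real n * (y / 2) = (s * s) * (inverse s * x / 2)" unfolding y_def s(2) ..
      also have "\<dots> = s * x / 2" using s(1) by (simp add: field_simps)
      finally show ?thesis .
    qed
    ultimately have "1 \<le> real n * sin y" using sx by linarith
    then show ?case unfolding y_def s_def by (simp add: min_def max_def)
  qed
  show ?thesis
  proof (cases x "0::real" rule: linorder_cases)
    case greater
    then show ?thesis using tendsto_eventually[OF pos[OF greater]] by simp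
  next
    case less
    then have "0 < - x" by simp
    from pos[OF this] have "\<forall>\<^sub>F n in sequentially. max (-1) (min 1 (real n * sin (inverse (sqrt (real n)) * x))) = -1"
      by eventually_elim (auto simp: max_def min_def split: if_splits)
    then show ?thesis using less tendsto_eventually by simp
  qed simp
qed

text \<open>A polynomial close to the clamp on [-1, 1], evaluated at a sine, is a trigonometric
  polynomial. The bound 2 is the bound 1 of the clamp plus an approximation error of at most 1, and
  it supplies the domination.\<close>

lemma trig_approx_sgn:
  assumes e: "e > 0"
  obtains F :: "real \<Rightarrow> real" where "trig (\<lambda>x. complex_of_real (F x))" "F \<in> borel_measurable borel" "\<And>x. \<bar>F x\<bar> \<le> 2"
    "(LINT x|N1. (F x - sgn x)\<^sup>2) \<le> e"
proof -
  have "\<exists>q::real \<Rightarrow> real. real_polynomial_function q \<and> (\<forall>y\<in>{-1..1}. \<bar>max (-1) (min 1 (real n * y)) - q y\<bar> < 1 / real (Suc n))" for n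
    by (rule Stone_Weierstrass_real_polynomial_function[of "{-1..1::real}" "\<lambda>y. max (-1) (min 1 (real n * y))" "1 / real (Suc n)"])
       (auto intro!: continuous_intros)
  then obtain q :: "nat \<Rightarrow> real \<Rightarrow> real" where q: "\<And>n. real_polynomial_function (q n)"
      "\<And>n y. y \<in> {-1..1} \<Longrightarrow> \<bar>max (-1) (min 1 (real n * y)) - q n y\<bar> < 1 / real (Suc n)"
    by metis
  define F where "F n x = q n (sin (inverse (sqrt (real n)) * x))" for n x
  have tr: "trig (\<lambda>x. complex_of_real (F n x))" for n unfolding F_def by (rule trig_polynomial[OF q(1)])
  have Fm[measurable]: "F n \<in> borel_measurable borel" for n
  proof -
    have "(\<lambda>x. Re (complex_of_real (F n x))) \<in> borel_measurable borel" using trig_meas[OF tr[of n]] by measurable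
    then show ?thesis by simp
  qed
  have err: "\<bar>max (-1) (min 1 (real n * sin (inverse (sqrt (real n)) * x))) - F n x\<bar> \<le> 1 / real (Suc n)" for n x
    unfolding F_def by (rule less_imp_le, rule q(2)) simp
  have F2: "\<bar>F n x\<bar> \<le> 2" for n x
  proof -
    have "1 / real (Suc n) \<le> 1" by simp
    then show ?thesis using err[of n x] by linarith
  qed
  have lim: "(\<lambda>n. F n x) \<longlonglongrightarrow> sgn x" for x
  proof -
    have "(\<lambda>n. max (-1) (min 1 (real n * sin (inverse (sqrt (real n)) * x))) - F n x) \<longlonglongrightarrow> 0"
      by (rule Lim_null_comparison[OF _ LIMSEQ_Suc[OF lim_1_over_n]]) (use err in auto)
    from tendsto_diff[OF clamp_sin_tendsto_sgn[of x] this] show ?thesis by simp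
  qed
  have "(\<lambda>n. LINT x|N1. (F n x - sgn x)\<^sup>2) \<longlonglongrightarrow> (LINT x|N1. (0::real))"
  proof (rule integral_dominated_convergence[where w = "\<lambda>_. 9"])
    show "AE x in N1. (\<lambda>n. (F n x - sgn x)\<^sup>2) \<longlonglongrightarrow> 0"
    proof (rule AE_I2)
      fix x :: real
      have "(\<lambda>n. (F n x - sgn x)\<^sup>2) \<longlonglongrightarrow> (sgn x - sgn x)\<^sup>2" by (intro tendsto_intros lim)
      then show "(\<lambda>n. (F n x - sgn x)\<^sup>2) \<longlonglongrightarrow> 0" by simp
    qed
    show "AE x in N1. norm ((F n x - sgn x)\<^sup>2) \<le> 9" for n
    proof (rule AE_I2)
      fix x :: real
      have "\<bar>sgn x\<bar> \<le> 1" by (simp add: abs_sgn_eq)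
      then have "\<bar>F n x - sgn x\<bar> \<le> 3" using F2[of n x] by linarith
      then have "\<bar>F n x - sgn x\<bar>^2 \<le> 3^2" by (intro power_mono) auto
      then show "norm ((F n x - sgn x)\<^sup>2) \<le> 9" by simp
    qed
  qed auto
  then have "(\<lambda>n. LINT x|N1. (F n x - sgn x)\<^sup>2) \<longlonglongrightarrow> 0" by simp
  from order_tendstoD(2)[OF this e] obtain n where "(LINT x|N1. (F n x - sgn x)\<^sup>2) < e"
    unfolding eventually_sequentially by blast
  then show ?thesis by (intro that[OF tr[of n] Fm[of n] F2[of n]] less_imp_le)
qed

section \<open>Wiener's theorem with Gaussian averages\<close>

text \<open>Fubini with a weight that is integrable but may be unbounded, as the frequency itself is
  in the derivative of the covariance.\<close>

lemma weighted_integral_swap: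
  fixes g :: "'a \<Rightarrow> 'b \<Rightarrow> complex" and w :: "'b \<Rightarrow> real"
  assumes M1: "prob_space M1" and M2: "prob_space M2" and w: "integrable M2 w"
    and [measurable]: "(\<lambda>z. g (fst z) (snd z)) \<in> borel_measurable (M1 \<Otimes>\<^sub>M M2)"
    and g: "\<And>x y. norm (g x y) \<le> B"
  shows "(CLINT x|M1. CLINT y|M2. complex_of_real (w y) * g x y) = (CLINT y|M2. complex_of_real (w y) * (CLINT x|M1. g x y))"
proof -
  interpret M1: prob_space M1 by fact
  interpret M2: prob_space M2 by fact
  interpret P: pair_prob_space M1 M2 ..
  note [measurable] = borel_measurable_integrable[OF w]
  have m1: "(\<lambda>y. g x y) \<in> borel_measurable M2" if "x \<in> space M1" for x
    using measurable_compose[OF measurable_Pair1'[OF that, of M2], of "\<lambda>z. g (fst z) (snd z)" borel] by simp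
  have le: "norm (complex_of_real (w y) * g x y) \<le> \<bar>w y\<bar> * B" for x y
    unfolding norm_mult by (simp add: mult_left_mono g)
  have wB: "integrable M2 (\<lambda>y. \<bar>w y\<bar> * B)" using w by simp
  have iy: "integrable M2 (\<lambda>y. complex_of_real (w y) * g x y)" if "x \<in> space M1" for x
    using m1[OF that] by (intro norm_integral_le(1)[OF wB] le) measurable
  have "integrable (M1 \<Otimes>\<^sub>M M2) (\<lambda>z. complex_of_real (w (snd z)) * g (fst z) (snd z))"
  proof (rule P.Fubini_integrable)
    show "integrable M1 (\<lambda>x. LINT y|M2. norm (complex_of_real (w (snd (x, y))) * g (fst (x, y)) (snd (x, y))))"
    proof (rule M1.integrable_const_bound[of _ "LINT y|M2. \<bar>w y\<bar> * B"])
      show "AE x in M1. norm (LINT y|M2. norm (complex_of_real (w (snd (x, y))) * g (fst (x, y)) (snd (x, y)))) \<le> (LINT y|M2. \<bar>w y\<bar> * B)"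
      proof (rule AE_I2)
        fix x assume x: "x \<in> space M1"
        have "(LINT y|M2. norm (complex_of_real (w y) * g x y)) \<le> (LINT y|M2. \<bar>w y\<bar> * B)"
          by (rule integral_mono[OF integrable_norm[OF iy[OF x]] wB le])
        then show "norm (LINT y|M2. norm (complex_of_real (w (snd (x, y))) * g (fst (x, y)) (snd (x, y)))) \<le> (LINT y|M2. \<bar>w y\<bar> * B)"
          by simp
      qed
    qed measurable
    show "AE x in M1. integrable M2 (\<lambda>y. complex_of_real (w (snd (x, y))) * g (fst (x, y)) (snd (x, y)))"
      using iy by simp
  qed measurable
  then have "integrable (M1 \<Otimes>\<^sub>M M2) (case_prod (\<lambda>x y. complex_of_real (w y) * g x y))" by (simp add: case_prod_beta')
  from P.Fubini_integral[OF this] show ?thesis by (simp only: integral_mult_right_zero)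
qed

context spectral
begin

text \<open>The Fourier transform of the signed measure with density \<open>w\<close>; different
  weights give the covariance and its derivative.\<close>

definition ft :: "(real \<Rightarrow> real) \<Rightarrow> real \<Rightarrow> complex" where
  "ft w s = (CLINT l|\<rho>. complex_of_real (w l) * iexp (l * s))"

context
  fixes w :: "real \<Rightarrow> real"
  assumes w_meas[measurable]: "w \<in> borel_measurable borel" and w_int: "integrable \<rho> w"
begin

lemma ft_le: "norm (ft w s) \<le> (LINT l|\<rho>. \<bar>w l\<bar>)"
  unfolding ft_def by (rule norm_integral_le(2)) (use w_int in \<open>auto simp: norm_mult\<close>)

lemma ft_integrable: "integrable \<rho> (\<lambda>l. complex_of_real (w l) * iexp (l * s))"
  by (rule norm_integral_le(1)[OF integrable_abs[OF w_int]]) (auto simp: norm_mult)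

lemma ft_continuous: "continuous_on S (ft w)"
proof (rule continuous_at_imp_continuous_on, rule ballI, unfold continuous_at_sequentially o_def, intro allI impI)
  fix s and X :: "nat \<Rightarrow> real" assume X: "X \<longlonglongrightarrow> s"
  show "(\<lambda>n. ft w (X n)) \<longlonglongrightarrow> ft w s"
    unfolding ft_def
  proof (rule integral_dominated_convergence[where w = "\<lambda>l. \<bar>w l\<bar>"])
    show "AE l in \<rho>. (\<lambda>n. complex_of_real (w l) * iexp (l * X n)) \<longlonglongrightarrow> complex_of_real (w l) * iexp (l * s)"
      by (intro AE_I2 tendsto_intros X)
  qed (use w_int in \<open>auto simp: norm_mult\<close>)
qed

lemma ft_meas[measurable]: "ft w \<in> borel_measurable borel"
  by (rule borel_measurable_continuous_onI[OF ft_continuous])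

text \<open>Averaging the exponential of i (l - l') a x over a normal x produces the Gaussian
  factor, a smooth substitute for the indicator of l = l' when \<open>a\<close> is large.\<close>

definition "ft_kernel a l = (LINT l'|\<rho>. w l' * exp (- ((l - l') * a)\<^sup>2 / 2))"

lemma ft_kernel_le: "\<bar>ft_kernel a l\<bar> \<le> (LINT l|\<rho>. \<bar>w l\<bar>)"
proof -
  have "norm (LINT l'|\<rho>. w l' * exp (- ((l - l') * a)\<^sup>2 / 2)) \<le> (LINT l|\<rho>. \<bar>w l\<bar>)"
    by (rule norm_integral_le(2)[OF integrable_abs[OF w_int]]) (auto simp: abs_mult intro!: mult_left_le)
  then show ?thesis by (simp add: ft_kernel_def)
qed

text \<open>The squared modulus is a double spectral integral, and the Gaussian mean acts on the
  difference of the two frequencies.\<close>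

lemma ft_mean_square: "(LINT x|N1. (norm (ft w (a * x)))\<^sup>2) = (LINT l|\<rho>. w l * ft_kernel a l)"
proof -
  note [measurable_cong] = rho_sets
  have [measurable]: "cnj \<in> borel_measurable borel" by (intro borel_measurable_continuous_onI continuous_intros)
  have inner: "(CLINT x|N1. iexp (l * (a * x)) * cnj (ft w (a * x))) = complex_of_real (ft_kernel a l)" for l
  proof -
    have c: "iexp (l * (a * x)) * cnj (ft w (a * x)) = (CLINT l'|\<rho>. complex_of_real (w l') * iexp (((l - l') * a) * x))" for x
    proof -
      have "cnj (ft w (a * x)) = (CLINT l'|\<rho>. cnj (complex_of_real (w l') * iexp (l' * (a * x))))"
        unfolding ft_def by (rule Bochner_Integration.integral_cnj[symmetric])
      then have "iexp (l * (a * x)) * cnj (ft w (a * x)) = (CLINT l'|\<rho>. iexp (l * (a * x)) * cnj (complex_of_real (w l') * iexp (l' * (a * x))))"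
        by (simp only: integral_mult_right_zero)
      moreover have "iexp (l * (a * x)) * cnj (complex_of_real (w l') * iexp (l' * (a * x))) = complex_of_real (w l') * iexp (((l - l') * a) * x)" for l'
      proof -
        have "iexp (l * (a * x)) * cnj (iexp (l' * (a * x))) = iexp (((l - l') * a) * x)"
        proof -
          have "cnj (iexp u) = iexp (- u)" for u by (simp add: exp_cnj)
          then show ?thesis by (simp only: exp_add[symmetric]) (simp add: algebra_simps)
        qed
        then show ?thesis by (simp only: complex_cnj_mult complex_cnj_complex_of_real mult.left_commute)
      qed
      ultimately show ?thesis by (simp only:)
    qed
    have "(CLINT x|N1. CLINT l'|\<rho>. complex_of_real (w l') * iexp (((l - l') * a) * x)) =
        (CLINT l'|\<rho>. complex_of_real (w l') * (CLINT x|N1. iexp (((l - l') * a) * x)))"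
      by (rule weighted_integral_swap[OF N1.prob_space_axioms R.prob_space_axioms w_int, of _ 1]) auto
    also have "\<dots> = (CLINT l'|\<rho>. complex_of_real (w l' * exp (- ((l - l') * a)\<^sup>2 / 2)))"
      unfolding char_N1 by simp
    also have "\<dots> = complex_of_real (ft_kernel a l)" unfolding ft_kernel_def by (rule integral_complex_of_real)
    finally show ?thesis unfolding c .
  qed
  have "complex_of_real (LINT x|N1. (norm (ft w (a * x)))\<^sup>2) = (CLINT x|N1. ft w (a * x) * cnj (ft w (a * x)))"
    unfolding complex_norm_square[symmetric] of_real_power[symmetric] by (rule integral_complex_of_real[symmetric])
  also have "\<dots> = (CLINT x|N1. CLINT l|\<rho>. complex_of_real (w l) * (iexp (l * (a * x)) * cnj (ft w (a * x))))"
  proof -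
    have "ft w (a * x) * cnj (ft w (a * x)) = (CLINT l|\<rho>. complex_of_real (w l) * iexp (l * (a * x)) * cnj (ft w (a * x)))" for x
      unfolding integral_mult_left_zero ft_def ..
    then show ?thesis by (simp only: mult.assoc)
  qed
  also have "\<dots> = (CLINT l|\<rho>. complex_of_real (w l) * (CLINT x|N1. iexp (l * (a * x)) * cnj (ft w (a * x))))"
    by (rule weighted_integral_swap[OF N1.prob_space_axioms R.prob_space_axioms w_int, of _ "LINT l|\<rho>. \<bar>w l\<bar>"])
       (use ft_le in \<open>auto simp: norm_mult\<close>)
  also have "\<dots> = complex_of_real (LINT l|\<rho>. w l * ft_kernel a l)"
    unfolding inner of_real_mult[symmetric] by (rule integral_complex_of_real)
  finally show ?thesis by (simp only: of_real_eq_iff)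
qed

text \<open>Off the diagonal the Gaussian factor tends to 0, so only the mass at \<open>l\<close>
  itself survives.\<close>

lemma ft_kernel_tendsto:
  assumes a: "filterlim a at_top sequentially"
  shows "(\<lambda>n. ft_kernel (a n) l) \<longlonglongrightarrow> w l * measure \<rho> {l}"
proof -
  note [measurable_cong] = rho_sets
  have "(\<lambda>n. ft_kernel (a n) l) \<longlonglongrightarrow> (LINT l'|\<rho>. w l' * indicator {l} l')"
    unfolding ft_kernel_def
  proof (rule integral_dominated_convergence[where w = "\<lambda>l. \<bar>w l\<bar>"])
    show "AE l' in \<rho>. (\<lambda>n. w l' * exp (- ((l - l') * a n)\<^sup>2 / 2)) \<longlonglongrightarrow> w l' * indicator {l} l'"
    proof (rule AE_I2, rule tendsto_mult_left)
      fix l' :: real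
      show "(\<lambda>n. exp (- ((l - l') * a n)\<^sup>2 / 2)) \<longlonglongrightarrow> indicator {l} l'"
      proof (cases "l' = l")
        case False
        have "filterlim (\<lambda>n. (l - l')\<^sup>2 / 2 * (a n)^2) at_top sequentially"
          by (rule filterlim_tendsto_pos_mult_at_top[OF tendsto_const _ filterlim_pow_at_top[OF _ a]]) (use False in auto)
        then have "filterlim (\<lambda>n. - ((l - l')\<^sup>2 / 2 * (a n)^2)) at_bot sequentially"
          by (simp add: filterlim_uminus_at_bot)
        then have "(\<lambda>n. exp (- ((l - l')\<^sup>2 / 2 * (a n)^2))) \<longlonglongrightarrow> 0" by (rule filterlim_compose[OF exp_at_bot])
        then show ?thesis using False by (simp add: power_mult_distrib)
      qed simp
    qed
  qed (use w_int in \<open>auto simp: abs_mult intro!: mult_left_le\<close>)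
  moreover have "(LINT l'|\<rho>. w l' * indicator {l} l') = (LINT l'|\<rho>. w l * indicator {l} l')"
    by (intro Bochner_Integration.integral_cong) (auto split: split_indicator)
  moreover have "(LINT l'|\<rho>. w l * indicator {l} l') = w l * measure \<rho> {l}" by (simp add: sets_eq_imp_space_eq[OF rho_sets])
  ultimately show ?thesis by simp
qed

text \<open>A form of Wiener's theorem on the continuous part of a measure, with Gaussian averages.\<close>

lemma ft_mean_tendsto_0:
  assumes a: "filterlim a at_top sequentially" and atom: "\<And>l. w l = 0 \<or> measure \<rho> {l} = 0"
  shows "(\<lambda>n. LINT x|N1. norm (ft w (a n * x))) \<longlonglongrightarrow> 0"
proof -
  note [measurable_cong] = rho_sets
  have [measurable]: "ft_kernel b \<in> borel_measurable borel" for b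
    unfolding ft_kernel_def[abs_def] by measurable
  have "(\<lambda>n. LINT l|\<rho>. w l * ft_kernel (a n) l) \<longlonglongrightarrow> (LINT l|\<rho>. 0)"
  proof (rule integral_dominated_convergence[where w = "\<lambda>l. \<bar>w l\<bar> * (LINT l|\<rho>. \<bar>w l\<bar>)"])
    show "AE l in \<rho>. (\<lambda>n. w l * ft_kernel (a n) l) \<longlonglongrightarrow> 0"
    proof (rule AE_I2)
      fix l
      have "(\<lambda>n. w l * ft_kernel (a n) l) \<longlonglongrightarrow> w l * (w l * measure \<rho> {l})" by (rule tendsto_mult_left[OF ft_kernel_tendsto[OF a]])
      then show "(\<lambda>n. w l * ft_kernel (a n) l) \<longlonglongrightarrow> 0" using atom[of l] by auto
    qed
    show "AE l in \<rho>. norm (w l * ft_kernel (a n) l) \<le> \<bar>w l\<bar> * (LINT l|\<rho>. \<bar>w l\<bar>)" for n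
      using ft_kernel_le by (auto simp: abs_mult intro!: mult_left_mono)
  qed (use w_int in auto)
  then have "(\<lambda>n. sqrt (LINT x|N1. (norm (ft w (a n * x)))\<^sup>2)) \<longlonglongrightarrow> sqrt 0"
    unfolding ft_mean_square by (intro tendsto_real_sqrt) simp
  then have s: "(\<lambda>n. sqrt (LINT x|N1. (norm (ft w (a n * x)))\<^sup>2)) \<longlonglongrightarrow> 0" by simp
  show ?thesis
  proof (rule Lim_null_comparison[OF _ s], rule always_eventually, rule allI)
    fix n
    define B where "B = (LINT l|\<rho>. \<bar>w l\<bar>)"
    define X where "X x = norm (ft w (a n * x))" for x
    have [measurable]: "X \<in> borel_measurable borel" unfolding X_def[abs_def] by measurable
    have X: "0 \<le> X x" "X x \<le> B" for x using ft_le by (simp_all add: X_def B_def)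
    have X2: "(X x)\<^sup>2 \<le> B\<^sup>2" for x using X by (intro power_mono) auto
    have i: "integrable N1 X" by (rule N1.integrable_const_bound[of _ B]) (use X in auto)
    have i2: "integrable N1 (\<lambda>x. (X x)\<^sup>2)" by (rule N1.integrable_const_bound[of _ "B\<^sup>2"]) (use X2 in auto)
    have "0 \<le> (LINT x|N1. (X x)\<^sup>2) - (LINT x|N1. X x)\<^sup>2"
      using N1.variance_eq[OF i i2] N1.variance_positive[of X] by simp
    then have "(LINT x|N1. X x) \<le> sqrt (LINT x|N1. (X x)\<^sup>2)" by (intro real_le_rsqrt) simp
    moreover have "0 \<le> (LINT x|N1. X x)" using X by simp
    ultimately show "norm (LINT x|N1. norm (ft w (a n * x))) \<le> sqrt (LINT x|N1. (norm (ft w (a n * x)))\<^sup>2)"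
      unfolding X_def by simp
  qed
qed

text \<open>After rescaling time by \<open>T\<close> the window lies in [-2, 1], where the normal
  density is at least its value at 2. Flat averages over windows shifted by at most
  \<open>2 * T\<close> are thus dominated by the Gaussian average.\<close>

lemma ft_window_le:
  assumes T: "T > 0" and b: "0 \<le> b" "b \<le> 2 * T"
  shows "integral {0..T} (\<lambda>s. norm (ft w (s - b))) \<le> T / std_normal_density 2 * (LINT x|N1. norm (ft w (T * x)))"
proof -
  define B where "B = (LINT l|\<rho>. \<bar>w l\<bar>)"
  have w: "norm (ft w x) \<le> B" for x unfolding B_def by (rule ft_le)
  have "continuous_on {0..T} (\<lambda>s. norm (ft w (s - b)))"
    by (intro continuous_on_norm continuous_on_compose2[OF ft_continuous[of UNIV]] continuous_intros) auto
  then have si: "set_integrable lborel {0..T} (\<lambda>s. norm (ft w (s - b)))" by (rule borel_integrable_atLeastAtMost')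
  have "integral {0..T} (\<lambda>s. norm (ft w (s - b))) = (LBINT s. indicator {0..T} s * norm (ft w (s - b)))"
    using set_borel_integral_eq_integral(2)[OF si] by (simp add: set_lebesgue_integral_def)
  also have "\<dots> = T * (LBINT x. indicator {0..T} (b + T * x) * norm (ft w (T * x)))"
    using T lborel_integral_real_affine[of T "\<lambda>s. indicator {0..T} s * norm (ft w (s - b))" b] by simp
  also have "(LBINT x. indicator {0..T} (b + T * x) * norm (ft w (T * x))) \<le> (LBINT x. std_normal_density x * norm (ft w (T * x)) / std_normal_density 2)"
  proof (rule order_trans[OF abs_ge_self], unfold real_norm_def[symmetric], rule norm_integral_le(2))
    have "integrable N1 (\<lambda>x. norm (ft w (T * x)))" by (rule N1.integrable_const_bound[of _ B]) (use w in auto)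
    then show "integrable lborel (\<lambda>x. std_normal_density x * norm (ft w (T * x)) / std_normal_density 2)"
      by (subst (asm) integrable_density) auto
    fix x :: real
    have "indicator {0..T} (b + T * x) \<le> std_normal_density x / std_normal_density 2"
    proof (cases "b + T * x \<in> {0..T}")
      case True
      then have "T * x \<le> T * 1" "T * (-2) \<le> T * x" using b by auto
      then have "x \<le> 1" "-2 \<le> x" using T by (simp_all only: mult_le_cancel_left_pos)
      then have "x\<^sup>2 \<le> 2\<^sup>2" by (intro abs_le_square_iff[THEN iffD1]) auto
      then have "std_normal_density 2 \<le> std_normal_density x" by (simp add: std_normal_density_def divide_right_mono)
      moreover have "std_normal_density 2 > 0" by (rule normal_density_pos) simp
      ultimately show ?thesis using True by (simp add: field_simps)
    qed simp
    from mult_right_mono[OF this norm_ge_zero, of "ft w (T * x)"]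
    show "norm (indicator {0..T} (b + T * x) * norm (ft w (T * x))) \<le> std_normal_density x * norm (ft w (T * x)) / std_normal_density 2"
      by simp
  qed simp
  also have "\<dots> = (LINT x|N1. norm (ft w (T * x))) / std_normal_density 2"
    by (simp add: integral_density)
  finally show ?thesis using T by simp
qed

end

end

section \<open>Expansion of the Kac--Rice density; upper and lower variance bounds\<close>

lemma (in prob_space) Cauchy_Schwarz_expectation:
  fixes X Y :: "'a \<Rightarrow> real"
  assumes [measurable]: "X \<in> borel_measurable M" "Y \<in> borel_measurable M"
    and X: "integrable M (\<lambda>\<omega>. (X \<omega>)\<^sup>2)" and Y: "integrable M (\<lambda>\<omega>. (Y \<omega>)\<^sup>2)"
  shows "integrable M (\<lambda>\<omega>. X \<omega> * Y \<omega>)"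
    "\<bar>expectation (\<lambda>\<omega>. X \<omega> * Y \<omega>)\<bar> \<le> sqrt (expectation (\<lambda>\<omega>. (X \<omega>)\<^sup>2)) * sqrt (expectation (\<lambda>\<omega>. (Y \<omega>)\<^sup>2))"
proof -
  show XY: "integrable M (\<lambda>\<omega>. X \<omega> * Y \<omega>)"
  proof (rule norm_integral_le(1))
    show "integrable M (\<lambda>\<omega>. (X \<omega>)\<^sup>2 + (Y \<omega>)\<^sup>2)" using X Y by (rule Bochner_Integration.integrable_add)
    fix \<omega>
    have "2 * (\<bar>X \<omega>\<bar> * \<bar>Y \<omega>\<bar>) \<le> (X \<omega>)\<^sup>2 + (Y \<omega>)\<^sup>2" using sum_squares_bound[of "\<bar>X \<omega>\<bar>" "\<bar>Y \<omega>\<bar>"] by simp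
    moreover have "0 \<le> \<bar>X \<omega>\<bar> * \<bar>Y \<omega>\<bar>" by simp
    ultimately show "norm (X \<omega> * Y \<omega>) \<le> (X \<omega>)\<^sup>2 + (Y \<omega>)\<^sup>2" unfolding real_norm_def abs_mult by linarith
  qed measurable
  define A B c where "A = expectation (\<lambda>\<omega>. (X \<omega>)\<^sup>2)" and "B = expectation (\<lambda>\<omega>. (Y \<omega>)\<^sup>2)" and "c = expectation (\<lambda>\<omega>. X \<omega> * Y \<omega>)"
  have q: "0 \<le> a\<^sup>2 * A - 2 * a * b * c + b\<^sup>2 * B" for a b
  proof -
    have "0 \<le> expectation (\<lambda>\<omega>. (a * X \<omega> - b * Y \<omega>)\<^sup>2)" by simp
    also have "(\<lambda>\<omega>. (a * X \<omega> - b * Y \<omega>)\<^sup>2) = (\<lambda>\<omega>. a\<^sup>2 * (X \<omega>)\<^sup>2 - (2 * a * b) * (X \<omega> * Y \<omega>) + b\<^sup>2 * (Y \<omega>)\<^sup>2)"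
      by (auto simp: power2_eq_square algebra_simps)
    also have "expectation \<dots> = a\<^sup>2 * A - 2 * a * b * c + b\<^sup>2 * B"
      using X Y XY by (simp add: A_def B_def c_def)
    finally show ?thesis .
  qed
  have AB: "0 \<le> A" "0 \<le> B" by (auto simp: A_def B_def)
  have "c\<^sup>2 \<le> A * B"
  proof (cases "B = 0")
    case True
    have "c = 0"
    proof (rule ccontr)
      assume "c \<noteq> 0"
      then show False using q[of 1 "(A + 1) / (2 * c)"] True by simp
    qed
    then show ?thesis using True by simp
  next
    case False
    then have "0 < B" using AB by simp
    moreover have "0 \<le> B * (A * B - c\<^sup>2)" using q[of B c] by (simp add: power2_eq_square algebra_simps)
    ultimately show ?thesis by (simp add: zero_le_mult_iff)
  qed
  then have "sqrt (c\<^sup>2) \<le> sqrt (A * B)" by (rule real_sqrt_le_mono)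
  then show "\<bar>expectation (\<lambda>\<omega>. X \<omega> * Y \<omega>)\<bar> \<le> sqrt (expectation (\<lambda>\<omega>. (X \<omega>)\<^sup>2)) * sqrt (expectation (\<lambda>\<omega>. (Y \<omega>)\<^sup>2))"
    by (simp add: real_sqrt_mult A_def B_def c_def)
qed

lemma (in prob_space) norm_expectation_bounded_mult:
  fixes F :: "'a \<Rightarrow> complex"
  assumes [measurable]: "X \<in> borel_measurable M" "F \<in> borel_measurable M"
    and X: "integrable M (\<lambda>\<omega>. (X \<omega>)\<^sup>2)" and F: "\<And>\<omega>. norm (F \<omega>) \<le> B"
  shows "norm (CLINT \<omega>|M. complex_of_real (X \<omega>) * F \<omega>) \<le> B * sqrt (expectation (\<lambda>\<omega>. (X \<omega>)\<^sup>2))"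
proof -
  have B: "0 \<le> B" using order_trans[OF norm_ge_zero F] by blast
  have X1: "integrable M X" by (rule square_integrable_imp_integrable[OF _ X]) measurable
  have "norm (CLINT \<omega>|M. complex_of_real (X \<omega>) * F \<omega>) \<le> (LINT \<omega>|M. B * \<bar>X \<omega>\<bar>)"
  proof (rule norm_integral_le(2))
    show "integrable M (\<lambda>\<omega>. B * \<bar>X \<omega>\<bar>)" using X1 by (intro integrable_mult_right integrable_abs)
    show "norm (complex_of_real (X \<omega>) * F \<omega>) \<le> B * \<bar>X \<omega>\<bar>" for \<omega>
      using mult_right_mono[OF F, of "\<bar>X \<omega>\<bar>"] by (simp add: norm_mult mult.commute)
  qed measurable
  also have "\<dots> = B * expectation (\<lambda>\<omega>. \<bar>X \<omega>\<bar>)" by (rule integral_mult_right_zero)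
  also have "\<dots> \<le> B * sqrt (expectation (\<lambda>\<omega>. (X \<omega>)\<^sup>2))"
  proof (rule mult_left_mono[OF _ B])
    show "expectation (\<lambda>\<omega>. \<bar>X \<omega>\<bar>) \<le> sqrt (expectation (\<lambda>\<omega>. (X \<omega>)\<^sup>2))"
      using Cauchy_Schwarz_expectation(2)[of "\<lambda>\<omega>. \<bar>X \<omega>\<bar>" "\<lambda>_. 1"] X prob_space by (simp add: abs_le_iff)
  qed
  finally show ?thesis .
qed

lemma N1_moment_4: "integrable N1 (\<lambda>y. y^4)" "(LINT y|N1. y^4) = 3"
  using integrable_std_normal_distribution_moment[of 4] std_normal_distribution_even_moments(1)[of 2]
  by (simp_all add: fact_numeral)

text \<open>Second-order expansion of the cosine: the third absolute moment is twice the first, and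
  the fourth moment 3 controls the error.\<close>

lemma ell_expansion: "\<bar>ell b * sqrt (pi/2) - (1 - b\<^sup>2)\<bar> \<le> \<bar>b\<bar>^3"
proof -
  have p4: "z * z^3 = z^4" for z :: real by (simp add: eval_nat_numeral)
  have i: "integrable N1 (\<lambda>y. \<bar>y\<bar>)" "integrable N1 (\<lambda>y. \<bar>y\<bar>^3)" using N1_abs_moment[of 1] N1_abs_moment[of 3] by simp_all
  have "sqrt (2/pi) * (1 - b\<^sup>2) = (LINT y|N1. \<bar>y\<bar> - b\<^sup>2 / 2 * \<bar>y\<bar>^3)"
    using i by (simp add: N1_abs_moments algebra_simps)
  then have "ell b - sqrt (2/pi) * (1 - b\<^sup>2) = (LINT y|N1. \<bar>y\<bar> * cos (b * y) - (\<bar>y\<bar> - b\<^sup>2 / 2 * \<bar>y\<bar>^3))"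
    unfolding ell_def using i integrable_abs_cos by simp
  also have "norm \<dots> \<le> (LINT y|N1. \<bar>b\<bar>^3 / 6 * y^4)"
  proof (rule norm_integral_le(2))
    show "integrable N1 (\<lambda>y. \<bar>b\<bar>^3 / 6 * y^4)" using N1_moment_4(1) by (rule integrable_mult_right)
    fix y :: real
    have "\<bar>y\<bar> * cos (b * y) - (\<bar>y\<bar> - b\<^sup>2 / 2 * \<bar>y\<bar>^3) = \<bar>y\<bar> * (cos (b * y) - (1 - (b * y)\<^sup>2 / 2))"
      by (simp add: power_mult_distrib algebra_simps power2_eq_square power3_eq_cube)
    then have "norm (\<bar>y\<bar> * cos (b * y) - (\<bar>y\<bar> - b\<^sup>2 / 2 * \<bar>y\<bar>^3)) = \<bar>y\<bar> * \<bar>cos (b * y) - (1 - (b * y)\<^sup>2 / 2)\<bar>"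
      by (simp add: abs_mult)
    also have "\<dots> \<le> \<bar>y\<bar> * (\<bar>b * y\<bar>^3 / 6)" by (intro mult_left_mono cos_second_order) simp
    also have "\<dots> = \<bar>b\<bar>^3 / 6 * (\<bar>y\<bar> * \<bar>y\<bar>^3)"
      unfolding abs_mult power_mult_distrib by (simp only: times_divide_eq_right times_divide_eq_left mult_ac)
    also have "\<bar>y\<bar> * \<bar>y\<bar>^3 = \<bar>y\<bar>^4" by (rule p4)
    finally show "norm (\<bar>y\<bar> * cos (b * y) - (\<bar>y\<bar> - b\<^sup>2 / 2 * \<bar>y\<bar>^3)) \<le> \<bar>b\<bar>^3 / 6 * y^4" by simp
  qed measurable
  also have "\<dots> = \<bar>b\<bar>^3 / 2" unfolding integral_mult_right_zero N1_moment_4(2) by simp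
  finally have e: "\<bar>ell b - sqrt (2/pi) * (1 - b\<^sup>2)\<bar> \<le> \<bar>b\<bar>^3 / 2" by simp
  have s2: "sqrt (pi/2) \<le> 2" "0 \<le> sqrt (pi/2)" using pi_less_4 by (auto intro!: real_le_lsqrt)
  have "sqrt (2/pi) * sqrt (pi/2) = sqrt ((2/pi) * (pi/2))" by (rule real_sqrt_mult[symmetric])
  then have q: "sqrt (2/pi) * sqrt (pi/2) = 1" by simp
  have "ell b * sqrt (pi/2) - (1 - b\<^sup>2) = ell b * sqrt (pi/2) - (sqrt (2/pi) * sqrt (pi/2)) * (1 - b\<^sup>2)" unfolding q by simp
  also have "\<dots> = (ell b - sqrt (2/pi) * (1 - b\<^sup>2)) * sqrt (pi/2)" by (simp only: left_diff_distrib right_diff_distrib mult_ac)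
  finally have "\<bar>ell b * sqrt (pi/2) - (1 - b\<^sup>2)\<bar> = \<bar>ell b - sqrt (2/pi) * (1 - b\<^sup>2)\<bar> * sqrt (pi/2)"
    using s2 by (simp only: abs_mult abs_of_nonneg)
  also have "\<dots> \<le> (\<bar>b\<bar>^3 / 2) * 2" using e s2 by (intro mult_mono) auto
  finally show ?thesis by simp
qed

text \<open>The exponential contributes (a^2 + b^2)/2 and \<open>ell\<close> contributes -b^2; the
  reversed sign of the b^2 term is what makes \<sigma> the critical frequency. In the constant 5,
  the errors of \<open>ell\<close>, of the exponential and of multiplying the two quadratic terms
  account for 2, 2 and 1.\<close>

lemma kr_density_expansion:
  assumes k: "0 \<le> k" "k \<le> 1" and a: "\<bar>a\<bar> \<le> k" and b: "\<bar>b\<bar> \<le> k"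
  shows "\<bar>kr_density a b - 1 - (a\<^sup>2 - b\<^sup>2) / 2\<bar> \<le> 5 * k^3"
proof -
  define x where "x = (a\<^sup>2 + b\<^sup>2) / 2"
  define \<theta> where "\<theta> = ell b * sqrt (pi/2) - (1 - b\<^sup>2)"
  define \<eta> where "\<eta> = exp x - 1 - x"
  have a2: "a\<^sup>2 \<le> k\<^sup>2" and b2: "b\<^sup>2 \<le> k\<^sup>2" using power_mono[OF a, of 2] power_mono[OF b, of 2] by simp_all
  have k2: "k\<^sup>2 \<le> 1" using k power_le_one by blast
  have k34: "k^4 \<le> k^3" using k by (intro power_decreasing) auto
  have k31: "k^3 \<le> 1" "0 \<le> k^3" using k power_le_one by auto
  have x: "0 \<le> x" "x \<le> k\<^sup>2" "x \<le> 1" using a2 b2 k2 by (auto simp: x_def)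
  have x4: "x\<^sup>2 \<le> k^4"
  proof -
    have "x\<^sup>2 \<le> (k\<^sup>2)\<^sup>2" using x by (intro power_mono) auto
    then show ?thesis by simp
  qed
  have \<theta>: "\<bar>\<theta>\<bar> \<le> k^3"
  proof -
    have "\<bar>\<theta>\<bar> \<le> \<bar>b\<bar>^3" unfolding \<theta>_def by (rule ell_expansion)
    also have "\<dots> \<le> k^3" using b by (intro power_mono) auto
    finally show ?thesis .
  qed
  have \<eta>: "\<bar>\<eta>\<bar> \<le> k^3" using exp_bound[OF x(1) x(3)] exp_ge_add_one_self[of x] x4 k34 unfolding \<eta>_def by linarith
  have "kr_density a b = exp x * (ell b * sqrt (pi/2))" by (simp add: kr_density_def x_def)
  also have "\<dots> = (1 + x + \<eta>) * (1 - b\<^sup>2 + \<theta>)" by (simp add: \<eta>_def \<theta>_def)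
  finally have "kr_density a b - 1 - (a\<^sup>2 - b\<^sup>2) / 2 = (1 + x) * \<theta> + \<eta> * (1 - b\<^sup>2 + \<theta>) - x * b\<^sup>2"
    by (simp add: x_def field_simps)
  also have "\<bar>\<dots>\<bar> \<le> \<bar>(1 + x) * \<theta>\<bar> + \<bar>\<eta> * (1 - b\<^sup>2 + \<theta>)\<bar> + \<bar>x * b\<^sup>2\<bar>" by linarith
  also have "\<dots> \<le> 2 * k^3 + k^3 * 2 + k^3"
  proof (intro add_mono)
    show "\<bar>(1 + x) * \<theta>\<bar> \<le> 2 * k^3" unfolding abs_mult using x \<theta> by (intro mult_mono) auto
    have "\<bar>1 - b\<^sup>2 + \<theta>\<bar> \<le> 2" using b2 k2 \<theta> k31 zero_le_power2[of b] by linarith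
    then show "\<bar>\<eta> * (1 - b\<^sup>2 + \<theta>)\<bar> \<le> k^3 * 2" unfolding abs_mult using \<eta> k by (intro mult_mono) auto
    have "x * b\<^sup>2 \<le> k\<^sup>2 * k\<^sup>2" using x b2 by (intro mult_mono) auto
    also have "\<dots> = k^4" by (simp add: power2_eq_square eval_nat_numeral)
    finally show "\<bar>x * b\<^sup>2\<bar> \<le> k^3" using x k34 by simp
  qed
  finally show ?thesis by simp
qed

text \<open>The sampling times have spacing 1/q and total length q^2: the spacing tends to 0, which
  excludes aliasing for any fixed nonzero x, and the length tends to infinity, which makes the mean
  of the geometric sum negligible.\<close>

lemma fejer_mean_tendsto:
  fixes x :: real
  shows "(\<lambda>q. (1 / of_nat (q^3)) * (\<Sum>k<q^3. iexp (x * (real k / real q)))) \<longlonglongrightarrow> (if x = 0 then 1 else 0)"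
proof (cases "x = 0")
  case True
  have "\<forall>\<^sub>F q in sequentially. (1 / of_nat (q^3)) * (\<Sum>k<q^3. iexp (x * (real k / real q))) = 1"
    using eventually_gt_at_top[of 0] by eventually_elim (simp add: True)
  then show ?thesis using True by (auto intro: tendsto_eventually)
next
  case False
  have l0: "(\<lambda>q. (4 / \<bar>x\<bar>) * inverse (real q)) \<longlonglongrightarrow> 0"
    by (rule tendsto_mult_right_zero) (rule lim_inverse_n)
  have "\<forall>\<^sub>F q in sequentially. norm ((1 / of_nat (q^3)) * (\<Sum>k<q^3. iexp (x * (real k / real q)))) \<le> (4 / \<bar>x\<bar>) * inverse (real q)"
    using eventually_ge_at_top[of "max 1 (nat \<lceil>\<bar>x\<bar>\<rceil>)"]
  proof eventually_elim
    case (elim q)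
    have q: "real q \<ge> 1" "\<bar>x\<bar> \<le> real q" using elim by linarith+
    define y where "y = x / real q"
    have y: "\<bar>y\<bar> \<le> 1" "0 < \<bar>y\<bar>" using q False by (auto simp: y_def)
    have "cmod (iexp y - 1 - \<i> * of_real y) \<le> y\<^sup>2 / 2" by (rule iexp_first_order)
    moreover have "y\<^sup>2 \<le> \<bar>y\<bar>"
    proof -
      have "\<bar>y\<bar> * \<bar>y\<bar> \<le> \<bar>y\<bar> * 1" using y by (intro mult_left_mono) auto
      then show ?thesis by (simp add: power2_eq_square)
    qed
    moreover have "cmod (\<i> * of_real y) \<le> cmod (iexp y - 1) + cmod (iexp y - 1 - \<i> * of_real y)"
      using norm_triangle_ineq4[of "iexp y - 1" "iexp y - 1 - \<i> * of_real y"] by simp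
    ultimately have lb: "\<bar>y\<bar> / 2 \<le> cmod (iexp y - 1)" by (simp add: norm_mult)
    then have ne: "iexp y \<noteq> 1" using y by auto
    have "(\<Sum>k<q^3. iexp (x * (real k / real q))) = (\<Sum>k<q^3. iexp y ^ k)"
      by (intro sum.cong refl) (simp add: y_def exp_of_nat_mult[symmetric] mult_ac)
    also have "\<dots> = (iexp y ^ (q^3) - 1) / (iexp y - 1)" using ne by (rule geometric_sum)
    finally have "norm (\<Sum>k<q^3. iexp (x * (real k / real q))) = norm (iexp y ^ (q^3) - 1) / cmod (iexp y - 1)"
      by (simp only: norm_divide)
    also have "\<dots> \<le> 2 / (\<bar>y\<bar> / 2)"
    proof (rule frac_le)
      have "norm (iexp y ^ (q^3) - 1) \<le> norm (iexp y ^ (q^3)) + norm (1::complex)" by (rule norm_triangle_ineq4)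
      then show "norm (iexp y ^ (q^3) - 1) \<le> 2" by (simp add: norm_power)
    qed (use lb y in auto)
    finally have s: "norm (\<Sum>k<q^3. iexp (x * (real k / real q))) \<le> 4 * real q / \<bar>x\<bar>" using q by (simp add: y_def)
    have "norm ((1 / of_nat (q^3)) * (\<Sum>k<q^3. iexp (x * (real k / real q)))) \<le> (1 / real q^3) * (4 * real q / \<bar>x\<bar>)"
      unfolding norm_mult using s q by (intro mult_mono) (auto simp: norm_divide norm_power)
    also have "\<dots> = (4 / \<bar>x\<bar>) * (inverse (real q) * inverse (real q))" using q by (simp add: field_simps eval_nat_numeral)
    also have "\<dots> \<le> (4 / \<bar>x\<bar>) * (inverse (real q) * 1)"
      using q by (intro mult_left_mono) (auto simp: inverse_le_1_iff)
    finally show ?case by simp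
  qed
  then show ?thesis using Lim_null_comparison[OF _ l0] False by simp
qed

lemma fejer_mean_bound:
  "norm ((1 / of_nat (q^3)) * (\<Sum>k<q^3. iexp (x * (real k / real q)))) \<le> 1"
proof -
  have "norm (\<Sum>k<q^3. iexp (x * (real k / real q))) \<le> (\<Sum>k<q^3. 1)" by (intro sum_norm_le) simp
  then have "norm (\<Sum>k<q^3. iexp (x * (real k / real q))) \<le> real (q^3)" by simp
  then show ?thesis by (cases "q = 0") (simp_all add: norm_mult norm_divide norm_power field_simps)
qed

context stat_gauss
begin

lemma zero_count_integrable:
  assumes p: "0 < p" "p \<le> \<delta>\<^sub>0"
  shows "integrable M (zero_count f (real K * p))"
  by (rule square_integrable_imp_integrable[OF zero_count_meas zero_count_second_moment(1)[OF p]])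

text \<open>Rice's formula, as the weighted formula for the empty linear combination.\<close>

lemma mean_zero_count:
  assumes p: "0 < p" "p \<le> \<delta>\<^sub>0"
  shows "expectation (zero_count f (real K * p)) = \<sigma> / pi * (real K * p)"
proof -
  let ?c = "\<lambda>_::nat. 0::real"
  have C: "(\<Sum>i\<in>{}. \<bar>?c i\<bar>) \<le> (0::real)" by simp
  note fc = finite.emptyI[where 'a=nat] C
  have z: "zf {} ?c ?c = (\<lambda>_. 0)" unfolding zf_def[OF fc] by simp
  have k: "kd {} ?c ?c s = 1" for s unfolding kd_def[OF fc] \<alpha>f_def \<beta>f_def by (simp add: kr_density_0)
  have "(CLINT \<omega>|M. complex_of_real (zero_count f (real K * p) \<omega>) * iexp 0) = complex_of_real (\<sigma> / pi * (real K * p))"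
    using weighted_kac_rice[OF fc p, of K ?c] p unfolding z k cov_zero by simp
  then have "complex_of_real (expectation (zero_count f (real K * p))) = complex_of_real (\<sigma> / pi * (real K * p))" by simp
  then show ?thesis by (simp only: of_real_eq_iff)
qed

definition dev :: "real \<Rightarrow> 'a \<Rightarrow> real" where
  "dev T \<omega> = zero_count f T \<omega> - expectation (zero_count f T)"

lemma dev_meas[measurable]: "dev T \<in> borel_measurable M" unfolding dev_def[abs_def] by measurable

lemma kd_continuous:
  assumes "finite I" "(\<Sum>i\<in>I. \<bar>c i\<bar>) \<le> C" shows "continuous_on S (kd I c t)"
proof (rule lipschitz_on_continuous_on)
  show "(2 * exp (C\<^sup>2) * (C + 1) * (2 * C * \<sigma>))-lipschitz_on S (kd I c t)"
    using kd_lipschitz[OF assms] C_nonneg[OF assms] sigma_pos by (intro lipschitz_onI) (auto simp: dist_real_def)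
qed

lemma dev_L2:
  assumes p: "0 < p" "p \<le> \<delta>\<^sub>0"
  shows "integrable M (\<lambda>\<omega>. (dev (real K * p) \<omega>)\<^sup>2)" "expectation (\<lambda>\<omega>. (dev (real K * p) \<omega>)\<^sup>2) \<le> (real K)\<^sup>2 * B\<^sub>0"
    "expectation (dev (real K * p)) = 0"
proof -
  let ?N = "zero_count f (real K * p)"
  note i = zero_count_integrable[OF p, of K] zero_count_second_moment[OF p, of K]
  have e: "(\<lambda>\<omega>. (dev (real K * p) \<omega>)\<^sup>2) = (\<lambda>\<omega>. (?N \<omega>)\<^sup>2 - (2 * expectation ?N) * ?N \<omega> + (expectation ?N)\<^sup>2)"
    by (auto simp: dev_def power2_diff)
  show "integrable M (\<lambda>\<omega>. (dev (real K * p) \<omega>)\<^sup>2)" unfolding e using i by simp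
  have "expectation (\<lambda>\<omega>. (dev (real K * p) \<omega>)\<^sup>2) = expectation (\<lambda>\<omega>. (?N \<omega>)\<^sup>2) - (2 * expectation ?N) * expectation ?N + (expectation ?N)\<^sup>2"
    unfolding e using i prob_space by simp
  then show "expectation (\<lambda>\<omega>. (dev (real K * p) \<omega>)\<^sup>2) \<le> (real K)\<^sup>2 * B\<^sub>0" using i(3) zero_le_power2[of "expectation ?N"]
    by (simp only: power2_eq_square)
  show "expectation (dev (real K * p)) = 0" unfolding dev_def[abs_def] using i prob_space by simp
qed

text \<open>Centring the count amounts to subtracting 1 from the density, since the mean is given by
  Rice's formula.\<close>

lemma cov_kac_rice:
  assumes fc: "finite I" "(\<Sum>i\<in>I. \<bar>c i\<bar>) \<le> C" and p: "0 < p" "p \<le> \<delta>\<^sub>0"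
  shows "(CLINT \<omega>|M. complex_of_real (dev (real K * p) \<omega>) * iexp (zf I c t \<omega>)) = 
    complex_of_real (\<sigma> / pi * exp (- (cov (zf I c t) (zf I c t) / 2)) * integral {0..real K * p} (\<lambda>s. kd I c t s - 1))"
proof -
  note [measurable] = zf_meas[OF fc]
  have T: "0 \<le> real K * p" using p by simp
  have i1: "integrable M (\<lambda>\<omega>. complex_of_real (zero_count f (real K * p) \<omega>) * iexp (zf I c t \<omega>))"
    by (rule Bochner_Integration.integrable_bound[OF zero_count_integrable[OF p, of K]]) (auto simp: norm_mult)
  have i2: "integrable M (\<lambda>\<omega>. iexp (zf I c t \<omega>))"
    by (rule integrable_const_bound[of _ 1]) auto
  have "(CLINT \<omega>|M. complex_of_real (dev (real K * p) \<omega>) * iexp (zf I c t \<omega>)) =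
     (CLINT \<omega>|M. complex_of_real (zero_count f (real K * p) \<omega>) * iexp (zf I c t \<omega>) - complex_of_real (\<sigma> / pi * (real K * p)) * iexp (zf I c t \<omega>))"
    unfolding dev_def mean_zero_count[OF p] by (simp only: of_real_diff left_diff_distrib)
  also have "\<dots> = (CLINT \<omega>|M. complex_of_real (zero_count f (real K * p) \<omega>) * iexp (zf I c t \<omega>)) - complex_of_real (\<sigma> / pi * (real K * p)) * (CLINT \<omega>|M. iexp (zf I c t \<omega>))"
    using i1 i2 by (simp only: Bochner_Integration.integral_diff integrable_mult_right integral_mult_right_zero)
  also have "\<dots> = complex_of_real (\<sigma> / pi * exp (- (cov (zf I c t) (zf I c t) / 2)) * integral {0..real K * p} (kd I c t)) -
      complex_of_real (\<sigma> / pi * (real K * p)) * complex_of_real (exp (- (cov (zf I c t) (zf I c t) / 2)))"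
    unfolding weighted_kac_rice[OF fc p] expectation_iexp[OF zf_lin[OF fc]] ..
  also have "\<dots> = complex_of_real (\<sigma> / pi * exp (- (cov (zf I c t) (zf I c t) / 2)) * (integral {0..real K * p} (kd I c t) - real K * p))"
    unfolding of_real_mult[symmetric] of_real_diff[symmetric] by (simp only: right_diff_distrib mult_ac)
  also have "integral {0..real K * p} (kd I c t) - real K * p = integral {0..real K * p} (\<lambda>s. kd I c t s - 1)"
    using T by (subst Henstock_Kurzweil_Integration.integral_diff) (auto intro!: integrable_continuous_real kd_continuous[OF fc])
  finally show ?thesis .
qed

lemma variance_eq_dev: "variance (zero_count f T) = expectation (\<lambda>\<omega>. (dev T \<omega>)\<^sup>2)"
  by (simp add: dev_def)

text \<open>Writing \<open>T\<close> as a multiple of a short step brings every large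
  \<open>T\<close> within reach of the results stated for \<open>real K * p\<close>, with
  \<open>K\<close> comparable to \<open>T\<close>.\<close>

lemma step_decomposition:
  assumes "T \<ge> \<delta>\<^sub>0"
  obtains K p where "0 < p" "p \<le> \<delta>\<^sub>0" "T = real K * p" "real K \<le> 2 * T / \<delta>\<^sub>0"
proof -
  define K where "K = nat \<lceil>T / \<delta>\<^sub>0\<rceil>"
  have T: "1 \<le> T / \<delta>\<^sub>0" "T > 0" using assms delta0(1) by auto
  have K: "T / \<delta>\<^sub>0 \<le> real K" "real K \<le> T / \<delta>\<^sub>0 + 1" using T unfolding K_def by linarith+
  have K0: "real K > 0" using K T by linarith
  show ?thesis
  proof (rule that)
    show "0 < T / real K" using T K0 by simp
    show "T / real K \<le> \<delta>\<^sub>0" using K(1) K0 delta0(1) by (simp add: field_simps)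
    show "T = real K * (T / real K)" using K0 by simp
    show "real K \<le> 2 * T / \<delta>\<^sub>0" using K(2) T by simp
  qed
qed

lemma variance_upper:
  assumes "T \<ge> \<delta>\<^sub>0"
  shows "variance (zero_count f T) \<le> (4 * B\<^sub>0 / \<delta>\<^sub>0\<^sup>2) * T\<^sup>2"
proof -
  obtain K p where p: "0 < p" "p \<le> \<delta>\<^sub>0" and T: "T = real K * p" and K: "real K \<le> 2 * T / \<delta>\<^sub>0"
    using step_decomposition[OF assms] by blast
  have "variance (zero_count f T) \<le> (real K)\<^sup>2 * B\<^sub>0" unfolding variance_eq_dev T by (rule dev_L2(2)[OF p])
  also have "\<dots> \<le> (2 * T / \<delta>\<^sub>0)\<^sup>2 * B\<^sub>0" using K B0_pos by (intro mult_right_mono power_mono) auto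
  also have "\<dots> = (4 * B\<^sub>0 / \<delta>\<^sub>0\<^sup>2) * T\<^sup>2" by (simp add: power_mult_distrib power_divide)
  finally show ?thesis .
qed

text \<open>Symmetry of the spectral measure; this removes the imaginary part in
  \<open>of_real_r1\<close>.\<close>

lemma mean_l_cos: "(LINT l|\<rho>. l * cos (l * s)) = 0"
proof -
  have "(LINT l|\<rho>. l * cos (l * s)) = (LINT l|distr \<rho> borel uminus. l * cos (l * s))" by (simp add: rho_sym)
  also have "\<dots> = (LINT l|\<rho>. - (l * cos (l * s)))" by (subst integral_distr) auto
  finally show ?thesis by simp
qed

lemma of_real_r: "complex_of_real (r s) = (CLINT l|\<rho>. iexp (l * s))"
  using spectral[of "- s"] by (simp add: r_even)

lemma of_real_r1: "complex_of_real (r1 s) = (CLINT l|\<rho>. \<i> * of_real l * iexp (l * s))"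
proof -
  have i: "integrable \<rho> (\<lambda>l. \<i> * of_real l * iexp (l * s))"
    by (rule Bochner_Integration.integrable_bound[OF int_l1]) (auto simp: norm_mult)
  show ?thesis
  proof (rule complex_eqI)
    have "Re (CLINT l|\<rho>. \<i> * of_real l * iexp (l * s)) = (LINT l|\<rho>. Re (\<i> * of_real l * iexp (l * s)))"
      by (rule integral_Re[OF i, symmetric])
    also have "\<dots> = (LINT l|\<rho>. - (l * sin (l * s)))" by (intro Bochner_Integration.integral_cong) (auto simp: Re_exp Im_exp)
    finally show "Re (complex_of_real (r1 s)) = Re (CLINT l|\<rho>. \<i> * of_real l * iexp (l * s))" by (simp add: r1_def)
    have "Im (CLINT l|\<rho>. \<i> * of_real l * iexp (l * s)) = (LINT l|\<rho>. Im (\<i> * of_real l * iexp (l * s)))"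
      by (rule integral_Im[OF i, symmetric])
    also have "\<dots> = (LINT l|\<rho>. l * cos (l * s))" by (intro Bochner_Integration.integral_cong) (auto simp: Re_exp Im_exp)
    finally show "Im (complex_of_real (r1 s)) = Im (CLINT l|\<rho>. \<i> * of_real l * iexp (l * s))" by (simp add: mean_l_cos)
  qed
qed

text \<open>If \<open>g\<close> is close to the indicator of \<mu>, the spectral integral is close
  to the contribution of the atom. The error bound does not involve \<open>s\<close>, so it holds
  along the whole window. The weights 1 and i l are those of the covariance and its
  derivative.\<close>

lemma spectral_mean_error:
  fixes g :: "real \<Rightarrow> complex" and w :: "real \<Rightarrow> complex"
  assumes [measurable]: "g \<in> borel_measurable borel" "w \<in> borel_measurable borel"
    and g: "\<And>l. norm (g l) \<le> 1" and w: "\<And>l. norm (w l) = \<bar>u l\<bar>" and u: "integrable \<rho> (\<lambda>l. \<bar>u l\<bar>)"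
  shows "norm ((CLINT l|\<rho>. w l * iexp (l * s) * g l) - of_real (measure \<rho> {\<mu>}) * (w \<mu> * iexp (\<mu> * s))) \<le>
     (LINT l|\<rho>. \<bar>u l\<bar> * norm (g l - indicator {\<mu>} l))"
proof -
  have i1: "integrable \<rho> (\<lambda>l. w l * iexp (l * s) * g l)"
    using g by (intro Bochner_Integration.integrable_bound[OF u]) (auto simp: norm_mult w intro!: mult_left_le)
  have i2: "integrable \<rho> (\<lambda>l. w l * iexp (l * s) * indicator {\<mu>} l)"
    by (intro Bochner_Integration.integrable_bound[OF u]) (auto simp: norm_mult w indicator_def)
  have i3: "integrable \<rho> (\<lambda>l. \<bar>u l\<bar> * norm (g l - indicator {\<mu>} l))"
  proof (rule Bochner_Integration.integrable_bound[OF integrable_mult_right[OF u, of 2]])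
    have "norm (g l - indicator {\<mu>} l) \<le> 1 + 1" for l
      by (rule order_trans[OF norm_triangle_ineq4]) (intro add_mono g, simp add: indicator_def)
    then have "\<bar>u l\<bar> * norm (g l - indicator {\<mu>} l) \<le> \<bar>u l\<bar> * 2" for l by (intro mult_left_mono) auto
    then show "AE l in \<rho>. norm (\<bar>u l\<bar> * norm (g l - indicator {\<mu>} l)) \<le> norm (2 * \<bar>u l\<bar>)" by (simp add: mult.commute)
  qed (use u in measurable)
  have "(CLINT l|\<rho>. w l * iexp (l * s) * indicator {\<mu>} l) = (CLINT l|\<rho>. (w \<mu> * iexp (\<mu> * s)) * complex_of_real (indicator {\<mu>} l))"
    by (intro Bochner_Integration.integral_cong) (auto simp: indicator_def)
  also have "\<dots> = (w \<mu> * iexp (\<mu> * s)) * complex_of_real (LINT l|\<rho>. indicator {\<mu>} l)"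
    by (simp only: integral_mult_right_zero integral_complex_of_real)
  also have "(LINT l|\<rho>. indicator {\<mu>} l) = measure \<rho> {\<mu>}" using sets_eq_imp_space_eq[OF rho_sets] by simp
  finally have e: "of_real (measure \<rho> {\<mu>}) * (w \<mu> * iexp (\<mu> * s)) = (CLINT l|\<rho>. w l * iexp (l * s) * indicator {\<mu>} l)" by (simp add: mult.commute)
  have "(CLINT l|\<rho>. w l * iexp (l * s) * g l) - of_real (measure \<rho> {\<mu>}) * (w \<mu> * iexp (\<mu> * s)) =
     (CLINT l|\<rho>. w l * iexp (l * s) * g l - w l * iexp (l * s) * indicator {\<mu>} l)"
    unfolding e by (rule Bochner_Integration.integral_diff[OF i1 i2, symmetric])
  moreover have "norm (CLINT l|\<rho>. w l * iexp (l * s) * g l - w l * iexp (l * s) * indicator {\<mu>} l) \<le> (LINT l|\<rho>. \<bar>u l\<bar> * norm (g l - indicator {\<mu>} l))"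
  proof (rule norm_integral_le(2)[OF i3])
    show "norm (w l * iexp (l * s) * g l - w l * iexp (l * s) * indicator {\<mu>} l) \<le> \<bar>u l\<bar> * norm (g l - indicator {\<mu>} l)" for l
      unfolding right_diff_distrib[symmetric] by (simp only: norm_mult norm_exp_i_times w mult_1_right)
  qed measurable
  ultimately show ?thesis by simp
qed

lemma spectral_mean_error_tendsto:
  assumes u: "integrable \<rho> (\<lambda>l. \<bar>u l\<bar>)" and [measurable]: "u \<in> borel_measurable borel"
  shows "(\<lambda>q. LINT l|\<rho>. \<bar>u l\<bar> * norm ((1 / of_nat (q^3)) * (\<Sum>k<q^3. iexp ((\<mu> - l) * (real k / real q))) - indicator {\<mu>} l)) \<longlonglongrightarrow> 0"
proof -
  let ?g = "\<lambda>q l. (1 / of_nat (q^3)) * (\<Sum>k<q^3. iexp ((\<mu> - l) * (real k / real q)))"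
  have "(\<lambda>q. LINT l|\<rho>. \<bar>u l\<bar> * norm (?g q l - indicator {\<mu>} l)) \<longlonglongrightarrow> (LINT l|\<rho>. 0)"
  proof (rule integral_dominated_convergence[where w = "\<lambda>l. 2 * \<bar>u l\<bar>"])
    show "integrable \<rho> (\<lambda>l. 2 * \<bar>u l\<bar>)" using u by (rule integrable_mult_right)
    show "AE l in \<rho>. (\<lambda>q. \<bar>u l\<bar> * norm (?g q l - indicator {\<mu>} l)) \<longlonglongrightarrow> 0"
    proof (rule AE_I2)
      fix l
      have "(if \<mu> - l = 0 then 1 else 0) = (indicator {\<mu>} l :: complex)" by (auto simp: indicator_def)
      then have "(\<lambda>q. ?g q l) \<longlonglongrightarrow> indicator {\<mu>} l" using fejer_mean_tendsto[of "\<mu> - l"] by (simp only:)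
      then have "(\<lambda>q. \<bar>u l\<bar> * norm (?g q l - indicator {\<mu>} l)) \<longlonglongrightarrow> \<bar>u l\<bar> * norm (indicator {\<mu>} l - indicator {\<mu>} l :: complex)"
        by (intro tendsto_intros)
      then show "(\<lambda>q. \<bar>u l\<bar> * norm (?g q l - indicator {\<mu>} l)) \<longlonglongrightarrow> 0" by simp
    qed
    show "AE l in \<rho>. norm (\<bar>u l\<bar> * norm (?g q l - indicator {\<mu>} l)) \<le> 2 * \<bar>u l\<bar>" for q
    proof (rule AE_I2)
      fix l
      have "norm (?g q l - indicator {\<mu>} l) \<le> 1 + 1"
        by (rule order_trans[OF norm_triangle_ineq4]) (intro add_mono fejer_mean_bound, simp add: indicator_def)
      then have "\<bar>u l\<bar> * norm (?g q l - indicator {\<mu>} l) \<le> \<bar>u l\<bar> * 2" by (intro mult_left_mono) auto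
      then show "norm (\<bar>u l\<bar> * norm (?g q l - indicator {\<mu>} l)) \<le> 2 * \<bar>u l\<bar>" by (simp add: mult.commute)
    qed
  qed measurable
  then show ?thesis by simp
qed

lemma atom_mass_times_frequency_le: "\<bar>\<mu>\<bar> * measure \<rho> {\<mu>} \<le> \<sigma>"
proof -
  have "\<bar>\<mu>\<bar> * measure \<rho> {\<mu>} = (LINT l|\<rho>. \<bar>\<mu>\<bar> * indicator {\<mu>} l)" 
    using sets_eq_imp_space_eq[OF rho_sets] by simp
  also have "\<dots> \<le> (LINT l|\<rho>. \<bar>l\<bar>)"
  proof (rule integral_mono)
    show "integrable \<rho> (\<lambda>l. \<bar>\<mu>\<bar> * indicator {\<mu>} l)" by (rule bounded_integrable[of _ "\<bar>\<mu>\<bar>"]) (auto simp: indicator_def)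
    show "\<bar>\<mu>\<bar> * indicator {\<mu>} l \<le> \<bar>l\<bar>" for l by (auto simp: indicator_def)
  qed (rule int_l1)
  also have "\<dots> \<le> \<sigma>" by (rule mean_abs_le)
  finally show ?thesis .
qed

text \<open>The test functional is built from the harmonic of frequency \<open>\<mu>\<close> in \<open>f\<close>, averaged over a long
  time; the covariance with the zero count then sees only the atom at \<open>\<mu>\<close>, through the factor
  \<open>\<rho>{\<mu>}\<^sup>2 (1 - \<mu>\<^sup>2 / \<sigma>\<^sup>2)\<close>.\<close>
lemma variance_lower:
  assumes \<mu>: "\<mu> \<noteq> \<sigma>" "\<mu> \<noteq> - \<sigma>" "measure \<rho> {\<mu>} > 0"
  shows "\<exists>C>0. \<forall>T\<ge>\<delta>\<^sub>0. C * T\<^sup>2 \<le> variance (zero_count f T)"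
proof -
  define m where "m = measure \<rho> {\<mu>}"
  have m: "0 < m" "m \<le> 1" using \<mu>(3) by (auto simp: m_def)
  \<comment> \<open>The limiting value of |A|^2 - |B|^2/\<sigma>^2 for the averages \<open>A\<close>
    and \<open>B\<close> defined below; it is nonzero because \<mu> is neither \<sigma> nor
    -\<sigma>.\<close>
  define d where "d = m\<^sup>2 - (\<mu> * m)\<^sup>2 / \<sigma>\<^sup>2"
  have d0: "d \<noteq> 0"
  proof
    assume "d = 0"
    then have "m\<^sup>2 * \<sigma>\<^sup>2 = m\<^sup>2 * \<mu>\<^sup>2" using sigma_pos by (simp add: d_def field_simps power_mult_distrib)
    then have "\<sigma>\<^sup>2 = \<mu>\<^sup>2" using m by simp
    then show False using \<mu> by (simp add: power2_eq_iff)
  qed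
  \<comment> \<open>Small amplitude: the cubic errors of the two expansions, 10 k^3 together, stay
    below k^2 |d| / 8.\<close>
  define k where "k = min 1 (\<bar>d\<bar> / 80)"
  have k: "0 < k" "k \<le> 1" "80 * k \<le> \<bar>d\<bar>" using d0 by (auto simp: k_def)
  define g where "g q l = (1 / of_nat (q^3)) * (\<Sum>j<q^3. iexp ((\<mu> - l) * (real j / real q)))" for q :: nat and l
  have gm[measurable]: "g q \<in> borel_measurable borel" for q unfolding g_def[abs_def] by measurable
  have gb: "norm (g q l) \<le> 1" for q l unfolding g_def by (rule fejer_mean_bound)
  define e0 e1 where "e0 q = (LINT l|\<rho>. \<bar>1\<bar> * norm (g q l - indicator {\<mu>} l))"
    and "e1 q = (LINT l|\<rho>. \<bar>l\<bar> * norm (g q l - indicator {\<mu>} l))" for q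
  have "(\<lambda>q. 2 * e0 q + 2 * e1 q / \<sigma>) \<longlonglongrightarrow> 2 * 0 + 2 * 0 / \<sigma>"
    unfolding e0_def e1_def g_def
    by (intro tendsto_add tendsto_mult tendsto_divide tendsto_const spectral_mean_error_tendsto[of "\<lambda>_. 1"] spectral_mean_error_tendsto[of "\<lambda>l. l"])
       (use int_l1 sigma_pos in auto)
  then have "\<forall>\<^sub>F q in sequentially. 2 * e0 q + 2 * e1 q / \<sigma> < \<bar>d\<bar> / 4"
    using d0 by (intro order_tendstoD(2)) auto
  then obtain q where q: "2 * e0 q + 2 * e1 q / \<sigma> < \<bar>d\<bar> / 4" "q > 0"
    using eventually_conj[OF _ eventually_gt_at_top[of 0]] eventually_happens'[OF sequentially_bot] by (metis (mono_tags, lifting))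
  define Q where "Q = q^3"
  have Q: "real Q > 0" using q(2) by (simp add: Q_def)
  define t where "t j = real j / real q" for j :: nat
  \<comment> \<open>Real and imaginary parts of the averaged harmonic. Each density alone oscillates
    with the time \<open>s\<close>; adding the two yields squared moduli in the quadratic terms,
    from which the phase has gone.\<close>
  define c1 c2 where "c1 j = k * cos (\<mu> * t j) / real Q" and "c2 j = k * sin (\<mu> * t j) / real Q" for j
  have ck: "\<bar>k * x / real Q\<bar> \<le> k / real Q" if "\<bar>x\<bar> \<le> 1" for x
    using that k(1) Q by (auto simp: abs_mult divide_right_mono mult_left_le)
  have fc1: "finite {..<Q}" "(\<Sum>j<Q. \<bar>c1 j\<bar>) \<le> k" and fc2: "finite {..<Q}" "(\<Sum>j<Q. \<bar>c2 j\<bar>) \<le> k"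
  proof -
    have "(\<Sum>j<Q. \<bar>c1 j\<bar>) \<le> (\<Sum>j<Q. k / real Q)" "(\<Sum>j<Q. \<bar>c2 j\<bar>) \<le> (\<Sum>j<Q. k / real Q)"
      unfolding c1_def c2_def by (intro sum_mono ck abs_cos_le_one abs_sin_le_one)+
    then show "(\<Sum>j<Q. \<bar>c1 j\<bar>) \<le> k" "(\<Sum>j<Q. \<bar>c2 j\<bar>) \<le> k" using Q by simp_all
  qed simp_all
  define A B where "A s = (1 / of_nat Q) * (\<Sum>j<Q. iexp (\<mu> * t j) * complex_of_real (r (s - t j)))"
    and "B s = (1 / of_nat Q) * (\<Sum>j<Q. iexp (\<mu> * t j) * complex_of_real (r1 (s - t j)))" for s
  have AB: "\<alpha>f {..<Q} c1 t s = k * Re (A s)" "\<alpha>f {..<Q} c2 t s = k * Im (A s)"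
     "\<beta>f {..<Q} c1 t s = k * Re (B s) / \<sigma>" "\<beta>f {..<Q} c2 t s = k * Im (B s) / \<sigma>" for s
    unfolding \<alpha>f_def \<beta>f_def A_def B_def c1_def c2_def
    by (simp_all add: Re_divide_of_nat Im_divide_of_nat Re_exp Im_exp sum_distrib_left sum_divide_distrib mult_ac)
  have nA: "norm (A s) \<le> 1" and nB: "norm (B s) \<le> \<sigma>" for s
  proof -
    have "norm (\<Sum>j<Q. iexp (\<mu> * t j) * complex_of_real (r (s - t j))) \<le> (\<Sum>j<Q. 1)"
      by (intro sum_norm_le) (simp only: norm_mult norm_exp_i_times norm_of_real abs_r_le mult_1_left)
    then show "norm (A s) \<le> 1" unfolding A_def norm_mult using Q by (simp add: norm_divide field_simps)
    have "norm (\<Sum>j<Q. iexp (\<mu> * t j) * complex_of_real (r1 (s - t j))) \<le> (\<Sum>j<Q. \<sigma>)"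
      by (intro sum_norm_le) (simp only: norm_mult norm_exp_i_times norm_of_real r1_le mult_1_left)
    then show "norm (B s) \<le> \<sigma>" unfolding B_def norm_mult using Q by (simp add: norm_divide field_simps)
  qed
  have shift: "iexp (\<mu> * t j) * iexp (l * (s - t j)) = iexp (l * s) * iexp ((\<mu> - l) * t j)" for l s j
    by (simp add: algebra_simps flip: exp_add)
  have Ai: "A s = (CLINT l|\<rho>. 1 * iexp (l * s) * g q l)" for s
  proof -
    have i: "integrable \<rho> (\<lambda>l. iexp (l * (s - t j)))" for j by (intro R.integrable_const_bound[of _ 1]) (auto simp del: of_real_mult)
    have "A s = (1 / of_nat Q) * (\<Sum>j<Q. (CLINT l|\<rho>. iexp (\<mu> * t j) * iexp (l * (s - t j))))"
      unfolding A_def of_real_r by (simp only: integral_mult_right_zero)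
    also have "\<dots> = (CLINT l|\<rho>. (1 / of_nat Q) * (\<Sum>j<Q. iexp (\<mu> * t j) * iexp (l * (s - t j))))"
      using i by (simp only: integral_mult_right_zero Bochner_Integration.integral_sum integrable_mult_right)
    also have "\<dots> = (CLINT l|\<rho>. 1 * iexp (l * s) * g q l)"
      unfolding shift unfolding g_def t_def Q_def by (simp only: sum_distrib_left mult_ac mult_1_left)
    finally show ?thesis .
  qed
  have Bi: "B s = (CLINT l|\<rho>. (\<i> * of_real l) * iexp (l * s) * g q l)" for s
  proof -
    have i: "integrable \<rho> (\<lambda>l. \<i> * of_real l * iexp (l * (s - t j)))" for j
      by (rule Bochner_Integration.integrable_bound[OF int_l1]) (auto simp: norm_mult simp del: of_real_mult of_real_diff)
    have "B s = (1 / of_nat Q) * (\<Sum>j<Q. (CLINT l|\<rho>. iexp (\<mu> * t j) * (\<i> * of_real l * iexp (l * (s - t j)))))"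
      unfolding B_def of_real_r1 by (simp only: integral_mult_right_zero)
    also have "\<dots> = (CLINT l|\<rho>. (1 / of_nat Q) * (\<Sum>j<Q. iexp (\<mu> * t j) * (\<i> * of_real l * iexp (l * (s - t j)))))"
      using i by (simp only: integral_mult_right_zero Bochner_Integration.integral_sum integrable_mult_right)
    also have "\<dots> = (CLINT l|\<rho>. (1 / of_nat Q) * (\<Sum>j<Q. (\<i> * of_real l) * (iexp (l * s) * iexp ((\<mu> - l) * t j))))"
      unfolding shift[symmetric] by (simp only: mult_ac)
    also have "\<dots> = (CLINT l|\<rho>. (\<i> * of_real l) * iexp (l * s) * g q l)"
      unfolding g_def t_def Q_def by (simp only: sum_distrib_left mult_ac)
    finally show ?thesis .
  qed
  have sq: "\<bar>x\<^sup>2 - y\<^sup>2\<bar> \<le> e * (2 * b)" if "\<bar>x - y\<bar> \<le> e" "0 \<le> x" "x \<le> b" "0 \<le> y" "y \<le> b" for x y e b :: real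
  proof -
    have "\<bar>x\<^sup>2 - y\<^sup>2\<bar> = \<bar>x - y\<bar> * \<bar>x + y\<bar>" by (simp add: power2_eq_square abs_mult[symmetric] algebra_simps)
    also have "\<dots> \<le> e * (2 * b)" using that by (intro mult_mono) auto
    finally show ?thesis .
  qed
  have main: "\<bar>((norm (A s))\<^sup>2 - (norm (B s))\<^sup>2 / \<sigma>\<^sup>2) - d\<bar> \<le> \<bar>d\<bar> / 4" for s
  proof -
    have "norm (A s - of_real m * (1 * iexp (\<mu> * s))) \<le> e0 q"
      unfolding Ai m_def e0_def by (rule spectral_mean_error) (use gb in auto)
    then have "\<bar>norm (A s) - m\<bar> \<le> e0 q"
      using norm_triangle_ineq3[of "A s" "of_real m * (1 * iexp (\<mu> * s))"] m by (simp only: norm_mult norm_exp_i_times norm_of_real, simp?)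
    then have a: "\<bar>(norm (A s))\<^sup>2 - m\<^sup>2\<bar> \<le> e0 q * (2 * 1)" using nA m by (intro sq) auto
    have "norm (B s - of_real m * ((\<i> * of_real \<mu>) * iexp (\<mu> * s))) \<le> e1 q"
      unfolding Bi m_def e1_def by (rule spectral_mean_error) (use gb int_l1 in \<open>auto simp: norm_mult\<close>)
    then have "\<bar>norm (B s) - m * \<bar>\<mu>\<bar>\<bar> \<le> e1 q"
      using norm_triangle_ineq3[of "B s" "of_real m * ((\<i> * of_real \<mu>) * iexp (\<mu> * s))"] m
      by (simp only: norm_mult norm_exp_i_times norm_of_real norm_ii, simp?)
    then have "\<bar>(norm (B s))\<^sup>2 - (m * \<bar>\<mu>\<bar>)\<^sup>2\<bar> \<le> e1 q * (2 * \<sigma>)"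
      using nB m atom_mass_times_frequency_le[of \<mu>] by (intro sq) (auto simp: m_def mult.commute)
    then have "\<bar>(norm (B s))\<^sup>2 - (\<mu> * m)\<^sup>2\<bar> \<le> e1 q * (2 * \<sigma>)" by (simp add: power_mult_distrib mult.commute)
    then have "\<bar>(norm (B s))\<^sup>2 - (\<mu> * m)\<^sup>2\<bar> / \<sigma>\<^sup>2 \<le> e1 q * (2 * \<sigma>) / \<sigma>\<^sup>2" by (rule divide_right_mono) simp
    also have "\<dots> = 2 * e1 q / \<sigma>" using sigma_pos by (simp add: power2_eq_square)
    finally have "\<bar>((norm (B s))\<^sup>2 - (\<mu> * m)\<^sup>2) / \<sigma>\<^sup>2\<bar> \<le> 2 * e1 q / \<sigma>" by (simp add: abs_divide)
    then show ?thesis using a q(1) unfolding d_def diff_divide_distrib by linarith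
  qed
  let ?k1 = "kd {..<Q} c1 t" and ?k2 = "kd {..<Q} c2 t"
  let ?z1 = "zf {..<Q} c1 t" and ?z2 = "zf {..<Q} c2 t"
  have pt: "\<bar>(?k1 s - 1) + (?k2 s - 1) - k\<^sup>2 * d / 2\<bar> \<le> k\<^sup>2 * \<bar>d\<bar> / 4" for s
  proof -
    let ?a1 = "\<alpha>f {..<Q} c1 t s" and ?a2 = "\<alpha>f {..<Q} c2 t s" and ?b1 = "\<beta>f {..<Q} c1 t s" and ?b2 = "\<beta>f {..<Q} c2 t s"
    have 1: "\<bar>?k1 s - 1 - (?a1\<^sup>2 - ?b1\<^sup>2) / 2\<bar> \<le> 5 * k^3"
      unfolding kd_def[OF fc1] using k by (intro kr_density_expansion alpha_le[OF fc1] beta_le[OF fc1]) auto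
    have 2: "\<bar>?k2 s - 1 - (?a2\<^sup>2 - ?b2\<^sup>2) / 2\<bar> \<le> 5 * k^3"
      unfolding kd_def[OF fc2] using k by (intro kr_density_expansion alpha_le[OF fc2] beta_le[OF fc2]) auto
    have "(?a1\<^sup>2 - ?b1\<^sup>2) / 2 + (?a2\<^sup>2 - ?b2\<^sup>2) / 2 = k\<^sup>2 / 2 * ((norm (A s))\<^sup>2 - (norm (B s))\<^sup>2 / \<sigma>\<^sup>2)"
      unfolding AB cmod_power2 using sigma_pos by (simp add: power_mult_distrib power_divide field_simps)
    then have 3: "(?a1\<^sup>2 - ?b1\<^sup>2) / 2 + (?a2\<^sup>2 - ?b2\<^sup>2) / 2 - k\<^sup>2 * d / 2 = k\<^sup>2 / 2 * (((norm (A s))\<^sup>2 - (norm (B s))\<^sup>2 / \<sigma>\<^sup>2) - d)"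
      by (simp add: algebra_simps)
    have "\<bar>k\<^sup>2 / 2 * (((norm (A s))\<^sup>2 - (norm (B s))\<^sup>2 / \<sigma>\<^sup>2) - d)\<bar> = k\<^sup>2 / 2 * \<bar>((norm (A s))\<^sup>2 - (norm (B s))\<^sup>2 / \<sigma>\<^sup>2) - d\<bar>"
      by (simp add: abs_mult)
    also have "\<dots> \<le> k\<^sup>2 / 2 * (\<bar>d\<bar> / 4)" by (intro mult_left_mono main) simp
    finally have 4: "\<bar>k\<^sup>2 / 2 * (((norm (A s))\<^sup>2 - (norm (B s))\<^sup>2 / \<sigma>\<^sup>2) - d)\<bar> \<le> k\<^sup>2 * \<bar>d\<bar> / 8" by simp
    have "k\<^sup>2 * (80 * k) \<le> k\<^sup>2 * \<bar>d\<bar>" using k by (intro mult_left_mono) auto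
    then have 5: "80 * k^3 \<le> k\<^sup>2 * \<bar>d\<bar>" by (simp add: power2_eq_square power3_eq_cube mult_ac)
    show ?thesis using 1 2 3 4 5 by linarith
  qed
  \<comment> \<open>The last division by 4 accounts for the bound on \<open>F\<close> below.\<close>
  define cc where "cc = (\<sigma> / pi * (k\<^sup>2 * \<bar>d\<bar> / 4)) / 4"
  have cc: "cc > 0" using sigma_pos k d0 by (simp add: cc_def)
  have "cc\<^sup>2 * T\<^sup>2 \<le> variance (zero_count f T)" if T: "T \<ge> \<delta>\<^sub>0" for T
  proof -
    obtain K p where p: "0 < p" "p \<le> \<delta>\<^sub>0" and TK: "T = real K * p" using step_decomposition[OF T] by blast
    have T0: "T \<ge> 0" using T delta0(1) by linarith
    have cv: "cov ?z1 ?z1 \<le> 1" "cov ?z2 ?z2 \<le> 1"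
      using cov_zf_le[OF fc1, of t] cov_zf_le[OF fc2, of t] power_le_one[of k 2] k by linarith+
    \<comment> \<open>The factors undo the damping exp (- cov / 2) in \<open>cov_kac_rice\<close>,
      so that the two densities are added with equal weight.\<close>
    define F where "F \<omega> = of_real (exp (cov ?z1 ?z1 / 2)) * iexp (?z1 \<omega>) + of_real (exp (cov ?z2 ?z2 / 2)) * iexp (?z2 \<omega>)" for \<omega>
    note [measurable] = zf_meas[OF fc1] zf_meas[OF fc2]
    have Fm[measurable]: "F \<in> borel_measurable M" unfolding F_def[abs_def] by measurable
    have "exp (v / 2) \<le> 2" if "v \<le> 1" for v :: real
      using order_trans[OF iffD2[OF exp_le_cancel_iff, of "v / 2" "1 / 2"] exp_half_le2] that by simp
    from this[OF cv(1)] this[OF cv(2)] have e2: "exp (cov ?z1 ?z1 / 2) \<le> 2" "exp (cov ?z2 ?z2 / 2) \<le> 2" .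
    have Fb: "norm (F \<omega>) \<le> 4" for \<omega>
    proof -
      have "norm (F \<omega>) \<le> exp (cov ?z1 ?z1 / 2) + exp (cov ?z2 ?z2 / 2)"
        unfolding F_def by (rule order_trans[OF norm_triangle_ineq]) (simp only: norm_mult norm_exp_i_times norm_of_real abs_exp_cancel mult_1_right order_refl)
      then show ?thesis using e2 by linarith
    qed
    have i: "integrable M (\<lambda>\<omega>. complex_of_real (dev T \<omega>) * iexp (zf {..<Q} c t \<omega>))" if "(\<Sum>j<Q. \<bar>c j\<bar>) \<le> k" for c
    proof -
      note [measurable] = zf_meas[OF finite_lessThan that]
      have "integrable M (dev T)" using zero_count_integrable[OF p, of K] unfolding dev_def[abs_def] TK by simp
      then show ?thesis by (rule Bochner_Integration.integrable_bound) (auto simp: norm_mult)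
    qed
    have one: "of_real (exp (cov z z / 2)) * (CLINT \<omega>|M. complex_of_real (dev T \<omega>) * iexp (z \<omega>)) = complex_of_real (\<sigma> / pi * integral {0..T} (\<lambda>s. kd {..<Q} c t s - 1))"
      if "(\<Sum>j<Q. \<bar>c j\<bar>) \<le> k" "z = zf {..<Q} c t" for c z
      unfolding TK cov_kac_rice[OF finite_lessThan that(1) p] that(2) of_real_mult[symmetric]
      by (simp add: exp_minus)
    have "(CLINT \<omega>|M. complex_of_real (dev T \<omega>) * F \<omega>) = 
       of_real (exp (cov ?z1 ?z1 / 2)) * (CLINT \<omega>|M. complex_of_real (dev T \<omega>) * iexp (?z1 \<omega>)) + of_real (exp (cov ?z2 ?z2 / 2)) * (CLINT \<omega>|M. complex_of_real (dev T \<omega>) * iexp (?z2 \<omega>))"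
    proof -
      have "(\<lambda>\<omega>. complex_of_real (dev T \<omega>) * F \<omega>) = (\<lambda>\<omega>. of_real (exp (cov ?z1 ?z1 / 2)) * (complex_of_real (dev T \<omega>) * iexp (?z1 \<omega>)) + of_real (exp (cov ?z2 ?z2 / 2)) * (complex_of_real (dev T \<omega>) * iexp (?z2 \<omega>)))"
        by (auto simp only: F_def distrib_left mult_ac)
      then show ?thesis using i[OF fc1(2)] i[OF fc2(2)]
        by (simp only: Bochner_Integration.integral_add integrable_mult_right integral_mult_right_zero)
    qed
    also have "\<dots> = complex_of_real (\<sigma> / pi * (integral {0..T} (\<lambda>s. ?k1 s - 1) + integral {0..T} (\<lambda>s. ?k2 s - 1)))"
      unfolding one[OF fc1(2) refl] one[OF fc2(2) refl] by (simp only: of_real_add[symmetric] distrib_left)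
    finally have "norm (CLINT \<omega>|M. complex_of_real (dev T \<omega>) * F \<omega>) = \<sigma> / pi * \<bar>integral {0..T} (\<lambda>s. ?k1 s - 1) + integral {0..T} (\<lambda>s. ?k2 s - 1)\<bar>"
      using sigma_pos by (simp only: norm_of_real abs_mult, simp?)
    \<comment> \<open>The integrand deviates from the constant k^2 d / 2 by at most half of its
      modulus, so the integral keeps at least half of the contribution of the constant.\<close>
    moreover have "integral {0..T} (\<lambda>s. ?k1 s - 1) + integral {0..T} (\<lambda>s. ?k2 s - 1) = T * (k\<^sup>2 * d / 2) + integral {0..T} (\<lambda>s. (?k1 s - 1) + (?k2 s - 1) - k\<^sup>2 * d / 2)"
      using T0 kd_continuous[OF fc1] kd_continuous[OF fc2]
      by (simp add: Henstock_Kurzweil_Integration.integral_diff Henstock_Kurzweil_Integration.integral_add integrable_continuous_real continuous_intros)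
    moreover have "\<bar>integral {0..T} (\<lambda>s. (?k1 s - 1) + (?k2 s - 1) - k\<^sup>2 * d / 2)\<bar> \<le> (k\<^sup>2 * \<bar>d\<bar> / 4) * (T - 0)"
      unfolding real_norm_def[symmetric]
      by (rule integral_bound) (use T0 pt kd_continuous[OF fc1] kd_continuous[OF fc2] in \<open>auto intro!: continuous_intros\<close>)
    moreover have "\<bar>T * (k\<^sup>2 * d / 2)\<bar> = T * (k\<^sup>2 * \<bar>d\<bar> / 2)" using T0 by (simp add: abs_mult)
    ultimately have "\<sigma> / pi * (T * (k\<^sup>2 * \<bar>d\<bar> / 4)) \<le> norm (CLINT \<omega>|M. complex_of_real (dev T \<omega>) * F \<omega>)"
    proof -
      assume a: "norm (CLINT \<omega>|M. complex_of_real (dev T \<omega>) * F \<omega>) = \<sigma> / pi * \<bar>integral {0..T} (\<lambda>s. ?k1 s - 1) + integral {0..T} (\<lambda>s. ?k2 s - 1)\<bar>"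
        and b: "integral {0..T} (\<lambda>s. ?k1 s - 1) + integral {0..T} (\<lambda>s. ?k2 s - 1) = T * (k\<^sup>2 * d / 2) + integral {0..T} (\<lambda>s. (?k1 s - 1) + (?k2 s - 1) - k\<^sup>2 * d / 2)"
        and c: "\<bar>integral {0..T} (\<lambda>s. (?k1 s - 1) + (?k2 s - 1) - k\<^sup>2 * d / 2)\<bar> \<le> (k\<^sup>2 * \<bar>d\<bar> / 4) * (T - 0)"
        and e: "\<bar>T * (k\<^sup>2 * d / 2)\<bar> = T * (k\<^sup>2 * \<bar>d\<bar> / 2)"
      have "\<bar>T * (k\<^sup>2 * d / 2)\<bar> - \<bar>integral {0..T} (\<lambda>s. (?k1 s - 1) + (?k2 s - 1) - k\<^sup>2 * d / 2)\<bar> \<le> \<bar>integral {0..T} (\<lambda>s. ?k1 s - 1) + integral {0..T} (\<lambda>s. ?k2 s - 1)\<bar>"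
        unfolding b by linarith
      moreover have "T * (k\<^sup>2 * \<bar>d\<bar> / 4) = T * (k\<^sup>2 * \<bar>d\<bar> / 2) - (k\<^sup>2 * \<bar>d\<bar> / 4) * (T - 0)" by (simp add: algebra_simps)
      ultimately have "T * (k\<^sup>2 * \<bar>d\<bar> / 4) \<le> \<bar>integral {0..T} (\<lambda>s. ?k1 s - 1) + integral {0..T} (\<lambda>s. ?k2 s - 1)\<bar>" using c e by linarith
      then show ?thesis unfolding a using sigma_pos by (intro mult_left_mono) auto
    qed
    also have "\<dots> \<le> 4 * sqrt (expectation (\<lambda>\<omega>. (dev T \<omega>)\<^sup>2))"
      using dev_L2(1)[OF p, of K] Fb unfolding TK[symmetric] by (intro norm_expectation_bounded_mult) auto
    finally have a: "\<sigma> / pi * (T * (k\<^sup>2 * \<bar>d\<bar> / 4)) \<le> 4 * sqrt (expectation (\<lambda>\<omega>. (dev T \<omega>)\<^sup>2))" .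
    have b: "cc * T = (\<sigma> / pi * (T * (k\<^sup>2 * \<bar>d\<bar> / 4))) / 4" by (simp add: cc_def)
    have "x / 4 \<le> z" if "x \<le> 4 * z" for x z :: real using that by simp
    from this[OF a] have "cc * T \<le> sqrt (expectation (\<lambda>\<omega>. (dev T \<omega>)\<^sup>2))" unfolding b .
    then have "(cc * T)\<^sup>2 \<le> (sqrt (expectation (\<lambda>\<omega>. (dev T \<omega>)\<^sup>2)))\<^sup>2" using cc T0 by (intro power_mono) auto
    then show ?thesis unfolding variance_eq_dev by (simp add: power_mult_distrib)
  qed
  then show ?thesis using cc by (intro exI[of _ "cc\<^sup>2"]) auto
qed

end

section \<open>The spectrum away from +-\<sigma> over full periods\<close>

lemma ell_even: "ell (- b) = ell b" by (simp add: ell_def)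

text \<open>The derivative of the sinusoid appears with a minus sign: \<open>\<beta>f\<close> is
  compared with minus an imaginary part.\<close>

lemma kr_density_even: "kr_density a (- b) = kr_density a b" by (simp add: kr_density_def ell_even)

context stat_gauss
begin

text \<open>The pair of frequencies +-\<sigma> is treated exactly; \<open>\<kappa>\<^sub>0\<close>
  and \<open>\<kappa>\<^sub>1\<close> are the weights of the remaining part in \<open>r\<close> and
  in its derivative.\<close>

definition "mass = measure \<rho> {\<sigma>, - \<sigma>}"
definition "\<kappa>\<^sub>0 l = (indicator (- {\<sigma>, - \<sigma>}) l :: real)"
definition "\<kappa>\<^sub>1 l = l * (indicator (- {\<sigma>, - \<sigma>}) l :: real)"

lemma kappa_meas[measurable]: "\<kappa>\<^sub>0 \<in> borel_measurable borel" "\<kappa>\<^sub>1 \<in> borel_measurable borel"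
  unfolding \<kappa>\<^sub>0_def[abs_def] \<kappa>\<^sub>1_def[abs_def] by measurable

lemma kappa_integrable: "integrable \<rho> \<kappa>\<^sub>0" "integrable \<rho> \<kappa>\<^sub>1"
proof -
  show "integrable \<rho> \<kappa>\<^sub>0" by (rule bounded_integrable[of _ 1]) (auto simp: \<kappa>\<^sub>0_def split: split_indicator)
  show "integrable \<rho> \<kappa>\<^sub>1"
    unfolding \<kappa>\<^sub>1_def[abs_def] by (rule int_l_mult[of _ 1]) (auto split: split_indicator)
qed

lemma mass: "0 \<le> mass" "mass \<le> 1" by (auto simp: mass_def)

lemma r_split: "r s = mass * cos (\<sigma> * s) + Re (ft \<kappa>\<^sub>0 s)"
proof -
  note [measurable_cong] = rho_sets
  have "Re (ft \<kappa>\<^sub>0 s) = (LINT l|\<rho>. Re (complex_of_real (\<kappa>\<^sub>0 l) * iexp (l * s)))"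
    unfolding ft_def by (rule integral_Re[OF ft_integrable[OF kappa_meas(1) kappa_integrable(1)], symmetric])
  also have "\<dots> = (LINT l|\<rho>. \<kappa>\<^sub>0 l * cos (l * s))" by (intro Bochner_Integration.integral_cong) (auto simp: Re_exp)
  finally have 1: "Re (ft \<kappa>\<^sub>0 s) = (LINT l|\<rho>. \<kappa>\<^sub>0 l * cos (l * s))" .
  have i: "integrable \<rho> (\<lambda>l. \<kappa>\<^sub>0 l * cos (l * s))"
    by (rule bounded_integrable[of _ 1]) (auto simp: \<kappa>\<^sub>0_def split: split_indicator)
  have i2: "integrable \<rho> (\<lambda>l. cos (\<sigma> * s) * indicator {\<sigma>, - \<sigma>} l)"
    by (rule bounded_integrable[of _ 1]) (auto split: split_indicator)
  have "r s = (LINT l|\<rho>. cos (\<sigma> * s) * indicator {\<sigma>, - \<sigma>} l + \<kappa>\<^sub>0 l * cos (l * s))"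
    unfolding r_cos by (intro Bochner_Integration.integral_cong) (auto simp: \<kappa>\<^sub>0_def split: split_indicator)
  also have "\<dots> = (LINT l|\<rho>. cos (\<sigma> * s) * indicator {\<sigma>, - \<sigma>} l) + (LINT l|\<rho>. \<kappa>\<^sub>0 l * cos (l * s))"
    by (rule Bochner_Integration.integral_add[OF i2 i])
  also have "(LINT l|\<rho>. cos (\<sigma> * s) * indicator {\<sigma>, - \<sigma>} l) = mass * cos (\<sigma> * s)"
    by (simp add: mass_def sets_eq_imp_space_eq[OF rho_sets])
  finally show ?thesis using 1 by simp
qed

lemma r1_split: "r1 s = - (mass * \<sigma> * sin (\<sigma> * s)) - Im (ft \<kappa>\<^sub>1 s)"
proof -
  note [measurable_cong] = rho_sets
  have "Im (ft \<kappa>\<^sub>1 s) = (LINT l|\<rho>. Im (complex_of_real (\<kappa>\<^sub>1 l) * iexp (l * s)))"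
    unfolding ft_def by (rule integral_Im[OF ft_integrable[OF kappa_meas(2) kappa_integrable(2)], symmetric])
  also have "\<dots> = (LINT l|\<rho>. \<kappa>\<^sub>1 l * sin (l * s))" by (intro Bochner_Integration.integral_cong) (auto simp: Im_exp)
  finally have 1: "Im (ft \<kappa>\<^sub>1 s) = (LINT l|\<rho>. \<kappa>\<^sub>1 l * sin (l * s))" .
  have i: "integrable \<rho> (\<lambda>l. \<kappa>\<^sub>1 l * sin (l * s))"
    unfolding \<kappa>\<^sub>1_def mult.assoc by (rule int_l_mult[of _ 1]) (auto split: split_indicator)
  have i2: "integrable \<rho> (\<lambda>l. (\<sigma> * sin (\<sigma> * s)) * indicator {\<sigma>, - \<sigma>} l)"
    by (rule bounded_integrable[of _ "\<bar>\<sigma> * sin (\<sigma> * s)\<bar>"]) (auto split: split_indicator)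
  have "(LINT l|\<rho>. l * sin (l * s)) = (LINT l|\<rho>. (\<sigma> * sin (\<sigma> * s)) * indicator {\<sigma>, - \<sigma>} l + \<kappa>\<^sub>1 l * sin (l * s))"
    by (intro Bochner_Integration.integral_cong) (auto simp: \<kappa>\<^sub>1_def split: split_indicator)
  also have "\<dots> = (LINT l|\<rho>. (\<sigma> * sin (\<sigma> * s)) * indicator {\<sigma>, - \<sigma>} l) + (LINT l|\<rho>. \<kappa>\<^sub>1 l * sin (l * s))"
    by (rule Bochner_Integration.integral_add[OF i2 i])
  also have "(LINT l|\<rho>. (\<sigma> * sin (\<sigma> * s)) * indicator {\<sigma>, - \<sigma>} l) = mass * \<sigma> * sin (\<sigma> * s)"
    by (simp add: mass_def sets_eq_imp_space_eq[OF rho_sets])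
  finally show ?thesis using 1 by (simp add: r1_def)
qed

text \<open>Gaussian time average, at scale \<open>T\<close>, of the parts of \<open>r\<close> and
  of its derivative that do not come from +-\<sigma>, the latter scaled like
  \<open>\<beta>f\<close>.\<close>

definition "\<omega>f T = (LINT x|N1. norm (ft \<kappa>\<^sub>0 (T * x))) + (LINT x|N1. norm (ft \<kappa>\<^sub>1 (T * x))) / \<sigma>"

lemma omega_tendsto_0:
  assumes a: "filterlim a at_top sequentially" and atom: "\<And>l. l \<noteq> \<sigma> \<Longrightarrow> l \<noteq> - \<sigma> \<Longrightarrow> measure \<rho> {l} = 0"
  shows "(\<lambda>n. \<omega>f (a n)) \<longlonglongrightarrow> 0"
proof -
  have "(\<lambda>n. LINT x|N1. norm (ft \<kappa>\<^sub>0 (a n * x))) \<longlonglongrightarrow> 0"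
    by (rule ft_mean_tendsto_0[OF kappa_meas(1) kappa_integrable(1) a]) (use atom in \<open>auto simp: \<kappa>\<^sub>0_def indicator_def\<close>)
  moreover have "(\<lambda>n. LINT x|N1. norm (ft \<kappa>\<^sub>1 (a n * x))) \<longlonglongrightarrow> 0"
    by (rule ft_mean_tendsto_0[OF kappa_meas(2) kappa_integrable(2) a]) (use atom in \<open>auto simp: \<kappa>\<^sub>1_def indicator_def\<close>)
  ultimately have "(\<lambda>n. \<omega>f (a n)) \<longlonglongrightarrow> 0 + 0 / \<sigma>" unfolding \<omega>f_def
    using sigma_pos by (intro tendsto_add tendsto_divide tendsto_const) auto
  then show ?thesis by simp
qed

text \<open>The part of \<open>\<alpha>f\<close> and \<open>\<beta>f\<close> due to the frequencies
  +-\<sigma> is a single sinusoid, whose density integrates to exactly \<open>T\<close> over full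
  periods. Its density can therefore replace the constant 1, and the Lipschitz bound of
  \<open>kr_density\<close> leaves averages of the remaining parts over shifted windows.\<close>

lemma kd_integral_le:
  assumes fc: "finite I" "(\<Sum>i\<in>I. \<bar>c i\<bar>) \<le> C" and T: "T = real L * (2 * pi / \<sigma>)" "T > 0"
    and t: "\<And>i. i \<in> I \<Longrightarrow> 0 \<le> t i \<and> t i \<le> 2 * T"
  shows "\<bar>integral {0..T} (\<lambda>s. kd I c t s - 1)\<bar> \<le> 2 * exp (C\<^sup>2) * (C + 1) * (C * (T / std_normal_density 2 * \<omega>f T))"
proof -
  define A where "A = 2 * exp (C\<^sup>2) * (C + 1)"
  have C: "C \<ge> 0" using C_nonneg[OF fc] .
  have A: "A \<ge> 0" using C by (simp add: A_def)
  \<comment> \<open>All the shifted terms share the frequency \<sigma>, so they combine into one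
    complex amplitude.\<close>
  define z where "z = (\<Sum>i\<in>I. complex_of_real (mass * c i) * iexp (- (\<sigma> * t i)))"
  define w where "w s = z * iexp (\<sigma> * s)" for s
  have ws: "w s = (\<Sum>i\<in>I. complex_of_real (mass * c i) * iexp (\<sigma> * (s - t i)))" for s
    unfolding w_def z_def sum_distrib_right
    by (intro sum.cong refl) (simp add: mult.assoc right_diff_distrib exp_diff exp_minus divide_inverse mult.commute)
  have nz: "norm z \<le> C"
  proof -
    have "norm z \<le> (\<Sum>i\<in>I. \<bar>c i\<bar>)"
      unfolding z_def
    proof (rule sum_norm_le)
      show "norm (complex_of_real (mass * c i) * iexp (- (\<sigma> * t i))) \<le> \<bar>c i\<bar>" for i
        unfolding norm_mult norm_exp_i_times norm_of_real abs_mult using mass by (simp add: mult_left_le_one_le)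
    qed
    then show ?thesis using fc by simp
  qed
  have nw: "norm (w s) \<le> C" for s unfolding w_def norm_mult norm_exp_i_times using nz by simp
  have Re_w: "Re (w s) = (\<Sum>i\<in>I. c i * (mass * cos (\<sigma> * (s - t i))))" for s
    unfolding ws Re_sum by (intro sum.cong refl) (simp add: Re_exp del: of_real_mult)
  have Im_w: "Im (w s) = (\<Sum>i\<in>I. c i * (mass * sin (\<sigma> * (s - t i))))" for s
    unfolding ws Im_sum by (intro sum.cong refl) (simp add: Im_exp del: of_real_mult)
  have a: "\<alpha>f I c t s - Re (w s) = (\<Sum>i\<in>I. c i * Re (ft \<kappa>\<^sub>0 (s - t i)))" for s
    unfolding \<alpha>f_def Re_w sum_subtractf[symmetric] r_split by (simp only: right_diff_distrib[symmetric] add_diff_cancel_left')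
  have b: "\<beta>f I c t s - (- Im (w s)) = - ((\<Sum>i\<in>I. c i * Im (ft \<kappa>\<^sub>1 (s - t i))) / \<sigma>)" for s
  proof -
    have "\<beta>f I c t s * \<sigma> = (\<Sum>i\<in>I. - (\<sigma> * (c i * (mass * sin (\<sigma> * (s - t i))))) - c i * Im (ft \<kappa>\<^sub>1 (s - t i)))"
      unfolding \<beta>f_def r1_split using sigma_pos by (simp add: right_diff_distrib mult_ac)
    also have "\<dots> = - (\<sigma> * Im (w s)) - (\<Sum>i\<in>I. c i * Im (ft \<kappa>\<^sub>1 (s - t i)))"
      unfolding Im_w sum_subtractf sum_negf sum_distrib_left ..
    finally have "\<beta>f I c t s * \<sigma> = - (\<sigma> * Im (w s)) - (\<Sum>i\<in>I. c i * Im (ft \<kappa>\<^sub>1 (s - t i)))" .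
    moreover have "y - (- x) = - (u / \<sigma>)" if "y * \<sigma> = - (\<sigma> * x) - u" for x y u :: real
      using that sigma_pos by (simp add: field_simps)
    ultimately show ?thesis by blast
  qed
  define G where "G s = A * ((\<Sum>i\<in>I. \<bar>c i\<bar> * norm (ft \<kappa>\<^sub>0 (s - t i))) + (\<Sum>i\<in>I. \<bar>c i\<bar> * norm (ft \<kappa>\<^sub>1 (s - t i))) / \<sigma>)" for s
  define k0 where "k0 s = kr_density (Re (w s)) (Im (w s))" for s
  have le: "norm (kd I c t s - k0 s) \<le> G s" for s
  proof -
    have "\<bar>kd I c t s - k0 s\<bar> = \<bar>kr_density (\<alpha>f I c t s) (\<beta>f I c t s) - kr_density (Re (w s)) (- Im (w s))\<bar>"
      unfolding kd_def[OF fc] k0_def kr_density_even ..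
    also have "\<dots> \<le> A * (\<bar>\<alpha>f I c t s - Re (w s)\<bar> + \<bar>\<beta>f I c t s - (- Im (w s))\<bar>)"
      unfolding A_def
      by (intro kr_density_lipschitz alpha_le[OF fc] beta_le[OF fc])
         (use order_trans[OF abs_Re_le_cmod nw[of s]] order_trans[OF abs_Im_le_cmod nw[of s]] in auto)
    also have "\<dots> \<le> G s"
      unfolding G_def a b
    proof (intro mult_left_mono[OF _ A] add_mono)
      show "\<bar>\<Sum>i\<in>I. c i * Re (ft \<kappa>\<^sub>0 (s - t i))\<bar> \<le> (\<Sum>i\<in>I. \<bar>c i\<bar> * norm (ft \<kappa>\<^sub>0 (s - t i)))"
        by (rule order_trans[OF sum_abs]) (auto simp: abs_mult intro!: sum_mono mult_left_mono abs_Re_le_cmod)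
      have "\<bar>\<Sum>i\<in>I. c i * Im (ft \<kappa>\<^sub>1 (s - t i))\<bar> \<le> (\<Sum>i\<in>I. \<bar>c i\<bar> * norm (ft \<kappa>\<^sub>1 (s - t i)))"
        by (rule order_trans[OF sum_abs]) (auto simp: abs_mult intro!: sum_mono mult_left_mono abs_Im_le_cmod)
      then show "\<bar>- ((\<Sum>i\<in>I. c i * Im (ft \<kappa>\<^sub>1 (s - t i))) / \<sigma>)\<bar> \<le> (\<Sum>i\<in>I. \<bar>c i\<bar> * norm (ft \<kappa>\<^sub>1 (s - t i))) / \<sigma>"
        using sigma_pos by (simp add: abs_divide divide_right_mono)
    qed
    finally show ?thesis by simp
  qed
  have cft: "continuous_on {0..T} (\<lambda>s. norm (ft \<kappa>\<^sub>0 (s - t i)))" "continuous_on {0..T} (\<lambda>s. norm (ft \<kappa>\<^sub>1 (s - t i)))" for i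
    by (intro continuous_on_norm continuous_on_compose2[OF ft_continuous[OF kappa_meas(1) kappa_integrable(1), of UNIV]]
        continuous_on_compose2[OF ft_continuous[OF kappa_meas(2) kappa_integrable(2), of UNIV]] continuous_intros; simp)+
  have kc: "continuous_on {0..T} k0"
  proof (rule continuous_on_eq[of _ "\<lambda>s. exp (((Re (w s))\<^sup>2 + (Im (w s))\<^sup>2) / 2) * ell (Im (w s)) * sqrt (pi/2)"])
    have "1-lipschitz_on UNIV ell" by (rule lipschitz_onI) (use ell_lipschitz in \<open>auto simp: dist_real_def\<close>)
    then have e: "continuous_on UNIV ell" by (rule lipschitz_on_continuous_on)
    have wc: "continuous_on {0..T} w" unfolding w_def by (intro continuous_intros)
    show "continuous_on {0..T} (\<lambda>s. exp (((Re (w s))\<^sup>2 + (Im (w s))\<^sup>2) / 2) * ell (Im (w s)) * sqrt (pi/2))"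
      by (intro continuous_intros continuous_on_compose2[OF e] wc) auto
  qed (simp add: k0_def kr_density_def)
  have ki: "kd I c t integrable_on {0..T}" "k0 integrable_on {0..T}"
    by (intro integrable_continuous_real kd_continuous[OF fc] kc)+
  have Gi: "G integrable_on {0..T}"
    unfolding G_def by (intro integrable_continuous_real continuous_intros cft) (use sigma_pos in auto)
  have "integral {0..T} k0 = T" unfolding k0_def w_def T(1) by (rule kr_density_sinusoid_integral[OF sigma_pos])
  moreover have "integral {0..T} (\<lambda>s. kd I c t s - 1) = integral {0..T} (kd I c t) - T"
    using ki(1) T by (subst Henstock_Kurzweil_Integration.integral_diff) auto
  moreover have "integral {0..T} (\<lambda>s. kd I c t s - k0 s) = integral {0..T} (kd I c t) - integral {0..T} k0"
    by (rule Henstock_Kurzweil_Integration.integral_diff[OF ki])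
  ultimately have "\<bar>integral {0..T} (\<lambda>s. kd I c t s - 1)\<bar> = norm (integral {0..T} (\<lambda>s. kd I c t s - k0 s))" by simp
  also have "\<dots> \<le> integral {0..T} G"
    by (rule integral_norm_bound_integral[OF Henstock_Kurzweil_Integration.integrable_diff[OF ki] Gi]) (rule le)
  also have "\<dots> = A * ((\<Sum>i\<in>I. \<bar>c i\<bar> * integral {0..T} (\<lambda>s. norm (ft \<kappa>\<^sub>0 (s - t i)))) + (\<Sum>i\<in>I. \<bar>c i\<bar> * integral {0..T} (\<lambda>s. norm (ft \<kappa>\<^sub>1 (s - t i)))) / \<sigma>)"
  proof (rule integral_unique)
    show "(G has_integral A * ((\<Sum>i\<in>I. \<bar>c i\<bar> * integral {0..T} (\<lambda>s. norm (ft \<kappa>\<^sub>0 (s - t i)))) + (\<Sum>i\<in>I. \<bar>c i\<bar> * integral {0..T} (\<lambda>s. norm (ft \<kappa>\<^sub>1 (s - t i)))) / \<sigma>)) {0..T}"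
      unfolding G_def
      by (intro has_integral_mult_right has_integral_add has_integral_divide has_integral_sum fc(1) integrable_integral integrable_continuous_real cft)
  qed
  also have "\<dots> \<le> A * (C * (T / std_normal_density 2 * (LINT x|N1. norm (ft \<kappa>\<^sub>0 (T * x)))) + C * (T / std_normal_density 2 * (LINT x|N1. norm (ft \<kappa>\<^sub>1 (T * x)))) / \<sigma>)"
  proof (intro mult_left_mono[OF _ A] add_mono divide_right_mono)
    have g: "(\<Sum>i\<in>I. \<bar>c i\<bar> * h i) \<le> C * D" if "\<And>i. i \<in> I \<Longrightarrow> h i \<le> D" "0 \<le> D" for h :: "nat \<Rightarrow> real" and D
    proof -
      have "(\<Sum>i\<in>I. \<bar>c i\<bar> * h i) \<le> (\<Sum>i\<in>I. \<bar>c i\<bar> * D)" using that by (intro sum_mono mult_left_mono) auto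
      also have "\<dots> = (\<Sum>i\<in>I. \<bar>c i\<bar>) * D" by (rule sum_distrib_right[symmetric])
      also have "\<dots> \<le> C * D" using fc(2) that(2) by (rule mult_right_mono)
      finally show ?thesis .
    qed
    have D0: "0 \<le> T / std_normal_density 2 * (LINT x|N1. norm (ft w (T * x)))" for w
      by (intro mult_nonneg_nonneg divide_nonneg_nonneg normal_density_nonneg Bochner_Integration.integral_nonneg norm_ge_zero less_imp_le[OF T(2)])
    show "(\<Sum>i\<in>I. \<bar>c i\<bar> * integral {0..T} (\<lambda>s. norm (ft \<kappa>\<^sub>0 (s - t i)))) \<le> C * (T / std_normal_density 2 * (LINT x|N1. norm (ft \<kappa>\<^sub>0 (T * x))))"
      by (intro g D0 ft_window_le[OF kappa_meas(1) kappa_integrable(1) T(2)]) (use t in auto)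
    show "(\<Sum>i\<in>I. \<bar>c i\<bar> * integral {0..T} (\<lambda>s. norm (ft \<kappa>\<^sub>1 (s - t i)))) \<le> C * (T / std_normal_density 2 * (LINT x|N1. norm (ft \<kappa>\<^sub>1 (T * x))))"
      by (intro g D0 ft_window_le[OF kappa_meas(2) kappa_integrable(2) T(2)]) (use t in auto)
  qed (use sigma_pos in simp)
  also have "\<dots> = A * (C * (T / std_normal_density 2 * \<omega>f T))"
    unfolding \<omega>f_def by (simp add: distrib_left)
  finally show ?thesis unfolding A_def .
qed

lemma dev_square_integrable: assumes "T \<ge> \<delta>\<^sub>0" shows "integrable M (\<lambda>\<omega>. (dev T \<omega>)\<^sup>2)" "integrable M (dev T)" "expectation (dev T) = 0"
proof -
  obtain K p where p: "0 < p" "p \<le> \<delta>\<^sub>0" and T: "T = real K * p" using step_decomposition[OF assms] by blast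
  show i: "integrable M (\<lambda>\<omega>. (dev T \<omega>)\<^sup>2)" "expectation (dev T) = 0" unfolding T by (rule dev_L2[OF p])+
  show "integrable M (dev T)" by (rule square_integrable_imp_integrable[OF dev_meas i(1)])
qed

text \<open>The product of two exponentials is the exponential of a two-term functional. The
  constant is independent of \<open>T\<close> and of the sampling points, a uniformity which the
  later sum over all grid points requires.\<close>

lemma dev_iexp_le:
  "\<exists>B\<ge>0. \<forall>T L a b. T \<ge> \<delta>\<^sub>0 \<longrightarrow> T = real L * (2 * pi / \<sigma>) \<longrightarrow> 0 \<le> a \<longrightarrow> a \<le> 2 * T \<longrightarrow> 0 \<le> b \<longrightarrow> b \<le> 2 * T \<longrightarrow>
     norm (CLINT \<omega>|M. complex_of_real (dev T \<omega>) * (iexp (\<theta> * f a \<omega>) * iexp (\<phi> * f b \<omega>))) \<le> B * (T * \<omega>f T)"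
proof -
  define c where "c i = (if i = 0 then \<theta> else \<phi>)" for i :: nat
  define C where "C = \<bar>\<theta>\<bar> + \<bar>\<phi>\<bar>"
  define I where "I = {0, 1::nat}"
  have fc: "finite I" "(\<Sum>i\<in>I. \<bar>c i\<bar>) \<le> C" by (simp_all add: I_def c_def C_def)
  define B where "B = \<sigma> / pi * (2 * exp (C\<^sup>2) * (C + 1) * (C / std_normal_density 2))"
  have B: "B \<ge> 0" using sigma_pos by (simp add: B_def C_def)
  show ?thesis
  proof (intro exI[of _ B] conjI B allI impI)
    fix T L a b assume T: "T \<ge> \<delta>\<^sub>0" "T = real L * (2 * pi / \<sigma>)" and ab: "0 \<le> a" "a \<le> 2 * T" "0 \<le> b" "b \<le> 2 * T"
    define t where "t i = (if i = 0 then a else b)" for i :: nat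
    have T0: "T > 0" using T(1) delta0(1) by linarith
    obtain K p where p: "0 < p" "p \<le> \<delta>\<^sub>0" and TK: "T = real K * p" using step_decomposition[OF T(1)] by blast
    have z: "iexp (zf I c t \<omega>) = iexp (\<theta> * f a \<omega>) * iexp (\<phi> * f b \<omega>)" for \<omega>
      unfolding zf_def[OF fc] by (simp add: I_def c_def t_def exp_add distrib_left)
    have "norm (CLINT \<omega>|M. complex_of_real (dev T \<omega>) * (iexp (\<theta> * f a \<omega>) * iexp (\<phi> * f b \<omega>))) =
       \<bar>\<sigma> / pi * exp (- (cov (zf I c t) (zf I c t) / 2)) * integral {0..T} (\<lambda>s. kd I c t s - 1)\<bar>"
      unfolding z[symmetric] TK cov_kac_rice[OF fc p] norm_of_real ..
    also have "\<dots> = \<sigma> / pi * exp (- (cov (zf I c t) (zf I c t) / 2)) * \<bar>integral {0..T} (\<lambda>s. kd I c t s - 1)\<bar>"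
      using sigma_pos by (simp add: abs_mult)
    also have "\<dots> \<le> \<sigma> / pi * 1 * (2 * exp (C\<^sup>2) * (C + 1) * (C * (T / std_normal_density 2 * \<omega>f T)))"
    proof (intro mult_mono)
      show "exp (- (cov (zf I c t) (zf I c t) / 2)) \<le> 1" using normal_law(2)[OF zf_lin[OF fc, of t]] by simp
      show "\<bar>integral {0..T} (\<lambda>s. kd I c t s - 1)\<bar> \<le> 2 * exp (C\<^sup>2) * (C + 1) * (C * (T / std_normal_density 2 * \<omega>f T))"
        by (rule kd_integral_le[OF fc T(2) T0]) (use ab in \<open>simp add: t_def\<close>)
    qed (use sigma_pos in auto)
    also have "\<dots> = B * (T * \<omega>f T)" unfolding B_def by simp
    finally show "norm (CLINT \<omega>|M. complex_of_real (dev T \<omega>) * (iexp (\<theta> * f a \<omega>) * iexp (\<phi> * f b \<omega>))) \<le> B * (T * \<omega>f T)" .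
  qed
qed

lemma dev_trig_integrable:
  assumes T: "T \<ge> \<delta>\<^sub>0" and F: "trig F" and G: "trig G"
  shows "integrable M (\<lambda>\<omega>. complex_of_real (dev T \<omega>) * (F (f a \<omega>) * G (f b \<omega>)))"
proof -
  note [measurable] = trig_meas[OF F] trig_meas[OF G]
  obtain A B where AB: "\<And>x. norm (F x) \<le> A" "\<And>x. norm (G x) \<le> B" using trig_bounded[OF F] trig_bounded[OF G] by blast
  have A: "0 \<le> A" using order_trans[OF norm_ge_zero AB(1)] .
  show ?thesis
  proof (rule norm_integral_le(1))
    show "integrable M (\<lambda>\<omega>. \<bar>dev T \<omega>\<bar> * (A * B))" using dev_square_integrable(2)[OF T] by simp
    show "norm (complex_of_real (dev T \<omega>) * (F (f a \<omega>) * G (f b \<omega>))) \<le> \<bar>dev T \<omega>\<bar> * (A * B)" for \<omega>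
      unfolding norm_mult norm_of_real using AB A by (intro mult_left_mono mult_mono) auto
  qed measurable
qed

text \<open>The expectation is bilinear in the two functions, so induction over the second, here,
  and then over the first, in \<open>dev_trig_trig_le\<close>, carries the bound from exponentials
  to the whole class.\<close>

lemma dev_iexp_trig_le:
  assumes "trig G"
  shows "\<exists>B\<ge>0. \<forall>T L a b. T \<ge> \<delta>\<^sub>0 \<longrightarrow> T = real L * (2 * pi / \<sigma>) \<longrightarrow> 0 \<le> a \<longrightarrow> a \<le> 2 * T \<longrightarrow> 0 \<le> b \<longrightarrow> b \<le> 2 * T \<longrightarrow>
     norm (CLINT \<omega>|M. complex_of_real (dev T \<omega>) * (iexp (\<theta> * f a \<omega>) * G (f b \<omega>))) \<le> B * (T * \<omega>f T)"
  using assms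
proof induction
  case (iexp \<phi>)
  show ?case by (rule dev_iexp_le)
next
  case (add F G)
  from add.IH obtain B B' where B: "B \<ge> 0" "B' \<ge> 0"
    and le: "\<forall>T L a b. T \<ge> \<delta>\<^sub>0 \<longrightarrow> T = real L * (2 * pi / \<sigma>) \<longrightarrow> 0 \<le> a \<longrightarrow> a \<le> 2 * T \<longrightarrow> 0 \<le> b \<longrightarrow> b \<le> 2 * T \<longrightarrow>
      norm (CLINT \<omega>|M. complex_of_real (dev T \<omega>) * (iexp (\<theta> * f a \<omega>) * F (f b \<omega>))) \<le> B * (T * \<omega>f T)"
     "\<forall>T L a b. T \<ge> \<delta>\<^sub>0 \<longrightarrow> T = real L * (2 * pi / \<sigma>) \<longrightarrow> 0 \<le> a \<longrightarrow> a \<le> 2 * T \<longrightarrow> 0 \<le> b \<longrightarrow> b \<le> 2 * T \<longrightarrow>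
      norm (CLINT \<omega>|M. complex_of_real (dev T \<omega>) * (iexp (\<theta> * f a \<omega>) * G (f b \<omega>))) \<le> B' * (T * \<omega>f T)"
    by blast
  show ?case
  proof (intro exI[of _ "B + B'"] conjI allI impI)
    fix T L a b assume T: "T \<ge> \<delta>\<^sub>0" "T = real L * (2 * pi / \<sigma>)" and ab: "0 \<le> a" "a \<le> 2 * T" "0 \<le> b" "b \<le> 2 * T"
    have "(CLINT \<omega>|M. complex_of_real (dev T \<omega>) * (iexp (\<theta> * f a \<omega>) * (F (f b \<omega>) + G (f b \<omega>)))) =
       (CLINT \<omega>|M. complex_of_real (dev T \<omega>) * (iexp (\<theta> * f a \<omega>) * F (f b \<omega>))) + (CLINT \<omega>|M. complex_of_real (dev T \<omega>) * (iexp (\<theta> * f a \<omega>) * G (f b \<omega>)))"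
      unfolding distrib_left
      by (rule Bochner_Integration.integral_add[OF dev_trig_integrable[OF T(1) trig.iexp add.hyps(1)] dev_trig_integrable[OF T(1) trig.iexp add.hyps(2)]])
    then show "norm (CLINT \<omega>|M. complex_of_real (dev T \<omega>) * (iexp (\<theta> * f a \<omega>) * (F (f b \<omega>) + G (f b \<omega>)))) \<le> (B + B') * (T * \<omega>f T)"
      unfolding distrib_right using norm_triangle_mono[OF le(1)[rule_format, OF T ab] le(2)[rule_format, OF T ab]] by (simp only:)
  qed (use B in simp)
next
  case (scale F c)
  from scale.IH obtain B where B: "B \<ge> 0"
    and le: "\<forall>T L a b. T \<ge> \<delta>\<^sub>0 \<longrightarrow> T = real L * (2 * pi / \<sigma>) \<longrightarrow> 0 \<le> a \<longrightarrow> a \<le> 2 * T \<longrightarrow> 0 \<le> b \<longrightarrow> b \<le> 2 * T \<longrightarrow>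
      norm (CLINT \<omega>|M. complex_of_real (dev T \<omega>) * (iexp (\<theta> * f a \<omega>) * F (f b \<omega>))) \<le> B * (T * \<omega>f T)"
    by blast
  show ?case
  proof (intro exI[of _ "norm c * B"] conjI allI impI)
    fix T L a b assume T: "T \<ge> \<delta>\<^sub>0" "T = real L * (2 * pi / \<sigma>)" and ab: "0 \<le> a" "a \<le> 2 * T" "0 \<le> b" "b \<le> 2 * T"
    have "(CLINT \<omega>|M. complex_of_real (dev T \<omega>) * (iexp (\<theta> * f a \<omega>) * (c * F (f b \<omega>)))) =
       c * (CLINT \<omega>|M. complex_of_real (dev T \<omega>) * (iexp (\<theta> * f a \<omega>) * F (f b \<omega>)))"
      unfolding integral_mult_right_zero[symmetric] by (simp only: mult.left_commute)
    then show "norm (CLINT \<omega>|M. complex_of_real (dev T \<omega>) * (iexp (\<theta> * f a \<omega>) * (c * F (f b \<omega>)))) \<le> norm c * B * (T * \<omega>f T)"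
      unfolding mult.assoc[of "norm c"] using mult_left_mono[OF le[rule_format, OF T ab] norm_ge_zero[of c]] by (simp only: norm_mult)
  qed (use B in simp)
qed

lemma dev_trig_trig_le:
  assumes "trig F" and G: "trig G"
  shows "\<exists>B\<ge>0. \<forall>T L a b. T \<ge> \<delta>\<^sub>0 \<longrightarrow> T = real L * (2 * pi / \<sigma>) \<longrightarrow> 0 \<le> a \<longrightarrow> a \<le> 2 * T \<longrightarrow> 0 \<le> b \<longrightarrow> b \<le> 2 * T \<longrightarrow>
     norm (CLINT \<omega>|M. complex_of_real (dev T \<omega>) * (F (f a \<omega>) * G (f b \<omega>))) \<le> B * (T * \<omega>f T)"
  using assms(1)
proof induction
  case (iexp \<phi>)
  show ?case by (rule dev_iexp_trig_le[OF G])
next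
  case (add F F')
  from add.IH obtain B B' where B: "B \<ge> 0" "B' \<ge> 0"
    and le: "\<forall>T L a b. T \<ge> \<delta>\<^sub>0 \<longrightarrow> T = real L * (2 * pi / \<sigma>) \<longrightarrow> 0 \<le> a \<longrightarrow> a \<le> 2 * T \<longrightarrow> 0 \<le> b \<longrightarrow> b \<le> 2 * T \<longrightarrow>
      norm (CLINT \<omega>|M. complex_of_real (dev T \<omega>) * (F (f a \<omega>) * G (f b \<omega>))) \<le> B * (T * \<omega>f T)"
     "\<forall>T L a b. T \<ge> \<delta>\<^sub>0 \<longrightarrow> T = real L * (2 * pi / \<sigma>) \<longrightarrow> 0 \<le> a \<longrightarrow> a \<le> 2 * T \<longrightarrow> 0 \<le> b \<longrightarrow> b \<le> 2 * T \<longrightarrow>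
      norm (CLINT \<omega>|M. complex_of_real (dev T \<omega>) * (F' (f a \<omega>) * G (f b \<omega>))) \<le> B' * (T * \<omega>f T)"
    by blast
  show ?case
  proof (intro exI[of _ "B + B'"] conjI allI impI)
    fix T L a b assume T: "T \<ge> \<delta>\<^sub>0" "T = real L * (2 * pi / \<sigma>)" and ab: "0 \<le> a" "a \<le> 2 * T" "0 \<le> b" "b \<le> 2 * T"
    have "(CLINT \<omega>|M. complex_of_real (dev T \<omega>) * ((F (f a \<omega>) + F' (f a \<omega>)) * G (f b \<omega>))) =
       (CLINT \<omega>|M. complex_of_real (dev T \<omega>) * (F (f a \<omega>) * G (f b \<omega>))) + (CLINT \<omega>|M. complex_of_real (dev T \<omega>) * (F' (f a \<omega>) * G (f b \<omega>)))"
      unfolding distrib_left distrib_right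
      by (rule Bochner_Integration.integral_add[OF dev_trig_integrable[OF T(1) add.hyps(1) G] dev_trig_integrable[OF T(1) add.hyps(2) G]])
    then show "norm (CLINT \<omega>|M. complex_of_real (dev T \<omega>) * ((F (f a \<omega>) + F' (f a \<omega>)) * G (f b \<omega>))) \<le> (B + B') * (T * \<omega>f T)"
      unfolding distrib_right[of B] using norm_triangle_mono[OF le(1)[rule_format, OF T ab] le(2)[rule_format, OF T ab]] by (simp only:)
  qed (use B in simp)
next
  case (scale F c)
  from scale.IH obtain B where B: "B \<ge> 0"
    and le: "\<forall>T L a b. T \<ge> \<delta>\<^sub>0 \<longrightarrow> T = real L * (2 * pi / \<sigma>) \<longrightarrow> 0 \<le> a \<longrightarrow> a \<le> 2 * T \<longrightarrow> 0 \<le> b \<longrightarrow> b \<le> 2 * T \<longrightarrow>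
      norm (CLINT \<omega>|M. complex_of_real (dev T \<omega>) * (F (f a \<omega>) * G (f b \<omega>))) \<le> B * (T * \<omega>f T)"
    by blast
  show ?case
  proof (intro exI[of _ "norm c * B"] conjI allI impI)
    fix T L a b assume T: "T \<ge> \<delta>\<^sub>0" "T = real L * (2 * pi / \<sigma>)" and ab: "0 \<le> a" "a \<le> 2 * T" "0 \<le> b" "b \<le> 2 * T"
    have "(CLINT \<omega>|M. complex_of_real (dev T \<omega>) * (c * F (f a \<omega>) * G (f b \<omega>))) =
       c * (CLINT \<omega>|M. complex_of_real (dev T \<omega>) * (F (f a \<omega>) * G (f b \<omega>)))"
      unfolding integral_mult_right_zero[symmetric] by (simp only: mult.left_commute mult.assoc)
    then show "norm (CLINT \<omega>|M. complex_of_real (dev T \<omega>) * (c * F (f a \<omega>) * G (f b \<omega>))) \<le> norm c * B * (T * \<omega>f T)"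
      unfolding mult.assoc[of "norm c"] using mult_left_mono[OF le[rule_format, OF T ab] norm_ge_zero[of c]] by (simp only: norm_mult)
  qed (use B in simp)
qed

lemma expectation_f:
  fixes g :: "real \<Rightarrow> real"
  assumes [measurable]: "g \<in> borel_measurable borel"
  shows "expectation (\<lambda>\<omega>. g (f t \<omega>)) = (LINT x|N1. g x)"
proof -
  have d: "distr M borel (f t) = distr N1 borel (\<lambda>x. x)"
    using normal_law(5)[OF f_lin, of t] by (simp add: cov_f r_at_0)
  have "expectation (\<lambda>\<omega>. g (f t \<omega>)) = (LINT x|distr M borel (f t). g x)" by (rule integral_distr[symmetric]) auto
  also have "\<dots> = (LINT x|N1. g x)" unfolding d by (rule integral_distr) auto
  finally show ?thesis .
qed

text \<open>For nonzero a and b the indicator of a sign change is (1 - sgn a sgn b)/2; here the sign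
  is replaced by its approximation.\<close>

definition soft_crossings :: "(real \<Rightarrow> real) \<Rightarrow> real \<Rightarrow> nat \<Rightarrow> 'a \<Rightarrow> real" where
  "soft_crossings F h J \<omega> = (\<Sum>j<J. (1 - F (f (real j * h) \<omega>) * F (f (real (Suc j) * h) \<omega>)) / 2)"

lemma soft_crossings_bounded:
  assumes F: "\<And>x. \<bar>F x\<bar> \<le> 2" shows "\<bar>soft_crossings F h J \<omega>\<bar> \<le> real J * 3"
proof -
  have "\<bar>soft_crossings F h J \<omega>\<bar> \<le> (\<Sum>j<J. 3)"
    unfolding soft_crossings_def
  proof (rule order_trans[OF sum_abs], rule sum_mono)
    fix j
    have "\<bar>F (f (real j * h) \<omega>) * F (f (real (Suc j) * h) \<omega>)\<bar> \<le> 2 * 2" unfolding abs_mult using F by (intro mult_mono) auto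
    moreover have "\<bar>(1 - z) / 2\<bar> \<le> 3" if "\<bar>z\<bar> \<le> 2 * 2" for z :: real
    proof -
      have "\<bar>1 - z\<bar> \<le> 3 * 2" using abs_triangle_ineq4[of 1 z] that by simp
      then show ?thesis by (simp add: abs_divide divide_le_eq)
    qed
    ultimately show "\<bar>(1 - F (f (real j * h) \<omega>) * F (f (real (Suc j) * h) \<omega>)) / 2\<bar> \<le> 3" by blast
  qed
  then show ?thesis by simp
qed

text \<open>The error in a cell is controlled linearly by F - sgn at its two ends, and every value
  of the process is standard normal, so the approximation on the line transfers to all grid points.
  Zeros on the grid have probability 0.\<close>

lemma crossings_approximation:
  assumes [measurable]: "F \<in> borel_measurable borel" and F: "\<And>x. \<bar>F x\<bar> \<le> 2"
    and e: "(LINT x|N1. (F x - sgn x)\<^sup>2) \<le> e"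
  shows "expectation (\<lambda>\<omega>. (crossings (\<lambda>t. f t \<omega>) 0 h J - soft_crossings F h J \<omega>)\<^sup>2) \<le> (real J)\<^sup>2 * (4 * e)"
proof -
  define x where "x j \<omega> = f (real j * h) \<omega>" for j \<omega>
  have [measurable]: "x j \<in> borel_measurable M" for j unfolding x_def[abs_def] by measurable
  define u where "u j \<omega> = (F (x j \<omega>) - sgn (x j \<omega>))\<^sup>2" for j \<omega>
  have [measurable]: "u j \<in> borel_measurable M" for j unfolding u_def[abs_def] by measurable
  have u: "0 \<le> u j \<omega>" "u j \<omega> \<le> 9" for j \<omega>
  proof -
    have "\<bar>sgn (x j \<omega>)\<bar> \<le> 1" by (simp add: abs_sgn_eq)
    then have "\<bar>F (x j \<omega>) - sgn (x j \<omega>)\<bar> \<le> 3" using F[of "x j \<omega>"] by linarith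
    then have "\<bar>F (x j \<omega>) - sgn (x j \<omega>)\<bar>^2 \<le> 3^2" by (intro power_mono) auto
    then show "u j \<omega> \<le> 9" by (simp add: u_def)
  qed (simp add: u_def)
  have iu: "integrable M (u j)" for j by (rule integrable_const_bound[of _ 9]) (use u in auto)
  have eu: "expectation (u j) \<le> e" for j
    using expectation_f[of "\<lambda>y. (F y - sgn y)\<^sup>2" "real j * h"] e unfolding u_def[abs_def] x_def by simp
  have AE0: "AE \<omega> in M. \<forall>j. x j \<omega> \<noteq> 0" unfolding x_def by (intro AE_all_countable[THEN iffD2] allI f_nonzero_AE)
  have pt: "(of_bool (a * b < 0) - (1 - F a * F b) / 2)\<^sup>2 \<le> 2 * ((F a - sgn a)\<^sup>2 + (F b - sgn b)\<^sup>2)" if "a \<noteq> 0" "b \<noteq> 0" for a b :: real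
  proof -
    have o: "of_bool (a * b < 0) = (1 - sgn a * sgn b) / 2" using that by (auto simp: sgn_real_def mult_less_0_iff)
    have "of_bool (a * b < 0) - (1 - F a * F b) / 2 = (F a * (F b - sgn b) + (F a - sgn a) * sgn b) / 2"
      unfolding o by (simp add: field_simps)
    also have "\<bar>\<dots>\<bar> \<le> (2 * \<bar>F b - sgn b\<bar> + \<bar>F a - sgn a\<bar> * 1) / 2"
    proof -
      have gen: "\<bar>(X + Y) / 2\<bar> \<le> (c + d) / 2" if "\<bar>X\<bar> \<le> c" "\<bar>Y\<bar> \<le> d" for X Y c d :: real
      proof -
        have "\<bar>X + Y\<bar> \<le> c + d" using abs_triangle_ineq[of X Y] that by linarith
        then have "\<bar>X + Y\<bar> / 2 \<le> (c + d) / 2" by (rule divide_right_mono) simp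
        then show ?thesis by (simp add: abs_divide)
      qed
      have 1: "\<bar>F a * (F b - sgn b)\<bar> \<le> 2 * \<bar>F b - sgn b\<bar>" unfolding abs_mult using F by (intro mult_right_mono) auto
      have 2: "\<bar>(F a - sgn a) * sgn b\<bar> \<le> \<bar>F a - sgn a\<bar> * 1" unfolding abs_mult by (intro mult_left_mono) (auto simp: abs_sgn_eq)
      show ?thesis by (rule gen[OF 1 2])
    qed
    also have "\<dots> \<le> \<bar>F b - sgn b\<bar> + \<bar>F a - sgn a\<bar>"
    proof -
      have "(2 * c + d * 1) / 2 \<le> c + d" if "0 \<le> d" for c d :: real using that by (simp add: add_divide_distrib)
      from this[OF abs_ge_zero] show ?thesis .
    qed
    finally have d: "\<bar>of_bool (a * b < 0) - (1 - F a * F b) / 2\<bar> \<le> \<bar>F b - sgn b\<bar> + \<bar>F a - sgn a\<bar>" .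
    define X Y where "X = \<bar>F b - sgn b\<bar>" and "Y = \<bar>F a - sgn a\<bar>"
    have "\<bar>of_bool (a * b < 0) - (1 - F a * F b) / 2\<bar>\<^sup>2 \<le> (X + Y)\<^sup>2" using d unfolding X_def Y_def by (intro power_mono) auto
    also have "\<dots> \<le> 2 * (Y\<^sup>2 + X\<^sup>2)" using sum_squares_bound[of X Y] by (simp add: power2_sum)
    finally show ?thesis by (simp add: X_def Y_def)
  qed
  have "expectation (\<lambda>\<omega>. (crossings (\<lambda>t. f t \<omega>) 0 h J - soft_crossings F h J \<omega>)\<^sup>2) \<le>
     expectation (\<lambda>\<omega>. real J * (\<Sum>j<J. 2 * (u j \<omega> + u (Suc j) \<omega>)))"
  proof (rule integral_mono_AE')
    show "integrable M (\<lambda>\<omega>. real J * (\<Sum>j<J. 2 * (u j \<omega> + u (Suc j) \<omega>)))"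
      by (intro integrable_mult_right Bochner_Integration.integrable_sum Bochner_Integration.integrable_add iu)
    show "AE \<omega> in M. (crossings (\<lambda>t. f t \<omega>) 0 h J - soft_crossings F h J \<omega>)\<^sup>2 \<le> real J * (\<Sum>j<J. 2 * (u j \<omega> + u (Suc j) \<omega>))"
      using AE0
    proof eventually_elim
      case (elim \<omega>)
      have "crossings (\<lambda>t. f t \<omega>) 0 h J - soft_crossings F h J \<omega> = 
         (\<Sum>j<J. of_bool (x j \<omega> * x (Suc j) \<omega> < 0) - (1 - F (x j \<omega>) * F (x (Suc j) \<omega>)) / 2)"
        unfolding crossings_def soft_crossings_def x_def sum_subtractf by simp
      then have "(crossings (\<lambda>t. f t \<omega>) 0 h J - soft_crossings F h J \<omega>)\<^sup>2 \<le> 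
         real J * (\<Sum>j<J. (of_bool (x j \<omega> * x (Suc j) \<omega> < 0) - (1 - F (x j \<omega>) * F (x (Suc j) \<omega>)) / 2)\<^sup>2)"
        using square_sum_le by (simp only:)
      also have "\<dots> \<le> real J * (\<Sum>j<J. 2 * (u j \<omega> + u (Suc j) \<omega>))"
        unfolding u_def using elim by (intro mult_left_mono sum_mono pt) auto
      finally show ?case .
    qed
    show "AE \<omega> in M. 0 \<le> real J * (\<Sum>j<J. 2 * (u j \<omega> + u (Suc j) \<omega>))"
      using u by (intro AE_I2 mult_nonneg_nonneg sum_nonneg) auto
  qed
  also have "\<dots> = real J * (\<Sum>j<J. 2 * (expectation (u j) + expectation (u (Suc j))))"
    using iu by simp
  also have "\<dots> \<le> real J * (\<Sum>j<J. 2 * (e + e))"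
    using eu by (intro mult_left_mono sum_mono add_mono) auto
  also have "\<dots> = (real J)\<^sup>2 * (4 * e)" by (simp add: power2_eq_square)
  finally show ?thesis .
qed

text \<open>The constant summand 1/2 disappears since \<open>dev\<close> has mean zero; what remains
  are the products of two values of \<open>F\<close> treated before.\<close>

lemma dev_soft_crossings_le:
  assumes F: "trig (\<lambda>x. complex_of_real (F x))"
  shows "\<exists>B\<ge>0. \<forall>T L h J. T \<ge> \<delta>\<^sub>0 \<longrightarrow> T = real L * (2 * pi / \<sigma>) \<longrightarrow> h \<ge> 0 \<longrightarrow> real J * h = T \<longrightarrow>
     \<bar>expectation (\<lambda>\<omega>. dev T \<omega> * soft_crossings F h J \<omega>)\<bar> \<le> real J * (B * (T * \<omega>f T))"
proof -
  obtain B where B: "B \<ge> 0" and le: "\<forall>T L a b. T \<ge> \<delta>\<^sub>0 \<longrightarrow> T = real L * (2 * pi / \<sigma>) \<longrightarrow> 0 \<le> a \<longrightarrow> a \<le> 2 * T \<longrightarrow> 0 \<le> b \<longrightarrow> b \<le> 2 * T \<longrightarrow>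
     norm (CLINT \<omega>|M. complex_of_real (dev T \<omega>) * (complex_of_real (F (f a \<omega>)) * complex_of_real (F (f b \<omega>)))) \<le> B * (T * \<omega>f T)"
    using dev_trig_trig_le[OF F F] by blast
  show ?thesis
  proof (intro exI[of _ B] conjI B allI impI)
    fix T L h J assume T: "T \<ge> \<delta>\<^sub>0" "T = real L * (2 * pi / \<sigma>)" and h: "h \<ge> 0" "real J * h = T"
    have T0: "T > 0" using T(1) delta0(1) by linarith
    define X where "X j \<omega> = dev T \<omega> * (F (f (real j * h) \<omega>) * F (f (real (Suc j) * h) \<omega>))" for j \<omega>
    have iX: "integrable M (X j)" for j
      using dev_trig_integrable[OF T(1) F F, of "real j * h" "real (Suc j) * h"] unfolding X_def of_real_mult[symmetric] complex_of_real_integrable_eq .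
    have X: "\<bar>expectation (X j)\<bar> \<le> B * (T * \<omega>f T)" if "j < J" for j
    proof -
      have "real j * h \<le> real J * h" "real (Suc j) * h \<le> real J * h" using that h by (auto intro!: mult_right_mono)
      then have ab: "0 \<le> real j * h" "real j * h \<le> 2 * T" "0 \<le> real (Suc j) * h" "real (Suc j) * h \<le> 2 * T" using h T0 by auto
      have "complex_of_real (expectation (X j)) = (CLINT \<omega>|M. complex_of_real (dev T \<omega>) * (complex_of_real (F (f (real j * h) \<omega>)) * complex_of_real (F (f (real (Suc j) * h) \<omega>))))"
        unfolding X_def of_real_mult[symmetric] by (rule integral_complex_of_real[symmetric])
      then have "norm (complex_of_real (expectation (X j))) \<le> B * (T * \<omega>f T)" using le[rule_format, OF T ab] by (simp only:)
      then show ?thesis by (simp only: norm_of_real)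
    qed
    have e: "dev T \<omega> * soft_crossings F h J \<omega> = (\<Sum>j<J. dev T \<omega> / 2 - X j \<omega> / 2)" for \<omega>
      unfolding soft_crossings_def X_def sum_distrib_left by (intro sum.cong refl) (simp only: right_diff_distrib diff_divide_distrib times_divide_eq_right mult_1_right)
    have "expectation (\<lambda>\<omega>. dev T \<omega> * soft_crossings F h J \<omega>) = (\<Sum>j<J. expectation (dev T) / 2 - expectation (X j) / 2)"
      unfolding e using iX dev_square_integrable(2)[OF T(1)] by simp
    then have "\<bar>expectation (\<lambda>\<omega>. dev T \<omega> * soft_crossings F h J \<omega>)\<bar> \<le> (\<Sum>j<J. \<bar>expectation (dev T) / 2 - expectation (X j) / 2\<bar>)"
      by (simp only: sum_abs)
    also have "\<dots> \<le> (\<Sum>j<J. B * (T * \<omega>f T))"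
    proof (rule sum_mono)
      fix j assume "j \<in> {..<J}"
      then show "\<bar>expectation (dev T) / 2 - expectation (X j) / 2\<bar> \<le> B * (T * \<omega>f T)"
        using X[of j] unfolding dev_square_integrable(3)[OF T(1)] by simp
    qed
    finally show "\<bar>expectation (\<lambda>\<omega>. dev T \<omega> * soft_crossings F h J \<omega>)\<bar> \<le> real J * (B * (T * \<omega>f T))" by simp
  qed
qed

end

section \<open>Variance along full periods and the equivalence\<close>

context stat_gauss
begin

text \<open>The variance is the covariance of the count with itself, and one copy is split into
  discretisation error, smoothing error of the signs, and soft count. The order of choices matters:
  thanks to \<open>NN_L2_uniform\<close> the mesh depends on \<open>e\<close> but not on the number
  of periods, the trigonometric polynomial is chosen after the mesh, and only then does the number
  of periods grow.\<close>

lemma variance_negligible: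
  assumes atom: "\<And>l. l \<noteq> \<sigma> \<Longrightarrow> l \<noteq> - \<sigma> \<Longrightarrow> measure \<rho> {l} = 0" and e: "e > 0"
  shows "\<forall>\<^sub>F L in sequentially. variance (zero_count f (real L * (2 * pi / \<sigma>))) \<le> e * (real L * (2 * pi / \<sigma>))\<^sup>2"
proof -
  define q where "q = 2 * pi / \<sigma>"
  have q: "q > 0" using sigma_pos by (simp add: q_def)
  \<comment> \<open>A period is divided into \<open>k\<close> equal steps below the basic scale, so
    \<open>p\<close> does not change with the number of periods.\<close>
  define k where "k = nat \<lceil>q / \<delta>\<^sub>0\<rceil>"
  have "0 < q / \<delta>\<^sub>0" using q delta0(1) by simp
  then have k: "real k > 0" "q / \<delta>\<^sub>0 \<le> real k" unfolding k_def by linarith+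
  define p where "p = q / real k"
  have p: "0 < p" "p \<le> \<delta>\<^sub>0" using q k delta0(1) by (simp_all add: p_def field_simps)
  have qk: "q = real k * p" using k by (simp add: p_def)
  have b0: "sqrt B\<^sub>0 \<ge> 0" using B0_pos by simp
  define en where "en n = expectation (\<lambda>\<omega>. (zero_count f p \<omega> - NN p 1 n \<omega>)\<^sup>2)" for n
  have en0: "en n \<ge> 0" for n by (simp add: en_def)
  have "en \<longlonglongrightarrow> 0" unfolding en_def[abs_def] using NN_L2_limit[OF p, of 1] by simp
  then have "(\<lambda>n. sqrt B\<^sub>0 * sqrt (en n)) \<longlonglongrightarrow> sqrt B\<^sub>0 * sqrt 0" by (intro tendsto_intros)
  then have "(\<lambda>n. sqrt B\<^sub>0 * sqrt (en n)) \<longlonglongrightarrow> 0" by simp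
  moreover have "0 < e * p\<^sup>2 / 3" using e p by simp
  ultimately have "\<forall>\<^sub>F n in sequentially. sqrt B\<^sub>0 * sqrt (en n) < e * p\<^sup>2 / 3" by (rule order_tendstoD(2))
  then obtain n where n: "sqrt B\<^sub>0 * sqrt (en n) < e * p\<^sup>2 / 3" unfolding eventually_sequentially by blast
  \<comment> \<open>Chosen so that the smoothing error over \<open>K * 2^n\<close> grid cells costs
    at most K^2 e p^2 / 3; the summand 1 keeps the denominator away from 0.\<close>
  define y where "y = e * p\<^sup>2 / (6 * 2^n * (sqrt B\<^sub>0 + 1))"
  have s1: "0 < sqrt B\<^sub>0 + 1" using b0 by linarith
  have y: "y > 0" unfolding y_def using e p by (intro divide_pos_pos mult_pos_pos s1) auto
  then have y2: "0 < y\<^sup>2" by simp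
  obtain F where F: "trig (\<lambda>x. complex_of_real (F x))" and Fm[measurable]: "F \<in> borel_measurable borel"
    and F2: "\<And>x. \<bar>F x\<bar> \<le> 2" and Fy: "(LINT x|N1. (F x - sgn x)\<^sup>2) \<le> y\<^sup>2"
    by (rule trig_approx_sgn[OF y2]) blast
  from dev_soft_crossings_le[OF F] obtain B where B: "B \<ge> 0" and soft: "\<forall>T L h J. T \<ge> \<delta>\<^sub>0 \<longrightarrow> T = real L * (2 * pi / \<sigma>) \<longrightarrow> h \<ge> 0 \<longrightarrow> real J * h = T \<longrightarrow>
     \<bar>expectation (\<lambda>\<omega>. dev T \<omega> * soft_crossings F h J \<omega>)\<bar> \<le> real J * (B * (T * \<omega>f T))"
    by blast
  have lim: "filterlim (\<lambda>L. real L * q) at_top sequentially"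
    by (rule filterlim_at_top_mult_tendsto_pos[OF tendsto_const q filterlim_real_sequentially])
  have "(\<lambda>L. B * 2^n / p * \<omega>f (real L * q)) \<longlonglongrightarrow> 0"
    by (rule tendsto_mult_right_zero[OF omega_tendsto_0[OF lim atom]])
  moreover have "0 < e / 3" using e by simp
  ultimately have "\<forall>\<^sub>F L in sequentially. B * 2^n / p * \<omega>f (real L * q) < e / 3" by (rule order_tendstoD(2))
  moreover have "\<forall>\<^sub>F L in sequentially. \<delta>\<^sub>0 \<le> real L * q" using lim by (simp add: filterlim_at_top)
  ultimately show ?thesis
    unfolding q_def[symmetric]
  proof eventually_elim
    case (elim L)
    define T where "T = real L * q"
    define K where "K = L * k"
    define J where "J = K * 2^n"
    define h where "h = p / 2^n"
    have T: "\<delta>\<^sub>0 \<le> T" "T = real L * (2 * pi / \<sigma>)" using elim by (simp_all add: T_def q_def)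
    have TK: "T = real K * p" by (simp add: T_def K_def qk)
    have h: "h \<ge> 0" "real J * h = T" using p by (simp_all add: h_def J_def TK)
    let ?N = "zero_count f T" and ?P = "soft_crossings F h J"
    have [measurable]: "?P \<in> borel_measurable M" unfolding soft_crossings_def[abs_def] by measurable
    have NNc: "NN p K n \<omega> = crossings (\<lambda>t. f t \<omega>) 0 h J" for \<omega> by (simp add: NN_def[OF p] h_def J_def)
    note [measurable] = NN_meas[OF p, of K n]
    have NNb: "0 \<le> NN p K n \<omega>" "NN p K n \<omega> \<le> real J" for \<omega>
      using NN_nonneg[OF p, of K n \<omega>] crossings_le[of "\<lambda>t. f t \<omega>" 0 h J] by (simp_all add: NNc)
    have Pb: "\<bar>?P \<omega>\<bar> \<le> real J * 3" for \<omega> by (rule soft_crossings_bounded[OF F2])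
    define D1 D2 where "D1 \<omega> = ?N \<omega> - NN p K n \<omega>" and "D2 \<omega> = NN p K n \<omega> - ?P \<omega>" for \<omega>
    have D1m[measurable]: "D1 \<in> borel_measurable M" unfolding D1_def[abs_def] by measurable
    have D2m[measurable]: "D2 \<in> borel_measurable M" unfolding D2_def[abs_def] by measurable
    have Pm: "?P \<in> borel_measurable M" by measurable
    have bsq: "integrable M (\<lambda>\<omega>. (X \<omega>)\<^sup>2)" if [measurable]: "X \<in> borel_measurable M" and b: "\<And>\<omega>. \<bar>X \<omega>\<bar> \<le> b" for X :: "'a \<Rightarrow> real" and b
    proof (rule integrable_const_bound[of _ "b\<^sup>2"])
      have "\<bar>X \<omega>\<bar>^2 \<le> b^2" for \<omega> by (rule power_mono[OF b abs_ge_zero])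
      then show "AE \<omega> in M. norm ((X \<omega>)\<^sup>2) \<le> b\<^sup>2" by simp
    qed measurable
    have iP: "integrable M (\<lambda>\<omega>. (?P \<omega>)\<^sup>2)" by (rule bsq[OF Pm Pb])
    have iD2: "integrable M (\<lambda>\<omega>. (D2 \<omega>)\<^sup>2)"
    proof (rule bsq[OF D2m])
      have gen: "\<bar>x - y\<bar> \<le> j * 4" if "0 \<le> x" "x \<le> j" "\<bar>y\<bar> \<le> j * 3" for x y j :: real using that by linarith
      show "\<bar>D2 \<omega>\<bar> \<le> real J * 4" for \<omega> unfolding D2_def by (rule gen[OF NNb Pb])
    qed
    have iD1: "integrable M (\<lambda>\<omega>. (D1 \<omega>)\<^sup>2)"
    proof (rule norm_integral_le(1))
      show "integrable M (\<lambda>\<omega>. 2 * (?N \<omega>)\<^sup>2 + 2 * (real J)\<^sup>2)"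
        using zero_count_second_moment(1)[OF p, of K] unfolding TK by (intro Bochner_Integration.integrable_add integrable_mult_right) auto
      have gen: "norm ((a - b)\<^sup>2) \<le> 2 * a\<^sup>2 + 2 * j\<^sup>2" if "0 \<le> b" "b \<le> j" for a b j :: real
      proof -
        have "b\<^sup>2 \<le> j\<^sup>2" using that by (intro power_mono)
        moreover have "2 * a\<^sup>2 + 2 * b\<^sup>2 - (a - b)\<^sup>2 = (a + b)\<^sup>2" by (simp add: power2_eq_square algebra_simps)
        moreover have "0 \<le> (a + b)\<^sup>2" by simp
        ultimately have "(a - b)\<^sup>2 \<le> 2 * a\<^sup>2 + 2 * j\<^sup>2" by linarith
        then show ?thesis by simp
      qed
      show "norm ((D1 \<omega>)\<^sup>2) \<le> 2 * (?N \<omega>)\<^sup>2 + 2 * (real J)\<^sup>2" for \<omega> unfolding D1_def by (rule gen[OF NNb])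
    qed measurable
    note dv = dev_square_integrable[OF T(1)]
    note C1 = Cauchy_Schwarz_expectation[OF dev_meas D1m dv(1) iD1]
      and C2 = Cauchy_Schwarz_expectation[OF dev_meas D2m dv(1) iD2]
      and C3 = Cauchy_Schwarz_expectation[OF dev_meas Pm dv(1) iP]
    define m where "m = expectation ?N"
    \<comment> \<open>One factor of the square is expanded into the three parts; the constant drops
      out of the expectation because the other factor has mean zero.\<close>
    have sq: "x\<^sup>2 = (x * a + x * b + x * c) - m' * x" if "x = a + b + c - m'" for x a b c m' :: real
      unfolding power2_eq_square that by (simp add: algebra_simps)
    have "dev T \<omega> = D1 \<omega> + D2 \<omega> + ?P \<omega> - m" for \<omega> by (simp add: dev_def D1_def D2_def m_def)
    then have "expectation (\<lambda>\<omega>. (dev T \<omega>)\<^sup>2) = expectation (\<lambda>\<omega>. (dev T \<omega> * D1 \<omega> + dev T \<omega> * D2 \<omega> + dev T \<omega> * ?P \<omega>) - m * dev T \<omega>)"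
      by (intro Bochner_Integration.integral_cong refl sq)
    then have V: "expectation (\<lambda>\<omega>. (dev T \<omega>)\<^sup>2) = expectation (\<lambda>\<omega>. dev T \<omega> * D1 \<omega>) + expectation (\<lambda>\<omega>. dev T \<omega> * D2 \<omega>) + expectation (\<lambda>\<omega>. dev T \<omega> * ?P \<omega>)"
      unfolding Bochner_Integration.integral_diff[OF Bochner_Integration.integrable_add[OF Bochner_Integration.integrable_add[OF C1(1) C2(1)] C3(1)] integrable_mult_right[OF dv(2)]]
        Bochner_Integration.integral_add[OF Bochner_Integration.integrable_add[OF C1(1) C2(1)] C3(1)] Bochner_Integration.integral_add[OF C1(1) C2(1)]
        integral_mult_right_zero dv(3) mult_zero_right diff_zero .
    have sK: "sqrt ((real K)\<^sup>2 * x) = real K * sqrt x" for x by (simp add: real_sqrt_mult)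
    have S: "sqrt (expectation (\<lambda>\<omega>. (dev T \<omega>)\<^sup>2)) \<le> real K * sqrt B\<^sub>0"
      unfolding sK[symmetric] TK by (rule real_sqrt_le_mono[OF dev_L2(2)[OF p, of K]])
    have d1: "sqrt (expectation (\<lambda>\<omega>. (D1 \<omega>)\<^sup>2)) \<le> real K * sqrt (en n)"
      unfolding sK[symmetric] D1_def TK en_def by (rule real_sqrt_le_mono[OF NN_L2_uniform[OF p, of K n]])
    have "real J * (2 * y) = sqrt ((real J)\<^sup>2 * (4 * y\<^sup>2))"
      by (rule real_sqrt_unique[symmetric]) (use y in \<open>simp_all add: power_mult_distrib\<close>)
    then have d2: "sqrt (expectation (\<lambda>\<omega>. (D2 \<omega>)\<^sup>2)) \<le> real J * (2 * y)"
      unfolding D2_def NNc using real_sqrt_le_mono[OF crossings_approximation[OF Fm F2 Fy, of h J]] by (simp only:)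
    have T2: "T\<^sup>2 = (real K)\<^sup>2 * p\<^sup>2" unfolding TK by (rule power_mult_distrib)
    have Ke: "(real K)\<^sup>2 * (e * p\<^sup>2 / 3) = e * T\<^sup>2 / 3" unfolding T2 by (simp only: times_divide_eq_right mult_ac)
    have mm: "u \<le> a * b" if "u \<le> s * t" "s \<le> a" "t \<le> b" "0 \<le> t" "0 \<le> a" for u s t a b :: real
      by (rule order_trans[OF that(1) mult_mono[OF that(2,3,5,4)]])
    have KB: "0 \<le> real K * sqrt B\<^sub>0" by (intro mult_nonneg_nonneg of_nat_0_le_iff b0)
    have s0: "0 \<le> sqrt (expectation (\<lambda>\<omega>. (X \<omega>)\<^sup>2))" for X :: "'a \<Rightarrow> real"
      by (intro real_sqrt_ge_zero Bochner_Integration.integral_nonneg zero_le_power2)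
    have "\<bar>expectation (\<lambda>\<omega>. dev T \<omega> * D1 \<omega>)\<bar> \<le> (real K * sqrt B\<^sub>0) * (real K * sqrt (en n))"
      by (rule mm[OF C1(2) S d1 s0 KB])
    also have "\<dots> = (real K)\<^sup>2 * (sqrt B\<^sub>0 * sqrt (en n))" by (simp only: power2_eq_square mult_ac)
    also have "\<dots> \<le> (real K)\<^sup>2 * (e * p\<^sup>2 / 3)" by (rule mult_left_mono[OF less_imp_le[OF n] zero_le_power2])
    finally have 1: "\<bar>expectation (\<lambda>\<omega>. dev T \<omega> * D1 \<omega>)\<bar> \<le> e * T\<^sup>2 / 3" unfolding Ke .
    have J': "real J = real K * 2^n" by (simp add: J_def)
    have "\<bar>expectation (\<lambda>\<omega>. dev T \<omega> * D2 \<omega>)\<bar> \<le> (real K * sqrt B\<^sub>0) * (real J * (2 * y))"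
      by (rule mm[OF C2(2) S d2 s0 KB])
    also have "\<dots> = (real K)\<^sup>2 * (e * p\<^sup>2 / 3) * (sqrt B\<^sub>0 / (sqrt B\<^sub>0 + 1))"
    proof -
      have gen: "(u * b) * (u * W * (2 * (c / (6 * W * D)))) = u\<^sup>2 * (c / 3) * (b / D)"
        if "0 < D" "0 < W" for u b W c D :: real using that by (simp add: power2_eq_square field_simps)
      show ?thesis unfolding y_def J' by (rule gen[OF s1]) simp
    qed
    also have "\<dots> \<le> (real K)\<^sup>2 * (e * p\<^sup>2 / 3) * 1"
    proof (rule mult_left_mono)
      show "sqrt B\<^sub>0 / (sqrt B\<^sub>0 + 1) \<le> 1" unfolding divide_le_eq_1_pos[OF s1] by simp
      show "0 \<le> (real K)\<^sup>2 * (e * p\<^sup>2 / 3)" using e by (intro mult_nonneg_nonneg divide_nonneg_nonneg) auto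
    qed
    finally have 2: "\<bar>expectation (\<lambda>\<omega>. dev T \<omega> * D2 \<omega>)\<bar> \<le> e * T\<^sup>2 / 3" unfolding mult_1_right Ke .
    have "\<bar>expectation (\<lambda>\<omega>. dev T \<omega> * ?P \<omega>)\<bar> \<le> real J * (B * (T * \<omega>f T))" by (rule soft[rule_format, OF T h])
    also have "\<dots> = T\<^sup>2 * (B * 2^n / p * \<omega>f T)"
    proof -
      have gen: "(u * W) * (b * (x * w)) = x\<^sup>2 * (b * W / v * w)" if "0 < v" "x = u * v" for u W b x w v :: real
        using that(1) unfolding that(2) by (simp add: power2_eq_square field_simps)
      show ?thesis unfolding J' by (rule gen[OF p(1) TK])
    qed
    also have "\<dots> \<le> T\<^sup>2 * (e / 3)" by (rule mult_left_mono[OF less_imp_le[OF elim(1)[folded T_def]] zero_le_power2])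
    finally have 3: "\<bar>expectation (\<lambda>\<omega>. dev T \<omega> * ?P \<omega>)\<bar> \<le> e * T\<^sup>2 / 3" by (simp only: times_divide_eq_right mult.commute)
    have gen: "x + y + z \<le> m" if "\<bar>x\<bar> \<le> m / 3" "\<bar>y\<bar> \<le> m / 3" "\<bar>z\<bar> \<le> m / 3" for x y z m :: real
    proof -
      have "x \<le> m / 3" "y \<le> m / 3" "z \<le> m / 3" using that by (simp_all add: abs_le_iff)
      then show ?thesis by linarith
    qed
    show "variance (zero_count f (real L * q)) \<le> e * (real L * q)\<^sup>2"
      unfolding T_def[symmetric] variance_eq_dev V by (rule gen[OF 1 2 3])
  qed
qed

text \<open>For the converse, a contradiction at one large full-period time is enough: half of the
  assumed lower constant serves as the \<open>e\<close> of
  \<open>variance_negligible\<close>.\<close>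

lemma quadratic_variance_iff_atom:
  "(\<exists>l. l \<noteq> \<sigma> \<and> l \<noteq> - \<sigma> \<and> measure \<rho> {l} > 0) \<longleftrightarrow>
   (\<exists>C1>0. \<exists>C2>0. \<exists>T0>0. \<forall>T\<ge>T0. C1 * T\<^sup>2 \<le> variance (zero_count f T) \<and> variance (zero_count f T) \<le> C2 * T\<^sup>2)"
proof
  assume "\<exists>l. l \<noteq> \<sigma> \<and> l \<noteq> - \<sigma> \<and> measure \<rho> {l} > 0"
  then obtain C where "C > 0" "\<forall>T\<ge>\<delta>\<^sub>0. C * T\<^sup>2 \<le> variance (zero_count f T)" using variance_lower by blast
  moreover have "4 * B\<^sub>0 / \<delta>\<^sub>0\<^sup>2 > 0" using B0_pos delta0(1) by simp
  ultimately show "\<exists>C1>0. \<exists>C2>0. \<exists>T0>0. \<forall>T\<ge>T0. C1 * T\<^sup>2 \<le> variance (zero_count f T) \<and> variance (zero_count f T) \<le> C2 * T\<^sup>2"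
    using variance_upper delta0(1) by blast
next
  assume "\<exists>C1>0. \<exists>C2>0. \<exists>T0>0. \<forall>T\<ge>T0. C1 * T\<^sup>2 \<le> variance (zero_count f T) \<and> variance (zero_count f T) \<le> C2 * T\<^sup>2"
  then obtain C1 T0 where C1: "C1 > 0" and T0: "T0 > 0" and lb: "\<And>T. T \<ge> T0 \<Longrightarrow> C1 * T\<^sup>2 \<le> variance (zero_count f T)" by blast
  show "\<exists>l. l \<noteq> \<sigma> \<and> l \<noteq> - \<sigma> \<and> measure \<rho> {l} > 0"
  proof (rule ccontr)
    assume "\<not> ?thesis"
    then have "l \<noteq> \<sigma> \<Longrightarrow> l \<noteq> - \<sigma> \<Longrightarrow> measure \<rho> {l} = 0" for l using zero_less_measure_iff[of \<rho> "{l}"] by blast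
    from variance_negligible[OF this, of "C1 / 2"] C1
    have "\<forall>\<^sub>F L in sequentially. variance (zero_count f (real L * (2 * pi / \<sigma>))) \<le> C1 / 2 * (real L * (2 * pi / \<sigma>))\<^sup>2" by simp
    moreover have "filterlim (\<lambda>L. real L * (2 * pi / \<sigma>)) at_top sequentially"
      by (rule filterlim_at_top_mult_tendsto_pos[OF tendsto_const _ filterlim_real_sequentially]) (use sigma_pos in simp)
    then have "\<forall>\<^sub>F L in sequentially. T0 \<le> real L * (2 * pi / \<sigma>)" by (simp add: filterlim_at_top)
    ultimately have "\<forall>\<^sub>F L in sequentially. variance (zero_count f (real L * (2 * pi / \<sigma>))) \<le> C1 / 2 * (real L * (2 * pi / \<sigma>))\<^sup>2 \<and> T0 \<le> real L * (2 * pi / \<sigma>)"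
      by (rule eventually_conj)
    then obtain L where L: "variance (zero_count f (real L * (2 * pi / \<sigma>))) \<le> C1 / 2 * (real L * (2 * pi / \<sigma>))\<^sup>2" "T0 \<le> real L * (2 * pi / \<sigma>)"
      unfolding eventually_sequentially by blast
    have "0 < (real L * (2 * pi / \<sigma>))\<^sup>2" using L(2) T0 by (intro zero_less_power) linarith
    then have "C1 / 2 * (real L * (2 * pi / \<sigma>))\<^sup>2 < C1 * (real L * (2 * pi / \<sigma>))\<^sup>2" using C1 by (intro mult_strict_right_mono) auto
    then show False using L(1) lb[OF L(2)] by linarith
  qed
qed

end

theorem theorem1p7:
  fixes M :: "'a measure" and f :: "real \<Rightarrow> 'a \<Rightarrow> real"
    and r :: "real \<Rightarrow> real" and \<rho> :: "real measure" and \<sigma> :: real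
  assumes "prob_space M"
    and gp: "gaussian_process M f"
    and paths: "\<forall>\<omega>\<in>space M. continuous_on UNIV (\<lambda>t. f t \<omega>)"
    and centred: "\<forall>t. prob_space.expectation M (f t) = 0"
    and cov: "\<forall>s t. prob_space.expectation M (\<lambda>\<omega>. f s \<omega> * f t \<omega>) = r (t - s)"
    and r_cont: "continuous_on UNIV r"
    and r0: "r 0 = 1"
    and rho_prob: "prob_space \<rho>"
    and rho_sets: "sets \<rho> = sets borel"
    and rho_sym: "distr \<rho> borel uminus = \<rho>"
    and spectral: "\<forall>t. complex_of_real (r t) =
                     (CLINT l|\<rho>. exp (- \<i> * complex_of_real (l * t)))"
    and geman: "integrable \<rho> (\<lambda>l. ln (1 + \<bar>l\<bar>) * l\<^sup>2)"
    and sigma_pos: "\<sigma> > 0"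
    and sigma_def: "\<sigma>\<^sup>2 = (LINT l|\<rho>. l\<^sup>2)"
  shows "(\<exists>l. l \<noteq> \<sigma> \<and> l \<noteq> - \<sigma> \<and> measure \<rho> {l} > 0) \<longleftrightarrow>
         (\<exists>C1>0. \<exists>C2>0. \<exists>T0>0. \<forall>T\<ge>T0.
            C1 * T\<^sup>2 \<le> prob_space.variance M (zero_count f T) \<and>
            prob_space.variance M (zero_count f T) \<le> C2 * T\<^sup>2)"
proof -
  interpret stat_gauss \<rho> r \<sigma> M f
    by (intro stat_gauss.intro spectral.intro spectral_axioms.intro stat_gauss_axioms.intro)
       (use assms in blast)+
  show ?thesis by (rule quadratic_variance_iff_atom)
qed

end
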